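(* Let $G$ be a semisimple group over $\mathbb C$ with maximal torus $A$ and root system $R$. Let $r:R\to\mathbb Z$ be a root valuation function and let $\lambda:R\to\mathbb Z$ be any function. Define a third function $k:R\to\mathbb Z$ as the difference $k:=\lambda-r$. Then $\Lambda_{r,\lambda}$ is a root valuation lattice if and only if $k$ satisfies the following two conditions: (1) $k(\alpha)+k(-\alpha)\ge r_m(\alpha)-r(\alpha)$ for all $\alpha\in R$, (2) $k(\alpha)+k(\beta)-k(\alpha+\beta)\ge r(\alpha+\beta)-\min\{r(\alpha),r(\beta)\}$ for all $\alpha,\beta\in R$ such that $\alpha+\beta\in R$. When $\Lambda_{r,\lambda}$ is a root valuation lattice, the Lie algebra of $K_{r,\lambda}$ is given by $$\mathfrak k_{r,\lambda}=\mathfrak a(\mathcal O)\oplus\Bigl(\bigoplus_{\alpha\in R}P_\alpha^{k(\alpha)}\Bigr).$$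
   Context: $F=\mathbb C((\epsilon))$, $\mathcal O=\mathbb C[[\epsilon]]$, $\mathrm{val}$ the $\epsilon$-adic valuation. $G$ is connected; $\mathfrak g=\mathrm{Lie}\,G$, $\mathfrak a=\mathrm{Lie}\,A$, and $\mathfrak g=\mathfrak a\oplus\bigoplus_{\alpha\in R}\mathfrak g_\alpha$ is the root space decomposition. For $n\in\mathbb Z$, $P_\alpha^n:=\epsilon^n\mathfrak g_\alpha(\mathcal O)$. A root valuation function is a function $r:R\to\mathbb Z$ such that for every $m\in\mathbb Z$ the set $\{\alpha\in R:r(\alpha)\ge m\}$ is $\mathbb Q$-closed (equivalently, the root system of a Levi subgroup of $G$ containing $A$). $\mathfrak a(F)_r=\{u\in\mathfrak a(F):\mathrm{val}\,\alpha(u)=r(\alpha)\ \forall\alpha\in R\}$ and $\mathfrak a(F)_{\ge r}=\{u\in\mathfrak a(F):\mathrm{val}\,\alpha(u)\ge r(\alpha)\ \forall\alpha\in R\}$. Roots $\alpha,\beta$ are strongly orthogonal if neither $\alpha+\beta$ nor $\alpha-\beta$ lies in $R\cup\{0\}$ (so $\alpha$ is not strongly orthogonal to itself). Put $r_m(\alpha):=\max\{r(\beta):\beta\in R\text{ is not strongly orthogonal to }\alpha\}$. For $\lambda:R\to\mathbb Z$, put $$\Lambda_{r,\lambda}:=\mathfrak a(F)_{\ge r}\oplus\Bigl(\bigoplus_{\alpha\in R}P_\alpha^{\lambda(\alpha)}\Bigr).$$ $K_{r,\lambda}$ is the identity component of the (proalgebraic) group $\{g\in G(F):g\Lambda_{r,\lambda}g^{-1}=\Lambda_{r,\lambda}\}$,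 and $\mathfrak k_{r,\lambda}$ is its Lie algebra; one has $\mathfrak k_{r,\lambda}=\{X\in\mathfrak g(F):[X,\Lambda_{r,\lambda}]\subset\Lambda_{r,\lambda}\}$. $\Lambda_{r,\lambda}$ is called a root valuation lattice (for $r$) if the morphism $\varphi:K_{r,\lambda}\times\mathfrak a(F)_r\to\Lambda_{r,\lambda}$, $(x,u)\mapsto xux^{-1}$, is a submersion, i.e. has surjective differential at every point; by $K_{r,\lambda}$-equivariance this means that $\mathfrak a(F)_{\ge r}+[\mathfrak k_{r,\lambda},u]=\Lambda_{r,\lambda}$ for every $u\in\mathfrak a(F)_r$. *)

theory Defs
  imports
    "HOL-Analysis.Analysis"
    "HOL-Algebra.Solvable_Groups"
    "HOL-Computational_Algebra.Formal_Laurent_Series"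
    "HOL-Library.Poly_Mapping"
    "HOL-Library.Extended"
    "HOL-Library.Function_Algebras"
begin

section \<open>Linear algebraic groups over the complex numbers\<close>

type_synonym 'v mpoly = "('v \<Rightarrow>\<^sub>0 nat) \<Rightarrow>\<^sub>0 complex"

text \<open>Evaluation of a complex polynomial at a point \<open>x\<close> of a commutative ring which is a
  complex algebra through the ring homomorphism \<open>\<iota>\<close>.\<close>

definition mpoly_eval :: "(complex \<Rightarrow> 'a::comm_ring_1) \<Rightarrow> 'v mpoly \<Rightarrow> ('v \<Rightarrow> 'a) \<Rightarrow> 'a"
  where "mpoly_eval \<iota> p x =
    (\<Sum>m\<in>Poly_Mapping.keys p. \<iota> (Poly_Mapping.lookup p m) *
       (\<Prod>v\<in>Poly_Mapping.keys m. x v ^ Poly_Mapping.lookup m v))"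

type_synonym 'n cmat = "complex ^ 'n ^ 'n"

definition entries :: "'a ^ 'n ^ 'n \<Rightarrow> 'n \<times> 'n \<Rightarrow> 'a"
  where "entries X = (\<lambda>(i, j). X $ i $ j)"

definition smult_mat :: "'a::comm_ring_1 \<Rightarrow> 'a ^ 'n ^ 'n \<Rightarrow> 'a ^ 'n ^ 'n"
  where "smult_mat c X = (\<chi> i j. c * X $ i $ j)"

definition lie_bracket :: "'a::comm_ring_1 ^ 'n ^ 'n \<Rightarrow> 'a ^ 'n ^ 'n \<Rightarrow> 'a ^ 'n ^ 'n"
  where "lie_bracket X Y = X ** Y - Y ** X"

definition mat_group :: "('n cmat) set \<Rightarrow> ('n::finite cmat) monoid"
  where "mat_group S = \<lparr>carrier = S, monoid.mult = (**), one = mat 1\<rparr>"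

definition linear_algebraic_group :: "('n::finite cmat) set \<Rightarrow> bool"
  where "linear_algebraic_group G \<longleftrightarrow>
    subgroup G (mat_group {g. invertible g}) \<and>
    (\<exists>S :: ('n \<times> 'n) mpoly set.
       G = {g. invertible g \<and> (\<forall>p\<in>S. mpoly_eval id p (entries g) = 0)})"

definition zariski :: "('n::finite cmat) set \<Rightarrow> ('n cmat) topology"
  where "zariski S = topology_generated_by
    {{g \<in> S. mpoly_eval id p (entries g) \<noteq> 0} | p. True}"

text \<open>Semisimple means connected with trivial radical.\<close>

definition semisimple_group :: "('n::finite cmat) set \<Rightarrow> bool"
  where "semisimple_group G \<longleftrightarrow>
    linear_algebraic_group G \<and> connected_space (zariski G) \<and>
    (\<forall>N. linear_algebraic_group N \<and> N \<lhd> mat_group G \<and>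
         connected_space (zariski N) \<and> solvable (mat_group N) \<longrightarrow> N = {mat 1})"

text \<open>A torus is a connected diagonalizable group (over the complex numbers, a group isomorphic
  to a power of the multiplicative group).\<close>

definition algebraic_torus :: "('n::finite cmat) set \<Rightarrow> bool"
  where "algebraic_torus T \<longleftrightarrow>
    linear_algebraic_group T \<and> connected_space (zariski T) \<and>
    (\<exists>P :: 'n cmat. invertible P \<and> (\<forall>t\<in>T. \<forall>i j. i \<noteq> j \<longrightarrow> (matrix_inv P ** t ** P) $ i $ j = 0))"

definition maximal_torus :: "('n::finite cmat) set \<Rightarrow> ('n cmat) set \<Rightarrow> bool"
  where "maximal_torus A G \<longleftrightarrow>
    algebraic_torus A \<and> A \<subseteq> G \<and> (\<forall>T. algebraic_torus T \<and> A \<subseteq> T \<and> T \<subseteq> G \<longrightarrow> T = A)"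

text \<open>Polynomials in the entries suffice for the ideal and for the Lie algebra: the coordinate
  ring of \<open>GL\<^sub>n\<close> only inverts the determinant.\<close>

definition vanishing_ideal :: "('n::finite cmat) set \<Rightarrow> ('n \<times> 'n) mpoly set"
  where "vanishing_ideal G = {p. \<forall>g\<in>G. mpoly_eval id p (entries g) = 0}"

text \<open>The Lie algebra is the Zariski tangent space at the identity.\<close>

definition lie_algebra :: "('n::finite cmat) set \<Rightarrow> ('n cmat) set"
  where "lie_algebra G = {X. \<forall>p\<in>vanishing_ideal G.
    ((\<lambda>t. mpoly_eval id p (entries (mat 1 + smult_mat t X))) has_field_derivative 0) (at 0)}"


section \<open>Roots\<close>

text \<open>A root is identified with its differential, a linear form on the Lie algebra of \<open>A\<close>.
  Linear forms are extended by zero outside that Lie algebra, so that equality, sums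
  and negatives of forms are those of functions.\<close>

definition dual_space :: "('n::finite cmat) set \<Rightarrow> ('n cmat \<Rightarrow> complex) set"
  where "dual_space V = {\<alpha>.
    (\<forall>X\<in>V. \<forall>Y\<in>V. \<alpha> (X + Y) = \<alpha> X + \<alpha> Y) \<and>
    (\<forall>c. \<forall>X\<in>V. \<alpha> (smult_mat c X) = c * \<alpha> X) \<and>
    (\<forall>X. X \<notin> V \<longrightarrow> \<alpha> X = 0)}"

definition root_space ::
    "('n::finite cmat) set \<Rightarrow> ('n cmat) set \<Rightarrow> ('n cmat \<Rightarrow> complex) \<Rightarrow> ('n cmat) set"
  where "root_space G A \<alpha> =
    {X \<in> lie_algebra G. \<forall>H\<in>lie_algebra A. lie_bracket H X = smult_mat (\<alpha> H) X}"

definition roots :: "('n::finite cmat) set \<Rightarrow> ('n cmat) set \<Rightarrow> ('n cmat \<Rightarrow> complex) set"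
  where "roots G A = {\<alpha> \<in> dual_space (lie_algebra A). \<alpha> \<noteq> 0 \<and> root_space G A \<alpha> \<noteq> {0}}"

definition rat_closed ::
    "('n::finite cmat \<Rightarrow> complex) set \<Rightarrow> ('n cmat \<Rightarrow> complex) set \<Rightarrow> bool"
  where "rat_closed R R' \<longleftrightarrow> R' \<subseteq> R \<and>
    (\<forall>\<alpha>\<in>R. (\<exists>S q. finite S \<and> S \<subseteq> R' \<and>
        \<alpha> = (\<lambda>H. \<Sum>\<beta>\<in>S. of_rat (q \<beta>) * \<beta> H)) \<longrightarrow> \<alpha> \<in> R')"

definition root_valuation_function ::
    "('n::finite cmat) set \<Rightarrow> ('n cmat) set \<Rightarrow> (('n cmat \<Rightarrow> complex) \<Rightarrow> int) \<Rightarrow> bool"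
  where "root_valuation_function G A r \<longleftrightarrow>
    (\<forall>m. rat_closed (roots G A) {\<alpha> \<in> roots G A. r \<alpha> \<ge> m})"

definition strongly_orthogonal ::
    "('n::finite cmat \<Rightarrow> complex) set \<Rightarrow> ('n cmat \<Rightarrow> complex) \<Rightarrow> ('n cmat \<Rightarrow> complex) \<Rightarrow> bool"
  where "strongly_orthogonal R \<alpha> \<beta> \<longleftrightarrow> \<alpha> + \<beta> \<notin> R \<union> {0} \<and> \<alpha> - \<beta> \<notin> R \<union> {0}"

definition r_max ::
    "('n::finite cmat) set \<Rightarrow> ('n cmat) set \<Rightarrow> (('n cmat \<Rightarrow> complex) \<Rightarrow> int) \<Rightarrow>
     ('n cmat \<Rightarrow> complex) \<Rightarrow> int"
  where "r_max G A r \<alpha> =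
    Max (r ` {\<beta> \<in> roots G A. \<not> strongly_orthogonal (roots G A) \<alpha> \<beta>})"


section \<open>Points over Laurent series and lattices\<close>

type_synonym 'n fmat = "complex fls ^ 'n ^ 'n"

definition coeff_mat :: "'n::finite fmat \<Rightarrow> int \<Rightarrow> 'n cmat"
  where "coeff_mat X k = (\<chi> i j. fls_nth (X $ i $ j) k)"

text \<open>\<open>V \<otimes> F\<close> and \<open>V \<otimes> O\<close> for a linear subspace \<open>V\<close> of the complex matrices; as \<open>V\<close> is
  finite-dimensional these are the series with coefficients in \<open>V\<close>.\<close>

definition points_F :: "('n::finite cmat) set \<Rightarrow> ('n fmat) set"
  where "points_F V = {X. \<forall>k. coeff_mat X k \<in> V}"

definition points_O :: "('n::finite cmat) set \<Rightarrow> ('n fmat) set"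
  where "points_O V = {X \<in> points_F V. \<forall>k<0. coeff_mat X k = 0}"

definition val :: "complex fls \<Rightarrow> int extended"
  where "val f = (if f = 0 then Pinf else Fin (fls_subdegree f))"

text \<open>The \<open>F\<close>-linear extension of a linear form.\<close>

definition extend_form :: "('n::finite cmat \<Rightarrow> complex) \<Rightarrow> 'n fmat \<Rightarrow> complex fls"
  where "extend_form \<alpha> u = Abs_fls (\<lambda>k. \<alpha> (coeff_mat u k))"

definition a_eq ::
    "('n::finite cmat) set \<Rightarrow> ('n cmat) set \<Rightarrow> (('n cmat \<Rightarrow> complex) \<Rightarrow> int) \<Rightarrow> ('n fmat) set"
  where "a_eq G A r =
    {u \<in> points_F (lie_algebra A). \<forall>\<alpha>\<in>roots G A. val (extend_form \<alpha> u) = Fin (r \<alpha>)}"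

definition a_ge ::
    "('n::finite cmat) set \<Rightarrow> ('n cmat) set \<Rightarrow> (('n cmat \<Rightarrow> complex) \<Rightarrow> int) \<Rightarrow> ('n fmat) set"
  where "a_ge G A r =
    {u \<in> points_F (lie_algebra A). \<forall>\<alpha>\<in>roots G A. val (extend_form \<alpha> u) \<ge> Fin (r \<alpha>)}"

definition P_lattice ::
    "('n::finite cmat) set \<Rightarrow> ('n cmat) set \<Rightarrow> ('n cmat \<Rightarrow> complex) \<Rightarrow> int \<Rightarrow> ('n fmat) set"
  where "P_lattice G A \<alpha> n = smult_mat (fls_X_intpow n) ` points_O (root_space G A \<alpha>)"

text \<open>\<open>M \<oplus> (\<Oplus>\<alpha>\<in>R. P\<^sub>\<alpha>)\<close> inside the matrices over \<open>F\<close>, with \<open>P\<^sub>\<alpha>\<close> of exponent \<open>k \<alpha>\<close>.\<close>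

definition root_lattice ::
    "('n::finite cmat) set \<Rightarrow> ('n cmat) set \<Rightarrow> ('n fmat) set \<Rightarrow>
     (('n cmat \<Rightarrow> complex) \<Rightarrow> int) \<Rightarrow> ('n fmat) set"
  where "root_lattice G A M k =
    {u + (\<Sum>\<alpha>\<in>roots G A. X \<alpha>) | u X. u \<in> M \<and> (\<forall>\<alpha>\<in>roots G A. X \<alpha> \<in> P_lattice G A \<alpha> (k \<alpha>))}"

definition Lambda ::
    "('n::finite cmat) set \<Rightarrow> ('n cmat) set \<Rightarrow> (('n cmat \<Rightarrow> complex) \<Rightarrow> int) \<Rightarrow>
     (('n cmat \<Rightarrow> complex) \<Rightarrow> int) \<Rightarrow> ('n fmat) set"
  where "Lambda G A r lam = root_lattice G A (a_ge G A r) lam"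


section \<open>The proalgebraic group and its tangent spaces\<close>

definition group_F :: "('n::finite cmat) set \<Rightarrow> ('n fmat) set"
  where "group_F G = {g. invertible g \<and>
    (\<forall>p\<in>vanishing_ideal G. mpoly_eval fls_const p (entries g) = 0)}"

definition lattice_stabilizer :: "('n::finite cmat) set \<Rightarrow> ('n fmat) set \<Rightarrow> ('n fmat) set"
  where "lattice_stabilizer G L =
    {g \<in> group_F G. (\<lambda>X. g ** X ** matrix_inv g) ` L = L}"

text \<open>The loop group of \<open>GL\<^sub>n\<close> is embedded as a closed ind-subscheme in pairs of matrices over
  \<open>F\<close> by \<open>g \<mapsto> (g, g\<inverse>)\<close>. The coordinates of a pair are the Laurent coefficients of its entries.
  The pairs with pole order at most \<open>N\<close> form an affine scheme, and a function is regular if on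
  each of them it is a polynomial in (finitely many) coordinates. The stabilizer of a lattice
  has bounded pole order, and this is its structure of a proalgebraic group.\<close>

definition loop_coord ::
    "'n::finite fmat \<times> 'n fmat \<Rightarrow> ('n \<times> 'n \<times> int) + ('n \<times> 'n \<times> int) \<Rightarrow> complex"
  where "loop_coord z = case_sum
    (\<lambda>(i, j, k). fls_nth (fst z $ i $ j) k) (\<lambda>(i, j, k). fls_nth (snd z $ i $ j) k)"

definition loop_bounded :: "int \<Rightarrow> ('n::finite fmat \<times> 'n fmat) set"
  where "loop_bounded N =
    {z. \<forall>k < - N. coeff_mat (fst z) k = 0 \<and> coeff_mat (snd z) k = 0}"

definition loop_regular :: "('n::finite fmat \<times> 'n fmat \<Rightarrow> complex) \<Rightarrow> bool"
  where "loop_regular f \<longleftrightarrow>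
    (\<forall>N. \<exists>q. \<forall>z\<in>loop_bounded N. f z = mpoly_eval id q (loop_coord z))"

definition loop_zariski :: "('n::finite fmat) set \<Rightarrow> ('n fmat) topology"
  where "loop_zariski S = topology_generated_by
    {{g \<in> S. f (g, matrix_inv g) \<noteq> 0} | f. loop_regular f}"

definition K_group ::
    "('n::finite cmat) set \<Rightarrow> ('n cmat) set \<Rightarrow> (('n cmat \<Rightarrow> complex) \<Rightarrow> int) \<Rightarrow>
     (('n cmat \<Rightarrow> complex) \<Rightarrow> int) \<Rightarrow> ('n fmat) set"
  where "K_group G A r lam = connected_component_of_set
    (loop_zariski (lattice_stabilizer G (Lambda G A r lam))) (mat 1)"

text \<open>Zariski tangent space at \<open>x\<close>. A tangent vector at \<open>(x, x\<inverse>)\<close> is a pair \<open>(\<xi>, \<eta>)\<close>;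
  \<open>\<eta>\<close> is determined by \<open>\<xi>\<close>, being equal to \<open>- x\<inverse> \<xi> x\<inverse>\<close>.\<close>

definition tangent_space :: "('n::finite fmat) set \<Rightarrow> 'n fmat \<Rightarrow> ('n fmat) set"
  where "tangent_space S x = {\<xi>. \<exists>\<eta>. \<forall>f.
    loop_regular f \<and> (\<forall>y\<in>S. f (y, matrix_inv y) = 0) \<longrightarrow>
    ((\<lambda>t. f (x + smult_mat (fls_const t) \<xi>, matrix_inv x + smult_mat (fls_const t) \<eta>))
       has_field_derivative 0) (at 0)}"

definition K_lie_algebra ::
    "('n::finite cmat) set \<Rightarrow> ('n cmat) set \<Rightarrow> (('n cmat \<Rightarrow> complex) \<Rightarrow> int) \<Rightarrow>
     (('n cmat \<Rightarrow> complex) \<Rightarrow> int) \<Rightarrow> ('n fmat) set"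
  where "K_lie_algebra G A r lam = tangent_space (K_group G A r lam) (mat 1)"

text \<open>The differential at \<open>(x, u)\<close> of \<open>(x, u) \<mapsto> x u x\<inverse>\<close>.\<close>

definition conj_differential ::
    "'n::finite fmat \<Rightarrow> 'n fmat \<Rightarrow> 'n fmat \<Rightarrow> 'n fmat \<Rightarrow> 'n fmat"
  where "conj_differential x u \<xi> v =
    \<xi> ** u ** matrix_inv x + x ** v ** matrix_inv x
      - x ** u ** matrix_inv x ** \<xi> ** matrix_inv x"

text \<open>The source of the map is \<open>K_group \<times> a_eq\<close>. Since \<open>a_eq\<close> is Zariski open in the linear space
  \<open>a_ge\<close>, the tangent space of \<open>a_eq\<close> at each of its points is \<open>a_ge\<close>; that of the target, the
  linear space \<open>Lambda\<close>, is \<open>Lambda\<close> itself.\<close>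

definition root_valuation_lattice ::
    "('n::finite cmat) set \<Rightarrow> ('n cmat) set \<Rightarrow> (('n cmat \<Rightarrow> complex) \<Rightarrow> int) \<Rightarrow>
     (('n cmat \<Rightarrow> complex) \<Rightarrow> int) \<Rightarrow> bool"
  where "root_valuation_lattice G A r lam \<longleftrightarrow>
    (\<forall>x\<in>K_group G A r lam. \<forall>u\<in>a_eq G A r.
       (\<lambda>(\<xi>, v). conj_differential x u \<xi> v) `
         (tangent_space (K_group G A r lam) x \<times> a_ge G A r) = Lambda G A r lam)"

end

theory Submission
  imports Defs "HOL-Computational_Algebra.Computational_Algebra" "HOL-Computational_Algebra.Field_as_Ring"
begin

text \<open>
  Every lattice involved consists of the Laurent series whose \<open>m\<close>-th coefficient lies in a given subspace
  \<open>U\<^sub>m\<close> of \<open>\<gg>\<close>, so all questions about \<open>\<Lambda>\<close> become questions about coefficients and weights.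
  Let \<open>x\<close> be a point of \<open>K\<close>. Differentiating the regular functions \<open>g \<mapsto> l(coeff\<^sub>m(g u g\<inverse>))\<close>,
  which vanish on \<open>K\<close> for \<open>u\<close> in \<open>\<Lambda>\<close> and \<open>l\<close> in the annihilator of \<open>U\<^sub>m\<close>, bounds the tangent space at \<open>x\<close> from above.
  The curves \<open>x exp(t \<epsilon>\<^sup>i X)\<close>, with \<open>X\<close> a root vector for which \<open>\<epsilon>\<^sup>i X\<close> normalizes \<open>\<Lambda>\<close>, are polynomial in \<open>t\<close>
  because \<open>X\<close> is nilpotent; together with the curves \<open>exp(t \<epsilon>\<^sup>i H)\<close> in the torus they bound it from below, since a regular
  function sees only finitely many coefficients. The two bounds agree under conditions (1) and (2), which say
  exactly that \<open>\<epsilon>\<^sup>m X\<close> normalizes \<open>\<Lambda>\<close> for every \<open>X\<close> in \<open>\<gg>\<^sub>\<alpha>\<close> with \<open>m = k(\<alpha>)\<close>. Since \<open>\<alpha>(u)\<close> has valuation \<open>r(\<alpha>)\<close>,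
  bracketing with \<open>u\<close> maps exponent \<open>k(\<alpha>)\<close> onto exponent \<open>\<lambda>(\<alpha>)\<close>, which gives surjectivity; conversely,
  surjectivity forces \<open>\<epsilon>\<^sup>m \<gg>\<^sub>\<alpha>\<close> to be the \<open>\<alpha>\<close>-part of elements normalizing \<open>\<Lambda>\<close>.

  The root space decomposition is obtained from the definitions as follows. Replacing the eigenvalues of the
  semisimple part of a matrix in \<open>\<gg>\<close> by their images under an additive map \<open>\<complex> \<rightarrow> \<complex>\<close> stays in \<open>\<gg>\<close>. With complex
  conjugation as this map, the radical of the trace form is seen to consist of nilpotent matrices, hence
  vanishes by Engel's theorem, because a commutative ideal would exponentiate to a normal subgroup.
  The trace form then yields that the torus is its own centralizer, that the roots span, and the
  \<open>sl\<^sub>2\<close>-triples.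
\<close>

no_notation fps_nth (infixl "$" 75)

section \<open>Evaluation of polynomials\<close>

text \<open>The notions are the bare definitions for closed matrix groups, so the Jordan
  decomposition in the centralizer of the torus, the roots and the coroots all have to be derived.
  Exponentials are taken as matrices of formal power series because the same differential equation
  is solved over the complex numbers and over Laurent series; for the same reason polynomials are
  evaluated through an arbitrary homomorphism.

  The hypothesis on \<open>r\<close> enters through two facts: \<open>r\<close> behaves like a
  valuation on sums and negatives of roots, and \<open>a_eq\<close> has a point. Without such a
  point the converse would start from an empty condition. Its existence comes down to complex linear
  relations between roots implying rational ones, and that is the purpose of the coroots and their
  integrality.

  Tangent spaces of \<open>K\<close> are needed at every point. Away from the identity only root
  directions are realized by curves, which is enough because \<open>a_ge\<close> supplies the torus
  component of the vector to be reached.\<close>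

definition is_ring_hom :: "('a::comm_ring_1 \<Rightarrow> 'b::comm_ring_1) \<Rightarrow> bool"
  where "is_ring_hom \<phi> \<longleftrightarrow> \<phi> 1 = 1 \<and> (\<forall>x y. \<phi> (x + y) = \<phi> x + \<phi> y) \<and> (\<forall>x y. \<phi> (x * y) = \<phi> x * \<phi> y)"

lemma is_ring_homD:
  assumes "is_ring_hom \<phi>"
  shows "\<phi> 0 = 0" "\<phi> 1 = 1" "\<phi> (x + y) = \<phi> x + \<phi> y" "\<phi> (x * y) = \<phi> x * \<phi> y"
    "\<phi> (- x) = - \<phi> x" "\<phi> (x - y) = \<phi> x - \<phi> y"
proof -
  show *: "\<phi> 1 = 1" "\<And>x y. \<phi> (x + y) = \<phi> x + \<phi> y" "\<phi> (x * y) = \<phi> x * \<phi> y"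
    using assms by (auto simp: is_ring_hom_def)
  show 0: "\<phi> 0 = 0" using *(2)[of 0 0] by simp
  show m: "\<phi> (- x) = - \<phi> x" for x using *(2)[of x "- x"] 0 by (simp add: eq_neg_iff_add_eq_0 add.commute)
  show "\<phi> (x - y) = \<phi> x - \<phi> y" using *(2)[of x "- y"] m by simp
qed

lemma is_ring_hom_sum: "is_ring_hom \<phi> \<Longrightarrow> \<phi> (sum f S) = (\<Sum>x\<in>S. \<phi> (f x))"
  by (induction S rule: infinite_finite_induct) (auto simp: is_ring_homD)

lemma is_ring_hom_comp: "is_ring_hom \<phi> \<Longrightarrow> is_ring_hom \<psi> \<Longrightarrow> is_ring_hom (\<lambda>x. \<psi> (\<phi> x))"
  by (auto simp: is_ring_hom_def)

definition Cst :: "complex \<Rightarrow> 'v mpoly"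
  where "Cst = Poly_Mapping.single 0"

definition Var :: "'v \<Rightarrow> 'v mpoly"
  where "Var v = Poly_Mapping.single (Poly_Mapping.single v 1) 1"

lemma is_ring_hom_intros:
  "is_ring_hom (id :: 'a::comm_ring_1 \<Rightarrow> 'a)" "is_ring_hom (\<lambda>x::'a. x)"
  "is_ring_hom (fps_const :: 'a \<Rightarrow> 'a fps)" "is_ring_hom (fls_const :: 'a \<Rightarrow> 'a fls)"
  "is_ring_hom (\<lambda>c::'a. [:c:])" "is_ring_hom (Cst :: complex \<Rightarrow> 'v mpoly)"
  "is_ring_hom (fps_to_fls :: 'a fps \<Rightarrow> 'a fls)" "is_ring_hom (\<lambda>p. poly p (x::'a))"
  "is_ring_hom (fps_of_poly :: 'a poly \<Rightarrow> 'a fps)" "is_ring_hom (\<lambda>f::'a fps. fps_nth f 0)"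
  "is_ring_hom (\<lambda>f::'a poly. coeff f 0)"
  by (auto simp: is_ring_hom_def fls_plus_const fls_const_mult_const single_add mult_single one_pCons
      fls_times_fps_to_fls Cst_def fps_of_poly_mult fps_of_poly_add coeff_mult)

lemma poly_mapping_sum_singles:
  "p = (\<Sum>m\<in>Poly_Mapping.keys p. Poly_Mapping.single m (Poly_Mapping.lookup p m))"
  by (rule poly_mapping_eqI)
     (auto simp: lookup_sum lookup_single when_def sum.delta' in_keys_iff)

text \<open>Evaluation of a monoid algebra. The monoid of keys stays arbitrary because two are used:
  exponent vectors of polynomials, and the additive group of complex numbers, where a key
  \<open>z\<close> stands for the function \<open>exp (z s)\<close>.\<close>

definition pm_eval :: "('c::comm_ring_1 \<Rightarrow> 'a::comm_ring_1) \<Rightarrow> ('m::comm_monoid_add \<Rightarrow> 'a) \<Rightarrow> ('m \<Rightarrow>\<^sub>0 'c) \<Rightarrow> 'a"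
  where "pm_eval h u p = (\<Sum>m\<in>Poly_Mapping.keys p. h (Poly_Mapping.lookup p m) * u m)"

lemma pm_eval_superset:
  assumes "is_ring_hom h" "finite S" "Poly_Mapping.keys p \<subseteq> S"
  shows "pm_eval h u p = (\<Sum>m\<in>S. h (Poly_Mapping.lookup p m) * u m)"
  unfolding pm_eval_def
  by (rule sum.mono_neutral_left) (use assms in \<open>auto simp: in_keys_iff is_ring_homD\<close>)

lemma pm_eval_single: "is_ring_hom h \<Longrightarrow> pm_eval h u (Poly_Mapping.single m c) = h c * u m"
  by (subst pm_eval_superset[where S = "{m}"]) auto

lemma is_ring_hom_pm_eval:
  fixes h :: "'c::comm_ring_1 \<Rightarrow> 'a::comm_ring_1" and u :: "'m::comm_monoid_add \<Rightarrow> 'a"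
  assumes h: "is_ring_hom h" and u: "u 0 = 1" "\<And>m n. u (m + n) = u m * u n"
  shows "is_ring_hom (pm_eval h u)"
proof -
  have add: "pm_eval h u (p + q) = pm_eval h u p + pm_eval h u q" for p q
    using Poly_Mapping.keys_add[of p q]
    by (subst (1 2 3) pm_eval_superset[where S = "Poly_Mapping.keys p \<union> Poly_Mapping.keys q"])
       (auto simp: h is_ring_homD[OF h] lookup_add sum.distrib distrib_right)
  have sum: "pm_eval h u (sum f S) = (\<Sum>i\<in>S. pm_eval h u (f i))" for f :: "'m \<Rightarrow> 'm \<Rightarrow>\<^sub>0 'c" and S
    by (induction S rule: infinite_finite_induct) (auto simp: add, auto simp: pm_eval_def)
  have "pm_eval h u (p * q) = pm_eval h u p * pm_eval h u q" for p q
  proof -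
    let ?P = "Poly_Mapping.keys p" and ?Q = "Poly_Mapping.keys q"
    have eq: "p * q = (\<Sum>m\<in>?P. \<Sum>m'\<in>?Q. Poly_Mapping.single (m + m') (Poly_Mapping.lookup p m * Poly_Mapping.lookup q m'))"
      using arg_cong2[OF poly_mapping_sum_singles[of p] poly_mapping_sum_singles[of q], of "(*)"]
      by (simp add: sum_product mult_single)
    show ?thesis
      unfolding eq sum pm_eval_single[OF h] unfolding pm_eval_def sum_product
      by (simp add: is_ring_homD[OF h] u ac_simps)
  qed
  moreover have "pm_eval h u 1 = 1"
    using pm_eval_single[OF h, of u 0 1] by (simp add: is_ring_homD[OF h] u)
  ultimately show ?thesis using add by (simp add: is_ring_hom_def)
qed

definition monom_eval :: "('v \<Rightarrow> 'a::comm_ring_1) \<Rightarrow> ('v \<Rightarrow>\<^sub>0 nat) \<Rightarrow> 'a"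
  where "monom_eval x m = (\<Prod>v\<in>Poly_Mapping.keys m. x v ^ Poly_Mapping.lookup m v)"

lemma monom_eval_superset:
  "finite S \<Longrightarrow> Poly_Mapping.keys m \<subseteq> S \<Longrightarrow> monom_eval x m = (\<Prod>v\<in>S. x v ^ Poly_Mapping.lookup m v)"
  unfolding monom_eval_def by (rule prod.mono_neutral_left) (auto simp: in_keys_iff)

lemma monom_eval_add: "monom_eval x (m + m') = monom_eval x m * monom_eval x m'"
proof -
  let ?S = "Poly_Mapping.keys m \<union> Poly_Mapping.keys m'"
  have "monom_eval x (m + m') = (\<Prod>v\<in>?S. x v ^ Poly_Mapping.lookup (m + m') v)"
    by (rule monom_eval_superset) (auto simp: Poly_Mapping.keys_add)
  also have "\<dots> = monom_eval x m * monom_eval x m'"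
    by (simp add: monom_eval_superset[where S = ?S] lookup_add power_add prod.distrib)
  finally show ?thesis .
qed

lemma monom_eval_0 [simp]: "monom_eval x 0 = 1"
  by (simp add: monom_eval_def)

lemma monom_eval_single [simp]: "monom_eval x (Poly_Mapping.single v k) = x v ^ k"
  by (auto simp: monom_eval_def)

context
  fixes \<iota> :: "complex \<Rightarrow> 'a::comm_ring_1" and x :: "'v \<Rightarrow> 'a"
  assumes hom: "is_ring_hom \<iota>"
begin

lemma mpoly_eval_eq_pm_eval: "mpoly_eval \<iota> p x = pm_eval \<iota> (monom_eval x) p"
  by (simp add: mpoly_eval_def pm_eval_def monom_eval_def)

lemma is_ring_hom_mpoly_eval: "is_ring_hom (\<lambda>p. mpoly_eval \<iota> p x)"
  unfolding mpoly_eval_eq_pm_eval by (rule is_ring_hom_pm_eval) (auto simp: hom monom_eval_add)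

lemmas mpoly_eval_0 = is_ring_homD(1)[OF is_ring_hom_mpoly_eval]
  and mpoly_eval_add = is_ring_homD(3)[OF is_ring_hom_mpoly_eval]
  and mpoly_eval_mult = is_ring_homD(4)[OF is_ring_hom_mpoly_eval]
  and mpoly_eval_sum = is_ring_hom_sum[OF is_ring_hom_mpoly_eval]

lemma mpoly_eval_single: "mpoly_eval \<iota> (Poly_Mapping.single m c) x = \<iota> c * monom_eval x m"
  by (simp add: mpoly_eval_eq_pm_eval pm_eval_single hom)

lemma mpoly_eval_Cst [simp]: "mpoly_eval \<iota> (Cst c) x = \<iota> c"
  by (simp add: mpoly_eval_single Cst_def)

lemma mpoly_eval_Var [simp]: "mpoly_eval \<iota> (Var v) x = x v"
  by (simp add: mpoly_eval_single Var_def is_ring_homD[OF hom])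

end

lemma single_eq_Cst_times_Vars:
  "Poly_Mapping.single m c = Cst c * (monom_eval Var m :: 'v mpoly)"
proof -
  have 1: "(Var v :: 'v mpoly) ^ k = Poly_Mapping.single (Poly_Mapping.single v k) 1" for v k
    by (induction k) (simp_all add: Var_def mult_single single_add[symmetric])
  have 2: "(\<Prod>v\<in>S. Poly_Mapping.single (f v) 1 :: 'v mpoly) = Poly_Mapping.single (\<Sum>v\<in>S. f v) 1"
    for S :: "'v set" and f
    by (induction S rule: infinite_finite_induct) (auto simp: mult_single)
  have "(monom_eval Var m :: 'v mpoly) = Poly_Mapping.single m 1"
    unfolding monom_eval_def 1 2 poly_mapping_sum_singles[symmetric] ..
  then show ?thesis
    by (simp add: Cst_def mult_single)
qed

text \<open>Constants and variables generate the polynomial ring, so homomorphisms and derivations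
  need to be compared only on these generators.\<close>

lemma mpoly_induct [case_names const var add mult]:
  fixes p :: "'v mpoly"
  assumes const: "\<And>c. P (Cst c)" and var: "\<And>v. P (Var v)"
    and add: "\<And>p q. P p \<Longrightarrow> P q \<Longrightarrow> P (p + q)" and mult: "\<And>p q. P p \<Longrightarrow> P q \<Longrightarrow> P (p * q)"
  shows "P p"
proof -
  have pow: "P (Var v ^ k)" for v k
    by (induction k) (use const[of 1] var mult in \<open>auto simp: Cst_def\<close>)
  have prod: "P (\<Prod>v\<in>S. Var v ^ f v)" for S :: "'v set" and f
    by (induction S rule: infinite_finite_induct) (use const[of 1] pow mult in \<open>auto simp: Cst_def\<close>)
  have single: "P (Poly_Mapping.single m c)" for m c
    unfolding single_eq_Cst_times_Vars monom_eval_def by (intro mult const prod)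
  have "P (\<Sum>m\<in>S. Poly_Mapping.single m (f m))" for S f
    by (induction S rule: infinite_finite_induct) (use const[of 0] single add in \<open>auto simp: Cst_def\<close>)
  then show ?thesis
    by (subst poly_mapping_sum_singles)
qed

lemma mpoly_eval_hom:
  assumes "is_ring_hom \<phi>" "is_ring_hom \<iota>"
  shows "\<phi> (mpoly_eval \<iota> p x) = mpoly_eval (\<lambda>c. \<phi> (\<iota> c)) p (\<lambda>v. \<phi> (x v))"
proof -
  note [simp] = is_ring_hom_comp[OF assms(2,1)]
  show ?thesis
    by (induction p rule: mpoly_induct)
       (auto simp: assms mpoly_eval_add mpoly_eval_mult is_ring_homD[OF assms(1)])
qed

lemma mpoly_eval_subst:
  assumes "is_ring_hom \<iota>"
  shows "mpoly_eval \<iota> (mpoly_eval Cst p \<sigma>) x = mpoly_eval \<iota> p (\<lambda>v. mpoly_eval \<iota> (\<sigma> v) x)"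
  using mpoly_eval_hom[OF is_ring_hom_mpoly_eval[OF assms, of x] is_ring_hom_intros(6), of p \<sigma>]
  by (simp add: mpoly_eval_Cst[OF assms])

section \<open>Left invariant derivations\<close>

text \<open>The generic matrix times \<open>1 + t X\<close>, with \<open>t\<close> the outer
  polynomial variable: the coefficient of \<open>t\<close> then gives a derivative without any
  analysis.\<close>

definition D_curve :: "'n::finite cmat \<Rightarrow> 'n \<times> 'n \<Rightarrow> ('n \<times> 'n) mpoly poly"
  where "D_curve X = (\<lambda>(i, j). [: Var (i, j), \<Sum>k\<in>UNIV. Var (i, k) * Cst (X $ k $ j) :])"

text \<open>\<open>D X p\<close> is the polynomial \<open>x \<mapsto> d/dt p(x (1 + t X))\<close> at \<open>t = 0\<close>.\<close>

definition D :: "'n::finite cmat \<Rightarrow> ('n \<times> 'n) mpoly \<Rightarrow> ('n \<times> 'n) mpoly"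
  where "D X p = coeff (mpoly_eval (\<lambda>c. [: Cst c :]) p (D_curve X)) 1"

lemma is_ring_hom_Cst_poly: "is_ring_hom (\<lambda>c. [: Cst c :: 'v mpoly :])"
  by (rule is_ring_hom_comp[OF is_ring_hom_intros(6) is_ring_hom_intros(5)])

lemma D_simps:
  "D X (Cst c) = 0"
  "D X (Var (i, j)) = (\<Sum>k\<in>UNIV. Var (i, k) * Cst (X $ k $ j))"
  "D X (p + q) = D X p + D X q"
  "D X (p * q) = D X p * q + p * D X q"
proof -
  have 0: "coeff (mpoly_eval (\<lambda>c. [: Cst c :]) p (D_curve X)) 0 = p" for p
    by (induction p rule: mpoly_induct)
       (auto simp: mpoly_eval_add mpoly_eval_mult is_ring_hom_Cst_poly D_curve_def coeff_mult split: prod.splits)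
  show "D X (p * q) = D X p * q + p * D X q"
    unfolding D_def mpoly_eval_mult[OF is_ring_hom_Cst_poly] coeff_mult
    by (simp add: 0)
qed (auto simp: D_def mpoly_eval_add is_ring_hom_Cst_poly D_curve_def)

lemma D_Var: "D X (Var v) = (\<Sum>k\<in>UNIV. Var (fst v, k) * Cst (X $ k $ snd v))"
  by (cases v) (simp add: D_simps)

lemma D_0: "D X 0 = 0"
  using D_simps(1)[of X 0] by (simp add: is_ring_homD[OF is_ring_hom_intros(6)])

lemma D_add: "D (X + Y) p = D X p + D Y p"
  by (induction p rule: mpoly_induct)
     (auto simp: D_simps D_Var is_ring_homD[OF is_ring_hom_intros(6)] distrib_left sum.distrib algebra_simps)

lemma D_smult: "D (smult_mat c X) p = Cst c * D X p"
  by (induction p rule: mpoly_induct)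
     (auto simp: D_simps D_Var smult_mat_def sum_distrib_left is_ring_homD[OF is_ring_hom_intros(6)] algebra_simps)

lemma D_sum: "D X (sum f S) = (\<Sum>i\<in>S. D X (f i))"
  by (induction S rule: infinite_finite_induct) (auto simp: D_simps D_0)

text \<open>Both sides are derivations in \<open>p\<close>, so agreement on the coordinate functions
  suffices. There \<open>D X\<close> followed by \<open>D Y\<close> amounts to right multiplication
  by a matrix product.\<close>

lemma D_commutator: "D X (D Y p) - D Y (D X p) = D (lie_bracket X Y) p"
proof (induction p rule: mpoly_induct)
  case const
  then show ?case by (simp add: D_simps D_0)
next
  case (var v)
  have *: "D X (D Y (Var v)) = (\<Sum>k\<in>UNIV. Var (fst v, k) * Cst ((X ** Y) $ k $ snd v))" for X Y :: "'a cmat"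
  proof -
    have "D X (D Y (Var v)) = (\<Sum>j\<in>UNIV. \<Sum>k\<in>UNIV. Var (fst v, k) * (Cst (X $ k $ j) * Cst (Y $ j $ snd v)))"
      by (simp add: D_Var D_sum D_simps D_0 sum_distrib_right mult.assoc)
    also have "\<dots> = (\<Sum>k\<in>UNIV. Var (fst v, k) * Cst ((X ** Y) $ k $ snd v))"
      by (subst sum.swap)
         (simp add: matrix_matrix_mult_def is_ring_hom_sum[OF is_ring_hom_intros(6)] sum_distrib_left is_ring_homD[OF is_ring_hom_intros(6)] mult.assoc)
    finally show ?thesis .
  qed
  show ?case
    unfolding * unfolding D_Var lie_bracket_def
    by (simp add: sum_subtractf[symmetric] is_ring_homD(6)[OF is_ring_hom_intros(6)] algebra_simps)
next
  case (add p q)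
  then show ?case by (simp add: D_simps algebra_simps add.IH[symmetric])
next
  case (mult p q)
  then show ?case by (simp add: D_simps algebra_simps mult.IH[symmetric])
qed

lemma mpoly_eval_curve_has_derivative:
  "((\<lambda>t. mpoly_eval id p (entries (mat 1 + smult_mat t X))) has_field_derivative
     mpoly_eval id (D X p) (entries (mat 1))) (at 0)"
proof (induction p rule: mpoly_induct)
  case (var v)
  obtain i j where v: "v = (i, j)" by (cases v)
  have "mpoly_eval id (D X (Var v)) (entries (mat 1)) = X $ i $ j"
    by (simp add: v D_simps mpoly_eval_sum mpoly_eval_mult is_ring_hom_intros entries_def mat_def if_distrib
        if_distribR cong: if_cong)
  moreover have "((\<lambda>t. mpoly_eval id (Var v) (entries (mat 1 + smult_mat t X))) has_field_derivative X $ i $ j) (at 0)"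
    by (auto simp: v is_ring_hom_intros entries_def smult_mat_def intro!: derivative_eq_intros)
  ultimately show ?case by (simp only:)
next
  case (mult p q)
  have 1: "mat 1 + smult_mat 0 X = mat 1" by (simp add: smult_mat_def vec_eq_iff)
  show ?case
    using DERIV_mult[OF mult.IH]
    by (simp add: D_simps mpoly_eval_mult mpoly_eval_add is_ring_hom_intros 1 mult.commute)
qed (auto simp: D_simps mpoly_eval_add mpoly_eval_0 is_ring_hom_intros intro!: derivative_eq_intros)

text \<open>Trades the analytic tangency condition for an algebraic one, so that closure properties
  of the Lie algebra follow from identities between the derivations \<open>D X\<close>.\<close>

lemma lie_algebra_iff:
  "X \<in> lie_algebra G \<longleftrightarrow> (\<forall>p\<in>vanishing_ideal G. mpoly_eval id (D X p) (entries (mat 1)) = 0)"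
proof -
  have "((\<lambda>t. mpoly_eval id p (entries (mat 1 + smult_mat t X))) has_field_derivative 0) (at 0)
    \<longleftrightarrow> mpoly_eval id (D X p) (entries (mat 1)) = 0" for p
    using DERIV_unique[OF mpoly_eval_curve_has_derivative[of p X], of 0] mpoly_eval_curve_has_derivative[of p X]
    by metis
  then show ?thesis by (simp only: lie_algebra_def mem_Collect_eq)
qed

lemma lie_algebra_mono: "A \<subseteq> G \<Longrightarrow> lie_algebra A \<subseteq> lie_algebra G"
  by (auto simp: lie_algebra_def vanishing_ideal_def)

lemma lie_algebra_0: "0 \<in> lie_algebra G"
proof -
  have "D 0 p = 0" for p :: "('a \<times> 'a) mpoly"
    using D_add[of 0 0 p] by simp
  then show ?thesis by (simp add: lie_algebra_iff mpoly_eval_0 is_ring_hom_intros)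
qed

lemma lie_algebra_add: "X \<in> lie_algebra G \<Longrightarrow> Y \<in> lie_algebra G \<Longrightarrow> X + Y \<in> lie_algebra G"
  by (simp add: lie_algebra_iff D_add mpoly_eval_add is_ring_hom_intros)

lemma lie_algebra_smult: "X \<in> lie_algebra G \<Longrightarrow> smult_mat c X \<in> lie_algebra G"
  by (simp add: lie_algebra_iff D_smult mpoly_eval_mult is_ring_hom_intros)

definition subst_mul :: "'n::finite cmat \<Rightarrow> 'n cmat \<Rightarrow> ('n \<times> 'n) mpoly \<Rightarrow> ('n \<times> 'n) mpoly"
  where "subst_mul g h p = mpoly_eval Cst p
    (\<lambda>(i, j). \<Sum>k\<in>UNIV. (\<Sum>l\<in>UNIV. Cst (g $ i $ l) * Var (l, k)) * Cst (h $ k $ j))"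

lemma mpoly_eval_subst_mul:
  assumes "is_ring_hom \<iota>"
  shows "mpoly_eval \<iota> (subst_mul g h p) (entries x)
    = mpoly_eval \<iota> p (entries ((\<chi> i j. \<iota> (g $ i $ j)) ** x ** (\<chi> i j. \<iota> (h $ i $ j))))"
  unfolding subst_mul_def mpoly_eval_subst[OF assms]
  by (rule arg_cong[of _ _ "mpoly_eval \<iota> p"])
     (auto simp: fun_eq_iff entries_def mpoly_eval_sum mpoly_eval_mult assms matrix_matrix_mult_def)

lemma mpoly_eval_subst_mul_id:
  "mpoly_eval id (subst_mul g h p) (entries x) = mpoly_eval id p (entries (g ** x ** h))"
  by (simp add: mpoly_eval_subst_mul is_ring_hom_intros)

text \<open>Chain rule for \<open>g x (1 + t X) h = (g x h) (1 + t h' X h)\<close>: left translation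
  leaves the derivation alone, right translation conjugates it.\<close>

lemma D_subst_mul:
  assumes "g' ** g = mat 1" "h ** h' = mat 1"
  shows "D X (subst_mul g h p) = subst_mul g h (D (h' ** X ** h) p)"
proof (induction p rule: mpoly_induct)
  case const
  then show ?case by (simp add: subst_mul_def D_simps mpoly_eval_0 is_ring_hom_intros)
next
  case (var v)
  define B :: "'a \<Rightarrow> 'a \<Rightarrow> ('a \<times> 'a) mpoly" where "B i k = (\<Sum>l\<in>UNIV. Cst (g $ i $ l) * Var (l, k))" for i k
  have a: "D X (B i k) = (\<Sum>m\<in>UNIV. B i m * Cst (X $ m $ k))" for i k
    unfolding B_def by (subst sum_distrib_right, subst sum.swap)
      (simp add: D_sum D_simps sum_distrib_left ac_simps)
  have b: "(\<Sum>k\<in>UNIV. (\<Sum>m\<in>UNIV. B i m * Cst (X $ m $ k)) * Cst (Y $ k $ j))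
    = (\<Sum>m\<in>UNIV. B i m * Cst ((X ** Y) $ m $ j))" for i j X Y
    by (subst sum_distrib_right, subst sum.swap)
       (simp add: matrix_matrix_mult_def is_ring_hom_sum[OF is_ring_hom_intros(6)] sum_distrib_left
         is_ring_homD[OF is_ring_hom_intros(6)] ac_simps)
  have c: "subst_mul g h (Var (i, j)) = (\<Sum>k\<in>UNIV. B i k * Cst (h $ k $ j))" for i j
    by (simp add: subst_mul_def is_ring_hom_intros B_def)
  obtain i j where v: "v = (i, j)" by (cases v)
  have "D X (subst_mul g h (Var v)) = (\<Sum>k\<in>UNIV. (\<Sum>m\<in>UNIV. B i m * Cst (X $ m $ k)) * Cst (h $ k $ j))"
    by (simp add: v c D_sum D_simps a)
  also have "\<dots> = (\<Sum>m\<in>UNIV. B i m * Cst ((h ** (h' ** X ** h)) $ m $ j))"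
    unfolding b by (simp add: matrix_mul_assoc assms)
  also have "\<dots> = (\<Sum>k\<in>UNIV. subst_mul g h (Var (i, k)) * Cst ((h' ** X ** h) $ k $ j))"
    unfolding b[symmetric] c ..
  also have "\<dots> = subst_mul g h (D (h' ** X ** h) (Var v))"
    by (simp add: v subst_mul_def is_ring_hom_intros D_simps mpoly_eval_sum mpoly_eval_mult)
  finally show ?case .
next
  case (add p q)
  then show ?case by (simp add: subst_mul_def D_simps mpoly_eval_add is_ring_hom_intros)
next
  case (mult p q)
  then show ?case by (simp add: subst_mul_def D_simps mpoly_eval_add mpoly_eval_mult is_ring_hom_intros)
qed

lemma lie_algebra_closed_sum: "(\<And>i. i \<in> S \<Longrightarrow> f i \<in> lie_algebra G) \<Longrightarrow> sum f S \<in> lie_algebra G"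
  by (induction S rule: infinite_finite_induct) (auto simp: lie_algebra_0 lie_algebra_add)

lemma lie_algebra_minus: "X \<in> lie_algebra G \<Longrightarrow> - X \<in> lie_algebra G"
  using lie_algebra_smult[of X G "-1"] by (simp add: smult_mat_def uminus_vec_def)

lemma lie_algebra_diff: "X \<in> lie_algebra G \<Longrightarrow> Y \<in> lie_algebra G \<Longrightarrow> X - Y \<in> lie_algebra G"
  using lie_algebra_add[of X G "- Y"] lie_algebra_minus[of Y G] by simp

lemma mat_cancel: "h ** g = mat 1 \<Longrightarrow> Z ** h ** g = (Z :: 'a::comm_semiring_1 ^ 'n ^ 'm)"
  by (metis matrix_mul_assoc matrix_mul_rid)

lemma matrix_inv_mult:
  assumes "invertible (g :: 'a::field ^ 'n ^ 'n)"
  shows "g ** matrix_inv g = mat 1" "matrix_inv g ** g = mat 1"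
  using assms unfolding invertible_def matrix_inv_def by (metis (mono_tags, lifting) someI_ex)+

text \<open>In fact a group of invertible matrices. It is kept separate from algebraic groups
  because generated groups such as \<open>exp J\<close> enter before their Zariski closure is
  taken.\<close>

locale matrix_monoid =
  fixes G :: "('n::finite cmat) set"
  assumes one_in: "mat 1 \<in> G" and mul_in: "g \<in> G \<Longrightarrow> h \<in> G \<Longrightarrow> g ** h \<in> G"
    and inv_in: "g \<in> G \<Longrightarrow> matrix_inv g \<in> G" and invertible_in: "g \<in> G \<Longrightarrow> invertible g"
begin

lemma subst_mul_vanishing:
  "g \<in> G \<Longrightarrow> h \<in> G \<Longrightarrow> p \<in> vanishing_ideal G \<Longrightarrow> subst_mul g h p \<in> vanishing_ideal G"
  by (simp add: vanishing_ideal_def mpoly_eval_subst_mul_id mul_in)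

text \<open>The value of \<open>D X p\<close> at \<open>g\<close> is the derivative at the identity
  of the left translate \<open>subst_mul g (mat 1) p\<close>, which again belongs to the
  ideal.\<close>

lemma D_vanishing:
  assumes "X \<in> lie_algebra G" "p \<in> vanishing_ideal G"
  shows "D X p \<in> vanishing_ideal G"
proof -
  have "mpoly_eval id (D X p) (entries g) = 0" if g: "g \<in> G" for g
  proof -
    have "D X (subst_mul g (mat 1) p) = subst_mul g (mat 1) (D X p)"
      using D_subst_mul[of "matrix_inv g" g "mat 1" "mat 1" X p] matrix_inv_mult[OF invertible_in[OF g]] by simp
    moreover have "mpoly_eval id (D X (subst_mul g (mat 1) p)) (entries (mat 1)) = 0"
      using assms subst_mul_vanishing[OF g one_in assms(2)] by (simp add: lie_algebra_iff)
    ultimately show ?thesis by (simp add: mpoly_eval_subst_mul_id)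
  qed
  then show ?thesis by (simp add: vanishing_ideal_def)
qed

lemma lie_algebra_bracket:
  assumes "X \<in> lie_algebra G" "Y \<in> lie_algebra G"
  shows "lie_bracket X Y \<in> lie_algebra G"
  unfolding lie_algebra_iff D_commutator[symmetric]
  using D_vanishing[OF assms(1)] D_vanishing[OF assms(2)] assms
  by (auto simp: lie_algebra_iff is_ring_homD[OF is_ring_hom_mpoly_eval[OF is_ring_hom_intros(1)]])

lemma lie_algebra_Ad:
  assumes "g \<in> G" "X \<in> lie_algebra G"
  shows "g ** X ** matrix_inv g \<in> lie_algebra G"
  unfolding lie_algebra_iff
proof
  fix p assume p: "p \<in> vanishing_ideal G"
  note g = matrix_inv_mult[OF invertible_in[OF assms(1)]]
  have "D X (subst_mul g (matrix_inv g) p) = subst_mul g (matrix_inv g) (D (g ** X ** matrix_inv g) p)"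
    using D_subst_mul[OF g(2) g(2)] by simp
  moreover have "mpoly_eval id (D X (subst_mul g (matrix_inv g) p)) (entries (mat 1)) = 0"
    using assms subst_mul_vanishing[OF assms(1) inv_in[OF assms(1)] p] by (simp add: lie_algebra_iff)
  ultimately show "mpoly_eval id (D (g ** X ** matrix_inv g) p) (entries (mat 1)) = 0"
    by (simp add: mpoly_eval_subst_mul_id g)
qed

text \<open>The formal solution of an ODE \<open>W' = c W X\<close> with \<open>X\<close> in the Lie algebra stays in the group:
  by the chain rule every Taylor coefficient of \<open>p(W)\<close> is determined by
  lower coefficients of \<open>(D X p)(W)\<close>.\<close>

lemma mpoly_eval_ODE_eq_0:
  fixes W :: "'a::field_char_0 fps ^ 'n ^ 'n" and \<phi> :: "complex \<Rightarrow> 'a"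
  assumes X: "X \<in> lie_algebra G" and \<phi>: "is_ring_hom \<phi>"
    and deriv: "\<And>i j. fps_deriv (W $ i $ j) = c * (\<Sum>k\<in>UNIV. W $ i $ k * fps_const (\<phi> (X $ k $ j)))"
    and init: "\<And>p. p \<in> vanishing_ideal G \<Longrightarrow> mpoly_eval \<phi> p (entries (\<chi> i j. fps_nth (W $ i $ j) 0)) = 0"
    and p: "p \<in> vanishing_ideal G"
  shows "mpoly_eval (\<lambda>z. fps_const (\<phi> z)) p (entries W) = 0"
proof -
  have h: "is_ring_hom (\<lambda>z. fps_const (\<phi> z))"
    by (rule is_ring_hom_comp[OF \<phi> is_ring_hom_intros(3)])
  let ?ev = "\<lambda>p. mpoly_eval (\<lambda>z. fps_const (\<phi> z)) p (entries W)"
  have D: "fps_deriv (?ev p) = c * ?ev (D X p)" for p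
  proof (induction p rule: mpoly_induct)
    case (var v)
    then show ?case
      by (cases v) (simp add: h entries_def deriv D_simps mpoly_eval_sum mpoly_eval_mult)
  qed (simp_all add: h D_simps mpoly_eval_add mpoly_eval_mult mpoly_eval_0 algebra_simps)
  have "\<forall>p\<in>vanishing_ideal G. fps_nth (?ev p) m = 0" for m
  proof (induction m rule: less_induct)
    case (less m)
    show ?case
    proof (cases m)
      case 0
      show ?thesis
        using init mpoly_eval_hom[OF is_ring_hom_intros(10) h, of _ "entries W"]
        by (auto simp: 0 entries_def split_def)
    next
      case (Suc l)
      have "fps_nth (?ev p) (Suc l) = 0" if p: "p \<in> vanishing_ideal G" for p
      proof -
        have "of_nat (Suc l) * fps_nth (?ev p) (Suc l) = fps_nth (c * ?ev (D X p)) l"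
          unfolding D[symmetric] by simp
        also have "\<dots> = 0"
          unfolding fps_mult_nth using less.IH D_vanishing[OF X p] Suc by (intro sum.neutral) auto
        finally show ?thesis by (simp del: of_nat_Suc)
      qed
      then show ?thesis by (simp add: Suc)
    qed
  qed
  then show ?thesis using p by (intro fps_ext) auto
qed

end

section \<open>The formal exponential\<close>

primrec matpow :: "'a::semiring_1 ^ 'n ^ 'n \<Rightarrow> nat \<Rightarrow> 'a ^ 'n ^ 'n"
  where "matpow X 0 = mat 1" | "matpow X (Suc m) = matpow X m ** X"

text \<open>The series \<open>exp (t X)\<close> in a formal variable \<open>t\<close>. Convergence
  plays no part here, so \<open>X\<close> may have entries in any field of characteristic zero, for
  instance Laurent series.\<close>

definition fexp :: "'a::field_char_0 ^ 'n ^ 'n \<Rightarrow> 'a fps ^ 'n ^ 'n"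
  where "fexp X = (\<chi> i j. Abs_fps (\<lambda>m. matpow X m $ i $ j / fact m))"

abbreviation map_mat :: "('a \<Rightarrow> 'b) \<Rightarrow> 'a ^ 'n ^ 'n \<Rightarrow> 'b ^ 'n ^ 'n"
  where "map_mat f X \<equiv> (\<chi> i j. f (X $ i $ j))"

abbreviation mat_deriv :: "'a::comm_ring_1 fps ^ 'n ^ 'n \<Rightarrow> 'a fps ^ 'n ^ 'n"
  where "mat_deriv \<equiv> map_mat fps_deriv"

lemma map_mat_mult:
  "is_ring_hom f \<Longrightarrow> map_mat f (X ** Y) = map_mat f X ** map_mat f Y"
  by (simp add: vec_eq_iff matrix_matrix_mult_def is_ring_hom_sum is_ring_homD)

lemma map_mat_1: "is_ring_hom f \<Longrightarrow> map_mat f (mat 1) = mat 1"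
  by (simp add: vec_eq_iff mat_def is_ring_homD)

lemma mat_deriv_mult: "mat_deriv (X ** Y) = mat_deriv X ** Y + X ** mat_deriv Y"
  by (simp add: vec_eq_iff matrix_matrix_mult_def sum.distrib fps_deriv_sum ac_simps)

lemma fexp_deriv: "mat_deriv (fexp X) = fexp X ** map_mat fps_const X"
  by (simp add: vec_eq_iff fexp_def matrix_matrix_mult_def fps_eq_iff fps_sum_nth
      sum_divide_distrib sum_distrib_left field_simps del: of_nat_Suc)

lemma fexp_0: "map_mat (\<lambda>f. fps_nth f 0) (fexp X) = mat 1"
  by (simp add: fexp_def vec_eq_iff mat_def)

text \<open>The equation determines the Taylor coefficients recursively. The addition and
  conjugation formulas for the exponential are obtained by checking that both sides solve the same
  equation.\<close>

lemma mat_ODE_unique: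
  fixes V W :: "'a::field_char_0 fps ^ 'n ^ 'n"
  assumes V: "mat_deriv V = V ** map_mat fps_const X" and W: "mat_deriv W = W ** map_mat fps_const X"
    and 0: "map_mat (\<lambda>f. fps_nth f 0) V = map_mat (\<lambda>f. fps_nth f 0) W"
  shows "V = W"
proof -
  have "\<forall>i j. fps_nth (V $ i $ j) m = fps_nth (W $ i $ j) m" for m
  proof (induction m)
    case 0
    then show ?case using assms(3) by (simp add: vec_eq_iff)
  next
    case (Suc m)
    have *: "of_nat (Suc m) * fps_nth (V $ i $ j) (Suc m) = (\<Sum>k\<in>UNIV. fps_nth (V $ i $ k) m * X $ k $ j)"
      if "mat_deriv V = V ** map_mat fps_const X" for i j and V :: "'a fps ^ 'n ^ 'n"
      using arg_cong[OF that, of "\<lambda>Z. fps_nth (Z $ i $ j) m"]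
      by (simp add: matrix_matrix_mult_def fps_sum_nth)
    have "of_nat (Suc m) * fps_nth (V $ i $ j) (Suc m) = of_nat (Suc m) * fps_nth (W $ i $ j) (Suc m)" for i j
      unfolding *[OF V] *[OF W] using Suc.IH by simp
    then show ?case by (simp del: of_nat_Suc)
  qed
  then show ?thesis by (simp add: vec_eq_iff fps_eq_iff)
qed

lemma map_mat_add_hom: "is_ring_hom f \<Longrightarrow> map_mat f (X + Y) = map_mat f X + map_mat f Y"
  by (simp add: vec_eq_iff is_ring_homD)

lemma matrix_add_rdistrib': "(A + B) ** (C :: 'a::semiring_1 ^ 'p ^ 'n) = A ** C + B ** C"
  by (vector matrix_matrix_mult_def sum.distrib[symmetric] field_simps)

lemma matpow_commute: "Y ** X = X ** Y \<Longrightarrow> matpow X m ** Y = Y ** matpow X m"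
  by (induction m) (simp_all, metis matrix_mul_assoc)

lemma fexp_commute:
  fixes X Y :: "'a::field_char_0 ^ 'n ^ 'n"
  assumes "Y ** X = X ** Y"
  shows "map_mat fps_const Y ** fexp X = fexp X ** map_mat fps_const Y"
  using arg_cong[OF matpow_commute[OF assms], of "\<lambda>Z. Z $ i $ j / fact m" for i j m]
  by (simp add: vec_eq_iff fps_eq_iff fexp_def matrix_matrix_mult_def fps_sum_nth sum_divide_distrib field_simps)

lemma fexp_add:
  fixes X Y :: "'a::field_char_0 ^ 'n ^ 'n"
  assumes "Y ** X = X ** Y"
  shows "fexp (X + Y) = fexp X ** fexp Y"
proof (rule mat_ODE_unique[OF fexp_deriv])
  let ?c = "map_mat fps_const :: _ \<Rightarrow> 'a fps ^ 'n ^ 'n"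
  have "mat_deriv (fexp X ** fexp Y) = fexp X ** (?c X ** fexp Y) + fexp X ** (fexp Y ** ?c Y)"
    by (simp add: mat_deriv_mult fexp_deriv matrix_mul_assoc)
  also have "?c X ** fexp Y = fexp Y ** ?c X"
    by (rule fexp_commute) (simp add: assms)
  finally show "mat_deriv (fexp X ** fexp Y) = fexp X ** fexp Y ** ?c (X + Y)"
    unfolding map_mat_add_hom[OF is_ring_hom_intros(3)]
    by (simp add: matrix_mul_assoc matrix_add_ldistrib)
  show "map_mat (\<lambda>f. fps_nth f 0) (fexp (X + Y)) = map_mat (\<lambda>f. fps_nth f 0) (fexp X ** fexp Y)"
    unfolding map_mat_mult[OF is_ring_hom_intros(10)] fexp_0 by simp
qed

lemma fexp_zero: "fexp (0 :: 'a::field_char_0 ^ 'n ^ 'n) = mat 1"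
proof -
  have "matpow (0 :: 'a ^ 'n ^ 'n) m = (if m = 0 then mat 1 else 0)" for m
    by (cases m) simp_all
  then show ?thesis
    by (simp add: fexp_def vec_eq_iff mat_def fps_eq_iff)
qed

lemma fexp_conj:
  fixes X :: "'a::field_char_0 ^ 'n ^ 'n"
  assumes "h ** g = mat 1"
  shows "fexp (g ** X ** h) = map_mat fps_const g ** fexp X ** map_mat fps_const h"
proof (rule mat_ODE_unique[OF fexp_deriv])
  have z: "mat_deriv (map_mat fps_const g) = 0" for g :: "'a ^ 'n ^ 'n"
    by (simp add: vec_eq_iff)
  note m = map_mat_mult[OF is_ring_hom_intros(3), symmetric]
  have "map_mat fps_const h ** map_mat fps_const g = mat 1"
    by (simp add: m assms map_mat_1[OF is_ring_hom_intros(3)])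
  then show "mat_deriv (map_mat fps_const g ** fexp X ** map_mat fps_const h) =
      map_mat fps_const g ** fexp X ** map_mat fps_const h ** map_mat fps_const (g ** X ** h)"
    unfolding mat_deriv_mult z fexp_deriv map_mat_mult[OF is_ring_hom_intros(3)]
    by (simp add: matrix_mul_assoc mat_cancel)
  show "map_mat (\<lambda>f. fps_nth f 0) (fexp (g ** X ** h)) =
    map_mat (\<lambda>f. fps_nth f 0) (map_mat fps_const g ** fexp X ** map_mat fps_const h)"
    unfolding map_mat_mult[OF is_ring_hom_intros(10)] fexp_0
    using assms matrix_left_right_inverse[of h g] by simp
qed

lemma (in matrix_monoid) mpoly_eval_fexp:
  assumes "X \<in> lie_algebra G" "p \<in> vanishing_ideal G"
  shows "mpoly_eval fps_const p (entries (fexp X)) = 0"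
proof -
  have "mpoly_eval (\<lambda>z. fps_const (id z)) p (entries (fexp X)) = 0"
  proof (rule mpoly_eval_ODE_eq_0[OF assms(1) is_ring_hom_intros(1) _ _ assms(2), where c = 1])
    show "fps_deriv (fexp X $ i $ j) = 1 * (\<Sum>k\<in>UNIV. fexp X $ i $ k * fps_const (id (X $ k $ j)))" for i j
    proof -
      have "mat_deriv (fexp X) $ i $ j = (fexp X ** map_mat fps_const X) $ i $ j"
        by (simp only: fexp_deriv)
      then show ?thesis by (simp add: matrix_matrix_mult_def)
    qed
    show "mpoly_eval id p (entries (map_mat (\<lambda>f. fps_nth f 0) (fexp X))) = 0" if "p \<in> vanishing_ideal G" for p
      using that one_in by (simp add: fexp_0 vanishing_ideal_def)
  qed
  then show ?thesis by simp
qed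

text \<open>Modulo \<open>t^2\<close> the exponential is \<open>1 + t X\<close>, so the linear
  coefficient of \<open>p (exp (t X))\<close> is the value of \<open>D X p\<close> at the
  identity.\<close>

lemma fexp_in_imp_lie_algebra:
  assumes "\<And>p. p \<in> vanishing_ideal G \<Longrightarrow> mpoly_eval fps_const p (entries (fexp X)) = 0"
  shows "X \<in> lie_algebra G"
proof -
  have h: "is_ring_hom (\<lambda>f::complex fps. fps_nth f 0)" by (rule is_ring_hom_intros)
  \<comment> \<open>The constant coefficient is carried along because the product rule for the
    linear one involves it.\<close>
  have *: "fps_nth (mpoly_eval fps_const p (entries (fexp X))) 1 = mpoly_eval id (D X p) (entries (mat 1)) \<and>
     fps_nth (mpoly_eval fps_const p (entries (fexp X))) 0 = mpoly_eval id p (entries (mat 1))" for p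
  proof (induction p rule: mpoly_induct)
    case (var v)
    then show ?case
      by (cases v) (simp add: is_ring_hom_intros D_simps mpoly_eval_sum mpoly_eval_mult entries_def fexp_def
        mat_def if_distrib if_distribR cong: if_cong del: matrix_mul_lid, simp add: matrix_matrix_mult_def
        if_distrib if_distribR cong: if_cong)
  next
    case (mult p q)
    then show ?case
      by (simp add: is_ring_hom_intros D_simps mpoly_eval_add mpoly_eval_mult fps_mult_nth)
  qed (simp_all add: is_ring_hom_intros D_simps mpoly_eval_add mpoly_eval_mult mpoly_eval_0)
  show ?thesis
    unfolding lie_algebra_iff using * assms by (metis fps_zero_nth)
qed

section \<open>Convergent exponentials\<close>

lemma norm_matpow_le:
  fixes X :: "complex ^ 'n ^ 'n"
  assumes "\<And>i j. norm (X $ i $ j) \<le> c" "c \<ge> 0"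
  shows "norm (matpow X m $ i $ j) \<le> (of_nat CARD('n) * c) ^ m"
proof (induction m arbitrary: j)
  case 0
  then show ?case by (simp add: mat_def)
next
  case (Suc m)
  have "norm (matpow X (Suc m) $ i $ j) \<le> (\<Sum>k\<in>UNIV. norm (matpow X m $ i $ k * X $ k $ j))"
    unfolding matpow.simps matrix_matrix_mult_def by (simp add: norm_sum)
  also have "\<dots> \<le> (\<Sum>k\<in>(UNIV :: 'n set). (of_nat CARD('n) * c) ^ m * c)"
    unfolding norm_mult using Suc.IH assms by (intro sum_mono mult_mono) auto
  finally show ?case by (simp add: ac_simps)
qed

definition entire :: "complex fps \<Rightarrow> bool"
  where "entire f \<longleftrightarrow> fps_conv_radius f = \<infinity>"

lemma entire_fexp: "entire (fexp X $ i $ j)"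
  unfolding entire_def fps_conv_radius_def
proof (rule conv_radius_inftyI'')
  fix z :: complex
  define c where "c = (\<Sum>i\<in>UNIV. \<Sum>j\<in>UNIV. norm (X $ i $ j))"
  have c: "norm (X $ i $ j) \<le> c" for i j
  proof -
    have "norm (X $ i $ j) \<le> (\<Sum>j\<in>UNIV. norm (X $ i $ j))"
      by (rule member_le_sum) auto
    also have "\<dots> \<le> c"
      unfolding c_def by (rule member_le_sum[where f = "\<lambda>i. \<Sum>j\<in>UNIV. norm (X $ i $ j)"]) (auto intro: sum_nonneg)
    finally show ?thesis .
  qed
  have c0: "c \<ge> 0" unfolding c_def by (intro sum_nonneg) auto
  show "summable (\<lambda>n. fps_nth (fexp X $ i $ j) n * z ^ n)"
  proof (rule summable_comparison_test')
    show "summable (\<lambda>n. inverse (fact n) * (of_nat CARD('a) * c * norm z) ^ n)"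
      by (rule summable_exp)
    show "norm (fps_nth (fexp X $ i $ j) n * z ^ n) \<le> inverse (fact n) * (of_nat CARD('a) * c * norm z) ^ n"
      if "n \<ge> 0" for n
      using norm_matpow_le[of X c, OF c c0, of n i j]
      by (auto simp: fexp_def norm_mult norm_divide norm_power power_mult_distrib divide_simps intro: mult_right_mono)
  qed
qed

lemma entire_intros:
  "entire (fps_const c)" "entire f \<Longrightarrow> entire g \<Longrightarrow> entire (f + g)" "entire f \<Longrightarrow> entire g \<Longrightarrow> entire (f * g)"
  using fps_conv_radius_add[of f g] fps_conv_radius_mult[of f g] by (auto simp: entire_def)

lemma entire_sum: "(\<And>i. i \<in> S \<Longrightarrow> entire (f i)) \<Longrightarrow> entire (sum f S)"
  by (induction S rule: infinite_finite_induct) (use entire_intros(1)[of 0] entire_intros(2) in auto)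

lemma entire_eval:
  "entire f \<Longrightarrow> entire g \<Longrightarrow> eval_fps (f + g) z = eval_fps f z + eval_fps g z"
  "entire f \<Longrightarrow> entire g \<Longrightarrow> eval_fps (f * g) z = eval_fps f z * eval_fps g z"
  by (auto simp: entire_def eval_fps_add eval_fps_mult)

lemma entire_eval_sum: "(\<And>i. i \<in> S \<Longrightarrow> entire (f i)) \<Longrightarrow> eval_fps (sum f S) z = (\<Sum>i\<in>S. eval_fps (f i) z)"
  by (induction S rule: infinite_finite_induct) (auto simp: entire_eval entire_sum)

lemma entire_mpoly_eval:
  assumes "\<And>v. entire (x v)"
  shows "entire (mpoly_eval fps_const p x) \<and>
    eval_fps (mpoly_eval fps_const p x) z = mpoly_eval id p (\<lambda>v. eval_fps (x v) z)"
  by (induction p rule: mpoly_induct)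
     (auto simp: is_ring_hom_intros assms mpoly_eval_add mpoly_eval_mult entire_intros entire_eval)

lemma entire_eq_0:
  assumes "entire f" "\<And>z. eval_fps f z = 0"
  shows "f = 0"
  by (rule eval_fps_eqD) (use assms in \<open>auto simp: entire_def\<close>)

definition mexp :: "complex \<Rightarrow> complex ^ 'n ^ 'n \<Rightarrow> complex ^ 'n ^ 'n"
  where "mexp t X = map_mat (\<lambda>f. eval_fps f t) (fexp X)"

lemma mpoly_eval_mexp: "mpoly_eval id p (entries (mexp t X)) = eval_fps (mpoly_eval fps_const p (entries (fexp X))) t"
  by (subst entire_mpoly_eval[THEN conjunct2])
     (auto simp: entries_def mexp_def entire_fexp split_def)

lemma continuous_mpoly_eval_mexp: "continuous_on UNIV (\<lambda>t. mpoly_eval id p (entries (mexp t X)))"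
  unfolding mpoly_eval_mexp
proof (rule continuous_on_eval_fps'[OF continuous_on_id])
  have "entire (mpoly_eval fps_const p (entries (fexp X)))"
    by (rule entire_mpoly_eval[THEN conjunct1]) (auto simp: entries_def entire_fexp split_def)
  then show "(\<lambda>x. x) ` UNIV \<subseteq> eball 0 (fps_conv_radius (mpoly_eval fps_const p (entries (fexp X))))"
    by (auto simp: entire_def in_eball_iff)
qed

lemma map_mat_eval_mult:
  assumes "\<And>i j. entire (V $ i $ j)" "\<And>i j. entire (W $ i $ j)"
  shows "map_mat (\<lambda>f. eval_fps f t) (V ** W) = map_mat (\<lambda>f. eval_fps f t) V ** map_mat (\<lambda>f. eval_fps f t) W"
  by (simp add: vec_eq_iff matrix_matrix_mult_def entire_eval_sum entire_eval entire_intros assms)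

lemma map_mat_eval_const: "map_mat (\<lambda>f. eval_fps f t) (map_mat fps_const X) = X"
  by (simp add: vec_eq_iff)

lemma mexp_add: "Y ** X = X ** Y \<Longrightarrow> mexp t (X + Y) = mexp t X ** mexp t Y"
  by (simp add: mexp_def fexp_add map_mat_eval_mult entire_fexp)

lemma map_mat_eval_1: "map_mat (\<lambda>f. eval_fps f t) (mat 1) = mat 1"
  by (simp add: vec_eq_iff mat_def)

lemma mexp_zero: "mexp t 0 = mat 1"
  by (simp add: mexp_def fexp_zero map_mat_eval_1)

lemma mexp_at_0: "mexp 0 X = mat 1"
  using fexp_0[of X] by (simp add: mexp_def eval_fps_at_0)

lemma mexp_minus: "mexp t X ** mexp t (- X) = mat 1" "mexp t (- X) ** mexp t X = mat 1"
proof -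
  have *: "(- X) ** X = X ** (- X)" for X :: "complex ^ 'n ^ 'n"
    by (simp add: vec_eq_iff matrix_matrix_mult_def)
  show "mexp t X ** mexp t (- X) = mat 1" "mexp t (- X) ** mexp t X = mat 1"
    using mexp_add[OF *[of X], of t] mexp_add[OF *[of "- X"], of t] by (simp_all add: mexp_zero)
qed

lemma mexp_conj:
  fixes X g h :: "complex ^ 'n ^ 'n"
  assumes "h ** g = mat 1"
  shows "mexp t (g ** X ** h) = g ** mexp t X ** h"
proof -
  have 1: "entire (map_mat fps_const g $ i $ j)" for g :: "complex ^ 'n ^ 'n" and i j
    by (simp add: entire_intros)
  have 2: "entire ((map_mat fps_const g ** fexp X) $ i $ j)" for i j
    by (simp add: matrix_matrix_mult_def entire_sum entire_intros entire_fexp)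
  show ?thesis
    unfolding mexp_def fexp_conj[OF assms] map_mat_eval_mult[OF 2 1] map_mat_eval_mult[OF 1 entire_fexp]
      map_mat_eval_const ..
qed

lemma matpow_smult: "matpow (smult_mat c X) m = smult_mat (c ^ m) (matpow X m)"
  by (induction m) (simp_all add: smult_mat_def vec_eq_iff matrix_matrix_mult_def sum_distrib_left ac_simps)

lemma mexp_smult: "mexp t (smult_mat c X) = mexp (c * t) X"
  by (simp add: mexp_def vec_eq_iff fexp_def eval_fps_def matpow_smult)
     (simp add: smult_mat_def power_mult_distrib ac_simps)

lemma invertible_mexp: "invertible (mexp t X)"
  using mexp_minus unfolding invertible_def by blast

lemma matrix_inv_eq:
  fixes g :: "'a::field ^ 'n ^ 'n"
  assumes "g ** h = mat 1"
  shows "matrix_inv g = h"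
proof -
  have i: "invertible g" "h ** g = mat 1"
    using assms matrix_left_right_inverse[of g h] unfolding invertible_def by auto
  show ?thesis using matrix_inv_mult[OF i(1)] assms by (metis i(2) matrix_mul_assoc matrix_mul_lid matrix_mul_rid)
qed

lemma matrix_inv_mexp: "matrix_inv (mexp t X) = mexp t (- X)"
  by (rule matrix_inv_eq) (rule mexp_minus)

section \<open>Polynomial functions and Zariski closures\<close>

definition poly_fun :: "('n::finite cmat \<Rightarrow> complex) \<Rightarrow> bool"
  where "poly_fun f \<longleftrightarrow> (\<exists>p. \<forall>x. f x = mpoly_eval id p (entries x))"

lemma poly_fun_intros:
  "poly_fun (\<lambda>x. c)" "poly_fun (\<lambda>x. x $ i $ j)"
  "poly_fun f \<Longrightarrow> poly_fun g \<Longrightarrow> poly_fun (\<lambda>x. f x + g x)"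
  "poly_fun f \<Longrightarrow> poly_fun g \<Longrightarrow> poly_fun (\<lambda>x. f x * g x)"
proof -
  show "poly_fun (\<lambda>x. c)"
    unfolding poly_fun_def by (rule exI[of _ "Cst c"]) (simp add: is_ring_hom_intros)
  show "poly_fun (\<lambda>x. x $ i $ j)"
    unfolding poly_fun_def by (rule exI[of _ "Var (i, j)"]) (simp add: is_ring_hom_intros entries_def)
  show "poly_fun f \<Longrightarrow> poly_fun g \<Longrightarrow> poly_fun (\<lambda>x. f x + g x)"
    unfolding poly_fun_def by (metis mpoly_eval_add[OF is_ring_hom_intros(1)])
  show "poly_fun f \<Longrightarrow> poly_fun g \<Longrightarrow> poly_fun (\<lambda>x. f x * g x)"
    unfolding poly_fun_def by (metis mpoly_eval_mult[OF is_ring_hom_intros(1)])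
qed

lemma poly_fun_sum: "(\<And>i. i \<in> S \<Longrightarrow> poly_fun (f i)) \<Longrightarrow> poly_fun (\<lambda>x. \<Sum>i\<in>S. f i x)"
  by (induction S rule: infinite_finite_induct) (auto intro: poly_fun_intros)

lemma poly_fun_prod: "(\<And>i. i \<in> S \<Longrightarrow> poly_fun (f i)) \<Longrightarrow> poly_fun (\<lambda>x. \<Prod>i\<in>S. f i x)"
  by (induction S rule: infinite_finite_induct) (auto intro: poly_fun_intros)

lemma poly_fun_power: "poly_fun f \<Longrightarrow> poly_fun (\<lambda>x. f x ^ m)"
  by (induction m) (auto intro: poly_fun_intros)

lemma poly_fun_det:
  "(\<And>i j. poly_fun (\<lambda>x. f x $ i $ j)) \<Longrightarrow> poly_fun (\<lambda>x. det (f x))"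
  unfolding det_def by (intro poly_fun_sum poly_fun_intros poly_fun_prod)

text \<open>Cramer's rule applied to the \<open>j\<close>-th column of the inverse.\<close>

lemma det_mult_matrix_inv:
  assumes "invertible (x :: complex ^ 'n ^ 'n)"
  shows "det x * matrix_inv x $ i $ j = det (\<chi> k l. if l = i then mat 1 $ k $ j else x $ k $ l)"
proof -
  have "x *v column j (matrix_inv x) = (\<chi> k. mat 1 $ k $ j)"
    using matrix_inv_mult(1)[OF assms]
    by (simp add: vec_eq_iff column_def matrix_vector_mult_def matrix_matrix_mult_def)
  then have "column j (matrix_inv x) $ i = det (\<chi> k l. if l = i then (\<chi> k. mat 1 $ k $ j) $ k else x $ k $ l) / det x"
    using assms cramer[of x "column j (matrix_inv x)" "\<chi> k. mat 1 $ k $ j"]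
    by (simp only: invertible_det_nz vec_lambda_beta) simp
  then show ?thesis using assms unfolding vec_lambda_beta by (simp add: invertible_det_nz column_def)
qed

text \<open>A power of the determinant clears the denominators of the inverse. This makes inversion
  accessible to polynomial closure arguments.\<close>

lemma mpoly_eval_matrix_inv:
  "\<exists>N f. poly_fun f \<and> (\<forall>x. invertible x \<longrightarrow> f x = det x ^ N * mpoly_eval id p (entries (matrix_inv x)))"
proof (induction p rule: mpoly_induct)
  case (const c)
  then show ?case
    by (intro exI[of _ 0] exI[of _ "\<lambda>x. c"]) (simp add: poly_fun_intros is_ring_hom_intros)
next
  case (var v)
  show ?case
  proof (intro exI conjI allI impI)
    show "poly_fun (\<lambda>x::'a cmat. det (\<chi> k l. if l = fst v then mat 1 $ k $ snd v else x $ k $ l))"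
    proof (rule poly_fun_det)
      fix k l
      show "poly_fun (\<lambda>x::'a cmat. (\<chi> k l. if l = fst v then mat 1 $ k $ snd v else x $ k $ l) $ k $ l)"
        by (cases "l = fst v") (simp_all add: poly_fun_intros)
    qed
    show "det (\<chi> k l. if l = fst v then mat 1 $ k $ snd v else x $ k $ l)
      = det x ^ 1 * mpoly_eval id (Var v) (entries (matrix_inv x))" if "invertible x" for x :: "'a cmat"
      using det_mult_matrix_inv[OF that, of "fst v" "snd v"] by (simp add: is_ring_hom_intros entries_def split_def)
  qed
next
  case (add p q)
  obtain N f M g where *: "poly_fun f" "\<forall>x. invertible x \<longrightarrow> f x = det x ^ N * mpoly_eval id p (entries (matrix_inv x))"
    "poly_fun g" "\<forall>x. invertible x \<longrightarrow> g x = det x ^ M * mpoly_eval id q (entries (matrix_inv x))"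
    using add by blast
  show ?case
  proof (intro exI conjI allI impI)
    show "poly_fun (\<lambda>x. f x * det x ^ M + g x * det x ^ N)"
      using * by (intro poly_fun_intros poly_fun_power poly_fun_det)
    show "f x * det x ^ M + g x * det x ^ N = det x ^ (N + M) * mpoly_eval id (p + q) (entries (matrix_inv x))"
      if "invertible x" for x
      using * that by (simp add: mpoly_eval_add is_ring_hom_intros power_add algebra_simps)
  qed
next
  case (mult p q)
  obtain N f M g where *: "poly_fun f" "\<forall>x. invertible x \<longrightarrow> f x = det x ^ N * mpoly_eval id p (entries (matrix_inv x))"
    "poly_fun g" "\<forall>x. invertible x \<longrightarrow> g x = det x ^ M * mpoly_eval id q (entries (matrix_inv x))"
    using mult by blast
  show ?case
  proof (intro exI conjI allI impI)
    show "poly_fun (\<lambda>x. f x * g x)"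
      using * by (intro poly_fun_intros)
    show "f x * g x = det x ^ (N + M) * mpoly_eval id (p * q) (entries (matrix_inv x))"
      if "invertible x" for x
      using * that by (simp add: mpoly_eval_mult is_ring_hom_intros power_add algebra_simps)
  qed
qed

definition Zcl :: "('n::finite cmat) set \<Rightarrow> ('n cmat) set"
  where "Zcl B = {g. invertible g \<and> (\<forall>p\<in>vanishing_ideal B. mpoly_eval id p (entries g) = 0)}"

lemma Zcl_poly_fun:
  "g \<in> Zcl B \<Longrightarrow> poly_fun f \<Longrightarrow> (\<And>b. b \<in> B \<Longrightarrow> f b = 0) \<Longrightarrow> f g = 0"
  unfolding Zcl_def poly_fun_def vanishing_ideal_def by auto

lemma Zcl_I:
  "invertible g \<Longrightarrow> (\<And>p. (\<And>b. b \<in> B \<Longrightarrow> mpoly_eval id p (entries b) = 0) \<Longrightarrow> mpoly_eval id p (entries g) = 0) \<Longrightarrow> g \<in> Zcl B"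
  unfolding Zcl_def vanishing_ideal_def by auto

lemma invertible_mul: "invertible g \<Longrightarrow> invertible h \<Longrightarrow> invertible (g ** h :: 'a::field ^ 'n ^ 'n)"
  by (rule invertible_mult)

lemma invertible_matrix_inv: "invertible g \<Longrightarrow> invertible (matrix_inv g :: 'a::field ^ 'n ^ 'n)"
  using matrix_inv_mult unfolding invertible_def by blast

text \<open>Products are closed up one factor at a time: first \<open>g ** b\<close> with
  \<open>b\<close> in \<open>B\<close>, then the second factor. Inversion is polynomial up to a
  power of the determinant, which is nonzero on invertible matrices.\<close>

lemma matrix_monoid_Zcl:
  assumes "matrix_monoid B"
  shows "matrix_monoid (Zcl B)" "B \<subseteq> Zcl B"
proof -
  interpret matrix_monoid B by fact
  show sub: "B \<subseteq> Zcl B"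
    using invertible_in by (auto simp: Zcl_def vanishing_ideal_def)
  have mul: "mpoly_eval id p (entries (a ** g ** b)) = 0"
    if "g \<in> Zcl B" "\<And>h. h \<in> B \<Longrightarrow> mpoly_eval id p (entries (a ** h ** b)) = 0" for p and a b g :: "'a cmat"
  proof -
    have "subst_mul a b p \<in> vanishing_ideal B"
      using that(2) by (simp add: vanishing_ideal_def mpoly_eval_subst_mul_id)
    then show ?thesis
      using that(1) mpoly_eval_subst_mul_id[of a b p g] by (auto simp: Zcl_def)
  qed
  show "matrix_monoid (Zcl B)"
  proof
    show "mat 1 \<in> Zcl B" using sub one_in by auto
    show "invertible g" if "g \<in> Zcl B" for g using that by (auto simp: Zcl_def)
  next
    fix g h assume g: "g \<in> Zcl B" and h: "h \<in> Zcl B"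
    show "g ** h \<in> Zcl B"
    proof (rule Zcl_I)
      show "invertible (g ** h)" using g h by (auto simp: Zcl_def invertible_mul)
      fix p assume p: "\<And>b. b \<in> B \<Longrightarrow> mpoly_eval id p (entries b) = 0"
      have 1: "mpoly_eval id p (entries (g ** b)) = 0" if "b \<in> B" for b
        using mul[OF g, where p = p and a = "mat 1" and b = b] p mul_in that by simp
      show "mpoly_eval id p (entries (g ** h)) = 0"
        using mul[OF h, where p = p and a = g and b = "mat 1"] 1 by simp
    qed
  next
    fix g assume g: "g \<in> Zcl B"
    then have i: "invertible g" by (auto simp: Zcl_def)
    show "matrix_inv g \<in> Zcl B"
    proof (rule Zcl_I)
      show "invertible (matrix_inv g)" using i by (rule invertible_matrix_inv)
      fix p :: "('a \<times> 'a) mpoly" assume p: "\<And>b. b \<in> B \<Longrightarrow> mpoly_eval id p (entries b) = 0"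
      obtain N f where f: "poly_fun f" "\<And>x. invertible x \<Longrightarrow> f x = det x ^ N * mpoly_eval id p (entries (matrix_inv x))"
        using mpoly_eval_matrix_inv[of p] by blast
      have "f g = 0"
        by (rule Zcl_poly_fun[OF g f(1)]) (simp add: f invertible_in inv_in p)
      then show "mpoly_eval id p (entries (matrix_inv g)) = 0"
        using f(2)[OF i] i by (simp add: invertible_det_nz)
    qed
  qed
qed

section \<open>Matrix groups as abstract groups; connectedness and solvability\<close>

lemma group_mat_group:
  fixes N :: "('n::finite cmat) set"
  assumes "matrix_monoid N"
  shows "group (mat_group N)" "g \<in> N \<Longrightarrow> inv\<^bsub>mat_group N\<^esub> g = matrix_inv g"
proof -
  interpret matrix_monoid N by fact
  show g: "group (mat_group N)"
  proof (rule groupI)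
    fix x assume "x \<in> carrier (mat_group N)"
    then show "\<exists>y\<in>carrier (mat_group N). y \<otimes>\<^bsub>mat_group N\<^esub> x = \<one>\<^bsub>mat_group N\<^esub>"
      by (intro bexI[of _ "matrix_inv x"]) (auto simp: mat_group_def matrix_inv_mult invertible_in inv_in)
  qed (auto simp: mat_group_def mul_in one_in matrix_mul_assoc)
  show "g \<in> N \<Longrightarrow> inv\<^bsub>mat_group N\<^esub> g = matrix_inv g"
    by (rule group.inv_equality[OF g]) (auto simp: mat_group_def matrix_inv_mult invertible_in inv_in)
qed

lemma matrix_monoid_invertible: "matrix_monoid {g :: 'n::finite cmat. invertible g}"
proof
  show "mat 1 \<in> {g :: 'n cmat. invertible g}"
    using matrix_mul_lid[of "mat 1 :: 'n cmat"] by (force simp: invertible_def)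
qed (auto simp: invertible_mul invertible_matrix_inv)

lemma subgroup_mat_group_iff:
  assumes "matrix_monoid H"
  shows "subgroup N (mat_group H) \<longleftrightarrow> matrix_monoid N \<and> N \<subseteq> H"
proof
  interpret H: matrix_monoid H by fact
  assume "subgroup N (mat_group H)"
  then interpret subgroup N "mat_group H" .
  have sub: "N \<subseteq> H" using subset by (auto simp: mat_group_def)
  have "matrix_monoid N"
  proof
    show "mat 1 \<in> N" using one_closed by (simp add: mat_group_def)
    show "g ** h \<in> N" if "g \<in> N" "h \<in> N" for g h using m_closed[OF that] by (simp add: mat_group_def)
    show "matrix_inv g \<in> N" if "g \<in> N" for g
      using m_inv_closed[OF that] sub that group_mat_group(2)[OF assms, of g] by (metis subsetD)
    show "invertible g" if "g \<in> N" for g using that sub H.invertible_in by auto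
  qed
  then show "matrix_monoid N \<and> N \<subseteq> H" using sub by simp
next
  assume N: "matrix_monoid N \<and> N \<subseteq> H"
  then interpret matrix_monoid N by simp
  show "subgroup N (mat_group H)"
  proof
    show "inv\<^bsub>mat_group H\<^esub> x \<in> N" if "x \<in> N" for x
      using that N group_mat_group(2)[OF assms, of x] by (auto simp: inv_in)
  qed (use N in \<open>auto simp: mat_group_def mul_in one_in\<close>)
qed

lemma subgroup_iff_matrix_monoid:
  "subgroup G (mat_group {g :: 'n::finite cmat. invertible g}) \<longleftrightarrow> matrix_monoid G"
  unfolding subgroup_mat_group_iff[OF matrix_monoid_invertible]
  using matrix_monoid.invertible_in by auto

lemma linear_algebraic_group_Zcl:
  assumes "matrix_monoid B"
  shows "linear_algebraic_group (Zcl B)"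
  unfolding linear_algebraic_group_def subgroup_iff_matrix_monoid
  using matrix_monoid_Zcl(1)[OF assms] by (auto simp: Zcl_def)

lemma linear_algebraic_group_closed:
  assumes "linear_algebraic_group G"
  shows "matrix_monoid G" "Zcl G = G"
proof -
  show m: "matrix_monoid G" using assms by (simp add: linear_algebraic_group_def subgroup_iff_matrix_monoid)
  obtain S where S: "G = {g. invertible g \<and> (\<forall>p\<in>S. mpoly_eval id p (entries g) = 0)}"
    using assms by (auto simp: linear_algebraic_group_def)
  then have "S \<subseteq> vanishing_ideal G" by (auto simp: vanishing_ideal_def)
  then show "Zcl G = G"
    using matrix_monoid_Zcl(2)[OF m] S by (auto simp: Zcl_def)
qed

lemma Zcl_mono: "B \<subseteq> C \<Longrightarrow> Zcl B \<subseteq> Zcl C"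
  by (auto simp: Zcl_def vanishing_ideal_def)

lemma topspace_zariski [simp]: "topspace (zariski S) = S"
proof -
  have "{g \<in> S. mpoly_eval id (Cst 1) (entries g) \<noteq> 0} = S"
    by (simp add: is_ring_hom_intros)
  then show ?thesis
    unfolding zariski_def topology_generated_by_topspace by blast
qed

lemma continuous_map_zariski:
  assumes "\<And>x. x \<in> topspace T \<Longrightarrow> \<gamma> x \<in> S"
    and "\<And>p. openin T {x \<in> topspace T. mpoly_eval id p (entries (\<gamma> x)) \<noteq> 0}"
  shows "continuous_map T (zariski S) \<gamma>"
  unfolding zariski_def continuous_on_generated_topo_iff
proof (intro conjI allI impI)
  fix U assume "U \<in> {{g \<in> S. mpoly_eval id p (entries g) \<noteq> 0} |p. True}"
  then obtain p where U: "U = {g \<in> S. mpoly_eval id p (entries g) \<noteq> 0}" by blast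
  have "\<gamma> -` U \<inter> topspace T = {x \<in> topspace T. mpoly_eval id p (entries (\<gamma> x)) \<noteq> 0}"
    using assms(1) by (auto simp: U)
  then show "openin T (\<gamma> -` U \<inter> topspace T)" using assms(2) by simp
next
  have "\<gamma> ` topspace T \<subseteq> topspace (zariski S)" using assms(1) by auto
  then show "\<gamma> ` topspace T \<subseteq> \<Union> {{g \<in> S. mpoly_eval id p (entries g) \<noteq> 0} |p. True}"
    unfolding zariski_def topology_generated_by_topspace .
qed

lemma connectedin_zariski_curve:
  fixes \<gamma> :: "complex \<Rightarrow> 'n::finite cmat"
  assumes "\<And>t. \<gamma> t \<in> S" "\<And>p. continuous_on UNIV (\<lambda>t. mpoly_eval id p (entries (\<gamma> t)))"
  shows "connectedin (zariski S) (range \<gamma>)"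
proof (rule connectedin_continuous_map_image[where X = euclidean])
  show "continuous_map euclidean (zariski S) \<gamma>"
  proof (rule continuous_map_zariski)
    fix p
    have "open ((\<lambda>t. mpoly_eval id p (entries (\<gamma> t))) -` (- {0}))"
      using assms(2)[of p] by (intro open_vimage) auto
    moreover have "{x \<in> topspace euclidean. mpoly_eval id p (entries (\<gamma> x)) \<noteq> 0} = (\<lambda>t. mpoly_eval id p (entries (\<gamma> t))) -` (- {0})"
      by auto
    ultimately show "openin euclidean {x \<in> topspace euclidean. mpoly_eval id p (entries (\<gamma> x)) \<noteq> 0}"
      by (simp only: open_openin)
  qed (use assms in auto)
qed (simp add: connected_UNIV)

text \<open>\<open>B\<close> is dense in its closure, since a polynomial that vanishes on
  \<open>B\<close> vanishes on \<open>Zcl B\<close>; and the closure of a connected set is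
  connected.\<close>

lemma connected_space_Zcl:
  assumes "matrix_monoid B" "connectedin (zariski (Zcl B)) B"
  shows "connected_space (zariski (Zcl B))"
proof -
  have sub: "B \<subseteq> Zcl B" by (rule matrix_monoid_Zcl(2)[OF assms(1)])
  have cl: "zariski (Zcl B) closure_of B = Zcl B"
  proof (rule antisym)
    show "zariski (Zcl B) closure_of B \<subseteq> Zcl B"
      using closure_of_subset_topspace[of "zariski (Zcl B)" B] by simp
    have *: "\<exists>b\<in>B. b \<in> U" if U: "openin (zariski (Zcl B)) U" and g: "g \<in> U" for U g
    proof -
      let ?P = "\<lambda>U p g. mpoly_eval id p (entries g) \<noteq> 0 \<and> g \<in> Zcl B \<and> (\<forall>h\<in>Zcl B. mpoly_eval id p (entries h) \<noteq> 0 \<longrightarrow> h \<in> U)"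
      have "generate_topology_on {{g \<in> Zcl B. mpoly_eval id p (entries g) \<noteq> 0} |p. True} U"
        using U unfolding zariski_def by (rule openin_topology_generated_by)
      \<comment> \<open>Nonvanishing sets of polynomials are closed under intersection, by
        multiplying the polynomials, so the generating family is a basis and not merely a
        subbasis.\<close>
      then have "\<forall>g\<in>U. \<exists>p. ?P U p g"
      proof induction
        case (Int a b)
        show ?case
        proof
          fix g assume "g \<in> a \<inter> b"
          then obtain p q where "?P a p g" "?P b q g"
            using Int.IH by blast
          then have "?P (a \<inter> b) (p * q) g"
            unfolding mpoly_eval_mult[OF is_ring_hom_intros(1)] by simp
          then show "\<exists>p. ?P (a \<inter> b) p g" ..
        qed
      next
        case (UN K)
        show ?case
        proof
          fix g assume "g \<in> \<Union> K"
          then obtain k p where "k \<in> K" "?P k p g" using UN.IH by blast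
          then have "?P (\<Union> K) p g" by blast
          then show "\<exists>p. ?P (\<Union> K) p g" ..
        qed
      next
        case (Basis s)
        then obtain p where p: "s = {g \<in> Zcl B. mpoly_eval id p (entries g) \<noteq> 0}" by blast
        show ?case
        proof
          fix g assume "g \<in> s"
          then have "?P s p g" unfolding p by blast
          then show "\<exists>p. ?P s p g" ..
        qed
      qed simp
      then obtain p where p: "?P U p g" using g by blast
      have "\<exists>b\<in>B. mpoly_eval id p (entries b) \<noteq> 0"
      proof (rule ccontr)
        assume "\<not> (\<exists>b\<in>B. mpoly_eval id p (entries b) \<noteq> 0)"
        then have "p \<in> vanishing_ideal B" by (auto simp: vanishing_ideal_def)
        then show False using p by (auto simp: Zcl_def)
      qed
      then show ?thesis using p sub by blast
    qed
    show "Zcl B \<subseteq> zariski (Zcl B) closure_of B"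
    proof
      fix g assume "g \<in> Zcl B"
      then show "g \<in> zariski (Zcl B) closure_of B"
        using * by (auto simp: in_closure_of)
    qed
  qed
  show ?thesis
    using connectedin_closure_of[OF assms(2)] unfolding cl
    by (metis connectedin_topspace topspace_zariski)
qed

lemma solvable_mat_group_commutative:
  fixes N :: "('n::finite cmat) set"
  assumes "matrix_monoid N" "\<And>g h. g \<in> N \<Longrightarrow> h \<in> N \<Longrightarrow> g ** h = h ** g"
  shows "group (mat_group N)" "solvable (mat_group N)"
proof -
  show g: "group (mat_group N)" by (rule group_mat_group[OF assms(1)])
  interpret group "mat_group N" by (rule g)
  have "x \<otimes>\<^bsub>mat_group N\<^esub> y \<otimes>\<^bsub>mat_group N\<^esub> inv\<^bsub>mat_group N\<^esub> x \<otimes>\<^bsub>mat_group N\<^esub> inv\<^bsub>mat_group N\<^esub> y = \<one>\<^bsub>mat_group N\<^esub>"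
    if "x \<in> carrier (mat_group N)" "y \<in> carrier (mat_group N)" for x y
  proof -
    have "x \<otimes>\<^bsub>mat_group N\<^esub> y = y \<otimes>\<^bsub>mat_group N\<^esub> x"
      using that assms(2) by (simp add: mat_group_def)
    then show ?thesis using that by (simp add: m_assoc)
  qed
  then have "derived (mat_group N) (carrier (mat_group N)) \<subseteq> {\<one>\<^bsub>mat_group N\<^esub>}"
    unfolding derived_def by (intro generate_subgroup_incl triv_subgroup) auto
  moreover have "\<one>\<^bsub>mat_group N\<^esub> \<in> derived (mat_group N) (carrier (mat_group N))"
    using derived_is_subgroup[of "carrier (mat_group N)"] subgroup.one_closed by blast
  ultimately have "(derived (mat_group N) ^^ 1) (carrier (mat_group N)) = {\<one>\<^bsub>mat_group N\<^esub>}" by auto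
  then show "solvable (mat_group N)"
    unfolding solvable_def by (rule trivial_derived_seq_imp_solvable[OF subgroup_self])
qed

section \<open>One-parameter subgroups and the exclusion of commutative ideals\<close>

lemma mexp_in_group:
  assumes "linear_algebraic_group G" "X \<in> lie_algebra G"
  shows "mexp t X \<in> G"
proof -
  interpret matrix_monoid G using linear_algebraic_group_closed(1)[OF assms(1)] .
  have "mexp t X \<in> Zcl G"
  proof (rule Zcl_I[OF invertible_mexp])
    fix p :: "('a \<times> 'a) mpoly" assume "\<And>b. b \<in> G \<Longrightarrow> mpoly_eval id p (entries b) = 0"
    then show "mpoly_eval id p (entries (mexp t X)) = 0"
      unfolding mpoly_eval_mexp using mpoly_eval_fexp[OF assms(2), of p]
      by (auto simp: vanishing_ideal_def eval_fps_def)
  qed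
  then show ?thesis using linear_algebraic_group_closed(2)[OF assms(1)] by simp
qed

text \<open>An entire function determines its coefficients, and the linear coefficient of
  \<open>exp (t X)\<close> is \<open>X\<close>.\<close>

lemma mexp_eq_1_imp:
  assumes "\<And>t. mexp t X = mat 1"
  shows "X = 0"
proof -
  have "fexp X $ i $ j - fps_const (mat 1 $ i $ j) = 0" for i j
  proof (rule entire_eq_0)
    show "entire (fexp X $ i $ j - fps_const (mat 1 $ i $ j))"
      using entire_intros(2)[OF entire_fexp entire_intros(1)[of "- mat 1 $ i $ j"]]
      by (simp add: fps_const_neg[symmetric] del: fps_const_neg)
    show "eval_fps (fexp X $ i $ j - fps_const (mat 1 $ i $ j)) z = 0" for z
      using entire_eval(1)[OF entire_fexp[of X i j] entire_intros(1)[of "- mat 1 $ i $ j"], of z]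
        arg_cong[OF assms[of z], of "\<lambda>Y. Y $ i $ j"]
      by (simp add: mexp_def eval_fps_const fps_const_neg[symmetric] del: fps_const_neg) (metis add.right_inverse eval_fps_const fps_const_neg)
  qed
  then have "fps_nth (fexp X $ i $ j - fps_const (mat 1 $ i $ j)) 1 = 0" for i j
    by simp
  then show ?thesis by (simp add: fexp_def vec_eq_iff)
qed

text \<open>Commuting with a fixed matrix is a polynomial condition, so commutativity passes to the
  closure in one factor and then in the other.\<close>

lemma Zcl_commutative:
  assumes "matrix_monoid B" "\<And>g h. g \<in> B \<Longrightarrow> h \<in> B \<Longrightarrow> g ** h = h ** g"
    and "g \<in> Zcl B" "h \<in> Zcl B"
  shows "g ** h = h ** g"
proof -
  have f: "poly_fun (\<lambda>x. (x ** b) $ i $ j - (b ** x) $ i $ j)" for b :: "'a cmat" and i j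
  proof -
    have "poly_fun (\<lambda>x. (\<Sum>k\<in>UNIV. x $ i $ k * b $ k $ j) + (-1) * (\<Sum>k\<in>UNIV. b $ i $ k * x $ k $ j))"
      by (intro poly_fun_intros poly_fun_sum)
    then show ?thesis by (simp add: matrix_matrix_mult_def)
  qed
  have 1: "x ** b = b ** x" if "x \<in> Zcl B" "\<And>y. y \<in> B \<Longrightarrow> y ** b = b ** y" for x b
    using Zcl_poly_fun[OF that(1) f[of b]] that(2) by (simp add: vec_eq_iff)
  show ?thesis
    by (rule 1[OF assms(3)], rule 1[OF assms(4), symmetric]) (rule assms(2))
qed

lemma Zcl_conj_closed:
  assumes "\<And>b. b \<in> B \<Longrightarrow> g ** b ** h \<in> B" "invertible g" "invertible h" "x \<in> Zcl B"
  shows "g ** x ** h \<in> Zcl B"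
proof (rule Zcl_I)
  show "invertible (g ** x ** h)" using assms by (auto simp: Zcl_def intro: invertible_mul)
  fix p assume p: "\<And>b. b \<in> B \<Longrightarrow> mpoly_eval id p (entries b) = 0"
  then have "subst_mul g h p \<in> vanishing_ideal B"
    using assms(1) by (simp add: vanishing_ideal_def mpoly_eval_subst_mul_id)
  then show "mpoly_eval id p (entries (g ** x ** h)) = 0"
    using assms(4) mpoly_eval_subst_mul_id[of g h p x] by (auto simp: Zcl_def)
qed

text \<open>The group generated by \<open>exp J\<close> would be a connected commutative normal subgroup.\<close>

lemma commuting_Ad_stable_trivial:
  assumes ss: "semisimple_group G" and J: "J \<subseteq> lie_algebra G" "0 \<in> J"
    "\<And>X Y. X \<in> J \<Longrightarrow> Y \<in> J \<Longrightarrow> X + Y \<in> J" "\<And>c X. X \<in> J \<Longrightarrow> smult_mat c X \<in> J"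
    and comm: "\<And>X Y. X \<in> J \<Longrightarrow> Y \<in> J \<Longrightarrow> X ** Y = Y ** X"
    and Ad: "\<And>g X. g \<in> G \<Longrightarrow> X \<in> J \<Longrightarrow> g ** X ** matrix_inv g \<in> J"
  shows "J = {0}"
proof -
  have alg: "linear_algebraic_group G" using ss by (simp add: semisimple_group_def)
  interpret G: matrix_monoid G using linear_algebraic_group_closed(1)[OF alg] .
  define B where "B = mexp 1 ` J"
  have BG: "B \<subseteq> G" using mexp_in_group[OF alg] J(1) by (auto simp: B_def)
  have neg: "- X \<in> J" if "X \<in> J" for X
  proof -
    have "smult_mat (-1) X = - X" by (simp add: smult_mat_def vec_eq_iff)
    then show ?thesis using J(4)[OF that, of "-1"] by simp
  qed
  have B: "matrix_monoid B"
  proof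
    show "mat 1 \<in> B" using imageI[OF J(2), of "mexp 1"] by (simp add: B_def mexp_zero)
    show "invertible g" if "g \<in> B" for g using that invertible_mexp by (auto simp: B_def)
    show "matrix_inv g \<in> B" if "g \<in> B" for g
      using that neg by (auto simp: B_def matrix_inv_mexp)
    fix g h assume "g \<in> B" "h \<in> B"
    then obtain X Y where XY: "X \<in> J" "g = mexp 1 X" "Y \<in> J" "h = mexp 1 Y" by (auto simp: B_def)
    then have "g ** h = mexp 1 (X + Y)" by (simp add: mexp_add comm)
    then show "g ** h \<in> B" using J(3) XY by (auto simp: B_def)
  qed
  let ?N = "Zcl B"
  have BN: "B \<subseteq> ?N" and N: "matrix_monoid ?N" using matrix_monoid_Zcl[OF B] by auto
  have curve: "mexp t X \<in> B" if "X \<in> J" for t X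
    using J(4)[OF that, of t] mexp_smult[of 1 t X] by (force simp: B_def)
  have Bcomm: "g ** h = h ** g" if "g \<in> B" "h \<in> B" for g h
  proof -
    obtain X Y where "X \<in> J" "g = mexp 1 X" "Y \<in> J" "h = mexp 1 Y" using \<open>g \<in> B\<close> \<open>h \<in> B\<close> by (auto simp: B_def)
    then show ?thesis using mexp_add[of Y X 1] mexp_add[of X Y 1] comm by (simp add: add.commute)
  qed
  \<comment> \<open>\<open>B\<close> is a union of one-parameter curves that all pass through the
    identity.\<close>
  have "connectedin (zariski ?N) (\<Union> ((\<lambda>X. range (\<lambda>t. mexp t X)) ` J))"
  proof (rule connectedin_Union)
    show "connectedin (zariski ?N) S" if "S \<in> (\<lambda>X. range (\<lambda>t. mexp t X)) ` J" for S
      using that curve BN by (auto intro!: connectedin_zariski_curve continuous_mpoly_eval_mexp)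
    have "mat 1 \<in> range (\<lambda>t. mexp t X)" for X :: "'a cmat"
      using mexp_at_0[of X] by (metis rangeI)
    then show "\<Inter> ((\<lambda>X. range (\<lambda>t. mexp t X)) ` J) \<noteq> {}" by blast
  qed
  also have "\<Union> ((\<lambda>X. range (\<lambda>t. mexp t X)) ` J) = B"
    using curve by (auto simp: B_def)
  finally have conn: "connected_space (zariski ?N)" by (rule connected_space_Zcl[OF B])
  have "?N \<lhd> mat_group G"
  proof (rule group.normal_invI[OF group_mat_group(1)])
    show "subgroup ?N (mat_group G)"
      unfolding subgroup_mat_group_iff[OF G.matrix_monoid_axioms]
      using N Zcl_mono[OF BG] linear_algebraic_group_closed(2)[OF alg] by simp
    fix x h assume "x \<in> carrier (mat_group G)" "h \<in> ?N"
    then have x: "x \<in> G" by (simp add: mat_group_def)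
    have "x ** h ** matrix_inv x \<in> ?N"
    proof (rule Zcl_conj_closed[OF _ G.invertible_in[OF x] G.invertible_in[OF G.inv_in[OF x]] \<open>h \<in> ?N\<close>])
      fix b assume "b \<in> B"
      then obtain X where X: "X \<in> J" "b = mexp 1 X" by (auto simp: B_def)
      have "x ** b ** matrix_inv x = mexp 1 (x ** X ** matrix_inv x)"
        by (simp add: X mexp_conj matrix_inv_mult G.invertible_in[OF x])
      then show "x ** b ** matrix_inv x \<in> B" using Ad[OF x X(1)] by (simp add: B_def)
    qed
    then show "x \<otimes>\<^bsub>mat_group G\<^esub> h \<otimes>\<^bsub>mat_group G\<^esub> inv\<^bsub>mat_group G\<^esub> x \<in> ?N"
      using group_mat_group(2)[OF G.matrix_monoid_axioms x] by (simp add: mat_group_def)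
  qed (rule G.matrix_monoid_axioms)
  moreover have "solvable (mat_group ?N)"
    by (rule solvable_mat_group_commutative[OF N]) (rule Zcl_commutative[OF B Bcomm])
  ultimately have "?N = {mat 1}"
    using ss conn linear_algebraic_group_Zcl[OF B] by (simp add: semisimple_group_def)
  then have "X = 0" if "X \<in> J" for X
    using curve[OF that] BN by (intro mexp_eq_1_imp) auto
  then show ?thesis using J(2) by auto
qed

section \<open>Spectral idempotents and replicas\<close>

lemma matrix_mult_sum_left: "sum f S ** (Y :: 'a::comm_ring_1 ^ 'n ^ 'n) = (\<Sum>i\<in>S. f i ** Y)"
  by (induction S rule: infinite_finite_induct) (auto simp: matrix_add_rdistrib')

lemma matrix_mult_sum_right: "(Y :: 'a::comm_ring_1 ^ 'n ^ 'n) ** sum f S = (\<Sum>i\<in>S. Y ** f i)"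
  by (induction S rule: infinite_finite_induct) (auto simp: matrix_add_ldistrib)

lemma matrix_mult_diff:
  "(X - Y) ** Z = X ** Z - Y ** (Z :: 'a::comm_ring_1 ^ 'n ^ 'n)"
  "Z ** (X - Y) = Z ** X - Z ** (Y :: 'a::comm_ring_1 ^ 'n ^ 'n)"
  by (simp_all add: vec_eq_iff matrix_matrix_mult_def algebra_simps sum_subtractf)

lemma mat_mult: "mat a ** Y = smult_mat a (Y :: 'a::comm_ring_1 ^ 'n ^ 'n)" "Y ** mat a = smult_mat a Y"
  by (simp_all add: vec_eq_iff matrix_matrix_mult_def mat_def smult_mat_def if_distrib if_distribR sum.delta mult.commute cong: if_cong)

lemma smult_mat_mult:
  "Y ** smult_mat a Z = smult_mat a (Y ** (Z :: 'a::comm_ring_1 ^ 'n ^ 'n))" "smult_mat a Y ** Z = smult_mat a (Y ** Z)"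
  by (simp_all add: smult_mat_def vec_eq_iff matrix_matrix_mult_def sum_distrib_left mult.left_commute mult.assoc)

lemma smult_smult_mat: "smult_mat a (smult_mat b Y) = smult_mat (a * b) Y"
  by (simp add: smult_mat_def vec_eq_iff mult.assoc)

lemma mat_commute: "Y ** mat a = mat a ** (Y :: 'a::comm_ring_1 ^ 'n ^ 'n)"
  by (simp add: mat_mult)

lemma mat_hom:
  "mat (a + b) = mat a + (mat b :: 'a::comm_ring_1 ^ 'n ^ 'n)" "mat (a * b) = mat a ** (mat b :: 'a ^ 'n ^ 'n)"
  by (simp_all add: mat_mult) (simp_all add: mat_def smult_mat_def vec_eq_iff)

definition mat_poly :: "complex poly \<Rightarrow> complex ^ 'n ^ 'n \<Rightarrow> complex ^ 'n ^ 'n"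
  where "mat_poly p X = fold_coeffs (\<lambda>a M. mat a + M ** X) p 0"

lemma mat_poly_0 [simp]: "mat_poly 0 X = 0"
  by (simp add: mat_poly_def)

lemma mat_poly_pCons: "mat_poly (pCons a p) X = mat a + mat_poly p X ** X"
  by (cases "p = 0 \<and> a = 0") (auto simp: mat_poly_def)

lemma mat_poly_add: "mat_poly (p + q) X = mat_poly p X + mat_poly q X"
proof (induction p q rule: poly_induct2)
  case (pCons a p b q)
  then show ?case by (simp add: mat_poly_pCons mat_hom matrix_add_rdistrib' algebra_simps)
qed simp

lemma mat_poly_commute: "Y ** X = X ** Y \<Longrightarrow> Y ** mat_poly p X = mat_poly p X ** Y"
  by (induction p) (simp_all add: mat_poly_pCons matrix_add_rdistrib' matrix_add_ldistrib mat_commute,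
      metis matrix_mul_assoc)

lemma mat_poly_smult: "mat_poly (smult a p) X = mat a ** mat_poly p X"
  by (induction p) (simp_all add: mat_poly_pCons mat_hom matrix_add_ldistrib matrix_mul_assoc)

lemma mat_poly_mult: "mat_poly (p * q) X = mat_poly p X ** mat_poly q X"
proof (induction p)
  case (pCons a p)
  have "X ** mat_poly q X = mat_poly q X ** X" by (rule mat_poly_commute) simp
  then have "mat_poly p X ** mat_poly q X ** X = mat_poly p X ** X ** mat_poly q X"
    by (metis matrix_mul_assoc)
  then show ?case
    using pCons by (simp add: mat_poly_add mat_poly_smult mat_poly_pCons matrix_add_rdistrib')
qed simp

lemma mat_poly_const: "mat_poly [:a:] X = mat a"
  by (simp add: mat_poly_pCons)

lemma mat_poly_sum: "mat_poly (sum f S) X = (\<Sum>i\<in>S. mat_poly (f i) X)"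
  by (induction S rule: infinite_finite_induct) (auto simp: mat_poly_add)

lemma mat_poly_1: "mat_poly 1 X = mat 1"
  by (simp add: one_pCons mat_poly_const)

lemma mat_poly_linear_power: "mat_poly ([:- z, 1:] ^ m) X = matpow (X - mat z) m"
proof (induction m)
  case (Suc m)
  have 1: "mat_poly [:- z, 1:] X = X - mat z"
    by (simp add: mat_poly_pCons) (simp add: mat_def vec_eq_iff)
  have "[:- z, 1:] ^ Suc m = [:- z, 1:] ^ m * [:- z, 1:]" by simp
  then show ?case by (simp only: mat_poly_mult Suc 1 matpow.simps)
qed (simp add: mat_poly_1)

lemma mat_poly_monom: "mat_poly (monom a m) X = mat a ** matpow X m"
proof -
  have "mat_poly (monom 1 m) X = matpow X m"
    using mat_poly_linear_power[of 0 m X] by (simp add: monom_altdef)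
  then show ?thesis using mat_poly_smult[of a "monom 1 m" X] by (simp add: smult_monom)
qed

text \<open>The powers of \<open>X\<close> live in a finite-dimensional real vector space. If they
  are all distinct, they satisfy a relation that even has real coefficients; a repetition gives a
  difference of two monomials.\<close>

lemma ex_annihilating_poly: "\<exists>q. q \<noteq> 0 \<and> mat_poly q X = 0"
proof (cases "inj (matpow X)")
  case False
  then obtain i j where ij: "i \<noteq> j" "matpow X i = matpow X j" by (auto simp: inj_on_def)
  have "coeff (monom 1 i + monom (-1) j :: complex poly) i = 1"
    using ij by (simp add: coeff_monom)
  then have "monom 1 i + monom (-1) j \<noteq> (0 :: complex poly)" by force
  moreover have "mat (-1) ** Y = - Y" for Y :: "complex ^ 'a ^ 'a"
    by (simp add: mat_mult smult_mat_def vec_eq_iff)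
  then have "mat_poly (monom 1 i + monom (-1) j) X = 0"
    by (simp add: mat_poly_add mat_poly_monom ij)
  ultimately show ?thesis by blast
next
  case True
  have "\<not> finite (range (matpow X))" using True by (simp add: finite_image_iff)
  then have "dependent (range (matpow X))" using independent_bound by blast
  then obtain S u where S: "finite S" "S \<subseteq> range (matpow X)" "\<exists>v\<in>S. u v \<noteq> 0" "(\<Sum>v\<in>S. u v *\<^sub>R v) = 0"
    unfolding dependent_explicit by blast
  define idx where "idx = inv_into UNIV (matpow X)"
  have idx: "matpow X (idx v) = v" if "v \<in> S" for v
    using that S(2) unfolding idx_def by (meson f_inv_into_f subsetD)
  define q where "q = (\<Sum>v\<in>S. monom (complex_of_real (u v)) (idx v))"
  have r: "mat (complex_of_real r) ** Y = r *\<^sub>R Y" for r and Y :: "complex ^ 'a ^ 'a"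
    unfolding mat_mult smult_mat_def vec_eq_iff by (simp add: scaleR_conv_of_real[where 'a = complex])
  have "mat_poly q X = (\<Sum>v\<in>S. u v *\<^sub>R v)"
    unfolding q_def mat_poly_sum mat_poly_monom r by (rule sum.cong) (auto simp: idx)
  then have q0: "mat_poly q X = 0" using S(4) by simp
  obtain v where v: "v \<in> S" "u v \<noteq> 0" using S(3) by blast
  have "coeff q (idx v) = (\<Sum>w\<in>S. if w = v then of_real (u w) else 0)"
    unfolding q_def coeff_sum
  proof (rule sum.cong[OF refl])
    fix w assume "w \<in> S"
    then have "idx w = idx v \<longleftrightarrow> w = v" using idx v(1) by metis
    then show "coeff (monom (complex_of_real (u w)) (idx w)) (idx v) = (if w = v then of_real (u w) else 0)"
      by (simp add: coeff_monom)
  qed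
  also have "\<dots> = of_real (u v)" using v(1) S(1) by (simp add: sum.delta)
  finally have "q \<noteq> 0" using v(2) by force
  then show ?thesis using q0 by blast
qed

lemma prod_dvd_of_pairwise_coprime:
  fixes f :: "'i \<Rightarrow> complex poly"
  assumes "finite S" "\<And>i. i \<in> S \<Longrightarrow> f i dvd h" "\<And>i j. i \<in> S \<Longrightarrow> j \<in> S \<Longrightarrow> i \<noteq> j \<Longrightarrow> coprime (f i) (f j)"
  shows "prod f S dvd h"
  using assms
proof (induction S rule: finite_induct)
  case (insert i S)
  have "coprime (f i) (prod f S)"
    by (rule prod_coprime_right) (use insert.prems(2) insert.hyps in auto)
  then show ?case using insert by (simp add: divides_mult)
qed simp

text \<open>\<open>E z\<close> projects onto the generalized eigenspace of \<open>X\<close> for \<open>z\<close>.\<close>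

definition spectral :: "complex ^ 'n ^ 'n \<Rightarrow> complex set \<Rightarrow> (complex \<Rightarrow> complex ^ 'n ^ 'n) \<Rightarrow> bool"
  where "spectral X Z E \<longleftrightarrow> finite Z \<and> (\<Sum>z\<in>Z. E z) = mat 1 \<and>
    (\<forall>z\<in>Z. \<forall>w\<in>Z. E z ** E w = (if z = w then E z else 0)) \<and>
    (\<forall>z\<in>Z. \<exists>p. E z = mat_poly p X) \<and>
    (\<exists>m. \<forall>z\<in>Z. E z ** matpow (X - mat z) m = 0)"

text \<open>The Chinese remainder theorem for an annihilating polynomial, evaluated at
  \<open>X\<close>.\<close>

lemma ex_spectral: "\<exists>Z E. spectral X Z E"
proof -
  obtain q where q: "q \<noteq> 0" "mat_poly q X = 0" using ex_annihilating_poly by blast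
  define Z where "Z = {z. poly q z = 0}"
  \<comment> \<open>The common exponent \<open>degree q\<close> bounds every root multiplicity, so
    that \<open>q\<close> divides the product of the factors.\<close>
  define f where "f z = [:- z, 1:] ^ degree q" for z :: complex
  have fin: "finite Z" using q(1) unfolding Z_def by (rule poly_roots_finite)
  have "(\<Prod>z\<in>Z. [:- z, 1:] ^ Polynomial.order z q) dvd prod f Z"
    unfolding f_def using q(1) by (intro prod_dvd_prod le_imp_power_dvd Polynomial.order_degree) auto
  moreover have "smult (lead_coeff q) (\<Prod>z\<in>Z. [:- z, 1:] ^ Polynomial.order z q) = q"
    unfolding Z_def by (rule complex_poly_decompose)
  ultimately have "q dvd prod f Z" using smult_dvd[of _ "prod f Z" "lead_coeff q"] q(1) by (metis leading_coeff_0_iff)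
  then have prod0: "mat_poly h X = 0" if "prod f Z dvd h" for h
    using that q(2) by (metis dvdE dvd_trans mat_poly_mult times0_left)
  have cop: "coprime (f z) (f w)" if "z \<noteq> w" for z w
  proof -
    have "coprime [:- z, 1:] [:- w, 1:]"
    proof (rule coprimeI)
      fix c assume "c dvd [:- z, 1:]" "c dvd [:- w, 1:]"
      then have "c dvd [:- z, 1:] - [:- w, 1:]" by (rule dvd_diff)
      then have "c dvd [:w - z:]" by simp
      then show "is_unit c" using that
        by (metis dvd_trans is_unit_const_poly_iff dvd_field_iff eq_iff_diff_eq_0)
    qed
    then show ?thesis by (simp add: f_def)
  qed
  define g where "g z = prod f (Z - {z})" for z
  have "\<exists>a b. a * f z + b * g z = 1" for z
  proof -
    have "coprime (f z) (g z)" unfolding g_def by (rule prod_coprime_right) (auto intro: cop)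
    then show ?thesis using bezout_coefficients_fst_snd[of "f z" "g z"] by (metis coprime_iff_gcd_eq_1)
  qed
  then obtain a b where ab: "a z * f z + b z * g z = 1" for z by metis
  \<comment> \<open>The Chinese remainder idempotents: \<open>e z\<close> is 1 modulo
    \<open>f z\<close> and 0 modulo the other factors.\<close>
  define e where "e z = b z * g z" for z
  have e1: "f z dvd e z - 1" for z
    using ab[of z] by (metis (no_types, opaque_lifting) add_diff_cancel_right' diff_minus_eq_add dvd_minus_iff dvd_triv_right e_def minus_diff_eq)
  have e0: "f w dvd e z" if "z \<noteq> w" "w \<in> Z" for z w
    unfolding e_def g_def using that fin by (intro dvd_mult dvd_prodI) auto
  define E where "E z = mat_poly (e z) X" for z
  have "spectral X Z E"
    unfolding spectral_def
  proof (intro conjI ballI)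
    have "prod f Z dvd sum e Z - 1"
    proof (rule prod_dvd_of_pairwise_coprime[OF fin])
      fix w assume w: "w \<in> Z"
      have "sum e Z - 1 = (e w - 1) + (\<Sum>z\<in>Z - {w}. e z)" using w fin by (simp add: sum.remove)
      moreover have "f w dvd (\<Sum>z\<in>Z - {w}. e z)" using w e0 by (intro dvd_sum) auto
      ultimately show "f w dvd sum e Z - 1" using dvd_add[OF e1[of w]] by metis
    qed (rule cop)
    from prod0[OF this] have "mat_poly (sum e Z + (- 1)) X = 0" by simp
    then have "mat_poly (sum e Z) X + mat_poly (- 1) X = 0" by (simp only: mat_poly_add)
    moreover have "mat_poly (- 1) X = - mat 1"
      using mat_poly_const[of "-1" X] by (simp add: one_pCons mat_def vec_eq_iff)
    ultimately show "(\<Sum>z\<in>Z. E z) = mat 1" by (simp add: mat_poly_sum E_def)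
    fix z assume z: "z \<in> Z"
    show "\<exists>p. E z = mat_poly p X" unfolding E_def by blast
    fix w assume w: "w \<in> Z"
    show "E z ** E w = (if z = w then E z else 0)"
    proof (cases "z = w")
      case True
      have "prod f Z dvd e z * (e z - 1)"
        using e1 e0 cop fin by (intro prod_dvd_of_pairwise_coprime) (metis dvd_mult dvd_mult2)+
      then have "mat_poly (e z * (e z - 1)) X = 0" by (rule prod0)
      then have "mat_poly (e z * (e z - 1) + e z) X = E z" by (simp only: mat_poly_add E_def) simp
      then show ?thesis
        using True by (simp add: mat_poly_mult[symmetric] E_def algebra_simps)
    next
      case False
      have "prod f Z dvd e z * e w"
        using e0 cop fin False by (intro prod_dvd_of_pairwise_coprime) (metis dvd_mult dvd_mult2)+
      then show ?thesis using prod0[of "e z * e w"] False by (simp add: mat_poly_mult E_def)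
    qed
  next
    have "E z ** matpow (X - mat z) (degree q) = 0" if "z \<in> Z" for z
    proof -
      have "prod f Z dvd e z * f z"
        using e0 cop fin by (intro prod_dvd_of_pairwise_coprime) (metis dvd_mult dvd_mult2 dvd_refl)+
      from prod0[OF this] show ?thesis by (simp add: mat_poly_mult E_def f_def mat_poly_linear_power)
    qed
    then show "\<exists>m. \<forall>z\<in>Z. E z ** matpow (X - mat z) m = 0" by blast
  qed (rule fin)
  then show ?thesis by blast
qed

lemma matpow_mat: "matpow (mat z) m = mat (z ^ m :: 'a::comm_ring_1)"
  by (induction m) (simp_all add: mat_hom(2)[symmetric] mult.commute)

lemma fexp_mat: "fexp (mat z) = mat (fps_exp (z :: 'a::field_char_0))"
  by (simp add: fexp_def matpow_mat vec_eq_iff fps_eq_iff) (simp add: mat_def)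

text \<open>On the block of \<open>z\<close>, \<open>exp (t X)\<close> is \<open>exp (t z)\<close>
  times \<open>exp (t (X - z))\<close>. The second factor is polynomial in \<open>t\<close> because
  \<open>X - z\<close> is nilpotent there, and its constant term is \<open>E z\<close>.\<close>

lemma fexp_spectral:
  assumes "spectral X Z E"
  shows "\<exists>r. (\<forall>i j. fexp X $ i $ j = (\<Sum>z\<in>Z. fps_of_poly (r z i j) * fps_exp z)) \<and>
    (\<forall>z\<in>Z. \<forall>i j. coeff (r z i j) 0 = E z $ i $ j)"
proof -
  obtain m where m: "\<And>z. z \<in> Z \<Longrightarrow> E z ** matpow (X - mat z) m = 0"
    and sum1: "(\<Sum>z\<in>Z. E z) = mat 1" using assms unfolding spectral_def by blast
  define r where "r z i j = (\<Sum>k\<le>m. monom ((E z ** matpow (X - mat z) k) $ i $ j / fact k) k)" for z i j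
  have "map_mat fps_const (E z) ** fexp X = (\<chi> i j. fps_of_poly (r z i j) * fps_exp z)" if z: "z \<in> Z" for z
  proof -
    have kill: "E z ** matpow (X - mat z) k = 0" if "k \<ge> m" for k
      using that by (induction k rule: dec_induct) (simp_all add: m[OF z] matrix_mul_assoc)
    have "fexp X = fexp ((X - mat z) + mat z)" by simp
    also have "\<dots> = fexp (X - mat z) ** mat (fps_exp z)"
      by (subst fexp_add) (simp_all add: mat_mult(1) mat_mult(2)[symmetric] fexp_mat)
    finally have "map_mat fps_const (E z) ** fexp X = smult_mat (fps_exp z) (map_mat fps_const (E z) ** fexp (X - mat z))"
      by (simp add: mat_mult smult_mat_mult)
    moreover have "(map_mat fps_const (E z) ** fexp (X - mat z)) $ i $ j = fps_of_poly (r z i j)" for i j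
    proof (rule fps_ext)
      fix k
      have "fps_nth ((map_mat fps_const (E z) ** fexp (X - mat z)) $ i $ j) k = (E z ** matpow (X - mat z) k) $ i $ j / fact k"
        by (simp add: matrix_matrix_mult_def fps_sum_nth fexp_def sum_divide_distrib)
      also have "\<dots> = coeff (r z i j) k"
        using kill[of k] by (simp add: r_def coeff_sum coeff_monom)
      finally show "fps_nth ((map_mat fps_const (E z) ** fexp (X - mat z)) $ i $ j) k = fps_nth (fps_of_poly (r z i j)) k"
        by simp
    qed
    ultimately show ?thesis by (simp add: smult_mat_def vec_eq_iff mult.commute)
  qed
  moreover have "fexp X = (\<Sum>z\<in>Z. map_mat fps_const (E z) ** fexp X)"
  proof -
    have "map_mat fps_const (sum f S) = (\<Sum>z\<in>S. map_mat fps_const (f z))" for f :: "complex \<Rightarrow> complex ^ 'a ^ 'a" and S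
      by (simp add: vec_eq_iff is_ring_hom_sum[OF is_ring_hom_intros(3)])
    then have "(\<Sum>z\<in>Z. map_mat fps_const (E z)) = mat 1"
      using sum1 by (metis map_mat_1[OF is_ring_hom_intros(3)])
    then show ?thesis
      by (simp add: matrix_mult_sum_left[symmetric])
  qed
  ultimately have "fexp X = (\<Sum>z\<in>Z. (\<chi> i j. fps_of_poly (r z i j) * fps_exp z))" by simp
  then have "fexp X $ i $ j = (\<Sum>z\<in>Z. fps_of_poly (r z i j) * fps_exp z)" for i j
    by (simp add: vec_eq_iff)
  moreover have "coeff (r z i j) 0 = E z $ i $ j" for z i j
    by (simp add: r_def coeff_sum coeff_monom if_distrib cong: if_cong)
  ultimately show ?thesis by (intro exI[of _ r]) auto
qed

text \<open>The operator \<open>d/dt - \<nu>\<close> turns the coefficient \<open>p\<close> of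
  \<open>exp (\<mu> t)\<close> into \<open>T (\<mu> - \<nu>) p\<close>. Applied once more than the
  degree of \<open>c \<nu>\<close>, it removes that term, while it is injective on the coefficients
  with \<open>\<mu> \<noteq> \<nu>\<close>.\<close>

lemma exp_poly_independent:
  fixes c :: "complex \<Rightarrow> complex poly"
  assumes "finite S" "(\<Sum>\<mu>\<in>S. fps_of_poly (c \<mu>) * fps_exp \<mu>) = 0" "\<mu> \<in> S"
  shows "c \<mu> = 0"
  using assms
proof (induction S arbitrary: c \<mu> rule: finite_induct)
  case (insert \<nu> S)
  define T where "T a p = pderiv p + smult a p" for a :: complex and p
  have T0: "p = 0" if "T a p = 0" "a \<noteq> 0" for a p
  proof (rule ccontr)
    assume "p \<noteq> 0"
    have "coeff (T a p) (degree p) = a * lead_coeff p"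
      by (simp add: T_def coeff_pderiv coeff_eq_0)
    then show False using that \<open>p \<noteq> 0\<close> by simp
  qed
  have Tn0: "p = 0" if "(T a ^^ n) p = 0" "a \<noteq> 0" for a n p
    using that by (induction n arbitrary: p) (auto simp: funpow_swap1 dest: T0)
  have step: "(\<Sum>\<mu>\<in>insert \<nu> S. fps_of_poly ((T (\<mu> - \<nu>) ^^ n) (c \<mu>)) * fps_exp \<mu>) = 0" for n
  proof (induction n)
    case 0
    then show ?case using insert.prems by simp
  next
    case (Suc n)
    have d: "fps_deriv (fps_of_poly p * fps_exp \<mu>) - fps_const \<nu> * (fps_of_poly p * fps_exp \<mu>)
      = fps_of_poly (T (\<mu> - \<nu>) p) * fps_exp \<mu>" for p \<mu>
    proof -
      have "fps_of_poly (smult (\<mu> - \<nu>) p) = (fps_const \<mu> - fps_const \<nu>) * fps_of_poly p"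
        by (simp add: fps_of_poly_smult)
      then have "fps_of_poly (T (\<mu> - \<nu>) p) = fps_deriv (fps_of_poly p) + (fps_const \<mu> - fps_const \<nu>) * fps_of_poly p"
        by (simp only: T_def fps_of_poly_add fps_of_poly_pderiv)
      then show ?thesis
        by (simp only: fps_deriv_mult fps_exp_deriv) (simp add: algebra_simps del: fps_const_sub)
    qed
    have "0 = fps_deriv (\<Sum>\<mu>\<in>insert \<nu> S. fps_of_poly ((T (\<mu> - \<nu>) ^^ n) (c \<mu>)) * fps_exp \<mu>)
       - fps_const \<nu> * (\<Sum>\<mu>\<in>insert \<nu> S. fps_of_poly ((T (\<mu> - \<nu>) ^^ n) (c \<mu>)) * fps_exp \<mu>)"
      unfolding Suc.IH by simp
    also have "\<dots> = (\<Sum>\<mu>\<in>insert \<nu> S. fps_of_poly (T (\<mu> - \<nu>) ((T (\<mu> - \<nu>) ^^ n) (c \<mu>))) * fps_exp \<mu>)"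
      unfolding fps_deriv_sum sum_distrib_left sum_subtractf[symmetric] d ..
    finally show ?case by simp
  qed
  have "(T 0 ^^ n) p = 0" if "degree p < n" for n p
    using that
  proof (induction n arbitrary: p)
    case (Suc n)
    have "pderiv p = 0 \<or> degree (pderiv p) < n"
      using Suc.prems by (cases "degree p = 0") (auto simp: pderiv_eq_0_iff degree_pderiv)
    moreover have "(T 0 ^^ n) 0 = 0" by (induction n) (auto simp: T_def)
    ultimately show ?case using Suc.IH[of "pderiv p"] by (auto simp: funpow_swap1 T_def)
  qed simp
  then have "(\<Sum>\<mu>\<in>S. fps_of_poly ((T (\<mu> - \<nu>) ^^ Suc (degree (c \<nu>))) (c \<mu>)) * fps_exp \<mu>) = 0"
    using step[of "Suc (degree (c \<nu>))"] insert.hyps by (simp del: funpow.simps)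
  note S = insert.IH[of "\<lambda>\<mu>. (T (\<mu> - \<nu>) ^^ Suc (degree (c \<nu>))) (c \<mu>)", OF this]
  have S0: "c \<mu> = 0" if "\<mu> \<in> S" for \<mu>
    by (rule Tn0[OF S[OF that]]) (use that insert.hyps in auto)
  then have "fps_of_poly (c \<nu>) * fps_exp \<nu> = 0"
    using insert.prems(1) insert.hyps by simp
  moreover have "fps_exp \<nu> \<noteq> 0"
  proof
    assume "fps_exp \<nu> = 0"
    then have "fps_nth (fps_exp \<nu>) 0 = 0" by (simp only: fps_zero_nth)
    then show False by simp
  qed
  ultimately have "c \<nu> = 0" using fps_of_poly_eq_iff[of "c \<nu>" 0] by simp
  then show ?case using S0 insert.prems by auto
qed simp

lemma matpow_spectral_sum:
  assumes "spectral X Z E"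
  shows "matpow (\<Sum>z\<in>Z. smult_mat (f z) (E z)) m = (\<Sum>z\<in>Z. smult_mat (f z ^ m) (E z))"
proof (induction m)
  case 0
  then show ?case using assms by (simp add: spectral_def mat_mult(1)[symmetric])
next
  case (Suc m)
  have "smult_mat (f z ^ m) (E z) ** (\<Sum>w\<in>Z. smult_mat (f w) (E w)) = smult_mat (f z ^ Suc m) (E z)" if z: "z \<in> Z" for z
  proof -
    have "smult_mat (f z ^ m) (E z) ** (\<Sum>w\<in>Z. smult_mat (f w) (E w))
      = (\<Sum>w\<in>Z. smult_mat (f z ^ m * f w) (E z ** E w))"
      by (simp add: matrix_mult_sum_right smult_mat_mult smult_smult_mat mult.commute)
    also have "\<dots> = (\<Sum>w\<in>Z. if w = z then smult_mat (f z ^ m * f w) (E z) else 0)"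
      using assms z unfolding spectral_def by (intro sum.cong) (auto simp: smult_mat_def vec_eq_iff)
    finally show ?thesis using assms z by (simp add: spectral_def mult.commute)
  qed
  then show ?case by (simp add: Suc matrix_mult_sum_left)
qed

text \<open>The coordinates of \<open>exp(sX)\<close> are exponential polynomials in \<open>s\<close>, and by linear independence
  an algebraic relation between them survives replacing \<open>exp(z s)\<close> by \<open>exp(f(z) s)\<close>.\<close>

lemma (in matrix_monoid) replica_in_lie_algebra:
  assumes X: "X \<in> lie_algebra G" and sp: "spectral X Z E" and f: "\<And>a b. f (a + b) = f a + f b"
  shows "(\<Sum>z\<in>Z. smult_mat (f z) (E z)) \<in> lie_algebra G"
proof (rule fexp_in_imp_lie_algebra)
  fix p assume p: "p \<in> vanishing_ideal G"
  obtain r where r: "\<And>i j. fexp X $ i $ j = (\<Sum>z\<in>Z. fps_of_poly (r z i j) * fps_exp z)"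
    "\<And>z i j. z \<in> Z \<Longrightarrow> coeff (r z i j) 0 = E z $ i $ j"
    using fexp_spectral[OF sp] by blast
  \<comment> \<open>\<open>Y\<close> is \<open>exp (s X)\<close> with each function
    \<open>exp (z s)\<close> replaced by the key \<open>z\<close> of a monoid algebra over
    polynomials in \<open>s\<close>. One evaluation of this algebra gives back
    \<open>exp (s X)\<close>. Another sets \<open>s = 0\<close> in the coefficients and sends
    \<open>z\<close> to \<open>exp (f z s)\<close>, which gives the exponential of the
    replica.\<close>
  define Y :: "'n \<times> 'n \<Rightarrow> complex \<Rightarrow>\<^sub>0 complex poly" where "Y = (\<lambda>(i, j). \<Sum>z\<in>Z. Poly_Mapping.single z (r z i j))"
  define \<iota> :: "complex \<Rightarrow> complex \<Rightarrow>\<^sub>0 complex poly" where "\<iota> c = Poly_Mapping.single 0 [:c:]" for c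
  have \<iota>: "is_ring_hom \<iota>"
    by (simp add: is_ring_hom_def \<iota>_def single_add[symmetric] mult_single one_pCons[symmetric] mult.commute)
  have f0: "f 0 = 0" using f[of 0 0] by simp
  have h1: "is_ring_hom (pm_eval fps_of_poly fps_exp :: (complex \<Rightarrow>\<^sub>0 complex poly) \<Rightarrow> complex fps)"
    by (rule is_ring_hom_pm_eval) (auto simp: is_ring_hom_intros fps_exp_add_mult)
  have c: "is_ring_hom (\<lambda>p::complex poly. fps_const (coeff p 0))"
    by (rule is_ring_hom_comp[OF is_ring_hom_intros(11) is_ring_hom_intros(3)])
  have h2: "is_ring_hom (pm_eval (\<lambda>p. fps_const (coeff p 0)) (\<lambda>z. fps_exp (f z)) :: (complex \<Rightarrow>\<^sub>0 complex poly) \<Rightarrow> complex fps)"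
    by (rule is_ring_hom_pm_eval) (auto simp: c f f0 fps_exp_add_mult)
  have e1: "pm_eval fps_of_poly fps_exp (mpoly_eval \<iota> p Y) = mpoly_eval fps_const p (entries (fexp X))"
    unfolding mpoly_eval_hom[OF h1 \<iota>]
    by (rule arg_cong2[of _ _ _ _ "\<lambda>i x. mpoly_eval i p x"])
       (auto simp: fun_eq_iff \<iota>_def Y_def entries_def r(1) pm_eval_single is_ring_hom_intros is_ring_hom_sum[OF h1] fps_of_poly_const)
  have "mpoly_eval \<iota> p Y = 0"
  proof (rule poly_mapping_eqI)
    fix z
    have "(\<Sum>\<mu>\<in>Poly_Mapping.keys (mpoly_eval \<iota> p Y). fps_of_poly (Poly_Mapping.lookup (mpoly_eval \<iota> p Y) \<mu>) * fps_exp \<mu>) = 0"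
      using e1 mpoly_eval_fexp[OF X p] by (simp add: pm_eval_def)
    then show "Poly_Mapping.lookup (mpoly_eval \<iota> p Y) z = Poly_Mapping.lookup 0 z"
      using exp_poly_independent[OF finite_keys, of "Poly_Mapping.lookup (mpoly_eval \<iota> p Y)"] by (auto simp: in_keys_iff)
  qed
  then have "0 = pm_eval (\<lambda>p. fps_const (coeff p 0)) (\<lambda>z. fps_exp (f z)) (mpoly_eval \<iota> p Y)"
    by (simp add: is_ring_homD[OF h2])
  also have "\<dots> = mpoly_eval fps_const p (entries (fexp (\<Sum>z\<in>Z. smult_mat (f z) (E z))))"
    unfolding mpoly_eval_hom[OF h2 \<iota>]
  proof (rule arg_cong2[of _ _ _ _ "\<lambda>i x. mpoly_eval i p x"]; intro ext)
    fix v :: "'n \<times> 'n" obtain i j where v: "v = (i, j)" by (cases v)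
    have "pm_eval (\<lambda>p. fps_const (coeff p 0)) (\<lambda>z. fps_exp (f z)) (Y v) = (\<Sum>z\<in>Z. fps_const (E z $ i $ j) * fps_exp (f z))"
      by (simp add: v Y_def is_ring_hom_sum[OF h2] pm_eval_single[OF c] r(2))
    also have "\<dots> = fexp (\<Sum>z\<in>Z. smult_mat (f z) (E z)) $ i $ j"
      by (rule fps_ext) (simp add: fexp_def matpow_spectral_sum[OF sp] fps_sum_nth,
          simp add: smult_mat_def sum_divide_distrib mult.commute)
    finally show "pm_eval (\<lambda>p. fps_const (coeff p 0)) (\<lambda>z. fps_exp (f z)) (Y v) = entries (fexp (\<Sum>z\<in>Z. smult_mat (f z) (E z))) v"
      by (simp add: v entries_def)
  qed (simp add: \<iota>_def pm_eval_single[OF c] f0)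
  finally show "mpoly_eval fps_const p (entries (fexp (\<Sum>z\<in>Z. smult_mat (f z) (E z)))) = 0" ..
qed

section \<open>Idempotents, nilpotents and Engel's theorem\<close>

text \<open>The columns of \<open>Q\<close> are bases of the ranges \<open>R i\<close> put together,
  and \<open>c b\<close> records the idempotent that fixes the column \<open>b\<close>.\<close>

lemma simultaneous_diagonalization:
  fixes E :: "'i \<Rightarrow> complex ^ 'n ^ 'n"
  assumes fin: "finite I" and sum1: "(\<Sum>i\<in>I. E i) = mat 1"
    and orth: "\<And>i j. i \<in> I \<Longrightarrow> j \<in> I \<Longrightarrow> E i ** E j = (if i = j then E i else 0)"
  shows "\<exists>(Q :: complex ^ 'n ^ 'n) c. invertible Q \<and> range c \<subseteq> I \<and>
    (\<forall>i\<in>I. matrix_inv Q ** E i ** Q = (\<chi> a b. if a = b \<and> c a = i then 1 else 0))"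
proof -
  define R where "R i = {x. E i *v x = x}" for i
  have "vec.subspace (R i)" for i
    by (auto simp: vec.subspace_def R_def matrix_vector_right_distrib vector_scalar_commute)
  then have "\<exists>B. finite B \<and> B \<subseteq> R i \<and> vec.independent B \<and> vec.span B = R i" for i
    using vec.basis_subspace_exists[of "R i"] by metis
  then obtain B where B: "\<And>i. finite (B i)" "\<And>i. B i \<subseteq> R i" "\<And>i. vec.independent (B i)" "\<And>i. vec.span (B i) = R i"
    by metis
  have EB: "E i *v x = (if i = j then x else 0)" if "x \<in> B j" "i \<in> I" "j \<in> I" for i j x
  proof -
    have x: "E j *v x = x" using that B(2) by (auto simp: R_def)
    then have "E i *v x = (E i ** E j) *v x" by (simp add: matrix_vector_mul_assoc[symmetric])
    then show ?thesis using orth[OF that(2,3)] x by auto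
  qed
  have ne0: "x \<noteq> 0" if "x \<in> B i" for x i
    using B(3)[of i] that vec.dependent_zero by blast
  have uniq: "i = j" if "x \<in> B i" "x \<in> B j" "i \<in> I" "j \<in> I" for i j x
    using EB[OF that(1) that(4,3)] EB[OF that(2) that(4,4)] ne0[OF that(1)] by (auto split: if_splits)
  define BB where "BB = (\<Union>i\<in>I. B i)"
  have finB: "finite BB" using fin B(1) by (auto simp: BB_def)
  have ind: "vec.independent BB"
    unfolding vec.dependent_finite[OF finB]
  proof
    assume "\<exists>u. (\<exists>v\<in>BB. u v \<noteq> 0) \<and> (\<Sum>v\<in>BB. u v *s v) = 0"
    then obtain u v where uv: "v \<in> BB" "u v \<noteq> 0" "(\<Sum>v\<in>BB. u v *s v) = 0" by blast
    obtain i where i: "i \<in> I" "v \<in> B i" using uv(1) by (auto simp: BB_def)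
    have mv: "E i *v (\<Sum>w\<in>S. f w) = (\<Sum>w\<in>S. E i *v f w)" for f :: "(complex ^ 'n) \<Rightarrow> _" and S
      by (induction S rule: infinite_finite_induct) (auto simp: matrix_vector_right_distrib)
    have "0 = E i *v (\<Sum>v\<in>BB. u v *s v)" by (simp add: uv(3))
    also have "\<dots> = (\<Sum>w\<in>BB. u w *s (E i *v w))" unfolding mv by (simp add: vector_scalar_commute)
    also have "\<dots> = (\<Sum>w\<in>BB. if w \<in> B i then u w *s w else 0)"
    proof (rule sum.cong[OF refl])
      fix w assume "w \<in> BB"
      then obtain j where j: "j \<in> I" "w \<in> B j" by (auto simp: BB_def)
      show "u w *s (E i *v w) = (if w \<in> B i then u w *s w else 0)"
      proof (cases "i = j")
        case True
        then show ?thesis using EB[OF j(2) i(1) j(1)] j(2) by simp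
      next
        case False
        then have "w \<notin> B i" using uniq[OF j(2) _ j(1) i(1)] by blast
        then show ?thesis using EB[OF j(2) i(1) j(1)] False by simp
      qed
    qed
    also have "\<dots> = (\<Sum>w\<in>B i. u w *s w)"
      using finB i(1) by (subst sum.inter_restrict[symmetric]) (auto simp: BB_def intro: sum.cong)
    finally have "vec.dependent (B i)"
      unfolding vec.dependent_finite[OF B(1)] using i(2) uv(2) by auto
    then show False using B(3) by simp
  qed
  have span: "vec.span BB = UNIV"
  proof -
    have "x \<in> vec.span BB" for x
    proof -
      have "x = (\<Sum>i\<in>I. E i) *v x" by (simp add: sum1)
      also have "\<dots> = (\<Sum>i\<in>I. E i *v x)"
        by (rule sym, induction I rule: infinite_finite_induct) (auto simp: matrix_vector_mult_add_rdistrib)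
      also have "\<dots> \<in> vec.span BB"
      proof (rule vec.span_sum)
        fix i assume i: "i \<in> I"
        have "E i *v x \<in> R i" using orth[OF i i] by (simp add: R_def matrix_vector_mul_assoc)
        then show "E i *v x \<in> vec.span BB"
          using B(4)[of i] vec.span_mono[of "B i" BB] i by (auto simp: BB_def)
      qed
      finally show ?thesis .
    qed
    then show ?thesis by blast
  qed
  have "card BB = CARD('n)"
    using vec.dim_span_eq_card_independent[OF ind] unfolding span vec_dim_card ..
  then obtain h where h: "bij_betw h (UNIV :: 'n set) BB"
    using finite_same_card_bij[of "UNIV :: 'n set" BB] finB by auto
  define Q where "Q = (\<chi> a b. h b $ a)"
  have colQ: "column b Q = h b" for b by (simp add: column_def Q_def vec_eq_iff)
  have "columns Q = BB" using h by (auto simp: columns_def colQ bij_betw_def)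
  then obtain Q' where Q': "Q ** Q' = mat 1" using span matrix_right_invertible_span_columns[of Q] by metis
  then have inv: "invertible Q" by (metis invertible_right_inverse)
  have "\<exists>i. i \<in> I \<and> h b \<in> B i" for b
    using h by (auto simp: bij_betw_def BB_def)
  then obtain c where c: "\<And>b. c b \<in> I" "\<And>b. h b \<in> B (c b)" by metis
  have "matrix_inv Q ** E i ** Q = (\<chi> a b. if a = b \<and> c a = i then 1 else 0)" if i: "i \<in> I" for i
  proof -
    have "(E i ** Q) $ a $ b = (Q ** (\<chi> a b. if a = b \<and> c a = i then 1 else 0)) $ a $ b" for a b
    proof -
      have "(E i ** Q) $ a $ b = (E i *v h b) $ a"
        by (simp add: matrix_matrix_mult_def matrix_vector_mult_def Q_def)
      also have "\<dots> = (if c b = i then h b $ a else 0)" using EB[OF c(2) i c(1), of b] by simp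
      also have "\<dots> = (Q ** (\<chi> a b. if a = b \<and> c a = i then 1 else 0)) $ a $ b"
        unfolding matrix_matrix_mult_def Q_def vec_lambda_beta
        by (subst sum.remove[of _ b]) (auto intro!: sum.neutral[symmetric])
      finally show ?thesis .
    qed
    then have "E i ** Q = Q ** (\<chi> a b. if a = b \<and> c a = i then 1 else 0)" by (simp add: vec_eq_iff)
    then have "matrix_inv Q ** E i ** Q = matrix_inv Q ** (Q ** (\<chi> a b. if a = b \<and> c a = i then 1 else 0))"
      by (simp add: matrix_mul_assoc[symmetric])
    then show ?thesis
      by (simp add: matrix_mul_assoc matrix_inv_mult(2)[OF inv])
  qed
  then show ?thesis using inv c(1) by (intro exI[of _ Q] exI[of _ c] conjI) auto
qed

lemma trace_conj:
  fixes Q X :: "complex ^ 'n ^ 'n"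
  shows "invertible Q \<Longrightarrow> trace (matrix_inv Q ** X ** Q) = trace X"
  using trace_mul_sym[of "matrix_inv Q ** X" Q] by (simp add: matrix_mul_assoc matrix_inv_mult)

lemma trace_sum: "trace (sum f S :: 'a::comm_ring_1 ^ 'n ^ 'n) = (\<Sum>i\<in>S. trace (f i))"
  by (induction S rule: infinite_finite_induct) (simp_all add: trace_add trace_0[simplified])

lemma trace_smult: "trace (smult_mat c X) = c * trace X"
  by (simp add: trace_def smult_mat_def sum_distrib_left)

text \<open>In the diagonalizing basis the trace counts the basis vectors belonging to
  \<open>i\<close>, so it is the rank of \<open>E i\<close>.\<close>

lemma trace_idempotents:
  fixes E :: "'i \<Rightarrow> complex ^ 'n ^ 'n"
  assumes "finite I" "(\<Sum>i\<in>I. E i) = mat 1"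
    and "\<And>i j. i \<in> I \<Longrightarrow> j \<in> I \<Longrightarrow> E i ** E j = (if i = j then E i else 0)" and i: "i \<in> I"
  shows "\<exists>d. trace (E i) = of_nat d \<and> (d = 0 \<longrightarrow> E i = 0)"
proof -
  obtain Q and c :: "'n \<Rightarrow> 'i" where Q: "invertible Q"
    "matrix_inv Q ** E i ** Q = (\<chi> a b. if a = b \<and> c a = i then 1 else 0)"
    using simultaneous_diagonalization[OF assms(1-3)] i by blast
  have "trace (E i) = trace (matrix_inv Q ** E i ** Q)" by (rule trace_conj[OF Q(1), symmetric])
  also have "\<dots> = (\<Sum>a\<in>UNIV. if c a = i then 1 else 0)" unfolding Q(2) trace_def by simp
  also have "\<dots> = of_nat (card {a. c a = i})" by (simp add: sum.If_cases)
  finally have t: "trace (E i) = of_nat (card {a. c a = i})" .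
  have "E i = 0" if "card {a. c a = i} = 0"
  proof -
    have "c a \<noteq> i" for a using that by auto
    then have "matrix_inv Q ** E i ** Q = 0" unfolding Q(2) by (simp add: vec_eq_iff)
    then have "Q ** (matrix_inv Q ** E i ** Q) ** matrix_inv Q = 0" by simp
    moreover have "Q ** (matrix_inv Q ** E i ** Q) ** matrix_inv Q = (Q ** matrix_inv Q) ** E i ** (Q ** matrix_inv Q)"
      by (simp only: matrix_mul_assoc)
    ultimately show ?thesis by (simp add: matrix_inv_mult[OF Q(1)])
  qed
  then show ?thesis using t by (intro exI[of _ "card {a. c a = i}"] conjI impI)
qed

definition nilpotent :: "'a::semiring_1 ^ 'n ^ 'n \<Rightarrow> bool"
  where "nilpotent X \<longleftrightarrow> (\<exists>m. matpow X m = 0)"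

lemma matpow_commute_self: "X ** matpow X m = matpow X m ** (X :: 'a::comm_ring_1 ^ 'n ^ 'n)"
  by (induction m) (simp_all add: matrix_mul_assoc)

lemma matpow_mult_commuting:
  "X ** Y = Y ** X \<Longrightarrow> matpow (X ** Y) m = matpow X m ** matpow (Y :: 'a::comm_ring_1 ^ 'n ^ 'n) m"
proof (induction m)
  case (Suc m)
  have "matpow Y m ** X = X ** matpow Y m" by (rule matpow_commute) (simp add: Suc.prems)
  then show ?case using Suc by (simp add: matrix_mul_assoc) (metis matrix_mul_assoc)
qed simp

lemma nilpotent_mult_commuting: "nilpotent X \<Longrightarrow> X ** Y = Y ** X \<Longrightarrow> nilpotent (X ** (Y :: 'a::comm_ring_1 ^ 'n ^ 'n))"
  unfolding nilpotent_def by (metis matpow_mult_commuting times0_left)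

text \<open>With \<open>N ** Z ** N = N\<close> the matrix \<open>E = N ** Z\<close> projects onto the range of \<open>N\<close>, and passing from \<open>N\<close>
  to \<open>N ** E\<close> preserves the trace but lowers the order of nilpotency.\<close>

lemma trace_nilpotent:
  fixes N :: "complex ^ 'n ^ 'n"
  assumes "nilpotent N"
  shows "trace N = 0"
proof -
  have "matpow N m = 0 \<Longrightarrow> trace N = 0" for m
  proof (induction m arbitrary: N)
    case 0
    then have "(mat 1 :: complex ^ 'n ^ 'n) $ i $ i = 0" for i by simp
    then show ?case by (simp add: mat_def)
  next
    case (Suc m)
    obtain g where g: "Vector_Spaces.linear (*s) (*s) g" "\<forall>v\<in>range ((*v) N). N *v g v = v"
      using vec.linear_exists_right_inverse_on[OF matrix_vector_mul_linear_gen vec.subspace_UNIV, of N] by blast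
    define E where "E = N ** matrix g"
    have EN: "E ** N = N"
    proof -
      have "(E ** N) *v x = N *v x" for x
        using g(2) matrix_works[OF g(1)] by (simp add: E_def matrix_vector_mul_assoc[symmetric])
      then show ?thesis by (simp add: matrix_eq)
    qed
    have pow: "matpow (N ** E) k = (if k = 0 then mat 1 else matpow N k ** E)" for k
      by (induction k) (simp_all add: matrix_mul_assoc, metis EN matrix_mul_assoc)
    show ?case
    proof (cases "m = 0")
      case True
      then show ?thesis using Suc.prems by (simp add: trace_def)
    next
      case False
      have "matpow N m ** E = matpow N (Suc m) ** matrix g" by (simp add: E_def matrix_mul_assoc)
      then have "matpow (N ** E) m = 0" using Suc.prems False by (simp add: pow)
      then have "trace (N ** E) = 0" by (rule Suc.IH)
      then show ?thesis using trace_mul_sym[of E N] by (simp add: EN)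
    qed
  qed
  then show ?thesis using assms by (auto simp: nilpotent_def)
qed

definition prodm :: "(complex ^ 'n ^ 'n) list \<Rightarrow> complex ^ 'n ^ 'n"
  where "prodm xs = foldr (**) xs (mat 1)"

lemma prodm_simps [simp]: "prodm [] = mat 1" "prodm (x # xs) = x ** prodm xs"
  by (simp_all add: prodm_def)

lemma prodm_append: "prodm (xs @ ys) = prodm xs ** prodm ys"
  by (induction xs) (auto simp: matrix_mul_assoc)

lemma prodm_long_eq_0:
  assumes "\<And>xs. set xs \<subseteq> M \<Longrightarrow> length xs = k \<Longrightarrow> prodm xs = 0" "set xs \<subseteq> M" "length xs \<ge> k"
  shows "prodm xs = 0"
proof -
  have "prodm xs = prodm (take k xs) ** prodm (drop k xs)" by (simp flip: prodm_append)
  moreover have "prodm (take k xs) = 0"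
    using assms set_take_subset[of k xs] by (intro assms(1)) auto
  ultimately show ?thesis by simp
qed

text \<open>Expanding the brackets leaves terms with \<open>Y\<close> between two words in
  \<open>M\<close> of total length at least \<open>2 * k\<close>, so one of the words has length at
  least \<open>k\<close>.\<close>

lemma foldr_bracket_eq_0:
  assumes M: "\<And>xs. set xs \<subseteq> M \<Longrightarrow> length xs = k \<Longrightarrow> prodm xs = 0"
    and "set ms \<subseteq> M" "length ms \<ge> 2 * k"
  shows "foldr lie_bracket ms Y = 0"
proof -
  have "prodm xs ** foldr lie_bracket ms Y ** prodm ys = 0"
    if "set xs \<subseteq> M" "set ys \<subseteq> M" "set ms \<subseteq> M" "length xs + length ms + length ys \<ge> 2 * k" for xs ys ms
    using that
  proof (induction ms arbitrary: xs ys)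
    case Nil
    then have "length xs \<ge> k \<or> length ys \<ge> k" by auto
    then have "prodm xs = 0 \<or> prodm ys = 0" using prodm_long_eq_0[OF M] Nil by blast
    then show ?case by auto
  next
    case (Cons m ms)
    have "prodm (xs @ [m]) ** foldr lie_bracket ms Y ** prodm ys = 0"
      using Cons.prems by (intro Cons.IH) auto
    moreover have "prodm xs ** foldr lie_bracket ms Y ** prodm (m # ys) = 0"
      using Cons.prems by (intro Cons.IH) auto
    ultimately show ?case
      by (simp add: lie_bracket_def[of m "foldr lie_bracket ms Y"] matrix_mult_diff prodm_append matrix_mul_assoc)
  qed
  from this[of "[]" "[]" ms] show ?thesis using assms by simp
qed

lemma scaleR_matrix_mult:
  "Y ** (c *\<^sub>R Z) = c *\<^sub>R (Y ** (Z :: complex ^ 'n ^ 'n))" "(c *\<^sub>R Y) ** Z = c *\<^sub>R (Y ** Z)"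
  by (simp_all add: vec_eq_iff matrix_matrix_mult_def scaleR_sum_right)

text \<open>By induction on the real dimension. A proper subalgebra \<open>M\<close> of maximal
  dimension is normalized by some \<open>X\<close> outside it, so that \<open>L\<close> is
  \<open>M\<close> plus the real line through \<open>X\<close>; the nilpotency of \<open>M\<close>
  and of \<open>X\<close> is then combined along a filtration.\<close>

theorem engel:
  fixes L :: "(complex ^ 'n ^ 'n) set"
  assumes "subspace L" "\<And>X Y. X \<in> L \<Longrightarrow> Y \<in> L \<Longrightarrow> lie_bracket X Y \<in> L"
    and "\<And>X. X \<in> L \<Longrightarrow> nilpotent X"
  shows "\<exists>k. \<forall>xs. set xs \<subseteq> L \<longrightarrow> length xs = k \<longrightarrow> prodm xs = 0"
  using assms
proof (induction "dim L" arbitrary: L rule: less_induct)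
  case less
  show ?case
  proof (cases "L = {0}")
    case True
    then have "prodm xs = 0" if "set xs \<subseteq> L" "length xs = 1" for xs
      using that by (cases xs) auto
    then show ?thesis by blast
  next
    case False
    define P where "P M \<longleftrightarrow> subspace M \<and> M \<subset> L \<and> (\<forall>X\<in>M. \<forall>Y\<in>M. lie_bracket X Y \<in> M)" for M
    have "P {0}"
      using False less.prems(1) subspace_0 by (auto simp: P_def lie_bracket_def)
    moreover have "\<forall>M. P M \<longrightarrow> dim M < dim L + 1"
      by (auto simp: P_def less_Suc_eq_le intro: dim_subset)
    ultimately obtain M where M: "P M" and max: "\<And>M'. P M' \<Longrightarrow> dim M' \<le> dim M"
      using ex_has_greatest_nat[of P "{0}" dim "dim L + 1"] by (metis order_less_imp_le)
    have subM: "subspace M" "M \<subseteq> L" "M \<noteq> L" using M by (auto simp: P_def)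
    have "dim M < dim L" using M by (simp add: P_def dim_psubset span_eq_iff[THEN iffD2] less.prems(1))
    then obtain k where k: "\<And>xs. set xs \<subseteq> M \<Longrightarrow> length xs = k \<Longrightarrow> prodm xs = 0"
      using less.hyps[of M] M less.prems(3) unfolding P_def by blast
    obtain Y where Y: "Y \<in> L" "Y \<notin> M" using subM by blast
    let ?good = "\<lambda>ms. set ms \<subseteq> M \<and> foldr lie_bracket ms Y \<notin> M"
    have "?good []" using Y by simp
    moreover have "\<forall>ms. ?good ms \<longrightarrow> length ms < 2 * k"
      using foldr_bracket_eq_0[OF k] subspace_0[OF subM(1)] by (metis not_less)
    \<comment> \<open>A longest iterated bracket of \<open>Y\<close> with elements of
      \<open>M\<close> that is still outside \<open>M\<close>: every further bracket falls into
      \<open>M\<close>, so the result normalizes \<open>M\<close>.\<close>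
    ultimately obtain ms where ms: "?good ms" and msmax: "\<And>ms'. ?good ms' \<Longrightarrow> length ms' \<le> length ms"
      using ex_has_greatest_nat[of ?good "[]" length "2 * k"] by (metis (no_types, lifting) order_less_imp_le)
    define X where "X = foldr lie_bracket ms Y"
    have XM: "X \<notin> M" using ms by (simp add: X_def)
    have XL: "X \<in> L"
    proof -
      have "set ms \<subseteq> L \<Longrightarrow> foldr lie_bracket ms Y \<in> L" for ms
        by (induction ms) (auto simp: Y less.prems(2))
      then show ?thesis using ms subM(2) by (auto simp: X_def)
    qed
    have brM: "lie_bracket m X \<in> M" if "m \<in> M" for m
      using msmax[of "m # ms"] ms that by (auto simp: X_def)
    have anti: "lie_bracket A B = - lie_bracket B A" for A B :: "complex ^ 'n ^ 'n"
      by (simp add: lie_bracket_def)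
    have brM': "lie_bracket X m \<in> M" if "m \<in> M" for m
      using brM[OF that] subspace_neg[OF subM(1)] anti by metis
    define M' where "M' = span (insert X M)"
    have M'_iff: "Z \<in> M' \<longleftrightarrow> (\<exists>c. Z - c *\<^sub>R X \<in> M)" for Z
      unfolding M'_def using span_breakdown_eq[of Z X M] span_eq_iff[THEN iffD2, OF subM(1)] by simp
    have "M' = L"
    proof (rule ccontr)
      assume "M' \<noteq> L"
      have sub: "M' \<subseteq> L" unfolding M'_def using XL subM(2) less.prems(1) by (intro span_minimal) auto
      have "lie_bracket A B \<in> M'" if AB: "A \<in> M'" "B \<in> M'" for A B
      proof -
        obtain a b where ab: "A - a *\<^sub>R X \<in> M" "B - b *\<^sub>R X \<in> M" using AB M'_iff by auto
        have "lie_bracket A B = lie_bracket (A - a *\<^sub>R X) (B - b *\<^sub>R X)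
           + b *\<^sub>R lie_bracket (A - a *\<^sub>R X) X + a *\<^sub>R lie_bracket X (B - b *\<^sub>R X)"
          by (simp add: lie_bracket_def matrix_mult_diff scaleR_matrix_mult algebra_simps)
        also have "\<dots> \<in> M"
          using ab M brM brM' subM(1) by (intro subspace_add subspace_scale) (auto simp: P_def)
        finally show ?thesis unfolding M'_def by (simp add: span_base)
      qed
      then have "P M'" using \<open>M' \<noteq> L\<close> sub by (auto simp: P_def M'_def)
      moreover have "dim M < dim M'"
      proof (rule dim_psubset)
        have "M \<subseteq> M'" unfolding M'_def by (auto intro: span_base)
        moreover have "X \<in> M'" unfolding M'_def by (auto intro: span_base)
        ultimately show "span M \<subset> span M'" using XM subM(1) by (auto simp: M'_def span_eq_iff[THEN iffD2])
      qed
      ultimately show False using max by (metis not_less)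
    qed
    then have L_dec: "\<exists>c. Z - c *\<^sub>R X \<in> M" if "Z \<in> L" for Z using that M'_iff by auto
    obtain p where p: "matpow X p = 0" using less.prems(3)[OF XL] by (auto simp: nilpotent_def)
    \<comment> \<open>The matrices killed from the left by all words of length \<open>j\<close> in
      \<open>M\<close>. Left multiplication by \<open>M\<close> maps \<open>F (Suc j)\<close> to
      \<open>F j\<close> and \<open>X\<close> preserves each \<open>F j\<close>; hence modulo
      \<open>F j\<close> a word in \<open>L\<close> acts on \<open>F (Suc j)\<close> like a multiple
      of a power of \<open>X\<close>.\<close>
    define F :: "nat \<Rightarrow> (complex ^ 'n ^ 'n) set" where "F j = {Z. \<forall>ms. set ms \<subseteq> M \<longrightarrow> length ms = j \<longrightarrow> prodm ms ** Z = 0}" for j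
    have F_add: "Z + W \<in> F j" if "Z \<in> F j" "W \<in> F j" for Z W j
      using that by (auto simp: F_def matrix_add_ldistrib)
    have F_scale: "c *\<^sub>R Z \<in> F j" if "Z \<in> F j" for Z c j
      using that by (auto simp: F_def scaleR_matrix_mult)
    have F_M: "m ** Z \<in> F j" if "Z \<in> F (Suc j)" "m \<in> M" for m Z j
    proof -
      have *: "prodm ns ** Z = 0" if "set ns \<subseteq> M" "length ns = Suc j" for ns
        using that \<open>Z \<in> F (Suc j)\<close> by (simp add: F_def)
      have "prodm (ms @ [m]) ** Z = 0" if "set ms \<subseteq> M" "length ms = j" for ms
        by (rule *) (use that \<open>m \<in> M\<close> in auto)
      then show ?thesis by (auto simp: F_def prodm_append matrix_mul_assoc)
    qed
    have F_mono: "Z \<in> F (Suc j)" if "Z \<in> F j" for Z j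
    proof -
      have "prodm ms ** Z = 0" if "set ms \<subseteq> M" "length ms = Suc j" for ms
      proof -
        obtain m ms' where "ms = m # ms'" using \<open>length ms = Suc j\<close> by (cases ms) auto
        then have "prodm ms' ** Z = 0" "prodm ms ** Z = m ** (prodm ms' ** Z)"
          using that \<open>Z \<in> F j\<close> by (auto simp: F_def matrix_mul_assoc[symmetric])
        then show ?thesis by simp
      qed
      then show ?thesis by (auto simp: F_def)
    qed
    have F_X: "X ** Z \<in> F j" if "Z \<in> F j" for Z j
    proof -
      have "prodm ms ** X ** prodm ns ** Z = 0" if "set ms \<subseteq> M" "set ns \<subseteq> M" "length ms + length ns = j" for ms ns
        using that
      proof (induction ms arbitrary: ns rule: rev_induct)
        case Nil
        then have "prodm ns ** Z = 0" using \<open>Z \<in> F j\<close> by (auto simp: F_def)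
        then show ?case by (simp add: matrix_mul_assoc[symmetric])
      next
        case (snoc m ms)
        have "prodm (ms @ [lie_bracket m X] @ ns) ** Z = 0"
          using \<open>Z \<in> F j\<close> snoc.prems brM[of m] by (auto simp: F_def)
        moreover have "prodm ms ** X ** prodm (m # ns) ** Z = 0"
          using snoc.prems by (intro snoc.IH) auto
        ultimately show ?case
          by (simp add: prodm_append lie_bracket_def matrix_mult_diff matrix_mul_assoc)
      qed
      from this[of _ "[]"] show ?thesis by (auto simp: F_def matrix_mul_assoc)
    qed
    have F_L: "A ** Z \<in> F j" if "Z \<in> F j" "A \<in> L" for A Z j
    proof -
      obtain c where c: "A - c *\<^sub>R X \<in> M" using L_dec[OF \<open>A \<in> L\<close>] by blast
      have "A ** Z = (A - c *\<^sub>R X) ** Z + c *\<^sub>R (X ** Z)"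
        by (simp add: matrix_mult_diff scaleR_matrix_mult)
      then show ?thesis using F_M[OF F_mono[OF that(1)] c] F_X[OF that(1)] by (simp add: F_add F_scale)
    qed
    have F_word: "\<exists>c. prodm ls ** Z - c *\<^sub>R (matpow X (length ls) ** Z) \<in> F j"
      if "Z \<in> F (Suc j)" "set ls \<subseteq> L" for ls Z j
      using that(2)
    proof (induction ls)
      case Nil
      have "0 \<in> F j" by (auto simp: F_def)
      then show ?case by (intro exI[of _ 1]) simp
    next
      case (Cons A ls)
      then obtain c where c: "prodm ls ** Z - c *\<^sub>R (matpow X (length ls) ** Z) \<in> F j" by auto
      obtain a where a: "A - a *\<^sub>R X \<in> M" using L_dec Cons.prems by auto
      have XZ: "matpow X i ** Z \<in> F (Suc j)" for i
        using that(1) by (induction i) (auto simp: matpow_commute_self[symmetric] matrix_mul_assoc[symmetric] intro: F_X)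
      define W where "W = matpow X (length ls) ** Z"
      have "A ** (prodm ls ** Z - c *\<^sub>R W) + c *\<^sub>R ((A - a *\<^sub>R X) ** W) \<in> F j"
        using F_L[OF c] Cons.prems F_M[OF XZ a] by (intro F_add F_scale) (auto simp: W_def)
      also have "A ** (prodm ls ** Z - c *\<^sub>R W) + c *\<^sub>R ((A - a *\<^sub>R X) ** W)
        = prodm (A # ls) ** Z - (c * a) *\<^sub>R (X ** W)"
        by (simp add: matrix_mult_diff matrix_mul_assoc scaleR_matrix_mult algebra_simps)
      also have "X ** W = matpow X (length (A # ls)) ** Z"
        by (simp add: W_def matrix_mul_assoc matpow_commute_self)
      finally show ?case by blast
    qed
    have "\<exists>N. \<forall>Z\<in>F j. \<forall>ls. set ls \<subseteq> L \<longrightarrow> length ls = N \<longrightarrow> prodm ls ** Z = 0" for j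
    proof (induction j)
      case 0
      have "Z = 0" if "Z \<in> F 0" for Z using that by (simp add: F_def)
      then show ?case by (intro exI[of _ 0]) auto
    next
      case (Suc j)
      then obtain N where N: "\<And>Z ls. Z \<in> F j \<Longrightarrow> set ls \<subseteq> L \<Longrightarrow> length ls = N \<Longrightarrow> prodm ls ** Z = 0" by blast
      \<comment> \<open>The last \<open>p\<close> letters carry \<open>F (Suc j)\<close> into
        \<open>F j\<close> because \<open>matpow X p\<close> vanishes; the first \<open>N\<close>
        letters kill \<open>F j\<close>.\<close>
      have "prodm ls ** Z = 0" if "Z \<in> F (Suc j)" "set ls \<subseteq> L" "length ls = N + p" for Z ls
      proof -
        have s: "set (drop N ls) \<subseteq> L" "set (take N ls) \<subseteq> L" using that(2) set_drop_subset set_take_subset by fast+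
        have "prodm (drop N ls) ** Z \<in> F j"
          using F_word[OF that(1) s(1)] that(3) p by auto
        then have "prodm (take N ls) ** (prodm (drop N ls) ** Z) = 0"
          using s that(3) by (intro N) auto
        then show ?thesis by (simp add: matrix_mul_assoc prodm_append[symmetric])
      qed
      then show ?case by blast
    qed
    then obtain N where N: "\<And>Z ls. Z \<in> F k \<Longrightarrow> set ls \<subseteq> L \<Longrightarrow> length ls = N \<Longrightarrow> prodm ls ** Z = 0" by meson
    have "mat 1 \<in> F k" using k by (auto simp: F_def)
    then have "prodm xs = 0" if "set xs \<subseteq> L" "length xs = N" for xs using N[OF _ that] by fastforce
    then show ?thesis by (intro exI[of _ N] allI impI)
  qed
qed

section \<open>Nondegeneracy of the trace form\<close>

lemma spectral_commute:
  assumes "spectral X Z E" "z \<in> Z" "Y ** X = X ** Y"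
  shows "Y ** E z = E z ** Y"
proof -
  obtain p where p: "E z = mat_poly p X" using assms(1,2) by (auto simp: spectral_def)
  show ?thesis unfolding p by (rule mat_poly_commute) (rule assms(3))
qed

lemma spectral_orth:
  assumes "spectral X Z E"
  shows "finite Z" "(\<Sum>z\<in>Z. E z) = mat 1"
    "\<And>z w. z \<in> Z \<Longrightarrow> w \<in> Z \<Longrightarrow> E z ** E w = (if z = w then E z else 0)"
  using assms unfolding spectral_def by auto

lemma spectral_sum_mult:
  assumes "spectral X Z E" "z \<in> Z"
  shows "(\<Sum>w\<in>Z. smult_mat (f w) (E w)) ** E z = smult_mat (f z) (E z)"
proof -
  have "(\<Sum>w\<in>Z. smult_mat (f w) (E w)) ** E z = (\<Sum>w\<in>Z. if w = z then smult_mat (f z) (E z) else 0)"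
    unfolding matrix_mult_sum_left smult_mat_mult
    using spectral_orth(3)[OF assms(1) _ assms(2)]
    by (intro sum.cong refl) (auto simp: smult_mat_def vec_eq_iff)
  then show ?thesis using spectral_orth(1)[OF assms(1)] assms(2) by simp
qed

text \<open>On the block of \<open>z\<close> the subtracted sum is the scalar \<open>z\<close>, so
  the difference acts there as \<open>X - z\<close>.\<close>

lemma spectral_nilpotent:
  assumes sp: "spectral X Z E"
  shows "nilpotent (X - (\<Sum>z\<in>Z. smult_mat z (E z)))"
    and "z \<in> Z \<Longrightarrow> nilpotent ((X - mat z) ** E z)"
proof -
  let ?N = "X - (\<Sum>z\<in>Z. smult_mat z (E z))"
  obtain m where m: "\<And>z. z \<in> Z \<Longrightarrow> E z ** matpow (X - mat z) m = 0"
    using sp unfolding spectral_def by blast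
  have comm: "(X - mat w) ** E z = E z ** (X - mat w)" if "z \<in> Z" for z w
    using spectral_commute[OF sp that, of X] by (simp add: matrix_mult_diff mat_mult)
  have "matpow ?N k ** E z = E z ** matpow (X - mat z) k" if z: "z \<in> Z" for z k
  proof (induction k)
    case (Suc k)
    have "?N ** E z = E z ** (X - mat z)"
      using spectral_sum_mult[OF sp z, of "\<lambda>z. z"] spectral_commute[OF sp z, of X]
      by (simp add: matrix_mult_diff mat_mult)
    then have "matpow ?N (Suc k) ** E z = (matpow ?N k ** E z) ** (X - mat z)"
      by (simp add: matrix_mul_assoc[symmetric])
    then show ?case by (simp add: Suc matrix_mul_assoc)
  qed simp
  then have "matpow ?N m ** (\<Sum>z\<in>Z. E z) = 0" by (simp add: matrix_mult_sum_right m)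
  then show "nilpotent ?N" using spectral_orth(2)[OF sp] by (auto simp: nilpotent_def)
  assume z: "z \<in> Z"
  have "matpow ((X - mat z) ** E z) k = (if k = 0 then mat 1 else E z ** matpow (X - mat z) k)" for k
  proof (induction k)
    case (Suc k)
    have EE: "E z ** E z = E z" using spectral_orth(3)[OF sp z z] by simp
    have c: "matpow (X - mat z) k ** E z = E z ** matpow (X - mat z) k" by (rule matpow_commute) (simp add: comm[OF z])
    show ?case
    proof (cases "k = 0")
      case True
      then show ?thesis by (simp add: comm[OF z])
    next
      case False
      then have "matpow ((X - mat z) ** E z) (Suc k) = E z ** matpow (X - mat z) k ** (E z ** (X - mat z))"
        unfolding matpow.simps(2) Suc using False by (simp add: comm[OF z])
      also have "\<dots> = E z ** (matpow (X - mat z) k ** E z) ** (X - mat z)" by (simp add: matrix_mul_assoc)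
      also have "\<dots> = (E z ** E z) ** matpow (X - mat z) k ** (X - mat z)" unfolding c by (simp add: matrix_mul_assoc)
      finally show ?thesis by (simp add: EE matrix_mul_assoc)
    qed
  qed simp
  from this[of "Suc m"] m[OF z] show "nilpotent ((X - mat z) ** E z)"
    unfolding nilpotent_def by (metis matpow.simps(2) matrix_mul_assoc nat.distinct(1) times0_left)
qed

lemma trace_spectral:
  assumes "spectral X Z E" "z \<in> Z"
  shows "trace (X ** E z) = z * trace (E z)"
proof -
  have "trace (X ** E z) = trace ((X - mat z) ** E z) + trace (mat z ** E z)"
    by (simp add: matrix_mult_diff trace_sub)
  then show ?thesis
    using trace_nilpotent[OF spectral_nilpotent(2)[OF assms]] by (simp add: mat_mult trace_smult)
qed

text \<open>The trace equals the sum of \<open>|z|^2\<close> times the rank of \<open>E z\<close>.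
  This positivity is the reason for choosing complex conjugation as the additive map: vanishing
  leaves no nonzero eigenvalue.\<close>

lemma nilpotent_of_trace_cnj_replica:
  assumes sp: "spectral X Z E" and 0: "trace (X ** (\<Sum>z\<in>Z. smult_mat (cnj z) (E z))) = 0"
  shows "nilpotent X"
proof -
  note o = spectral_orth[OF sp]
  have "\<forall>z\<in>Z. \<exists>d. trace (E z) = of_nat d \<and> (d = 0 \<longrightarrow> E z = 0)"
    using trace_idempotents[OF o] by blast
  then obtain d where d: "\<And>z. z \<in> Z \<Longrightarrow> trace (E z) = of_nat (d z)" "\<And>z. z \<in> Z \<Longrightarrow> d z = 0 \<Longrightarrow> E z = 0"
    by metis
  have "(\<Sum>z\<in>Z. (cmod z)\<^sup>2 * d z) = 0"
  proof -
    have "trace (X ** (\<Sum>z\<in>Z. smult_mat (cnj z) (E z))) = (\<Sum>z\<in>Z. cnj z * (z * of_nat (d z)))"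
      unfolding matrix_mult_sum_right smult_mat_mult trace_sum trace_smult
      by (intro sum.cong refl) (simp add: trace_spectral[OF sp] d)
    also have "\<dots> = of_real (\<Sum>z\<in>Z. (cmod z)\<^sup>2 * d z)"
    proof -
      have "cnj z * (z * of_nat (d z)) = of_real ((cmod z)\<^sup>2 * d z)" for z
        using complex_norm_square[of z] by (simp add: mult.assoc mult.commute mult.left_commute)
      then show ?thesis by (simp only: of_real_sum)
    qed
    finally show ?thesis using 0 by (metis of_real_eq_0_iff)
  qed
  then have "(cmod z)\<^sup>2 * d z = 0" if "z \<in> Z" for z
    using that o(1) by (subst (asm) sum_nonneg_eq_0_iff) auto
  then have "z = 0 \<or> E z = 0" if "z \<in> Z" for z using that d(2) by fastforce
  then have "(\<Sum>z\<in>Z. smult_mat z (E z)) = 0"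
    by (intro sum.neutral) (auto simp: smult_mat_def vec_eq_iff)
  then show ?thesis using spectral_nilpotent(1)[OF sp] by simp
qed

lemma trace_bracket: "trace (lie_bracket X W ** Y) = trace (X ** lie_bracket W (Y :: complex ^ 'n ^ 'n))"
  using trace_mul_sym[of W "X ** Y"]
  by (simp add: lie_bracket_def matrix_mult_diff trace_sub matrix_mul_assoc)

lemma smult_mat_bracket:
  "lie_bracket (smult_mat c X) Y = smult_mat c (lie_bracket X (Y :: 'a::comm_ring_1 ^ 'n ^ 'n))"
  "lie_bracket X (smult_mat c Y) = smult_mat c (lie_bracket X Y)"
  by (simp_all add: lie_bracket_def smult_mat_mult) (simp_all add: smult_mat_def vec_eq_iff algebra_simps)

lemma smult_mat_0: "smult_mat c 0 = (0 :: 'a::comm_ring_1 ^ 'n ^ 'n)"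
  by (simp add: smult_mat_def vec_eq_iff)

lemma lie_bracket_add:
  "lie_bracket (X + X') Y = lie_bracket X Y + lie_bracket X' (Y :: 'a::comm_ring_1 ^ 'n ^ 'n)"
  "lie_bracket X (Y + Y') = lie_bracket X Y + lie_bracket X (Y' :: 'a ^ 'n ^ 'n)"
  by (simp_all add: lie_bracket_def matrix_add_ldistrib matrix_add_rdistrib')

lemma lie_bracket_sum:
  "lie_bracket (sum f S) Y = (\<Sum>i\<in>S. lie_bracket (f i) (Y :: 'a::comm_ring_1 ^ 'n ^ 'n))"
  "lie_bracket X (sum g S) = (\<Sum>i\<in>S. lie_bracket X (g i :: 'a ^ 'n ^ 'n))"
  by (simp_all add: lie_bracket_def matrix_mult_sum_left matrix_mult_sum_right sum_subtractf)

lemma lie_bracket_zero [simp]: "lie_bracket 0 Y = 0" "lie_bracket (X :: 'a::comm_ring_1 ^ 'n ^ 'n) 0 = 0"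
  by (simp_all add: lie_bracket_def)

lemma lie_bracket_antisym: "lie_bracket X Y = - lie_bracket Y (X :: 'a::comm_ring_1 ^ 'n ^ 'n)"
  by (simp add: lie_bracket_def)

lemma lie_bracket_jacobi:
  "lie_bracket X (lie_bracket Y Z) = lie_bracket (lie_bracket X Y) Z + lie_bracket Y (lie_bracket X (Z :: 'a::comm_ring_1 ^ 'n ^ 'n))"
  by (simp add: lie_bracket_def matrix_mult_diff matrix_mul_assoc)

lemma lie_bracket_eq_0_iff: "lie_bracket X Y = 0 \<longleftrightarrow> X ** Y = Y ** X"
  by (simp add: lie_bracket_def)

lemma conj_mult:
  fixes g :: "'a::field ^ 'n ^ 'n"
  assumes "invertible g"
  shows "(g ** X ** matrix_inv g) ** (g ** Y ** matrix_inv g) = g ** (X ** Y) ** matrix_inv g"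
  using matrix_inv_mult(2)[OF assms] by (simp add: matrix_mul_assoc mat_cancel)

lemma conj_bracket:
  fixes g :: "'a::field ^ 'n ^ 'n"
  assumes "invertible g"
  shows "lie_bracket (g ** X ** matrix_inv g) (g ** Y ** matrix_inv g) = g ** lie_bracket X Y ** matrix_inv g"
  unfolding lie_bracket_def conj_mult[OF assms] by (simp add: matrix_mult_diff)

lemma matrix_inv_inv: "invertible g \<Longrightarrow> matrix_inv (matrix_inv g) = (g :: 'a::field ^ 'n ^ 'n)"
  by (rule matrix_inv_eq) (rule matrix_inv_mult)

lemma conj_conj:
  fixes g :: "'a::field ^ 'n ^ 'n"
  assumes "invertible g"
  shows "g ** (matrix_inv g ** X ** g) ** matrix_inv g = X" "matrix_inv g ** (g ** X ** matrix_inv g) ** g = X"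
  using matrix_inv_mult[OF assms] by (simp_all add: matrix_mul_assoc mat_cancel)

section \<open>Centre and trace form of a semisimple Lie algebra\<close>

locale semisimple =
  fixes G :: "('n::finite cmat) set"
  assumes ss: "semisimple_group G"
begin

lemma alg: "linear_algebraic_group G"
  using ss by (simp add: semisimple_group_def)

sublocale matrix_monoid G
  by (rule linear_algebraic_group_closed(1)[OF alg])

abbreviation "\<gg> \<equiv> lie_algebra G"

lemma Ad_inverse:
  assumes "g \<in> G" "Y \<in> \<gg>"
  shows "\<exists>Y'\<in>\<gg>. Y = g ** Y' ** matrix_inv g"
proof
  show "matrix_inv g ** Y ** g \<in> \<gg>"
    using lie_algebra_Ad[OF inv_in[OF assms(1)] assms(2)] matrix_inv_inv[OF invertible_in[OF assms(1)]] by simp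
  show "Y = g ** (matrix_inv g ** Y ** g) ** matrix_inv g"
    by (simp add: conj_conj invertible_in[OF assms(1)])
qed

text \<open>The centre is a commutative subspace stable under \<open>G\<close>, hence excluded by
  \<open>commuting_Ad_stable_trivial\<close>.\<close>

lemma center_trivial:
  assumes "X \<in> \<gg>" "\<And>Y. Y \<in> \<gg> \<Longrightarrow> lie_bracket X Y = 0"
  shows "X = 0"
proof -
  let ?J = "{X \<in> \<gg>. \<forall>Y\<in>\<gg>. lie_bracket X Y = 0}"
  have "?J = {0}"
  proof (rule commuting_Ad_stable_trivial[OF ss])
    fix g X assume g: "g \<in> G" and X: "X \<in> ?J"
    have "lie_bracket (g ** X ** matrix_inv g) Y = 0" if "Y \<in> \<gg>" for Y
    proof -
      obtain Y' where Y': "Y' \<in> \<gg>" "Y = g ** Y' ** matrix_inv g" using Ad_inverse[OF g \<open>Y \<in> \<gg>\<close>] by blast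
      show ?thesis unfolding Y'(2) conj_bracket[OF invertible_in[OF g]] using X Y'(1) by simp
    qed
    then show "g ** X ** matrix_inv g \<in> ?J" using X lie_algebra_Ad[OF g] by simp
  next
    fix X Y assume "X \<in> ?J" "Y \<in> ?J"
    then show "X ** Y = Y ** X" using lie_bracket_eq_0_iff[of X Y] by blast
  qed (auto simp: lie_algebra_0 lie_algebra_add lie_algebra_smult lie_bracket_add smult_mat_bracket smult_mat_0)
  then show ?thesis using assms by blast
qed

theorem trace_form_nondegenerate:
  assumes "X \<in> \<gg>" "\<And>Y. Y \<in> \<gg> \<Longrightarrow> trace (X ** Y) = 0"
  shows "X = 0"
proof -
  define I where "I = {X \<in> \<gg>. \<forall>Y\<in>\<gg>. trace (X ** Y) = 0}"
  have I_sub: "X \<in> I \<Longrightarrow> X \<in> \<gg>" for X by (simp add: I_def)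
  have I_nil: "nilpotent X" if "X \<in> I" for X
  proof -
    obtain Z E where sp: "spectral X Z E" using ex_spectral by blast
    have "(\<Sum>z\<in>Z. smult_mat (cnj z) (E z)) \<in> \<gg>"
      by (rule replica_in_lie_algebra[OF I_sub[OF that] sp]) simp
    then show ?thesis using that by (intro nilpotent_of_trace_cnj_replica[OF sp]) (simp add: I_def)
  qed
  have I_br: "lie_bracket X W \<in> I" if "X \<in> I" "W \<in> \<gg>" for X W
    using that by (auto simp: I_def trace_bracket lie_algebra_bracket)
  have I_add: "X + Y \<in> I" if "X \<in> I" "Y \<in> I" for X Y
    using that by (auto simp: I_def lie_algebra_add matrix_add_rdistrib' trace_add)
  have I_smult: "smult_mat c X \<in> I" if "X \<in> I" for X c
    using that by (auto simp: I_def lie_algebra_smult smult_mat_mult trace_smult)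
  have I0: "0 \<in> I" by (auto simp: I_def lie_algebra_0 trace_def)
  have sc: "smult_mat (of_real c) X = c *\<^sub>R X" for c and X :: "'n cmat"
    unfolding smult_mat_def vec_eq_iff by (simp add: scaleR_conv_of_real[where 'a = complex])
  have "subspace I"
    unfolding subspace_def using I0 I_add I_smult sc by metis
  then obtain k where k: "\<And>xs. set xs \<subseteq> I \<Longrightarrow> length xs = k \<Longrightarrow> prodm xs = 0"
    using engel[of I] I_br I_nil I_sub by blast
  \<comment> \<open>The radical \<open>I\<close> need not be commutative a priori, so semisimplicity
    is applied to its centre.\<close>
  let ?J = "{X \<in> I. \<forall>Y\<in>I. lie_bracket X Y = 0}"
  have I_Ad: "g ** X ** matrix_inv g \<in> I" if g: "g \<in> G" and X: "X \<in> I" for g X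
  proof -
    have "trace (g ** X ** matrix_inv g ** Y) = 0" if "Y \<in> \<gg>" for Y
    proof -
      obtain Y' where Y': "Y' \<in> \<gg>" "Y = g ** Y' ** matrix_inv g" using Ad_inverse[OF g \<open>Y \<in> \<gg>\<close>] by blast
      have "trace (g ** X ** matrix_inv g ** Y) = trace (g ** (X ** Y') ** matrix_inv g)"
        unfolding Y'(2) conj_mult[OF invertible_in[OF g]] ..
      also have "\<dots> = trace (X ** Y')"
        using trace_conj[OF invertible_matrix_inv[OF invertible_in[OF g]], of "X ** Y'"]
        by (simp add: matrix_inv_inv invertible_in[OF g])
      finally show ?thesis using X Y'(1) by (simp add: I_def)
    qed
    then show ?thesis using X lie_algebra_Ad[OF g] by (simp add: I_def)
  qed
  have "?J = {0}"
  proof (rule commuting_Ad_stable_trivial[OF ss])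
    fix g X assume g: "g \<in> G" and X: "X \<in> ?J"
    have "lie_bracket (g ** X ** matrix_inv g) Y = 0" if "Y \<in> I" for Y
    proof -
      have Y: "matrix_inv g ** Y ** g \<in> I"
        using I_Ad[OF inv_in[OF g] that] by (simp add: matrix_inv_inv invertible_in[OF g])
      have "lie_bracket (g ** X ** matrix_inv g) Y
        = lie_bracket (g ** X ** matrix_inv g) (g ** (matrix_inv g ** Y ** g) ** matrix_inv g)"
        by (simp only: conj_conj invertible_in[OF g])
      also have "\<dots> = 0" unfolding conj_bracket[OF invertible_in[OF g]] using X Y by simp
      finally show ?thesis .
    qed
    then show "g ** X ** matrix_inv g \<in> ?J" using X I_Ad[OF g] by simp
  next
    fix X Y assume "X \<in> ?J" "Y \<in> ?J"
    then show "X ** Y = Y ** X" using lie_bracket_eq_0_iff[of X Y] by blast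
  qed (auto simp: I0 I_add I_smult I_sub lie_bracket_add smult_mat_bracket smult_mat_0)
  have "Y = 0" if "Y \<in> I" for Y
  proof (rule ccontr)
    assume "Y \<noteq> 0"
    \<comment> \<open>By Engel's theorem iterated brackets in \<open>I\<close> eventually vanish,
      and a longest nonzero one lies in the centre of \<open>I\<close>.\<close>
    let ?good = "\<lambda>ms. set ms \<subseteq> I \<and> foldr lie_bracket ms Y \<noteq> 0"
    have "?good []" using \<open>Y \<noteq> 0\<close> by simp
    moreover have "\<forall>ms. ?good ms \<longrightarrow> length ms < 2 * k"
      using foldr_bracket_eq_0[OF k] by (metis not_less)
    ultimately obtain ms where ms: "?good ms" and msmax: "\<And>ms'. ?good ms' \<Longrightarrow> length ms' \<le> length ms"
      using ex_has_greatest_nat[of ?good "[]" length "2 * k"] by (metis (no_types, lifting) order_less_imp_le)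
    have "set ms \<subseteq> I \<Longrightarrow> foldr lie_bracket ms Y \<in> I" for ms
      by (induction ms) (auto simp: that I_sub I_br)
    then have "foldr lie_bracket ms Y \<in> I" using ms by blast
    moreover have "lie_bracket m (foldr lie_bracket ms Y) = 0" if "m \<in> I" for m
      using msmax[of "m # ms"] ms that by auto
    ultimately have "foldr lie_bracket ms Y \<in> ?J" by (auto simp: lie_bracket_antisym[of "foldr lie_bracket ms Y"])
    then show False using \<open>?J = {0}\<close> ms by blast
  qed
  then show ?thesis using assms by (simp add: I_def)
qed

end

section \<open>Weights of a torus\<close>

text \<open>Dedekind's argument: translating the relation by \<open>s\<close> and subtracting
  \<open>\<psi> s\<close> times the original removes \<open>\<psi>\<close>. Characters agreeing on
  \<open>S\<close> must be equal as functions, since \<open>X\<close> is a set of functions on the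
  whole type.\<close>

lemma characters_independent:
  fixes c :: "('a \<Rightarrow> complex) \<Rightarrow> complex"
  assumes "finite X" "\<And>s t. s \<in> S \<Longrightarrow> t \<in> S \<Longrightarrow> op s t \<in> S" "e \<in> S"
    and "\<And>\<theta>. \<theta> \<in> X \<Longrightarrow> \<theta> e = 1" "\<And>\<theta> s t. \<theta> \<in> X \<Longrightarrow> s \<in> S \<Longrightarrow> t \<in> S \<Longrightarrow> \<theta> (op s t) = \<theta> s * \<theta> t"
    and "\<And>\<theta> \<psi>. \<theta> \<in> X \<Longrightarrow> \<psi> \<in> X \<Longrightarrow> (\<And>s. s \<in> S \<Longrightarrow> \<theta> s = \<psi> s) \<Longrightarrow> \<theta> = \<psi>"
    and "\<And>t. t \<in> S \<Longrightarrow> (\<Sum>\<theta>\<in>X. c \<theta> * \<theta> t) = 0" "\<theta> \<in> X"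
  shows "c \<theta> = 0"
  using assms
proof (induction X arbitrary: c \<theta> rule: finite_induct)
  case (insert \<psi> X)
  have X0: "c \<phi> = 0" if \<phi>: "\<phi> \<in> X" for \<phi>
  proof -
    have "\<phi> \<noteq> \<psi>" using insert.hyps \<phi> by auto
    then obtain s where s: "s \<in> S" "\<phi> s \<noteq> \<psi> s" using insert.prems(5)[of \<phi> \<psi>] \<phi> by blast
    have "c \<phi> * (\<phi> s - \<psi> s) = 0"
    proof (rule insert.IH[of "\<lambda>\<phi>. c \<phi> * (\<phi> s - \<psi> s)"])
      fix t assume t: "t \<in> S"
      have "(\<Sum>\<theta>\<in>insert \<psi> X. c \<theta> * \<theta> (op s t)) - \<psi> s * (\<Sum>\<theta>\<in>insert \<psi> X. c \<theta> * \<theta> t) = 0"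
        using insert.prems(6)[OF t] insert.prems(6)[OF insert.prems(1)[OF s(1) t]] by simp
      moreover have "(\<Sum>\<theta>\<in>insert \<psi> X. c \<theta> * \<theta> (op s t)) = (\<Sum>\<theta>\<in>insert \<psi> X. c \<theta> * (\<theta> s * \<theta> t))"
        using insert.prems(4) s(1) t by (intro sum.cong) auto
      ultimately have "(\<Sum>\<theta>\<in>insert \<psi> X. c \<theta> * (\<theta> s - \<psi> s) * \<theta> t) = 0"
        unfolding sum_distrib_left sum_subtractf[symmetric] by (simp add: algebra_simps sum_subtractf)
      then show "(\<Sum>\<phi>\<in>X. c \<phi> * (\<phi> s - \<psi> s) * \<phi> t) = 0" using insert.hyps by simp
    qed (use insert.prems \<phi> in auto)
    then show ?thesis using s by simp
  qed
  have "(\<Sum>\<theta>\<in>insert \<psi> X. c \<theta> * \<theta> e) = c \<psi>"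
    using insert.hyps X0 insert.prems(3) by simp
  then have "c \<psi> = 0" using insert.prems(2,6) by metis
  then show ?case using X0 insert.prems(7) by auto
qed simp

text \<open>A linear form is its own differential, so if it vanishes on the group it vanishes on the
  Lie algebra.\<close>

lemma lie_algebra_linear_relation:
  fixes P :: "'n::finite cmat"
  assumes "X \<in> lie_algebra A" "\<And>t. t \<in> A \<Longrightarrow> (matrix_inv P ** t ** P) $ i $ j = 0" "invertible P"
  shows "(matrix_inv P ** X ** P) $ i $ j = 0"
proof -
  note P = matrix_inv_mult[OF assms(3)]
  have "subst_mul (matrix_inv P) P (Var (i, j)) \<in> vanishing_ideal A"
    unfolding vanishing_ideal_def mem_Collect_eq mpoly_eval_subst_mul_id
    using assms(2) by (simp add: is_ring_hom_intros entries_def)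
  then have "mpoly_eval id (D X (subst_mul (matrix_inv P) P (Var (i, j)))) (entries (mat 1)) = 0"
    using assms(1) by (simp add: lie_algebra_iff)
  then have "mpoly_eval id (D (matrix_inv P ** X ** P) (Var (i, j))) (entries (mat 1)) = 0"
    unfolding D_subst_mul[OF P(1) P(1)] mpoly_eval_subst_mul_id by (simp add: P)
  moreover have "mpoly_eval id (D Y (Var (i, j))) (entries (mat 1)) = Y $ i $ j" for Y :: "'n cmat"
    by (simp add: D_simps mpoly_eval_sum mpoly_eval_mult is_ring_hom_intros entries_def mat_def if_distrib
        if_distribR cong: if_cong)
  ultimately show ?thesis by simp
qed

definition dg :: "('n \<Rightarrow> 'a::zero) \<Rightarrow> 'a ^ 'n ^ 'n"
  where "dg y = (\<chi> i j. if i = j then y i else 0)"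

lemma dg_mult: "(X ** dg y) $ i $ j = X $ i $ j * (y j :: 'a::comm_ring_1)" "(dg y ** X) $ i $ j = y i * X $ i $ j"
  by (simp_all add: matrix_matrix_mult_def dg_def if_distrib if_distribR sum.delta sum.delta' cong: if_cong)

lemma dg_eqI: "(\<And>i j. i \<noteq> j \<Longrightarrow> X $ i $ j = 0) \<Longrightarrow> X = dg (\<lambda>i. X $ i $ i)"
  by (auto simp: dg_def vec_eq_iff)

lemma dg_comp: "dg x ** dg y = dg (\<lambda>i. x i * (y i :: 'a::comm_ring_1))"
  by (simp add: vec_eq_iff dg_mult) (simp add: dg_def)

lemma prod_powi: "(\<Prod>i\<in>S. f i :: complex) powi a = (\<Prod>i\<in>S. f i powi a)"
  by (induction S rule: infinite_finite_induct) (auto simp: power_int_mult_distrib)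

lemma fexp_dg: "fexp (dg d) = dg (\<lambda>l. fps_exp (d l))"
  for d :: "'n::finite \<Rightarrow> complex"
proof -
  have "matpow (dg d) m = dg (\<lambda>i. d i ^ m)" for m
  proof (induction m)
    case 0
    show ?case by (simp add: mat_def dg_def)
  next
    case (Suc m)
    then show ?case by (simp add: dg_comp mult.commute)
  qed
  then show ?thesis
    by (simp add: fexp_def vec_eq_iff fps_eq_iff) (simp add: dg_def)
qed

section \<open>Coordinates that diagonalize the torus\<close>

locale cartan = semisimple G for G :: "('n::finite cmat) set" +
  fixes A :: "('n::finite cmat) set"
  assumes mt: "maximal_torus A G"
begin

abbreviation "\<aa> \<equiv> lie_algebra A"

lemma alg_A: "linear_algebraic_group A"
  using mt by (simp add: maximal_torus_def algebraic_torus_def)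

sublocale A: matrix_monoid A
  by (rule linear_algebraic_group_closed(1)[OF alg_A])

lemma A_sub: "A \<subseteq> G"
  using mt by (simp add: maximal_torus_def)

lemma a_sub: "\<aa> \<subseteq> \<gg>"
  by (rule lie_algebra_mono[OF A_sub])

definition P :: "'n cmat"
  where "P = (SOME P. invertible P \<and> (\<forall>t\<in>A. \<forall>i j. i \<noteq> j \<longrightarrow> (matrix_inv P ** t ** P) $ i $ j = 0))"

definition cj :: "'n cmat \<Rightarrow> 'n cmat"
  where "cj X = matrix_inv P ** X ** P"

definition ic :: "'n cmat \<Rightarrow> 'n cmat"
  where "ic X = P ** X ** matrix_inv P"

lemma P: "invertible P" "t \<in> A \<Longrightarrow> i \<noteq> j \<Longrightarrow> cj t $ i $ j = 0"
proof -
  have "\<exists>P :: 'n cmat. invertible P \<and> (\<forall>t\<in>A. \<forall>i j. i \<noteq> j \<longrightarrow> (matrix_inv P ** t ** P) $ i $ j = 0)"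
    using mt by (simp add: maximal_torus_def algebraic_torus_def)
  from someI_ex[OF this, folded P_def]
  show "invertible P" "t \<in> A \<Longrightarrow> i \<noteq> j \<Longrightarrow> cj t $ i $ j = 0" by (auto simp: cj_def)
qed

lemma cj_ic [simp]: "cj (ic X) = X" "ic (cj X) = X"
  by (simp_all add: cj_def ic_def conj_conj P(1))

lemma cj_inj: "cj X = cj Y \<longleftrightarrow> X = Y"
  using cj_ic(2) by metis

lemma cj_mult: "cj (X ** Y) = cj X ** cj Y"
  using matrix_inv_mult(1)[OF P(1)] by (simp add: cj_def matrix_mul_assoc mat_cancel)

lemma cj_add: "cj (X + Y) = cj X + cj Y"
  by (simp add: cj_def matrix_add_ldistrib matrix_add_rdistrib')

lemma cj_diff: "cj (X - Y) = cj X - cj Y"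
  by (simp add: cj_def matrix_mult_diff)

lemma cj_smult: "cj (smult_mat c X) = smult_mat c (cj X)"
  by (simp add: cj_def smult_mat_mult)

lemma cj_0 [simp]: "cj 0 = 0"
  by (simp add: cj_def)

lemma cj_1: "cj (mat 1) = mat 1"
  using matrix_inv_mult(2)[OF P(1)] by (simp add: cj_def)

lemma cj_sum: "cj (sum f S) = (\<Sum>i\<in>S. cj (f i))"
  by (simp add: cj_def matrix_mult_sum_left matrix_mult_sum_right)

lemma cj_bracket: "cj (lie_bracket X Y) = lie_bracket (cj X) (cj Y)"
  by (simp add: lie_bracket_def cj_diff cj_mult)

lemma trace_cj: "trace (cj X) = trace X"
  unfolding cj_def by (rule trace_conj[OF P(1)])

lemma a_diag: "H \<in> \<aa> \<Longrightarrow> i \<noteq> j \<Longrightarrow> cj H $ i $ j = 0"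
  unfolding cj_def by (rule lie_algebra_linear_relation[OF _ _ P(1)]) (use P(2) in \<open>auto simp: cj_def\<close>)

definition \<tau> :: "'n cmat \<Rightarrow> 'n \<Rightarrow> complex" where "\<tau> t i = cj t $ i $ i"

lemma cj_A: "t \<in> A \<Longrightarrow> cj t = dg (\<tau> t)"
  unfolding \<tau>_def using dg_eqI[of "cj t"] P(2) by blast

lemma cj_a: "H \<in> \<aa> \<Longrightarrow> cj H = dg (\<tau> H)"
  unfolding \<tau>_def using dg_eqI[of "cj H"] a_diag by blast

lemma \<tau>_mult: "s \<in> A \<Longrightarrow> t \<in> A \<Longrightarrow> \<tau> (s ** t) i = \<tau> s i * \<tau> t i"
  using dg_mult(2)[of "\<tau> s" "cj t" i i] by (simp add: cj_A[of s, symmetric] cj_mult \<tau>_def)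

lemma \<tau>_1: "\<tau> (mat 1) i = 1"
  unfolding \<tau>_def cj_1 by (simp add: mat_def)

lemma \<tau>_nz: "t \<in> A \<Longrightarrow> \<tau> t i \<noteq> 0"
  using \<tau>_mult[of t "matrix_inv t" i] A.inv_in[of t] matrix_inv_mult(1)[OF A.invertible_in, of t]
  by (auto simp: \<tau>_1)

lemma \<tau>_lin: "\<tau> (X + Y) i = \<tau> X i + \<tau> Y i" "\<tau> (smult_mat c X) i = c * \<tau> X i" "\<tau> 0 i = 0"
  "\<tau> (X - Y) i = \<tau> X i - \<tau> Y i"
  by (simp_all add: \<tau>_def cj_add cj_smult cj_diff) (simp add: smult_mat_def)

text \<open>The restriction of \<open>p\<close> to matrices diagonal in the basis \<open>P\<close>,
  as a polynomial in their diagonal entries.\<close>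

definition dpoly :: "('n \<times> 'n) mpoly \<Rightarrow> 'n mpoly"
  where "dpoly p = mpoly_eval Cst p (\<lambda>(i, j). \<Sum>l\<in>UNIV. Cst (P $ i $ l) * Var l * Cst (matrix_inv P $ l $ j))"

lemma mpoly_eval_dpoly:
  assumes "is_ring_hom \<iota>"
  shows "mpoly_eval \<iota> (dpoly p) y = mpoly_eval \<iota> p (entries (map_mat \<iota> P ** dg y ** map_mat \<iota> (matrix_inv P)))"
  unfolding dpoly_def mpoly_eval_subst[OF assms]
  by (rule arg_cong[of _ _ "mpoly_eval \<iota> p"])
     (auto simp: fun_eq_iff entries_def mpoly_eval_sum mpoly_eval_mult assms matrix_matrix_mult_def[of "_ ** _"] dg_mult)

text \<open>Group the monomials of an equation of \<open>A\<close> by the character they induce on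
  \<open>A\<close>. Independence of characters makes the coefficients in each group sum to 0, and by
  hypothesis all monomials of a group have the same exponential along \<open>d\<close>; hence the
  equation holds on the one-parameter group of \<open>d\<close>.\<close>

lemma ic_dg_in_a:
  assumes d: "\<And>m m'. (\<And>t. t \<in> A \<Longrightarrow> monom_eval (\<tau> t) m = monom_eval (\<tau> t) m') \<Longrightarrow>
    (\<Sum>l\<in>UNIV. of_nat (Poly_Mapping.lookup m l) * d l) = (\<Sum>l\<in>UNIV. of_nat (Poly_Mapping.lookup m' l) * d l)"
  shows "ic (dg d) \<in> \<aa>"
proof (rule fexp_in_imp_lie_algebra)
  fix p assume p: "p \<in> vanishing_ideal A"
  let ?K = "Poly_Mapping.keys (dpoly p)" and ?c = "Poly_Mapping.lookup (dpoly p)"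
  \<comment> \<open>The value 0 outside \<open>A\<close> makes equality on \<open>A\<close> the same
    as equality of functions, as \<open>characters_independent\<close> requires.\<close>
  define \<theta> where "\<theta> m t = (if t \<in> A then monom_eval (\<tau> t) m else 0)" for m t
  have van: "(\<Sum>m\<in>?K. ?c m * \<theta> m t) = 0" if t: "t \<in> A" for t
  proof -
    have "mpoly_eval id (dpoly p) (\<tau> t) = mpoly_eval id p (entries (ic (dg (\<tau> t))))"
      unfolding mpoly_eval_dpoly[OF is_ring_hom_intros(1)] by (simp add: ic_def)
    also have "ic (dg (\<tau> t)) = t" using cj_A[OF t] cj_ic by metis
    finally show ?thesis
      using p t by (simp add: vanishing_ideal_def \<theta>_def mpoly_eval_eq_pm_eval is_ring_hom_intros pm_eval_def)
  qed
  define C where "C \<phi> = (\<Sum>m\<in>{m\<in>?K. \<theta> m = \<phi>}. ?c m)" for \<phi>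
  have C0: "C \<phi> = 0" if "\<phi> \<in> \<theta> ` ?K" for \<phi>
  proof (rule characters_independent[where c = C and \<theta> = \<phi> and X = "\<theta> ` ?K" and S = A and op = "(**)" and e = "mat 1"])
    show "(\<Sum>\<psi>\<in>\<theta> ` ?K. C \<psi> * \<psi> t) = 0" if "t \<in> A" for t
    proof -
      have "(\<Sum>\<psi>\<in>\<theta> ` ?K. C \<psi> * \<psi> t) = (\<Sum>\<psi>\<in>\<theta> ` ?K. \<Sum>m\<in>{m\<in>?K. \<theta> m = \<psi>}. ?c m * \<theta> m t)"
        by (simp add: C_def sum_distrib_right)
      also have "\<dots> = (\<Sum>m\<in>?K. ?c m * \<theta> m t)" by (rule sum.image_gen[symmetric]) simp
      finally show ?thesis using van[OF that] by simp
    qed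
    show "\<phi> = \<psi>" if "\<phi> \<in> \<theta> ` ?K" "\<psi> \<in> \<theta> ` ?K" "\<And>s. s \<in> A \<Longrightarrow> \<phi> s = \<psi> s" for \<phi> \<psi>
      using that by (auto simp: \<theta>_def fun_eq_iff)
  qed (use that in \<open>auto simp: A.mul_in A.one_in \<theta>_def monom_eval_def \<tau>_1 \<tau>_mult power_mult_distrib prod.distrib\<close>)
  have mon: "monom_eval (\<lambda>l. fps_exp (d l)) m = fps_exp (\<Sum>l\<in>UNIV. of_nat (Poly_Mapping.lookup m l) * d l)" for m
  proof -
    have "monom_eval (\<lambda>l. fps_exp (d l)) m = (\<Prod>l\<in>UNIV. fps_exp (of_nat (Poly_Mapping.lookup m l) * d l))"
      by (subst monom_eval_superset[of UNIV]) (auto simp: fps_exp_power_mult)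
    also have "\<dots> = fps_exp (\<Sum>l\<in>S. of_nat (Poly_Mapping.lookup m l) * d l)" if "S = UNIV" for S
      unfolding that[symmetric] by (induction S rule: infinite_finite_induct) (auto simp: fps_exp_add_mult)
    finally show ?thesis by simp
  qed
  have fe: "fexp (ic (dg d)) = map_mat fps_const P ** dg (\<lambda>l. fps_exp (d l)) ** map_mat fps_const (matrix_inv P)"
    unfolding ic_def fexp_conj[OF matrix_inv_mult(2)[OF P(1)]] fexp_dg ..
  have "mpoly_eval fps_const p (entries (fexp (ic (dg d)))) = mpoly_eval fps_const (dpoly p) (\<lambda>l. fps_exp (d l))"
    unfolding fe mpoly_eval_dpoly[OF is_ring_hom_intros(3)] ..
  also have "\<dots> = (\<Sum>m\<in>?K. fps_const (?c m) * monom_eval (\<lambda>l. fps_exp (d l)) m)"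
    by (simp add: mpoly_eval_eq_pm_eval is_ring_hom_intros pm_eval_def)
  also have "\<dots> = (\<Sum>\<phi>\<in>\<theta> ` ?K. \<Sum>m\<in>{m\<in>?K. \<theta> m = \<phi>}. fps_const (?c m) * monom_eval (\<lambda>l. fps_exp (d l)) m)"
    by (rule sum.image_gen) simp
  also have "\<dots> = (\<Sum>\<phi>\<in>\<theta> ` ?K. 0)"
  proof (rule sum.cong[OF refl])
    fix \<phi> assume \<phi>: "\<phi> \<in> \<theta> ` ?K"
    then obtain m0 where m0: "\<phi> = \<theta> m0" by blast
    have "(\<Sum>m\<in>{m\<in>?K. \<theta> m = \<phi>}. fps_const (?c m) * monom_eval (\<lambda>l. fps_exp (d l)) m)
      = (\<Sum>m\<in>{m\<in>?K. \<theta> m = \<phi>}. fps_const (?c m) * monom_eval (\<lambda>l. fps_exp (d l)) m0)"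
    proof (rule sum.cong[OF refl])
      fix m assume "m \<in> {m\<in>?K. \<theta> m = \<phi>}"
      then have "\<theta> m = \<theta> m0" by (simp add: m0)
      then have "monom_eval (\<tau> t) m = monom_eval (\<tau> t) m0" if "t \<in> A" for t
        using that by (metis \<theta>_def)
      from d[OF this] show "fps_const (?c m) * monom_eval (\<lambda>l. fps_exp (d l)) m = fps_const (?c m) * monom_eval (\<lambda>l. fps_exp (d l)) m0"
        by (simp add: mon)
    qed
    also have "\<dots> = fps_const (C \<phi>) * monom_eval (\<lambda>l. fps_exp (d l)) m0"
      by (simp add: C_def is_ring_hom_sum[OF is_ring_hom_intros(3)] sum_distrib_right)
    finally show "(\<Sum>m\<in>{m\<in>?K. \<theta> m = \<phi>}. fps_const (?c m) * monom_eval (\<lambda>l. fps_exp (d l)) m) = 0"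
      using C0[OF \<phi>] by simp
  qed
  finally show "mpoly_eval fps_const p (entries (fexp (ic (dg d)))) = 0" by simp
qed

lemma poly_fun_\<tau>: "poly_fun (\<lambda>t. \<tau> t i)"
proof -
  have "poly_fun (\<lambda>t. \<Sum>k\<in>UNIV. (\<Sum>l\<in>UNIV. matrix_inv P $ i $ l * t $ l $ k) * P $ k $ i)"
    by (intro poly_fun_intros poly_fun_sum)
  then show ?thesis by (simp add: \<tau>_def cj_def matrix_matrix_mult_def)
qed

lemma openin_zariski_poly_fun:
  assumes "poly_fun f"
  shows "openin (zariski S) {t\<in>S. f t \<noteq> 0}"
proof -
  obtain p where p: "\<And>x. f x = mpoly_eval id p (entries x)" using assms by (auto simp: poly_fun_def)
  have "{t\<in>S. f t \<noteq> 0} \<in> {{g \<in> S. mpoly_eval id p (entries g) \<noteq> 0} |p. True}" unfolding p by blast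
  then show ?thesis unfolding zariski_def by (rule topology_generated_by_Basis)
qed

text \<open>Characters of a connected torus have no torsion: the cofactor \<open>?Q\<close> of
  \<open>\<tau> t i - \<tau> t j\<close> in the difference of \<open>k\<close>-th powers is nonzero
  exactly where the two eigenvalues agree, so this locus is open and closed.\<close>

lemma \<tau>_eq_of_power_eq:
  assumes k: "k > 0" and eq: "\<And>t. t \<in> A \<Longrightarrow> \<tau> t i ^ k = \<tau> t j ^ k" and t: "t \<in> A"
  shows "\<tau> t i = \<tau> t j"
proof -
  obtain n where n: "k = Suc n" using k by (cases k) auto
  let ?Q = "\<lambda>t. \<Sum>p<Suc n. \<tau> t i ^ p * \<tau> t j ^ (n - p)"
  have Q: "?Q t \<noteq> 0 \<longleftrightarrow> \<tau> t i = \<tau> t j" if "t \<in> A" for t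
  proof
    assume "?Q t \<noteq> 0"
    then show "\<tau> t i = \<tau> t j"
      using eq[OF that] diff_power_eq_sum[of "\<tau> t i" n "\<tau> t j"] by (simp add: n)
  next
    assume e: "\<tau> t i = \<tau> t j"
    have "?Q t = (\<Sum>p<Suc n. \<tau> t j ^ n)"
      unfolding e by (intro sum.cong refl) (simp add: power_add[symmetric])
    then show "?Q t \<noteq> 0" using \<tau>_nz[OF that] by (simp del: of_nat_Suc)
  qed
  let ?U = "{t\<in>A. ?Q t \<noteq> 0}" and ?V = "{t\<in>A. \<tau> t i + (-1) * \<tau> t j \<noteq> 0}"
  have op: "openin (zariski A) ?U" "openin (zariski A) ?V"
    by (intro openin_zariski_poly_fun poly_fun_sum poly_fun_intros poly_fun_power poly_fun_\<tau>)+
  have V: "?V = A - ?U" using Q by (auto simp: add_eq_0_iff)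
  have "connected_space (zariski A)"
    using mt by (simp add: maximal_torus_def algebraic_torus_def)
  moreover have "mat 1 \<in> ?U"
    by (intro CollectI conjI A.one_in iffD2[OF Q[OF A.one_in]]) (simp add: \<tau>_1)
  ultimately have "?V = {}"
    using op V unfolding connected_space_def topspace_zariski by blast
  then show ?thesis using V Q[OF t] t by blast
qed

text \<open>Distinct characters of the torus have distinct differentials. A rational functional that
  annihilates the multiplicative relations of \<open>A\<close>, but not the exponent vector of
  \<open>\<tau> t i / \<tau> t j\<close>, is a direction in \<open>\<aa>\<close> separating the
  two.\<close>

lemma weights_separate:
  assumes t: "t0 \<in> A" "\<tau> t0 i \<noteq> \<tau> t0 j"
  shows "\<exists>H\<in>\<aa>. \<tau> H i \<noteq> \<tau> H j"
proof -
  have ij: "i \<noteq> j" using t by auto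
  \<comment> \<open>Exponent vectors of trivial characters, up to a denominator \<open>k\<close>.
    Allowing denominators gives a rational subspace; they are removed again by
    \<open>\<tau>_eq_of_power_eq\<close>.\<close>
  define V :: "(rat ^ 'n) set" where "V = {v. \<exists>k>0. \<exists>m :: 'n \<Rightarrow> int. (\<forall>l. of_nat k * v $ l = of_int (m l)) \<and>
    (\<forall>t\<in>A. (\<Prod>l\<in>UNIV. \<tau> t l powi m l) = 1)}"
  have "vec.subspace V"
    unfolding vec.subspace_def
  proof (intro conjI ballI allI)
    show "0 \<in> V" unfolding V_def by (rule CollectI, rule exI[of _ 1]) (auto intro: exI[of _ "\<lambda>_. 0"])
  next
    fix v w assume "v \<in> V" "w \<in> V"
    then obtain k m k' m' where
      km: "k > 0" "\<And>l. of_nat k * v $ l = of_int (m l)" "\<And>t. t \<in> A \<Longrightarrow> (\<Prod>l\<in>UNIV. \<tau> t l powi m l) = 1"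
        "k' > 0" "\<And>l. of_nat k' * w $ l = of_int (m' l)" "\<And>t. t \<in> A \<Longrightarrow> (\<Prod>l\<in>UNIV. \<tau> t l powi m' l) = 1"
      unfolding V_def by blast
    have "(\<Prod>l\<in>UNIV. \<tau> t l powi (int k' * m l + int k * m' l)) = 1" if "t \<in> A" for t
    proof -
      have "(\<Prod>l\<in>UNIV. \<tau> t l powi (int k' * m l + int k * m' l))
        = (\<Prod>l\<in>UNIV. \<tau> t l powi m l) ^ k' * (\<Prod>l\<in>UNIV. \<tau> t l powi m' l) ^ k"
        by (simp add: power_int_add \<tau>_nz[OF that] prod.distrib mult.commute[of "int _"] power_int_mult prod_power_distrib)
      then show ?thesis using km that by simp
    qed
    moreover have "of_nat (k * k') * (v + w) $ l = of_int (int k' * m l + int k * m' l)" for l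
      using km(2)[of l] km(5)[of l] by (simp add: algebra_simps)
    ultimately show "v + w \<in> V"
      unfolding V_def using km(1,4) by (intro CollectI exI[of _ "k * k'"] exI[of _ "\<lambda>l. int k' * m l + int k * m' l"] conjI) auto
  next
    fix c :: rat and v assume "v \<in> V"
    then obtain k m where
      km: "k > 0" "\<And>l. of_nat k * v $ l = of_int (m l)" "\<And>t. t \<in> A \<Longrightarrow> (\<Prod>l\<in>UNIV. \<tau> t l powi m l) = 1"
      unfolding V_def by blast
    obtain a b where ab: "c = of_int a / of_int b" "b > 0"
      by (metis quotient_of_denom_pos quotient_of_div surj_pair)
    have "(\<Prod>l\<in>UNIV. \<tau> t l powi (m l * a)) = 1" if "t \<in> A" for t
      using km(3)[OF that] by (simp add: power_int_mult prod_powi[symmetric])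
    moreover have "of_nat (k * nat b) * (c *s v) $ l = of_int (m l * a)" for l
      using km(2)[of l] ab by (simp add: field_simps)
    ultimately show "c *s v \<in> V"
      unfolding V_def using km(1) ab(2) by (intro CollectI exI[of _ "k * nat b"] exI[of _ "\<lambda>l. m l * a"] conjI) auto
  qed
  define m0 :: "rat ^ 'n" where "m0 = axis i 1 - axis j 1"
  have "m0 \<notin> V"
  proof
    assume "m0 \<in> V"
    then obtain k m where
      km: "k > 0" "\<And>l. of_nat k * m0 $ l = of_int (m l)" "\<And>t. t \<in> A \<Longrightarrow> (\<Prod>l\<in>UNIV. \<tau> t l powi m l) = 1"
      unfolding V_def by blast
    have m: "m l = (if l = i then int k else if l = j then - int k else 0)" for l
    proof -
      have "(of_int (m l) :: rat) = of_int (if l = i then int k else if l = j then - int k else 0)"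
        using km(2)[of l] ij by (auto simp: m0_def axis_def split: if_splits)
      then show ?thesis by (simp only: of_int_eq_iff)
    qed
    have "\<tau> t i ^ k = \<tau> t j ^ k" if "t \<in> A" for t
    proof -
      have "1 = (\<Prod>l\<in>UNIV. \<tau> t l powi m l)" using km(3)[OF that] by simp
      also have "\<dots> = (\<Prod>l\<in>{i, j}. \<tau> t l powi m l)"
        by (rule prod.mono_neutral_right) (auto simp: m)
      also have "\<dots> = \<tau> t i ^ k * inverse (\<tau> t j ^ k)"
        using ij by (auto simp: m power_int_minus)
      finally show ?thesis using \<tau>_nz[OF that, of j] by (simp add: field_simps)
    qed
    then show False using \<tau>_eq_of_power_eq[OF km(1) _ t(1)] t(2) by blast
  qed
  obtain B where B: "vec.independent B" "vec.span B = V"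
    using vec.basis_subspace_exists[OF \<open>vec.subspace V\<close>] by metis
  have "vec.independent (insert m0 B)"
    using B \<open>m0 \<notin> V\<close> by (simp add: vec.independent_insert)
  \<comment> \<open>The \<open>i\<close>-th coordinate of \<open>g\<close> is the required
    functional: it vanishes on \<open>V\<close> and takes the value 1 at \<open>m0\<close>.\<close>
  then obtain g where g: "Vector_Spaces.linear (*s) (*s) g" "\<And>x. x \<in> insert m0 B \<Longrightarrow> g x = (if x = m0 then m0 else 0)"
    using vec.linear_independent_extend[of "insert m0 B" "\<lambda>x. if x = m0 then m0 else 0"] by blast
  have gV: "g v = 0" if "v \<in> V" for v
  proof (rule vec.linear_eq_0_on_span[OF g(1), of B])
    fix x assume "x \<in> B"
    then have "x \<noteq> m0" using \<open>m0 \<notin> V\<close> B(2) vec.span_base by blast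
    then show "g x = 0" using g(2) \<open>x \<in> B\<close> by simp
  qed (use that B in simp)
  have gx: "g x $ i = (\<Sum>l\<in>UNIV. x $ l * g (axis l 1) $ i)" for x
  proof -
    have "g x = g (\<Sum>l\<in>UNIV. x $ l *s axis l 1)" by (simp add: basis_expansion)
    also have "\<dots> = (\<Sum>l\<in>UNIV. x $ l *s g (axis l 1))"
      using g(1) by (simp add: vec.linear_sum vec.linear_scale)
    finally show ?thesis by simp
  qed
  define d :: "'n \<Rightarrow> complex" where "d l = of_rat (g (axis l 1) $ i)" for l
  have "ic (dg d) \<in> \<aa>"
  proof (rule ic_dg_in_a)
    fix m m' :: "'n \<Rightarrow>\<^sub>0 nat"
    assume eq: "\<And>t. t \<in> A \<Longrightarrow> monom_eval (\<tau> t) m = monom_eval (\<tau> t) m'"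
    let ?v = "(\<chi> l. of_nat (Poly_Mapping.lookup m l) - of_nat (Poly_Mapping.lookup m' l)) :: rat ^ 'n"
    have "?v \<in> V"
      unfolding V_def
    proof (intro CollectI exI[of _ "1::nat"] exI[of _ "\<lambda>l. int (Poly_Mapping.lookup m l) - int (Poly_Mapping.lookup m' l)"] conjI ballI allI)
      fix t assume "t \<in> A"
      have "(\<Prod>l\<in>UNIV. \<tau> t l powi (int (Poly_Mapping.lookup m l) - int (Poly_Mapping.lookup m' l)))
        = monom_eval (\<tau> t) m / monom_eval (\<tau> t) m'"
        by (simp add: power_int_diff \<tau>_nz[OF \<open>t \<in> A\<close>] prod_dividef monom_eval_superset[of UNIV])
      also have "\<dots> = 1"
        using eq[OF \<open>t \<in> A\<close>] by (simp add: monom_eval_def \<tau>_nz[OF \<open>t \<in> A\<close>])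
      finally show "(\<Prod>l\<in>UNIV. \<tau> t l powi (int (Poly_Mapping.lookup m l) - int (Poly_Mapping.lookup m' l))) = 1" .
    qed auto
    then have "(\<Sum>l\<in>UNIV. ?v $ l * g (axis l 1) $ i) = 0" using gV gx by (metis zero_index)
    then have "of_rat (\<Sum>l\<in>UNIV. ?v $ l * g (axis l 1) $ i) = (0 :: complex)" by (simp only: of_rat_0)
    then show "(\<Sum>l\<in>UNIV. of_nat (Poly_Mapping.lookup m l) * d l) = (\<Sum>l\<in>UNIV. of_nat (Poly_Mapping.lookup m' l) * d l)"
      by (simp add: of_rat_sum of_rat_mult of_rat_diff d_def algebra_simps sum_subtractf)
  qed
  moreover have "\<tau> (ic (dg d)) i \<noteq> \<tau> (ic (dg d)) j"
  proof -
    have "g m0 $ i = 1" using g(2)[of m0] ij by (simp add: m0_def axis_def)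
    moreover have "g m0 = g (axis i 1) - g (axis j 1)"
      unfolding m0_def using g(1) by (rule vec.linear_diff)
    ultimately have "g (axis i 1) $ i \<noteq> g (axis j 1) $ i" by auto
    then show ?thesis by (simp add: \<tau>_def) (simp add: dg_def d_def)
  qed
  ultimately show ?thesis by blast
qed

end

text \<open>Starting from a point \<open>x\<close> that avoids the earlier hyperplanes, move along a
  \<open>y\<close> off the new one; each hyperplane excludes at most one value of the parameter
  \<open>c\<close>. The operations are parameters because \<open>V\<close> is only a set closed
  under them, with \<open>smult_mat\<close> as scalar action.\<close>

lemma hyperplanes_avoid:
  fixes V :: "'v set" and f :: "'i \<Rightarrow> 'v \<Rightarrow> complex" and add :: "'v \<Rightarrow> 'v \<Rightarrow> 'v" and sc :: "complex \<Rightarrow> 'v \<Rightarrow> 'v"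
  assumes "finite I" "V \<noteq> {}" "\<And>x y. x \<in> V \<Longrightarrow> y \<in> V \<Longrightarrow> add x y \<in> V" "\<And>c x. x \<in> V \<Longrightarrow> sc c x \<in> V"
    and "\<And>i x y. i \<in> I \<Longrightarrow> x \<in> V \<Longrightarrow> y \<in> V \<Longrightarrow> f i (add x y) = f i x + f i y"
    and "\<And>i c x. i \<in> I \<Longrightarrow> x \<in> V \<Longrightarrow> f i (sc c x) = c * f i x"
    and "\<And>i. i \<in> I \<Longrightarrow> \<exists>x\<in>V. f i x \<noteq> 0"
  shows "\<exists>x\<in>V. \<forall>i\<in>I. f i x \<noteq> 0"
  using assms
proof (induction I rule: finite_induct)
  case (insert j I)
  have "\<exists>x\<in>V. \<forall>i\<in>I. f i x \<noteq> 0"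
    by (rule insert.IH) (use insert.prems in auto)
  then obtain x where x: "x \<in> V" "\<And>i. i \<in> I \<Longrightarrow> f i x \<noteq> 0" by blast
  obtain y where y: "y \<in> V" "f j y \<noteq> 0" using insert.prems(6) by auto
  define c0 where "c0 = - f j x / f j y"
  have "finite (((\<lambda>i. - f i x / f i y) ` I) \<union> {c0})" using insert.hyps by simp
  then obtain c where c: "c \<notin> ((\<lambda>i. - f i x / f i y) ` I) \<union> {c0}"
    using ex_new_if_finite[OF infinite_UNIV_char_0] by blast
  have "f i (add x (sc c y)) \<noteq> 0" if "i \<in> insert j I" for i
  proof
    assume "f i (add x (sc c y)) = 0"
    then have e: "f i x + c * f i y = 0"
      using insert.prems(4)[OF that x(1) insert.prems(3)[OF y(1), of c]] insert.prems(5)[OF that y(1)] by simp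
    have "f i y \<noteq> 0" using e x(2) y(2) that by (cases "i = j") auto
    then have "c = - f i x / f i y" using e by (simp add: field_simps eq_neg_iff_add_eq_0)
    then show False using c that by (auto simp: c0_def)
  qed
  then show ?case using insert.prems(2)[OF x(1) insert.prems(3)[OF y(1)]] by blast
qed auto

section \<open>Weight components of the Lie algebra and maximality of the torus\<close>

context cartan
begin

text \<open>Like the linear forms in \<open>dual_space\<close>, weights are extended by zero outside \<open>\<aa>\<close>, so that differences
  of weights and roots can be compared as functions.\<close>

definition wt :: "'n \<Rightarrow> 'n cmat \<Rightarrow> complex"
  where "wt i H = (if H \<in> \<aa> then \<tau> H i else 0)"

definition proj_wt :: "('n cmat \<Rightarrow> complex) \<Rightarrow> 'n cmat \<Rightarrow> 'n cmat"
  where "proj_wt \<alpha> X = ic (\<chi> i j. if wt i - wt j = \<alpha> then cj X $ i $ j else 0)"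

lemma cj_proj_wt: "cj (proj_wt \<alpha> X) $ i $ j = (if wt i - wt j = \<alpha> then cj X $ i $ j else 0)"
  by (simp add: proj_wt_def)

lemma cj_eqI: "(\<And>i j. cj X $ i $ j = cj Y $ i $ j) \<Longrightarrow> X = Y"
  using cj_inj[of X Y] by (simp add: vec_eq_iff)

lemma cj_lin_nth:
  "cj (X + Y) $ i $ j = cj X $ i $ j + cj Y $ i $ j" "cj (X - Y) $ i $ j = cj X $ i $ j - cj Y $ i $ j"
  "cj (smult_mat c X) $ i $ j = c * cj X $ i $ j" "cj 0 $ i $ j = 0"
  "cj (sum f S) $ i $ j = (\<Sum>k\<in>S. cj (f k) $ i $ j)"
  by (simp_all add: cj_add cj_diff cj_smult cj_sum) (simp add: smult_mat_def)

lemma proj_wt_linear: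
  "proj_wt \<alpha> (X + Y) = proj_wt \<alpha> X + proj_wt \<alpha> Y" "proj_wt \<alpha> (smult_mat c X) = smult_mat c (proj_wt \<alpha> X)"
  "proj_wt \<alpha> 0 = 0"
  by (rule cj_eqI; simp add: cj_proj_wt cj_lin_nth)+

lemma proj_wt_sum: "proj_wt \<alpha> (sum f S) = (\<Sum>k\<in>S. proj_wt \<alpha> (f k))"
  by (rule cj_eqI) (simp add: cj_proj_wt cj_lin_nth)

lemma bracket_a: "H \<in> \<aa> \<Longrightarrow> cj (lie_bracket H X) $ i $ j = (wt i - wt j) H * cj X $ i $ j"
  unfolding cj_bracket by (simp add: lie_bracket_def cj_a dg_mult wt_def algebra_simps)

definition wts :: "('n cmat \<Rightarrow> complex) set"
  where "wts = (\<lambda>(i, j). wt i - wt j) ` UNIV"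

lemma finite_wts: "finite wts" by (simp add: wts_def)

lemma zero_in_wts: "0 \<in> wts"
  unfolding wts_def by (rule image_eqI[of _ _ "(undefined, undefined)"]) auto

lemma sum_proj_wt: "(\<Sum>\<alpha>\<in>wts. proj_wt \<alpha> X) = X"
proof (rule cj_eqI)
  fix i j
  have "wt i - wt j \<in> wts" unfolding wts_def by (rule image_eqI[of _ _ "(i, j)"]) auto
  then show "cj (\<Sum>\<alpha>\<in>wts. proj_wt \<alpha> X) $ i $ j = cj X $ i $ j"
    by (simp add: cj_lin_nth cj_proj_wt sum.delta' finite_wts)
qed

lemma a_closed: "0 \<in> \<aa>" "H \<in> \<aa> \<Longrightarrow> H' \<in> \<aa> \<Longrightarrow> H + H' \<in> \<aa>" "H \<in> \<aa> \<Longrightarrow> smult_mat c H \<in> \<aa>"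
  by (auto simp: lie_algebra_0 lie_algebra_add lie_algebra_smult)

lemma wt_dual: "\<alpha> \<in> wts \<Longrightarrow> \<alpha> \<in> dual_space \<aa>"
  unfolding wts_def dual_space_def
  by (auto simp: wt_def a_closed \<tau>_lin algebra_simps)

lemma dual_spaceD:
  "\<alpha> \<in> dual_space V \<Longrightarrow> X \<in> V \<Longrightarrow> Y \<in> V \<Longrightarrow> \<alpha> (X + Y) = \<alpha> X + \<alpha> Y"
  "\<alpha> \<in> dual_space V \<Longrightarrow> X \<in> V \<Longrightarrow> \<alpha> (smult_mat c X) = c * \<alpha> X"
  "\<alpha> \<in> dual_space V \<Longrightarrow> X \<notin> V \<Longrightarrow> \<alpha> X = 0"
  by (auto simp: dual_space_def)

lemma separating_element: "\<exists>H\<in>\<aa>. \<forall>\<alpha>\<in>wts. \<forall>\<beta>\<in>wts. \<alpha> \<noteq> \<beta> \<longrightarrow> \<alpha> H \<noteq> \<beta> H"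
proof -
  let ?I = "{(\<alpha>, \<beta>) \<in> wts \<times> wts. \<alpha> \<noteq> \<beta>}"
  have "\<exists>H\<in>\<aa>. \<forall>p\<in>?I. (\<lambda>p H. fst p H - snd p H) p H \<noteq> 0"
  proof (rule hyperplanes_avoid[where add = "(+)" and sc = smult_mat])
    show "finite ?I" by (rule finite_subset[OF _ finite_cartesian_product[OF finite_wts finite_wts]]) auto
    show "\<exists>x\<in>\<aa>. fst i x - snd i x \<noteq> 0" if i: "i \<in> ?I" for i
    proof (rule ccontr)
      assume "\<not> (\<exists>x\<in>\<aa>. fst i x - snd i x \<noteq> 0)"
      moreover have "fst i x = snd i x" if "x \<notin> \<aa>" for x
        using i dual_spaceD(3)[OF wt_dual[of "fst i"] that] dual_spaceD(3)[OF wt_dual[of "snd i"] that]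
        by (auto simp: split_def)
      ultimately have "fst i = snd i" by (auto simp: fun_eq_iff)
      then show False using i by auto
    qed
  qed (use a_closed in \<open>auto simp: dual_spaceD(1,2)[OF wt_dual] algebra_simps\<close>)
  then show ?thesis by fastforce
qed

text \<open>For an \<open>H\<close> separating the weights, the projection is a Lagrange
  interpolation polynomial in the operator \<open>lie_bracket H\<close>, which preserves
  \<open>\<gg>\<close>.\<close>

lemma proj_wt_in_g:
  assumes "X \<in> \<gg>"
  shows "proj_wt \<alpha> X \<in> \<gg>"
proof (cases "\<alpha> \<in> wts")
  case False
  then have "wt i - wt j \<noteq> \<alpha>" for i j unfolding wts_def by auto
  then have "proj_wt \<alpha> X = 0" by (intro cj_eqI) (simp add: cj_proj_wt)
  then show ?thesis by (simp add: lie_algebra_0)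
next
  case True
  obtain H where H: "H \<in> \<aa>" "\<And>\<alpha> \<beta>. \<alpha> \<in> wts \<Longrightarrow> \<beta> \<in> wts \<Longrightarrow> \<alpha> \<noteq> \<beta> \<Longrightarrow> \<alpha> H \<noteq> \<beta> H"
    using separating_element by blast
  have "finite S \<Longrightarrow> S \<subseteq> wts - {\<alpha>} \<Longrightarrow> \<exists>Y\<in>\<gg>. \<forall>i j. cj Y $ i $ j =
    (\<Prod>\<beta>\<in>S. ((wt i - wt j) H - \<beta> H) / (\<alpha> H - \<beta> H)) * cj X $ i $ j" for S
  proof (induction S rule: finite_induct)
    case empty
    then show ?case using assms by (intro bexI[of _ X]) auto
  next
    case (insert \<beta> S)
    then obtain Y where Y: "Y \<in> \<gg>" "\<And>i j. cj Y $ i $ j =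
      (\<Prod>\<beta>\<in>S. ((wt i - wt j) H - \<beta> H) / (\<alpha> H - \<beta> H)) * cj X $ i $ j" by auto
    let ?Y = "smult_mat (1 / (\<alpha> H - \<beta> H)) (lie_bracket H Y - smult_mat (\<beta> H) Y)"
    have "?Y \<in> \<gg>"
      using Y(1) H(1) a_sub by (intro lie_algebra_smult lie_algebra_diff lie_algebra_bracket) auto
    moreover have "cj ?Y $ i $ j = (\<Prod>\<beta>\<in>insert \<beta> S. ((wt i - wt j) H - \<beta> H) / (\<alpha> H - \<beta> H)) * cj X $ i $ j" for i j
    proof -
      have "cj ?Y $ i $ j = ((wt i - wt j) H - \<beta> H) / (\<alpha> H - \<beta> H) * cj Y $ i $ j"
        unfolding cj_lin_nth bracket_a[OF H(1)] by (simp add: algebra_simps diff_divide_distrib add_divide_distrib)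
      then show ?thesis unfolding Y(2) using insert.hyps by (simp add: mult.assoc)
    qed
    ultimately show ?case by blast
  qed
  from this[of "wts - {\<alpha>}"] finite_wts obtain Y where Y: "Y \<in> \<gg>" "\<And>i j. cj Y $ i $ j =
    (\<Prod>\<beta>\<in>wts - {\<alpha>}. ((wt i - wt j) H - \<beta> H) / (\<alpha> H - \<beta> H)) * cj X $ i $ j" by auto
  have "Y = proj_wt \<alpha> X"
  proof (rule cj_eqI)
    fix i j
    have ij: "wt i - wt j \<in> wts" unfolding wts_def by (rule image_eqI[of _ _ "(i, j)"]) auto
    show "cj Y $ i $ j = cj (proj_wt \<alpha> X) $ i $ j"
    proof (cases "wt i - wt j = \<alpha>")
      case True
      have "(\<Prod>\<beta>\<in>wts - {\<alpha>}. ((wt i - wt j) H - \<beta> H) / (\<alpha> H - \<beta> H)) = (\<Prod>\<beta>\<in>wts - {\<alpha>}. 1)"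
        using H(2)[OF \<open>\<alpha> \<in> wts\<close>] by (intro prod.cong refl) (auto simp: True)
      then show ?thesis unfolding Y(2) cj_proj_wt using True by simp
    next
      case False
      then have "(\<Prod>\<beta>\<in>wts - {\<alpha>}. ((wt i - wt j) H - \<beta> H) / (\<alpha> H - \<beta> H)) = 0"
        using ij finite_wts by (intro prod_zero) (auto intro!: bexI[of _ "wt i - wt j"])
      then show ?thesis unfolding Y(2) cj_proj_wt using False by simp
    qed
  qed
  then show ?thesis using Y(1) by simp
qed

lemma weight_space_iff:
  assumes "\<alpha> \<in> dual_space \<aa>"
  shows "(\<forall>H\<in>\<aa>. lie_bracket H X = smult_mat (\<alpha> H) X) \<longleftrightarrow> (\<forall>i j. wt i - wt j \<noteq> \<alpha> \<longrightarrow> cj X $ i $ j = 0)"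
proof
  assume *: "\<forall>H\<in>\<aa>. lie_bracket H X = smult_mat (\<alpha> H) X"
  show "\<forall>i j. wt i - wt j \<noteq> \<alpha> \<longrightarrow> cj X $ i $ j = 0"
  proof (intro allI impI)
    fix i j assume "wt i - wt j \<noteq> \<alpha>"
    then obtain H where "(wt i - wt j) H \<noteq> \<alpha> H" by (auto simp: fun_eq_iff)
    moreover from this have "H \<in> \<aa>" by (rule contrapos_np) (simp add: wt_def dual_spaceD(3)[OF assms])
    moreover have "(wt i - wt j) H * cj X $ i $ j = \<alpha> H * cj X $ i $ j" if "H \<in> \<aa>" for H
      using bracket_a[OF that, of X i j] unfolding bspec[OF * that] cj_lin_nth by (rule sym)
    ultimately show "cj X $ i $ j = 0" by auto
  qed
next
  assume *: "\<forall>i j. wt i - wt j \<noteq> \<alpha> \<longrightarrow> cj X $ i $ j = 0"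
  show "\<forall>H\<in>\<aa>. lie_bracket H X = smult_mat (\<alpha> H) X"
  proof
    fix H assume H: "H \<in> \<aa>"
    show "lie_bracket H X = smult_mat (\<alpha> H) X"
    proof (rule cj_eqI)
      fix i j show "cj (lie_bracket H X) $ i $ j = cj (smult_mat (\<alpha> H) X) $ i $ j"
        unfolding bracket_a[OF H] cj_lin_nth using * by (cases "wt i - wt j = \<alpha>") auto
    qed
  qed
qed

lemma root_space_iff:
  "\<alpha> \<in> dual_space \<aa> \<Longrightarrow> X \<in> root_space G A \<alpha> \<longleftrightarrow> X \<in> \<gg> \<and> (\<forall>i j. wt i - wt j \<noteq> \<alpha> \<longrightarrow> cj X $ i $ j = 0)"
  by (simp add: root_space_def weight_space_iff)

text \<open>\<open>FW \<mu>\<close> is the projection onto the \<open>\<mu>\<close>-weight space of \<open>A\<close>, and a matrix has weight \<open>0\<close> iff it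
  commutes with all of them.\<close>

definition FW :: "('n cmat \<Rightarrow> complex) \<Rightarrow> 'n cmat"
  where "FW \<mu> = ic (dg (\<lambda>i. if wt i = \<mu> then 1 else 0))"

lemma FW_orth:
  "finite (range wt)" "(\<Sum>\<mu>\<in>range wt. FW \<mu>) = mat 1"
  "FW \<mu> ** FW \<nu> = (if \<mu> = \<nu> then FW \<mu> else 0)"
proof -
  show "(\<Sum>\<mu>\<in>range wt. FW \<mu>) = mat 1"
    by (rule cj_eqI) (simp add: cj_sum cj_1 FW_def, simp add: dg_def mat_def sum.delta)
  show "FW \<mu> ** FW \<nu> = (if \<mu> = \<nu> then FW \<mu> else 0)"
    by (rule cj_eqI) (simp add: cj_mult FW_def dg_mult, simp add: dg_def)
qed simp

lemma FW_commute:
  assumes "\<And>i j. wt i \<noteq> wt j \<Longrightarrow> cj X $ i $ j = 0"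
  shows "FW \<mu> ** X = X ** FW \<mu>"
  by (rule cj_eqI) (use assms in \<open>auto simp: cj_mult FW_def dg_mult\<close>)

text \<open>By \<open>weights_separate\<close> the eigenvalue of \<open>t\<close> on a basis vector
  depends only on the differential \<open>wt i\<close>.\<close>

lemma A_eq_sum_FW:
  assumes "t \<in> A"
  shows "\<exists>c. t = (\<Sum>\<mu>\<in>range wt. smult_mat (c \<mu>) (FW \<mu>))"
proof -
  have sep: "\<tau> t i = \<tau> t j" if "wt i = wt j" for i j
  proof (rule ccontr)
    assume "\<tau> t i \<noteq> \<tau> t j"
    then obtain H where "H \<in> \<aa>" "\<tau> H i \<noteq> \<tau> H j" using weights_separate[OF assms] by blast
    then show False using fun_cong[OF that, of H] by (simp add: wt_def)
  qed
  define c where "c \<mu> = \<tau> t (SOME i. wt i = \<mu>)" for \<mu>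
  have c: "c (wt i) = \<tau> t i" for i
    unfolding c_def by (rule sep) (rule someI[of "\<lambda>j. wt j = wt i" i], simp)
  have "t = (\<Sum>\<mu>\<in>range wt. smult_mat (c \<mu>) (FW \<mu>))"
  proof (rule cj_eqI)
    fix i j
    have "cj (\<Sum>\<mu>\<in>range wt. smult_mat (c \<mu>) (FW \<mu>)) $ i $ j = (\<Sum>\<mu>\<in>range wt. if \<mu> = wt i \<and> i = j then c \<mu> else 0)"
      unfolding cj_lin_nth by (rule sum.cong) (auto simp: FW_def dg_def)
    also have "\<dots> = (if i = j then c (wt i) else 0)" by (simp add: sum.delta)
    finally show "cj t $ i $ j = cj (\<Sum>\<mu>\<in>range wt. smult_mat (c \<mu>) (FW \<mu>)) $ i $ j"
      by (simp add: c cj_A[OF assms]) (simp add: dg_def)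
  qed
  then show ?thesis by blast
qed

text \<open>\<open>A\<close> and the one-parameter group of the semisimple part generate a connected
  group that is diagonal in a common basis. Its closure is a torus inside \<open>G\<close>
  containing \<open>A\<close>, hence equal to \<open>A\<close> by maximality.\<close>

lemma semisimple_part_in_a:
  assumes X: "X \<in> \<gg>" "\<And>i j. wt i \<noteq> wt j \<Longrightarrow> cj X $ i $ j = 0" and sp: "spectral X Z E"
  shows "(\<Sum>z\<in>Z. smult_mat z (E z)) \<in> \<aa>"
proof -
  let ?S = "\<Sum>z\<in>Z. smult_mat z (E z)"
  have S: "?S \<in> \<gg>" by (rule replica_in_lie_algebra[OF X(1) sp]) simp
  have FE: "FW \<mu> ** E z = E z ** FW \<mu>" if "z \<in> Z" for z \<mu>
    by (rule spectral_commute[OF sp that FW_commute]) (rule X(2))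
  note o = spectral_orth[OF sp]
  \<comment> \<open>The common refinement of the eigenspaces of \<open>X\<close> and the weight
    spaces of \<open>A\<close>, which exists because the two families of projections
    commute.\<close>
  let ?I = "Z \<times> range wt" and ?EF = "\<lambda>(z, \<mu>). E z ** FW \<mu>"
  have "(\<Sum>i\<in>?I. ?EF i) = (\<Sum>z\<in>Z. E z ** (\<Sum>\<mu>\<in>range wt. FW \<mu>))"
    by (simp add: matrix_mult_sum_right sum.cartesian_product)
  then have sum1: "(\<Sum>i\<in>?I. ?EF i) = mat 1" unfolding FW_orth by (simp add: o)
  have orth: "?EF i ** ?EF j = (if i = j then ?EF i else 0)" if ij: "i \<in> ?I" "j \<in> ?I" for i j
  proof -
    obtain z \<mu> w \<nu> where e: "i = (z, \<mu>)" "j = (w, \<nu>)" by (metis surj_pair)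
    have zw: "z \<in> Z" "w \<in> Z" using ij e by auto
    have "E z ** FW \<mu> ** (E w ** FW \<nu>) = E z ** (FW \<mu> ** E w) ** FW \<nu>" by (simp add: matrix_mul_assoc)
    also have "\<dots> = (E z ** E w) ** (FW \<mu> ** FW \<nu>)" unfolding FE[OF zw(2)] by (simp add: matrix_mul_assoc)
    finally show ?thesis by (auto simp: e o(3)[OF zw] FW_orth)
  qed
  have fin: "finite ?I" using o(1) by simp
  obtain Q and cc :: "'n \<Rightarrow> complex \<times> ('n cmat \<Rightarrow> complex)" where Q: "invertible Q"
    "\<And>i. i \<in> ?I \<Longrightarrow> matrix_inv Q ** ?EF i ** Q = (\<chi> a b. if a = b \<and> cc a = i then 1 else 0)"
    using simultaneous_diagonalization[OF fin sum1 orth] by blast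
  define D where "D M \<longleftrightarrow> (\<forall>i j. i \<noteq> j \<longrightarrow> (matrix_inv Q ** M ** Q) $ i $ j = 0)" for M
  have D_sum: "D (\<Sum>k\<in>K. smult_mat (c k) (M k))" if "\<And>k. k \<in> K \<Longrightarrow> D (M k)" for K c and M :: "'k \<Rightarrow> 'n cmat"
  proof -
    have "(matrix_inv Q ** (\<Sum>k\<in>K. smult_mat (c k) (M k)) ** Q) $ i $ j = (\<Sum>k\<in>K. c k * (matrix_inv Q ** M k ** Q) $ i $ j)" for i j
      by (simp add: matrix_mult_sum_left matrix_mult_sum_right smult_mat_mult) (simp add: smult_mat_def)
    then show ?thesis using that by (simp add: D_def)
  qed
  have D_EF: "D (E z ** FW \<mu>)" if "z \<in> Z" "\<mu> \<in> range wt" for z \<mu>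
    using Q(2)[of "(z, \<mu>)"] that by (simp add: D_def)
  have D_E: "D (E z)" if "z \<in> Z" for z
  proof -
    have "E z = (\<Sum>\<mu>\<in>range wt. smult_mat 1 (E z ** FW \<mu>))"
      using FW_orth(2) by (simp add: matrix_mult_sum_right[symmetric] mat_mult(1)[symmetric])
    then show ?thesis using D_sum[of "range wt" "\<lambda>\<mu>. E z ** FW \<mu>" "\<lambda>_. 1"] D_EF that by metis
  qed
  have D_F: "D (FW \<mu>)" if "\<mu> \<in> range wt" for \<mu>
  proof -
    have "FW \<mu> = (\<Sum>z\<in>Z. smult_mat 1 (E z ** FW \<mu>))"
      using o(2) by (simp add: matrix_mult_sum_left[symmetric] mat_mult(1)[symmetric])
    then show ?thesis using D_sum[of Z "\<lambda>z. E z ** FW \<mu>" "\<lambda>_. 1"] D_EF that by metis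
  qed
  have D_mult: "D (M ** M')" if "D M" "D M'" for M M'
  proof -
    have "matrix_inv Q ** (M ** M') ** Q = (matrix_inv Q ** M ** Q) ** (matrix_inv Q ** M' ** Q)"
      using matrix_inv_mult(1)[OF Q(1)] by (simp add: matrix_mul_assoc mat_cancel)
    moreover have V: "matrix_inv Q ** M' ** Q = dg (\<lambda>i. (matrix_inv Q ** M' ** Q) $ i $ i)"
      using that(2) by (intro dg_eqI) (auto simp: D_def)
    have "((matrix_inv Q ** M ** Q) ** (matrix_inv Q ** M' ** Q)) $ i $ j = (matrix_inv Q ** M ** Q) $ i $ j * (matrix_inv Q ** M' ** Q) $ j $ j" for i j
      using arg_cong[OF V, of "\<lambda>W. ((matrix_inv Q ** M ** Q) ** W) $ i $ j"] by (simp only: dg_mult)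
    ultimately have "(matrix_inv Q ** (M ** M') ** Q) $ i $ j = (matrix_inv Q ** M ** Q) $ i $ j * (matrix_inv Q ** M' ** Q) $ j $ j" for i j
      by simp
    then show ?thesis using that(1) by (simp add: D_def)
  qed
  have D_A: "D t" if "t \<in> A" for t
  proof -
    obtain c where "t = (\<Sum>\<mu>\<in>range wt. smult_mat (c \<mu>) (FW \<mu>))" using A_eq_sum_FW[OF \<open>t \<in> A\<close>] by blast
    then show ?thesis using D_sum[OF D_F, of "range wt" "\<lambda>x. x" c] by simp
  qed
  have mexp_S: "mexp s ?S = (\<Sum>z\<in>Z. smult_mat (exp (z * s)) (E z))" for s
  proof -
    have fe: "fexp ?S $ i $ j = (\<Sum>z\<in>Z. fps_const (E z $ i $ j) * fps_exp z)" for i j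
      by (rule fps_ext) (simp add: fexp_def matpow_spectral_sum[OF sp] fps_sum_nth,
          simp add: smult_mat_def sum_divide_distrib mult.commute)
    have "mexp s ?S $ i $ j = (\<Sum>z\<in>Z. E z $ i $ j * exp (z * s))" for i j
    proof -
      have e: "entire (fps_exp z)" for z :: complex by (simp add: entire_def)
      have "eval_fps (\<Sum>z\<in>Z. fps_const (E z $ i $ j) * fps_exp z) s = (\<Sum>z\<in>Z. E z $ i $ j * exp (z * s))"
        by (subst entire_eval_sum) (auto intro: entire_intros e simp: entire_eval(2)[OF entire_intros(1) e])
      then show ?thesis by (simp add: mexp_def fe)
    qed
    then show ?thesis by (simp add: vec_eq_iff smult_mat_def mult.commute)
  qed
  have D_mexp: "D (mexp s ?S)" for s
    unfolding mexp_S by (rule D_sum) (rule D_E)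
  have FS: "FW \<mu> ** ?S = ?S ** FW \<mu>" for \<mu>
    using FE by (simp add: matrix_mult_sum_left matrix_mult_sum_right smult_mat_mult)
  have comm: "t ** mexp s ?S = mexp s ?S ** t" if "t \<in> A" for t s
  proof -
    obtain c where "t = (\<Sum>\<mu>\<in>range wt. smult_mat (c \<mu>) (FW \<mu>))" using A_eq_sum_FW[OF \<open>t \<in> A\<close>] by blast
    moreover have "FW \<mu> ** mexp s ?S = mexp s ?S ** FW \<mu>" for \<mu>
      unfolding mexp_S using FE by (simp add: matrix_mult_sum_left matrix_mult_sum_right smult_mat_mult)
    ultimately show ?thesis by (simp add: matrix_mult_sum_left matrix_mult_sum_right smult_mat_mult)
  qed
  define B where "B = (\<lambda>(t, s). t ** mexp s ?S) ` (A \<times> UNIV)"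
  have mexp_plus: "mexp s ?S ** mexp u ?S = mexp (s + u) ?S" for s u
    unfolding mexp_S matrix_mult_sum_right[of "\<Sum>z\<in>Z. smult_mat (exp (z * s)) (E z)"] smult_mat_mult(1)
    by (rule sum.cong[OF refl]) (simp add: spectral_sum_mult[OF sp] smult_smult_mat exp_add[symmetric] algebra_simps)
  have B: "matrix_monoid B"
  proof
    show "mat 1 \<in> B" unfolding B_def
      by (rule image_eqI[of _ _ "(mat 1, 0)"]) (auto simp: mexp_at_0 A.one_in)
    show "invertible g" if "g \<in> B" for g
      using that by (auto simp: B_def intro: invertible_mul[OF A.invertible_in invertible_mexp])
  next
    fix g h assume "g \<in> B" "h \<in> B"
    then obtain t s u v where e: "t \<in> A" "g = t ** mexp s ?S" "u \<in> A" "h = u ** mexp v ?S" by (auto simp: B_def)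
    have "g ** h = t ** (mexp s ?S ** u) ** mexp v ?S" by (simp add: e matrix_mul_assoc)
    also have "\<dots> = (t ** u) ** mexp (s + v) ?S"
      unfolding comm[OF e(3), symmetric] mexp_plus[symmetric] by (simp add: matrix_mul_assoc)
    finally show "g ** h \<in> B" using A.mul_in[OF e(1,3)] by (auto simp: B_def)
  next
    fix g assume "g \<in> B"
    then obtain t s where e: "t \<in> A" "g = t ** mexp s ?S" by (auto simp: B_def)
    have "matrix_inv g = matrix_inv t ** mexp (- s) ?S"
    proof (rule matrix_inv_eq)
      have "g ** (matrix_inv t ** mexp (- s) ?S) = t ** (mexp s ?S ** matrix_inv t) ** mexp (- s) ?S"
        by (simp add: e matrix_mul_assoc)
      also have "\<dots> = (t ** matrix_inv t) ** (mexp s ?S ** mexp (- s) ?S)"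
        unfolding comm[OF A.inv_in[OF e(1)], symmetric] by (simp add: matrix_mul_assoc)
      finally show "g ** (matrix_inv t ** mexp (- s) ?S) = mat 1"
        by (simp add: mexp_plus mexp_at_0 matrix_inv_mult A.invertible_in[OF e(1)])
    qed
    then show "matrix_inv g \<in> B" using A.inv_in[OF e(1)] by (auto simp: B_def)
  qed
  let ?T = "Zcl B"
  have BT: "B \<subseteq> ?T" using matrix_monoid_Zcl[OF B] by simp
  have AB: "A \<subseteq> B"
  proof
    fix t assume "t \<in> A" then show "t \<in> B" unfolding B_def
      by (intro image_eqI[of _ _ "(t, 0)"]) (auto simp: mexp_at_0)
  qed
  have BG: "B \<subseteq> G"
    using A_sub mexp_in_group[OF alg S] mul_in by (auto simp: B_def)
  have conn: "connected_space (zariski ?T)"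
  proof (rule connected_space_Zcl[OF B])
    have cA: "connectedin (zariski ?T) A"
    proof -
      have "continuous_map (zariski A) (zariski ?T) id"
      proof (rule continuous_map_zariski)
        show "openin (zariski A) {x \<in> topspace (zariski A). mpoly_eval id p (entries (id x)) \<noteq> 0}" for p
          using openin_zariski_poly_fun[of "\<lambda>x. mpoly_eval id p (entries x)" A] by (auto simp: poly_fun_def)
      qed (use AB BT in auto)
      moreover have "connectedin (zariski A) A"
        using mt connectedin_topspace[of "zariski A"] by (simp add: maximal_torus_def algebraic_torus_def)
      ultimately show ?thesis using connectedin_continuous_map_image by fastforce
    qed
    have cS: "connectedin (zariski ?T) (range (\<lambda>s. t ** mexp s ?S))" if t: "t \<in> A" for t
    proof (rule connectedin_zariski_curve)
      show "t ** mexp s ?S \<in> ?T" for s using t BT by (auto simp: B_def)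
      show "continuous_on UNIV (\<lambda>s. mpoly_eval id p (entries (t ** mexp s ?S)))" for p
        using continuous_mpoly_eval_mexp[of "subst_mul t (mat 1) p" ?S] by (simp add: mpoly_eval_subst_mul_id)
    qed
    have "connectedin (zariski ?T) (\<Union> ((\<lambda>t. A \<union> range (\<lambda>s. t ** mexp s ?S)) ` A))"
    proof (rule connectedin_Union)
      fix U assume "U \<in> (\<lambda>t. A \<union> range (\<lambda>s. t ** mexp s ?S)) ` A"
      then obtain t where t: "t \<in> A" "U = A \<union> range (\<lambda>s. t ** mexp s ?S)" by blast
      have "t \<in> range (\<lambda>s. t ** mexp s ?S)" by (rule image_eqI[of _ _ 0]) (simp_all add: mexp_at_0)
      then show "connectedin (zariski ?T) U" unfolding t(2) using t(1) by (intro connectedin_Un cA cS) auto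
    next
      show "\<Inter> ((\<lambda>t. A \<union> range (\<lambda>s. t ** mexp s ?S)) ` A) \<noteq> {}" using A.one_in by blast
    qed
    moreover have "\<Union> ((\<lambda>t. A \<union> range (\<lambda>s. t ** mexp s ?S)) ` A) = B" using AB by (auto simp: B_def)
    ultimately show "connectedin (zariski ?T) B" by simp
  qed
  have "algebraic_torus ?T"
    unfolding algebraic_torus_def
  proof (intro conjI exI[of _ Q] ballI allI impI)
    fix t i j assume t: "t \<in> ?T" and ij: "i \<noteq> (j :: 'n)"
    show "(matrix_inv Q ** t ** Q) $ i $ j = 0"
    proof (rule Zcl_poly_fun[OF t])
      have "poly_fun (\<lambda>t. \<Sum>k\<in>UNIV. (\<Sum>l\<in>UNIV. matrix_inv Q $ i $ l * t $ l $ k) * Q $ k $ j)"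
        by (intro poly_fun_intros poly_fun_sum)
      then show "poly_fun (\<lambda>t. (matrix_inv Q ** t ** Q) $ i $ j)" by (simp add: matrix_matrix_mult_def)
      fix b assume "b \<in> B"
      then have "D b" using D_mult D_A D_mexp by (auto simp: B_def)
      then show "(matrix_inv Q ** b ** Q) $ i $ j = 0" using ij by (simp add: D_def)
    qed
  qed (use linear_algebraic_group_Zcl[OF B] conn Q(1) in auto)
  moreover have "A \<subseteq> ?T" "?T \<subseteq> G"
    using AB BT Zcl_mono[OF BG] linear_algebraic_group_closed(2)[OF alg] by auto
  ultimately have TA: "?T = A" using mt by (simp add: maximal_torus_def)
  have "mexp s ?S \<in> A" for s
  proof -
    have "mexp s ?S \<in> B" unfolding B_def by (rule image_eqI[of _ _ "(mat 1, s)"]) (auto simp: A.one_in)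
    then show ?thesis using BT TA by auto
  qed
  then show "?S \<in> \<aa>"
  proof (intro fexp_in_imp_lie_algebra entire_eq_0)
    fix p assume "\<And>s. mexp s ?S \<in> A" "p \<in> vanishing_ideal A"
    then show "eval_fps (mpoly_eval fps_const p (entries (fexp ?S))) z = 0" for z
      by (simp add: mpoly_eval_mexp[symmetric] vanishing_ideal_def)
    show "entire (mpoly_eval fps_const p (entries (fexp ?S)))"
      by (rule entire_mpoly_eval[THEN conjunct1]) (auto simp: entries_def entire_fexp split_def)
  qed
qed

end

section \<open>The root space decomposition\<close>

context cartan
begin

lemma trace_weight_orth:
  assumes "\<alpha> + \<beta> \<noteq> 0" "\<And>i j. wt i - wt j \<noteq> \<alpha> \<Longrightarrow> cj X $ i $ j = 0" "\<And>i j. wt i - wt j \<noteq> \<beta> \<Longrightarrow> cj Y $ i $ j = 0"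
  shows "trace (X ** Y) = 0"
proof -
  have 0: "cj X $ i $ k * cj Y $ k $ i = 0" for i k
  proof (cases "wt i - wt k = \<alpha>")
    case True
    then have "wt k - wt i \<noteq> \<beta>" using assms(1) by auto
    then show ?thesis using assms(3) by simp
  qed (use assms(2) in simp)
  have "trace (cj X ** cj Y) = 0"
    unfolding trace_def matrix_matrix_mult_def by (simp only: vec_lambda_beta 0 sum.neutral_const)
  then show ?thesis using trace_cj[of "X ** Y"] by (simp add: cj_mult)
qed

lemma sum_proj_wt_trace:
  assumes "\<And>\<beta>. \<beta> \<in> wts \<Longrightarrow> trace (X ** proj_wt \<beta> Y) = 0"
  shows "trace (X ** Y) = 0"
proof -
  have "trace (X ** (\<Sum>\<beta>\<in>wts. proj_wt \<beta> Y)) = 0"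
    unfolding matrix_mult_sum_right trace_sum using assms by simp
  then show ?thesis by (simp add: sum_proj_wt)
qed

lemma trace_mult_nilpotent_commuting:
  "nilpotent X \<Longrightarrow> X ** Y = Y ** X \<Longrightarrow> trace (X ** Y) = (0 :: complex)"
  by (rule trace_nilpotent) (rule nilpotent_mult_commuting)

text \<open>The nilpotent elements of the centralizer \<open>C\<close> of the torus are detected by the traces on the weight
  spaces, so they form a subspace, and by polarization the trace form vanishes on it.\<close>

theorem centralizer_eq_a: "root_space G A 0 = \<aa>"
proof
  have z: "(0 :: 'n cmat \<Rightarrow> complex) \<in> dual_space \<aa>" by (simp add: dual_space_def)
  show "\<aa> \<subseteq> root_space G A 0"
  proof
    fix H assume H: "H \<in> \<aa>"
    show "H \<in> root_space G A 0"
      unfolding root_space_iff[OF z] using H a_sub a_diag[OF H] by (metis diff_self subsetD)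
  qed
  define C where "C = root_space G A 0"
  have C: "X \<in> C \<longleftrightarrow> X \<in> \<gg> \<and> (\<forall>i j. wt i \<noteq> wt j \<longrightarrow> cj X $ i $ j = 0)" for X
    unfolding C_def root_space_iff[OF z] by simp
  have Fcomm: "FW \<mu> ** X = X ** FW \<mu>" if "X \<in> C" for X \<mu>
    by (rule FW_commute) (use that C in auto)
  \<comment> \<open>Jordan decomposition inside the centralizer, with the semisimple part already in
    \<open>\<aa>\<close>.\<close>
  have dec: "\<exists>S N. X = S + N \<and> S \<in> \<aa> \<and> nilpotent N \<and> N \<in> C" if X: "X \<in> C" for X
  proof -
    obtain Z E where sp: "spectral X Z E" using ex_spectral by blast
    let ?S = "\<Sum>z\<in>Z. smult_mat z (E z)"
    have S: "?S \<in> \<aa>" using X C by (intro semisimple_part_in_a[OF _ _ sp]) auto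
    have "X - ?S \<in> C" unfolding C
    proof (intro conjI allI impI)
      show "X - ?S \<in> \<gg>" using X C S a_sub by (intro lie_algebra_diff) auto
      show "cj (X - ?S) $ i $ j = 0" if "wt i \<noteq> wt j" for i j
        unfolding cj_lin_nth(2) using X C that a_diag[OF S, of i j] by auto
    qed
    then show ?thesis using S spectral_nilpotent(1)[OF sp] by (intro exI[of _ ?S] exI[of _ "X - ?S"]) auto
  qed
  have a_sum: "\<exists>c. S = (\<Sum>\<mu>\<in>range wt. smult_mat (c \<mu>) (FW \<mu>))" if S: "S \<in> \<aa>" for S
  proof (intro exI)
    show "S = (\<Sum>\<mu>\<in>range wt. smult_mat (\<mu> S) (FW \<mu>))"
    proof (rule cj_eqI)
      fix i j
      have "cj (\<Sum>\<mu>\<in>range wt. smult_mat (\<mu> S) (FW \<mu>)) $ i $ j = (\<Sum>\<mu>\<in>range wt. if \<mu> = wt i \<and> i = j then \<mu> S else 0)"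
        unfolding cj_lin_nth by (rule sum.cong) (auto simp: FW_def dg_def)
      then show "cj S $ i $ j = cj (\<Sum>\<mu>\<in>range wt. smult_mat (\<mu> S) (FW \<mu>)) $ i $ j"
        using S by (simp add: cj_a) (simp add: dg_def wt_def)
    qed
  qed
  have Nil: "nilpotent X \<longleftrightarrow> (\<forall>\<mu>. trace (X ** FW \<mu>) = 0)" if X: "X \<in> C" for X
  proof
    assume "nilpotent X"
    then show "\<forall>\<mu>. trace (X ** FW \<mu>) = 0"
      using Fcomm[OF X] by (intro allI trace_mult_nilpotent_commuting) simp_all
  next
    assume 0: "\<forall>\<mu>. trace (X ** FW \<mu>) = 0"
    obtain S N where SN: "X = S + N" "S \<in> \<aa>" "nilpotent N" "N \<in> C" using dec[OF X] by blast
    obtain c where c: "S = (\<Sum>\<mu>\<in>range wt. smult_mat (c \<mu>) (FW \<mu>))" using a_sum[OF SN(2)] by blast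
    have "smult_mat (c \<mu>) (FW \<mu>) = 0" if \<mu>: "\<mu> \<in> range wt" for \<mu>
    proof -
      have "trace (N ** FW \<mu>) = 0" using Fcomm[OF SN(4)] SN(3) by (intro trace_mult_nilpotent_commuting) simp_all
      moreover have "trace ((S + N) ** FW \<mu>) = 0" using 0 SN(1) by simp
      ultimately have "trace (S ** FW \<mu>) = 0" by (simp add: matrix_add_rdistrib' trace_add)
      moreover have "S ** FW \<mu> = (\<Sum>\<nu>\<in>range wt. if \<nu> = \<mu> then smult_mat (c \<mu>) (FW \<mu>) else 0)"
        unfolding c matrix_mult_sum_left smult_mat_mult FW_orth by (intro sum.cong refl) (auto simp: smult_mat_0)
      ultimately have "c \<mu> * trace (FW \<mu>) = 0" using \<mu> by (simp add: trace_smult)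
      moreover obtain d where "trace (FW \<mu>) = of_nat d" "d = 0 \<longrightarrow> FW \<mu> = 0"
        using trace_idempotents[OF FW_orth(1,2) FW_orth(3) \<mu>] by blast
      ultimately show ?thesis by (auto simp: smult_mat_0) (simp add: smult_mat_def vec_eq_iff)
    qed
    then have "S = 0" unfolding c by (intro sum.neutral) blast
    then show "nilpotent X" using SN by simp
  qed
  have "N = 0" if N: "N \<in> C" "nilpotent N" for N
  proof (rule trace_form_nondegenerate)
    show "N \<in> \<gg>" using N C by simp
    fix Y assume Y: "Y \<in> \<gg>"
    show "trace (N ** Y) = 0"
    proof (rule sum_proj_wt_trace)
      fix \<beta> assume \<beta>: "\<beta> \<in> wts"
      show "trace (N ** proj_wt \<beta> Y) = 0"
      proof (cases "\<beta> = 0")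
        case False
        then show ?thesis
          using N(1) C by (intro trace_weight_orth[of 0 \<beta>]) (auto simp: cj_proj_wt)
      next
        case True
        let ?Y = "proj_wt 0 Y"
        have "?Y \<in> C" unfolding C using proj_wt_in_g[OF Y] by (auto simp: cj_proj_wt)
        then obtain S M where SM: "?Y = S + M" "S \<in> \<aa>" "nilpotent M" "M \<in> C" using dec by blast
        have "N + M \<in> C" using N(1) SM(4) C by (auto simp: lie_algebra_add cj_lin_nth)
        moreover have "trace ((N + M) ** FW \<mu>) = 0" for \<mu>
          using N SM Nil by (simp add: matrix_add_rdistrib' trace_add)
        ultimately have "nilpotent (N + M)" using Nil by blast
        then have "trace ((N + M) ** (N + M)) = 0" "trace (N ** N) = 0" "trace (M ** M) = 0"
          using N(2) SM(3) by (auto intro: trace_mult_nilpotent_commuting)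
        then have NM: "trace (N ** M) = 0"
          using trace_mul_sym[of M N] by (simp add: matrix_add_rdistrib' matrix_add_ldistrib trace_add)
        obtain c where "S = (\<Sum>\<mu>\<in>range wt. smult_mat (c \<mu>) (FW \<mu>))" using a_sum[OF SM(2)] by blast
        then have "N ** S = S ** N"
          using Fcomm[OF N(1)] by (simp add: matrix_mult_sum_left matrix_mult_sum_right smult_mat_mult)
        then have "trace (N ** S) = 0" by (intro trace_mult_nilpotent_commuting N(2))
        then show ?thesis using True SM(1) NM by (simp add: matrix_add_ldistrib trace_add)
      qed
    qed
  qed
  then show "root_space G A 0 \<subseteq> \<aa>"
    using dec unfolding C_def[symmetric] by force
qed

abbreviation "R \<equiv> roots G A"

lemma proj_wt_in_root_space: "\<alpha> \<in> wts \<Longrightarrow> X \<in> \<gg> \<Longrightarrow> proj_wt \<alpha> X \<in> root_space G A \<alpha>"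
  by (simp add: root_space_iff wt_dual proj_wt_in_g cj_proj_wt)

lemma root_space_closed:
  "0 \<in> root_space G A \<alpha>" "X \<in> root_space G A \<alpha> \<Longrightarrow> Y \<in> root_space G A \<alpha> \<Longrightarrow> X + Y \<in> root_space G A \<alpha>"
  "X \<in> root_space G A \<alpha> \<Longrightarrow> smult_mat c X \<in> root_space G A \<alpha>"
  unfolding root_space_def
  by (auto simp: lie_algebra_0 lie_algebra_add lie_algebra_smult lie_bracket_add smult_mat_bracket smult_mat_0
      smult_smult_mat mult.commute) (simp add: smult_mat_def vec_eq_iff algebra_simps)

lemma root_in_wts:
  assumes "\<alpha> \<in> dual_space \<aa>" "X \<in> root_space G A \<alpha>" "X \<noteq> 0"
  shows "\<alpha> \<in> wts"
proof (rule ccontr)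
  assume "\<alpha> \<notin> wts"
  then have "wt i - wt j \<noteq> \<alpha>" for i j unfolding wts_def by auto
  then have "X = 0" using assms(1,2) by (intro cj_eqI) (simp add: root_space_iff cj_lin_nth)
  then show False using assms(3) by simp
qed

lemma roots_iff: "\<alpha> \<in> R \<longleftrightarrow> \<alpha> \<in> dual_space \<aa> \<and> \<alpha> \<noteq> 0 \<and> (\<exists>X\<in>root_space G A \<alpha>. X \<noteq> 0)"
  using root_space_closed(1)[of \<alpha>] by (auto simp: roots_def)

lemma roots_sub_wts: "R \<subseteq> wts"
  using root_in_wts by (auto simp: roots_iff)

lemma finite_roots: "finite R"
  using finite_subset[OF roots_sub_wts finite_wts] .

lemma root_dual: "\<alpha> \<in> R \<Longrightarrow> \<alpha> \<in> dual_space \<aa>"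
  by (simp add: roots_iff)

lemma proj_wt_not_root:
  assumes "X \<in> \<gg>" "\<alpha> \<noteq> 0" "\<alpha> \<notin> R"
  shows "proj_wt \<alpha> X = 0"
proof (cases "\<alpha> \<in> wts")
  case True
  then show ?thesis using proj_wt_in_root_space[OF True assms(1)] assms(2,3) wt_dual[OF True] by (auto simp: roots_iff)
next
  case False
  then have "wt i - wt j \<noteq> \<alpha>" for i j unfolding wts_def by auto
  then show ?thesis by (intro cj_eqI) (simp add: cj_proj_wt cj_lin_nth)
qed

lemma root_decomposition:
  assumes "X \<in> \<gg>"
  shows "X = proj_wt 0 X + (\<Sum>\<alpha>\<in>R. proj_wt \<alpha> X)"
proof -
  have n: "0 \<notin> R" by (simp add: roots_iff)
  have "X = (\<Sum>\<alpha>\<in>insert 0 R. proj_wt \<alpha> X)"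
    by (subst (1) sum_proj_wt[symmetric], rule sum.mono_neutral_right)
       (use finite_wts zero_in_wts roots_sub_wts proj_wt_not_root[OF assms] in auto)
  then show ?thesis using finite_roots n by simp
qed

lemma proj_wt_0_in_a: "X \<in> \<gg> \<Longrightarrow> proj_wt 0 X \<in> \<aa>"
  using proj_wt_in_root_space[OF zero_in_wts] centralizer_eq_a by auto

lemma proj_wt_root_space:
  assumes "\<beta> \<in> dual_space \<aa>" "X \<in> root_space G A \<beta>"
  shows "proj_wt \<alpha> X = (if \<alpha> = \<beta> then X else 0)"
  by (rule cj_eqI) (use assms in \<open>auto simp: root_space_iff cj_proj_wt cj_lin_nth\<close>)

lemma zero_dual: "(0 :: 'n cmat \<Rightarrow> complex) \<in> dual_space \<aa>" by (simp add: dual_space_def)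

lemma proj_wt_a: "H \<in> \<aa> \<Longrightarrow> proj_wt \<alpha> H = (if \<alpha> = 0 then H else 0)"
  using proj_wt_root_space[OF zero_dual] centralizer_eq_a by auto

lemma root_space_sub: "X \<in> root_space G A \<alpha> \<Longrightarrow> X \<in> \<gg>"
  by (simp add: root_space_def)

lemma bracket_root_space:
  assumes "X \<in> root_space G A \<alpha>" "Y \<in> root_space G A \<beta>"
  shows "lie_bracket X Y \<in> root_space G A (\<alpha> + \<beta>)"
  using assms unfolding root_space_def
  by (auto simp: lie_algebra_bracket lie_bracket_jacobi smult_mat_bracket)
     (simp add: smult_mat_def vec_eq_iff algebra_simps)

lemma dual_add: "\<alpha> \<in> dual_space \<aa> \<Longrightarrow> \<beta> \<in> dual_space \<aa> \<Longrightarrow> \<alpha> + \<beta> \<in> dual_space \<aa>"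
  and dual_uminus: "\<alpha> \<in> dual_space \<aa> \<Longrightarrow> - \<alpha> \<in> dual_space \<aa>"
  by (auto simp: dual_space_def algebra_simps)

lemma bracket_not_root:
  assumes "\<alpha> \<in> dual_space \<aa>" "\<beta> \<in> dual_space \<aa>" "X \<in> root_space G A \<alpha>" "Y \<in> root_space G A \<beta>"
    "\<alpha> + \<beta> \<notin> R" "\<alpha> + \<beta> \<noteq> 0"
  shows "lie_bracket X Y = 0"
  using bracket_root_space[OF assms(3,4)] assms dual_add by (auto simp: roots_iff)

text \<open>An element killed by all roots commutes with every weight component, hence is
  central.\<close>

lemma roots_span:
  assumes "H \<in> \<aa>" "\<And>\<alpha>. \<alpha> \<in> R \<Longrightarrow> \<alpha> H = 0"
  shows "H = 0"
proof (rule center_trivial)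
  show "H \<in> \<gg>" using assms(1) a_sub by blast
  fix Y assume Y: "Y \<in> \<gg>"
  have "lie_bracket H (proj_wt \<alpha> Y) = 0" if "\<alpha> \<in> R" for \<alpha>
  proof -
    have "proj_wt \<alpha> Y \<in> root_space G A \<alpha>" using proj_wt_in_root_space that roots_sub_wts Y by blast
    then show ?thesis using assms(1) assms(2)[OF that] by (simp add: root_space_def mat_mult(1)[symmetric])
  qed
  moreover have "lie_bracket H (proj_wt 0 Y) = 0"
  proof -
    have "proj_wt 0 Y \<in> root_space G A 0" using proj_wt_in_root_space[OF zero_in_wts Y] .
    then show ?thesis using assms(1) by (simp add: root_space_def mat_mult(1)[symmetric])
  qed
  ultimately show "lie_bracket H Y = 0"
    by (subst root_decomposition[OF Y]) (simp add: lie_bracket_add lie_bracket_sum)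
qed

text \<open>A copy of \<open>sl\<^sub>2\<close>: \<open>\<alpha>([x,y]) = 0\<close> would make \<open>[x,y]\<close> commute with \<open>x\<close> and \<open>y\<close>, so that the product of
  \<open>[x,y]\<close> with its complex conjugate has trace \<open>0\<close>.\<close>

lemma root_sl2:
  assumes "\<alpha> \<in> R"
  shows "- \<alpha> \<in> R" "\<exists>x\<in>root_space G A \<alpha>. \<exists>y\<in>root_space G A (- \<alpha>). lie_bracket x y \<in> \<aa> \<and> \<alpha> (lie_bracket x y) = 2"
proof -
  have da: "\<alpha> \<in> dual_space \<aa>" and a0: "\<alpha> \<noteq> 0" using assms by (auto simp: roots_iff)
  obtain x where x: "x \<in> root_space G A \<alpha>" "x \<noteq> 0" using assms by (auto simp: roots_iff)
  obtain y0 where y0: "y0 \<in> \<gg>" "trace (x ** y0) \<noteq> 0"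
    using trace_form_nondegenerate[OF root_space_sub[OF x(1)]] x(2) by blast
  have "trace (x ** proj_wt \<beta> y0) = 0" if "\<beta> \<noteq> - \<alpha>" for \<beta>
  proof (rule trace_weight_orth)
    show "\<alpha> + \<beta> \<noteq> 0" using that by (metis add_eq_0_iff)
  qed (use x(1) da in \<open>auto simp: root_space_iff cj_proj_wt\<close>)
  moreover obtain \<beta> where "\<beta> \<in> wts" "trace (x ** proj_wt \<beta> y0) \<noteq> 0"
    using sum_proj_wt_trace[of x y0] y0(2) by blast
  ultimately have ne: "- \<alpha> \<in> wts" "trace (x ** proj_wt (- \<alpha>) y0) \<noteq> 0" by metis+
  define y where "y = proj_wt (- \<alpha>) y0"
  have y: "y \<in> root_space G A (- \<alpha>)" unfolding y_def by (rule proj_wt_in_root_space[OF ne(1) y0(1)])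
  have "y \<noteq> 0" using ne(2) by (auto simp: y_def trace_def)
  then show m\<alpha>: "- \<alpha> \<in> R" using y da a0 dual_uminus by (auto simp: roots_iff)
  let ?t = "lie_bracket x y"
  have t: "?t \<in> \<aa>" using bracket_root_space[OF x(1) y] centralizer_eq_a by simp
  obtain H where H: "H \<in> \<aa>" "\<alpha> H \<noteq> 0"
    using a0 dual_spaceD(3)[OF da] by (metis ext zero_fun_apply)
  have "trace (H ** ?t) = trace (lie_bracket H x ** y)" by (simp add: trace_bracket)
  also have "\<dots> = \<alpha> H * trace (x ** y)"
    using x(1) H(1) by (simp add: root_space_def smult_mat_mult trace_smult)
  finally have t0: "?t \<noteq> 0" using H(2) ne(2) by (auto simp: y_def trace_def)
  have "\<alpha> ?t \<noteq> 0"
  proof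
    assume z: "\<alpha> ?t = 0"
    have cx: "\<tau> ?t i = \<tau> ?t j" if "cj x $ i $ j \<noteq> 0" for i j
    proof -
      have "wt i - wt j = \<alpha>" using that x(1) da by (auto simp: root_space_iff)
      then have "(wt i - wt j) ?t = \<alpha> ?t" by simp
      then show ?thesis using z t by (simp add: wt_def)
    qed
    let ?D = "dg (\<lambda>i. cnj (\<tau> ?t i))"
    have Dx: "?D ** cj x = cj x ** ?D" using cx by (auto simp: vec_eq_iff dg_mult)
    have "trace (?D ** cj ?t) = trace (?D ** cj x ** cj y) - trace (?D ** cj y ** cj x)"
      unfolding cj_bracket lie_bracket_def[of "cj x"] by (simp add: matrix_mult_diff trace_sub matrix_mul_assoc)
    also have "?D ** cj x ** cj y = cj x ** (?D ** cj y)" by (simp add: Dx matrix_mul_assoc)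
    also have "trace (cj x ** (?D ** cj y)) = trace (?D ** cj y ** cj x)" by (rule trace_mul_sym)
    finally have "trace (?D ** cj ?t) = 0" by simp
    then have "(\<Sum>i\<in>UNIV. cnj (\<tau> ?t i) * \<tau> ?t i) = 0"
      by (simp add: trace_def dg_mult \<tau>_def)
    moreover have "cnj (\<tau> ?t i) * \<tau> ?t i = of_real ((cmod (\<tau> ?t i))\<^sup>2)" for i
      using complex_norm_square[of "\<tau> ?t i"] by (simp add: mult.commute)
    ultimately have "(\<Sum>i\<in>UNIV. (cmod (\<tau> ?t i))\<^sup>2) = 0" by (metis (mono_tags, lifting) of_real_eq_0_iff of_real_sum sum.cong)
    then have "\<tau> ?t i = 0" for i by (simp add: sum_nonneg_eq_0_iff)
    then have "cj ?t = 0" using cj_a[OF t] by (simp add: dg_def vec_eq_iff)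
    then have "?t = 0" using cj_inj[of ?t 0] by simp
    then show False using t0 by simp
  qed
  moreover define c where "c = 2 / \<alpha> ?t"
  ultimately have "\<alpha> (lie_bracket (smult_mat c x) y) = 2"
    using dual_spaceD(2)[OF da t] by (simp add: smult_mat_bracket)
  then show "\<exists>x\<in>root_space G A \<alpha>. \<exists>y\<in>root_space G A (- \<alpha>). lie_bracket x y \<in> \<aa> \<and> \<alpha> (lie_bracket x y) = 2"
    using root_space_closed(3)[OF x(1), of c] y a_closed(3)[OF t, of c] by (metis smult_mat_bracket(1))
qed

section \<open>Strings of root vectors under a copy of sl2\<close>

definition coroot_triple :: "('n cmat \<Rightarrow> complex) \<Rightarrow> 'n cmat \<Rightarrow> 'n cmat \<Rightarrow> bool"
  where "coroot_triple \<alpha> e f \<longleftrightarrow> e \<in> root_space G A \<alpha> \<and> f \<in> root_space G A (- \<alpha>) \<and>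
    lie_bracket e f \<in> \<aa> \<and> \<alpha> (lie_bracket e f) = 2"

lemma ex_coroot_triple: "\<alpha> \<in> R \<Longrightarrow> \<exists>e f. coroot_triple \<alpha> e f"
  using root_sl2(2) unfolding coroot_triple_def by blast

text \<open>The weights \<open>\<beta> + k \<alpha>\<close> are distinct, and only finitely many of them occur.\<close>

lemma ladder_terminates:
  assumes "\<alpha> \<in> dual_space \<aa>" "\<alpha> \<noteq> 0" "\<beta> \<in> dual_space \<aa>" "\<And>k. v k \<in> root_space G A (\<beta> + (\<lambda>H. of_nat k * \<alpha> H))"
  shows "\<exists>k. v k = 0"
proof (rule ccontr)
  assume nz: "\<nexists>k. v k = 0"
  have d: "\<beta> + (\<lambda>H. of_nat k * \<alpha> H) \<in> dual_space \<aa>" for k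
    using assms(1,3) by (auto simp: dual_space_def algebra_simps)
  have "range (\<lambda>k::nat. \<beta> + (\<lambda>H. of_nat k * \<alpha> H)) \<subseteq> wts"
    using root_in_wts[OF d assms(4)] nz by auto
  then have "finite (range (\<lambda>k::nat. \<beta> + (\<lambda>H. of_nat k * \<alpha> H)))" using finite_wts finite_subset by blast
  moreover have "inj (\<lambda>k::nat. \<beta> + (\<lambda>H. of_nat k * \<alpha> H))"
  proof
    fix k l :: nat assume "\<beta> + (\<lambda>H. of_nat k * \<alpha> H) = \<beta> + (\<lambda>H. of_nat l * \<alpha> H)"
    then have e: "of_nat k * \<alpha> H = of_nat l * \<alpha> H" for H by (metis add_left_cancel)
    obtain H where "\<alpha> H \<noteq> 0" using assms(2) by (auto simp: fun_eq_iff)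
    then show "k = l" using e[of H] by simp
  qed
  ultimately show False using finite_imageD infinite_UNIV_nat by blast
qed

lemma root_space_cong: "X \<in> root_space G A \<alpha> \<Longrightarrow> \<alpha> = \<beta> \<Longrightarrow> X \<in> root_space G A \<beta>" by simp

lemma ad_root_space:
  assumes "x \<in> root_space G A \<alpha>" "v \<in> root_space G A (\<beta> + (\<lambda>H. of_nat k * \<alpha> H))"
  shows "lie_bracket x v \<in> root_space G A (\<beta> + (\<lambda>H. of_nat (Suc k) * \<alpha> H))"
  by (rule root_space_cong[OF bracket_root_space[OF assms]]) (auto simp: fun_eq_iff algebra_simps)

text \<open>The string of \<open>v\<close> under \<open>f\<close> terminates. At its last nonzero
  vector the commutation formula for \<open>e\<close> forces the eigenvalue of \<open>[e, f]\<close>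
  to be the length of the string.\<close>

lemma highest_weight:
  assumes t: "coroot_triple \<alpha> e f" and \<alpha>: "\<alpha> \<in> dual_space \<aa>" and \<beta>: "\<beta> \<in> dual_space \<aa>"
    and v: "v \<in> root_space G A \<beta>" "v \<noteq> 0" "lie_bracket e v = 0"
  shows "\<exists>m::nat. \<beta> (lie_bracket e f) = of_nat m"
proof -
  let ?h = "lie_bracket e f"
  have e: "e \<in> root_space G A \<alpha>" and f: "f \<in> root_space G A (- \<alpha>)" and h: "?h \<in> \<aa>" "\<alpha> ?h = 2"
    using t by (auto simp: coroot_triple_def)
  define w where "w k = (lie_bracket f ^^ k) v" for k
  have w: "w k \<in> root_space G A (\<beta> + (\<lambda>H. of_nat k * (- \<alpha>) H))" for k
  proof (induction k)
    case 0
    have "\<beta> + (\<lambda>H. of_nat 0 * (- \<alpha>) H) = \<beta>" by (auto simp: fun_eq_iff)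
    then show ?case using v(1) by (simp add: w_def)
  next
    case (Suc k)
    show ?case using ad_root_space[OF f Suc] unfolding w_def funpow.simps comp_apply .
  qed
  have a0: "- \<alpha> \<noteq> 0" using h(2) by auto
  obtain k where "w k = 0" using ladder_terminates[OF dual_uminus[OF \<alpha>] a0 \<beta> w] by blast
  define K where "K = (LEAST k. w k = 0)"
  have K: "w K = 0" unfolding K_def by (rule LeastI) fact
  have "K \<noteq> 0"
  proof
    assume "K = 0"
    then show False using K v(2) by (simp add: w_def)
  qed
  then obtain n where n: "K = Suc n" by (cases K) auto
  have wn: "w n \<noteq> 0" using not_less_Least[of n "\<lambda>k. w k = 0"] n by (simp add: K_def)
  have hw: "lie_bracket ?h (w k) = smult_mat (\<beta> ?h - 2 * of_nat k) (w k)" for k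
  proof -
    have "lie_bracket ?h (w k) = smult_mat ((\<beta> + (\<lambda>H. of_nat k * (- \<alpha>) H)) ?h) (w k)"
      using w[of k] h(1) by (simp add: root_space_def)
    also have "(\<beta> + (\<lambda>H. of_nat k * (- \<alpha>) H)) ?h = \<beta> ?h - 2 * of_nat k" by (simp add: h(2))
    finally show ?thesis .
  qed
  \<comment> \<open>The highest weight formula of sl2; the factor comes from adding up the
    eigenvalues \<open>\<beta> ?h - 2 * j\<close> for \<open>j \<le> k\<close>.\<close>
  have ew: "lie_bracket e (w (Suc k)) = smult_mat (of_nat (Suc k) * (\<beta> ?h - of_nat k)) (w k)" for k
  proof (induction k)
    case 0
    have "lie_bracket e (lie_bracket f v) = lie_bracket ?h v"
      using v(3) by (simp add: lie_bracket_jacobi[of e f v])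
    then show ?case using hw[of 0] by (simp add: w_def)
  next
    case (Suc k)
    have "lie_bracket e (w (Suc (Suc k))) = lie_bracket ?h (w (Suc k)) + lie_bracket f (lie_bracket e (w (Suc k)))"
      using lie_bracket_jacobi[of e f "w (Suc k)"] by (simp add: w_def)
    also have "lie_bracket f (lie_bracket e (w (Suc k))) = smult_mat (of_nat (Suc k) * (\<beta> ?h - of_nat k)) (w (Suc k))"
      unfolding Suc smult_mat_bracket by (simp add: w_def)
    finally have "lie_bracket e (w (Suc (Suc k))) = smult_mat ((\<beta> ?h - 2 * of_nat (Suc k)) + of_nat (Suc k) * (\<beta> ?h - of_nat k)) (w (Suc k))"
      unfolding hw by (simp add: smult_mat_def vec_eq_iff algebra_simps)
    then show ?case by (simp add: algebra_simps)
  qed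
  have "smult_mat (of_nat (Suc n) * (\<beta> ?h - of_nat n)) (w n) = 0"
    using ew[of n] K by (simp add: n del: of_nat_Suc)
  then have "of_nat (Suc n) * (\<beta> ?h - of_nat n) = (0 :: complex)"
    using wn by (auto simp: smult_mat_def vec_eq_iff simp del: of_nat_Suc)
  then have "\<beta> ?h = of_nat n" by (simp del: of_nat_Suc)
  then show ?thesis by blast
qed

text \<open>Raising by \<open>e\<close> ends in a highest weight vector of weight
  \<open>\<beta> + n \<alpha>\<close>, whose value is a natural number; since
  \<open>\<alpha>\<close> takes the value 2, an even integer has to be subtracted.\<close>

lemma root_coroot_integral:
  assumes t: "coroot_triple \<alpha> e f" and \<alpha>: "\<alpha> \<in> R" and \<beta>: "\<beta> \<in> R"
  shows "\<exists>m::int. \<beta> (lie_bracket e f) = of_int m"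
proof -
  let ?h = "lie_bracket e f"
  have e: "e \<in> root_space G A \<alpha>" and h: "\<alpha> ?h = 2" using t by (auto simp: coroot_triple_def)
  obtain v where v: "v \<in> root_space G A \<beta>" "v \<noteq> 0" using \<beta> by (auto simp: roots_iff)
  define w where "w k = (lie_bracket e ^^ k) v" for k
  have w: "w k \<in> root_space G A (\<beta> + (\<lambda>H. of_nat k * \<alpha> H))" for k
  proof (induction k)
    case 0
    have "\<beta> + (\<lambda>H. of_nat 0 * \<alpha> H) = \<beta>" by (auto simp: fun_eq_iff)
    then show ?case using v(1) by (simp add: w_def)
  next
    case (Suc k)
    show ?case using ad_root_space[OF e Suc] unfolding w_def funpow.simps comp_apply .
  qed
  have a0: "\<alpha> \<noteq> 0" using h by auto
  obtain k where "w k = 0" using ladder_terminates[OF root_dual[OF \<alpha>] a0 root_dual[OF \<beta>] w] by blast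
  define K where "K = (LEAST k. w k = 0)"
  have K: "w K = 0" unfolding K_def by (rule LeastI) fact
  have "K \<noteq> 0"
  proof
    assume "K = 0"
    then show False using K v(2) by (simp add: w_def)
  qed
  then obtain n where n: "K = Suc n" by (cases K) auto
  have wn: "w n \<noteq> 0" using not_less_Least[of n "\<lambda>k. w k = 0"] n by (simp add: K_def)
  have ewn: "lie_bracket e (w n) = 0" using K n by (simp add: w_def)
  have d: "\<beta> + (\<lambda>H. of_nat n * \<alpha> H) \<in> dual_space \<aa>"
    using root_dual[OF \<alpha>] root_dual[OF \<beta>] by (auto simp: dual_space_def algebra_simps)
  obtain m :: nat where "(\<beta> + (\<lambda>H. of_nat n * \<alpha> H)) ?h = of_nat m"
    using highest_weight[OF t root_dual[OF \<alpha>] d w wn ewn] by blast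
  then have "\<beta> ?h = of_int (int m - 2 * int n)" by (simp add: h algebra_simps)
  then show ?thesis by blast
qed

text \<open>If all brackets vanished, every vector of weight \<open>\<beta>\<close> would be a
  highest weight vector, so \<open>\<beta>\<close> would be nonnegative on the coroot; and
  \<open>[f, u]\<close> would be killed by \<open>e\<close> for \<open>u\<close> of weight
  \<open>\<alpha> + \<beta>\<close>. Then \<open>f\<close> undoes each raising of \<open>u\<close>
  up to a nonzero factor, so the string of \<open>u\<close> under \<open>e\<close> never
  ends.\<close>

lemma bracket_root_spaces_nonzero:
  assumes \<alpha>: "\<alpha> \<in> R" and \<beta>: "\<beta> \<in> R" and s: "\<alpha> + \<beta> \<in> R"
  shows "\<exists>x\<in>root_space G A \<alpha>. \<exists>y\<in>root_space G A \<beta>. lie_bracket x y \<noteq> 0"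
proof (rule ccontr)
  assume "\<not> ?thesis"
  then have 0: "lie_bracket x y = 0" if "x \<in> root_space G A \<alpha>" "y \<in> root_space G A \<beta>" for x y using that by blast
  obtain e f where t: "coroot_triple \<alpha> e f" using ex_coroot_triple[OF \<alpha>] by blast
  let ?h = "lie_bracket e f"
  have e: "e \<in> root_space G A \<alpha>" and f: "f \<in> root_space G A (- \<alpha>)" and h: "?h \<in> \<aa>" "\<alpha> ?h = 2"
    using t by (auto simp: coroot_triple_def)
  obtain v where v: "v \<in> root_space G A \<beta>" "v \<noteq> 0" using \<beta> by (auto simp: roots_iff)
  obtain m :: nat where m: "\<beta> ?h = of_nat m"
    using highest_weight[OF t root_dual[OF \<alpha>] root_dual[OF \<beta>] v 0[OF e v(1)]] by blast
  obtain u where u: "u \<in> root_space G A (\<alpha> + \<beta>)" "u \<noteq> 0" using s by (auto simp: roots_iff)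
  have fu: "lie_bracket e (lie_bracket f u) = 0"
  proof (rule 0[OF e])
    show "lie_bracket f u \<in> root_space G A \<beta>"
      by (rule root_space_cong[OF bracket_root_space[OF f u(1)]]) simp
  qed
  define w where "w k = (lie_bracket e ^^ k) u" for k
  have w: "w k \<in> root_space G A ((\<alpha> + \<beta>) + (\<lambda>H. of_nat k * \<alpha> H))" for k
  proof (induction k)
    case 0
    have "(\<alpha> + \<beta>) + (\<lambda>H. of_nat 0 * \<alpha> H) = \<alpha> + \<beta>" by (auto simp: fun_eq_iff)
    then show ?case unfolding w_def using u(1) by (simp only: funpow.simps id_apply)
  next
    case (Suc k)
    show ?case using ad_root_space[OF e Suc] unfolding w_def funpow.simps comp_apply .
  qed
  have hw: "lie_bracket ?h (w k) = smult_mat (of_nat (m + 2 + 2 * k)) (w k)" for k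
  proof -
    have "lie_bracket ?h (w k) = smult_mat (((\<alpha> + \<beta>) + (\<lambda>H. of_nat k * \<alpha> H)) ?h) (w k)"
      using w[of k] h(1) by (simp add: root_space_def)
    also have "((\<alpha> + \<beta>) + (\<lambda>H. of_nat k * \<alpha> H)) ?h = of_nat (m + 2 + 2 * k)" by (simp add: h m)
    finally show ?thesis .
  qed
  have anti: "lie_bracket f (lie_bracket e x) = lie_bracket e (lie_bracket f x) - lie_bracket ?h x" for x
    using lie_bracket_jacobi[of e f x] by simp
  have fw: "\<exists>c>0. lie_bracket f (w (Suc k)) = smult_mat (- of_nat c) (w k)" for k
  proof (induction k)
    case 0
    have "lie_bracket f (w (Suc 0)) = smult_mat (- of_nat (m + 2)) (w 0)"
      using anti[of u] fu hw[of 0] by (simp add: w_def) (simp add: smult_mat_def vec_eq_iff algebra_simps)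
    then show ?case by (intro exI[of _ "m + 2"]) simp
  next
    case (Suc k)
    then obtain c where c: "c > 0" "lie_bracket f (w (Suc k)) = smult_mat (- of_nat c) (w k)" by blast
    have "lie_bracket f (w (Suc (Suc k))) = lie_bracket e (lie_bracket f (w (Suc k))) - lie_bracket ?h (w (Suc k))"
      using anti[of "w (Suc k)"] by (simp add: w_def)
    also have "\<dots> = smult_mat (- of_nat (c + (m + 2 + 2 * Suc k))) (w (Suc k))"
    proof -
      have "lie_bracket e (lie_bracket f (w (Suc k))) = smult_mat (- of_nat c) (w (Suc k))"
        unfolding c smult_mat_bracket by (simp add: w_def)
      then show ?thesis unfolding hw by (simp add: smult_mat_def vec_eq_iff algebra_simps)
    qed
    finally show ?case using c(1) by (intro exI[of _ "c + (m + 2 + 2 * Suc k)"]) simp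
  qed
  have "w k \<noteq> 0" for k
  proof (induction k)
    case 0
    then show ?case using u(2) by (simp add: w_def)
  next
    case (Suc k)
    obtain c where "c > 0" "lie_bracket f (w (Suc k)) = smult_mat (- of_nat c) (w k)" using fw by blast
    note c = this
    show ?case
    proof
      assume "w (Suc k) = 0"
      then have "smult_mat (- of_nat c) (w k) = 0" using c(2) by simp
      then show False using c(1) Suc by (simp add: smult_mat_def vec_eq_iff)
    qed
  qed
  moreover have "\<alpha> \<noteq> 0" using h(2) by auto
  ultimately show False
    using ladder_terminates[OF root_dual[OF \<alpha>] _ root_dual[OF s] w] by blast
qed

end

section \<open>Root valuation functions\<close>

text \<open>Drop one form \<open>f j\<close>: if \<open>g\<close> fails to vanish on the common
  kernel of the others, subtracting a suitable multiple of \<open>f j\<close> makes it vanish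
  there.\<close>

lemma vanish_on_kernel_imp_combination:
  fixes V :: "'v set" and f :: "'i \<Rightarrow> 'v \<Rightarrow> complex" and add :: "'v \<Rightarrow> 'v \<Rightarrow> 'v" and sc :: "complex \<Rightarrow> 'v \<Rightarrow> 'v"
  assumes "finite I" "\<And>x y. x \<in> V \<Longrightarrow> y \<in> V \<Longrightarrow> add x y \<in> V" "\<And>c x. x \<in> V \<Longrightarrow> sc c x \<in> V"
    and "\<And>i x y. i \<in> I \<Longrightarrow> x \<in> V \<Longrightarrow> y \<in> V \<Longrightarrow> f i (add x y) = f i x + f i y"
    and "\<And>i c x. i \<in> I \<Longrightarrow> x \<in> V \<Longrightarrow> f i (sc c x) = c * f i x"
    and "\<And>x y. x \<in> V \<Longrightarrow> y \<in> V \<Longrightarrow> g (add x y) = g x + g y" "\<And>c x. x \<in> V \<Longrightarrow> g (sc c x) = c * g x"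
    and "\<And>x. x \<in> V \<Longrightarrow> (\<And>i. i \<in> I \<Longrightarrow> f i x = 0) \<Longrightarrow> g x = 0"
  shows "\<exists>c. \<forall>x\<in>V. g x = (\<Sum>i\<in>I. c i * f i x)"
  using assms
proof (induction I arbitrary: g rule: finite_induct)
  case empty
  then show ?case by simp
next
  case (insert j I)
  show ?case
  proof (cases "\<forall>x\<in>V. (\<forall>i\<in>I. f i x = 0) \<longrightarrow> g x = 0")
    case True
    have "\<exists>c. \<forall>x\<in>V. g x = (\<Sum>i\<in>I. c i * f i x)"
      by (rule insert.IH) (use insert.prems True in auto)
    then obtain c where "\<forall>x\<in>V. g x = (\<Sum>i\<in>I. c i * f i x)" by blast
    then have "\<forall>x\<in>V. g x = (\<Sum>i\<in>insert j I. (c(j := 0)) i * f i x)"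
      using insert.hyps by (auto intro!: sum.cong)
    then show ?thesis by blast
  next
    case False
    then obtain x0 where x0: "x0 \<in> V" "\<And>i. i \<in> I \<Longrightarrow> f i x0 = 0" "g x0 \<noteq> 0" by blast
    have fj: "f j x0 \<noteq> 0" using insert.prems(7)[OF x0(1)] x0 by auto
    define a where "a = g x0 / f j x0"
    have "\<exists>c. \<forall>x\<in>V. g x - a * f j x = (\<Sum>i\<in>I. c i * f i x)"
    proof (rule insert.IH)
      fix x assume x: "x \<in> V" "\<And>i. i \<in> I \<Longrightarrow> f i x = 0"
      let ?s = "- (f j x / f j x0)"
      have "g (add x (sc ?s x0)) = 0"
      proof (rule insert.prems(7))
        show "add x (sc ?s x0) \<in> V" using insert.prems(1,2) x(1) x0(1) by blast
        fix i assume i: "i \<in> insert j I"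
        have "f i (add x (sc ?s x0)) = f i x + ?s * f i x0"
          using insert.prems(3)[OF i x(1) insert.prems(2)[OF x0(1)]] insert.prems(4)[OF i x0(1)] by simp
        also have "\<dots> = 0" using i x(2) x0(2) fj by auto
        finally show "f i (add x (sc ?s x0)) = 0" .
      qed
      then have "g x + ?s * g x0 = 0"
        using insert.prems(5)[OF x(1) insert.prems(2)[OF x0(1)]] insert.prems(6)[OF x0(1)] by simp
      then show "g x - a * f j x = 0" by (simp add: a_def)
    qed (use insert.prems in \<open>auto simp: algebra_simps\<close>)
    then obtain c where "\<forall>x\<in>V. g x - a * f j x = (\<Sum>i\<in>I. c i * f i x)" by blast
    then have "\<forall>x\<in>V. g x = (\<Sum>i\<in>insert j I. (c(j := a)) i * f i x)"
      using insert.hyps by (auto simp: algebra_simps intro!: sum.cong)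
    then show ?thesis by blast
  qed
qed

text \<open>Extend 1 to a basis of the complex numbers over the rationals. The functional fixes
  rational numbers, so it can be applied to the coefficients of a relation with rational
  values.\<close>

lemma ex_rational_functional:
  "\<exists>f :: complex \<Rightarrow> rat. (\<forall>x y. f (x + y) = f x + f y) \<and> (\<forall>q z. f (of_rat q * z) = q * f z) \<and> f 1 = 1"
proof -
  interpret VC: vector_space "\<lambda>q (z::complex). of_rat q * z"
    by unfold_locales (auto simp: algebra_simps of_rat_add of_rat_mult)
  interpret VQ: vector_space "(*) :: rat \<Rightarrow> rat \<Rightarrow> rat"
    by unfold_locales (auto simp: algebra_simps)
  interpret VP: vector_space_pair "\<lambda>q (z::complex). of_rat q * z" "(*) :: rat \<Rightarrow> rat \<Rightarrow> rat" ..
  have "VC.independent {1}" by (simp add: VC.independent_insert)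
  from VP.linear_independent_extend[OF this, of "\<lambda>_. 1"]
  obtain f where f: "Vector_Spaces.linear (\<lambda>q (z::complex). of_rat q * z) (*) f" "f 1 = (1 :: rat)" by auto
  interpret Vector_Spaces.linear "\<lambda>q (z::complex). of_rat q * z" "(*) :: rat \<Rightarrow> rat \<Rightarrow> rat" f by fact
  show ?thesis using f(2) add scale by blast
qed

section \<open>Coroots and rational relations between roots\<close>

context cartan
begin

lemma trace_form_nondegenerate_a:
  assumes "H \<in> \<aa>" "\<And>H'. H' \<in> \<aa> \<Longrightarrow> trace (H ** H') = 0"
  shows "H = 0"
proof (rule trace_form_nondegenerate)
  show "H \<in> \<gg>" using assms(1) a_sub by blast
  fix Y assume Y: "Y \<in> \<gg>"
  show "trace (H ** Y) = 0"
  proof (rule sum_proj_wt_trace)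
    fix \<beta> assume "\<beta> \<in> wts"
    show "trace (H ** proj_wt \<beta> Y) = 0"
    proof (cases "\<beta> = 0")
      case True
      then show ?thesis using assms(2) proj_wt_0_in_a[OF Y] by simp
    next
      case False
      then show ?thesis
        using a_diag[OF assms(1)] by (intro trace_weight_orth[of 0 \<beta>]) (auto simp: cj_proj_wt, metis)
    qed
  qed
qed

definition coroot :: "('n cmat \<Rightarrow> complex) \<Rightarrow> 'n cmat"
  where "coroot \<alpha> = (SOME h. \<exists>e f. coroot_triple \<alpha> e f \<and> h = lie_bracket e f)"

lemma coroot: "\<alpha> \<in> R \<Longrightarrow> \<exists>e f. coroot_triple \<alpha> e f \<and> coroot \<alpha> = lie_bracket e f"
  unfolding coroot_def by (rule someI_ex) (use ex_coroot_triple in blast)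

lemma coroot_in_a: "\<alpha> \<in> R \<Longrightarrow> coroot \<alpha> \<in> \<aa>"
  using coroot[of \<alpha>] by (auto simp: coroot_triple_def)

text \<open>By invariance \<open>trace (H [e, f])\<close> is \<open>\<alpha> H\<close> times
  \<open>trace (e f)\<close>. If the last factor vanished, the coroot would be orthogonal to
  \<open>\<aa>\<close> and hence 0, although \<open>\<alpha>\<close> is 2 on it.\<close>

lemma trace_coroot: "\<alpha> \<in> R \<Longrightarrow> \<exists>c. c \<noteq> 0 \<and> (\<forall>H\<in>\<aa>. trace (H ** coroot \<alpha>) = c * \<alpha> H)"
proof -
  assume \<alpha>: "\<alpha> \<in> R"
  obtain e f where t: "coroot_triple \<alpha> e f" "coroot \<alpha> = lie_bracket e f" using coroot[OF \<alpha>] by blast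
  have *: "trace (H ** coroot \<alpha>) = trace (e ** f) * \<alpha> H" if "H \<in> \<aa>" for H
  proof -
    have "trace (H ** coroot \<alpha>) = trace (lie_bracket H e ** f)" by (simp add: t(2) trace_bracket)
    also have "\<dots> = \<alpha> H * trace (e ** f)"
      using t(1) that by (simp add: coroot_triple_def root_space_def smult_mat_mult trace_smult)
    finally show ?thesis by simp
  qed
  have "trace (e ** f) \<noteq> 0"
  proof
    assume "trace (e ** f) = 0"
    then have "trace (H ** coroot \<alpha>) = 0" if "H \<in> \<aa>" for H using *[OF that] by simp
    then have "coroot \<alpha> = 0"
      using trace_form_nondegenerate_a[OF coroot_in_a[OF \<alpha>]] trace_mul_sym by metis
    moreover have "\<alpha> 0 = 0" using dual_spaceD(2)[OF root_dual[OF \<alpha>] a_closed(1), of 0] by (simp add: smult_mat_0)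
    ultimately show False using t by (simp add: coroot_triple_def)
  qed
  then show ?thesis using * by blast
qed

text \<open>By \<open>roots_span\<close> only 0 is orthogonal to all coroots, so the pairing with
  any \<open>H'\<close> is a combination of the pairings with coroots; nondegeneracy carries this
  over to \<open>H'\<close> itself.\<close>

lemma coroots_span:
  assumes H': "H' \<in> \<aa>"
  shows "\<exists>c. H' = (\<Sum>\<alpha>\<in>R. smult_mat (c \<alpha>) (coroot \<alpha>))"
proof -
  have "\<exists>c. \<forall>H\<in>\<aa>. trace (H ** H') = (\<Sum>\<alpha>\<in>R. c \<alpha> * trace (H ** coroot \<alpha>))"
  proof (rule vanish_on_kernel_imp_combination[where add = "(+)" and sc = smult_mat])
    fix H assume H: "H \<in> \<aa>" "\<And>\<alpha>. \<alpha> \<in> R \<Longrightarrow> trace (H ** coroot \<alpha>) = 0"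
    have "H = 0" by (rule roots_span[OF H(1)]) (use H trace_coroot in force)
    then show "trace (H ** H') = 0" by (simp add: trace_def)
  qed (auto simp: finite_roots a_closed matrix_add_rdistrib' trace_add smult_mat_mult trace_smult)
  then obtain c where c: "\<And>H. H \<in> \<aa> \<Longrightarrow> trace (H ** H') = (\<Sum>\<alpha>\<in>R. c \<alpha> * trace (H ** coroot \<alpha>))" by blast
  let ?S = "\<Sum>\<alpha>\<in>R. smult_mat (c \<alpha>) (coroot \<alpha>)"
  have S: "?S \<in> \<aa>" by (intro lie_algebra_closed_sum lie_algebra_smult coroot_in_a)
  have "H' - ?S = 0"
  proof (rule trace_form_nondegenerate_a)
    show "H' - ?S \<in> \<aa>" using H' S by (rule lie_algebra_diff)
    fix H assume "H \<in> \<aa>"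
    then have "trace (H ** (H' - ?S)) = 0"
      using c by (simp add: matrix_mult_diff trace_sub matrix_mult_sum_right smult_mat_mult trace_sum trace_smult)
    then show "trace ((H' - ?S) ** H) = 0" by (subst trace_mul_sym)
  qed
  then show ?thesis by auto
qed

text \<open>Since the roots take integral values on the coroots, complex linear relations between roots imply
  rational ones: apply a rational functional to the coefficients.\<close>

lemma rational_combination:
  assumes "finite S" "S \<subseteq> R" "\<alpha> \<in> R" "\<And>H. H \<in> \<aa> \<Longrightarrow> (\<And>\<beta>. \<beta> \<in> S \<Longrightarrow> \<beta> H = 0) \<Longrightarrow> \<alpha> H = 0"
  shows "\<exists>q. \<alpha> = (\<lambda>H. \<Sum>\<beta>\<in>S. of_rat (q \<beta>) * \<beta> H)"
proof -
  note d = root_dual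
  have "\<exists>c. \<forall>H\<in>\<aa>. \<alpha> H = (\<Sum>\<beta>\<in>S. c \<beta> * \<beta> H)"
    by (rule vanish_on_kernel_imp_combination[where add = "(+)" and sc = smult_mat])
       (use assms a_closed in \<open>auto simp: dual_spaceD(1,2)[OF root_dual] subset_iff\<close>)
  then obtain c where c: "\<And>H. H \<in> \<aa> \<Longrightarrow> \<alpha> H = (\<Sum>\<beta>\<in>S. c \<beta> * \<beta> H)" by blast
  obtain f :: "complex \<Rightarrow> rat" where f: "\<And>x y. f (x + y) = f x + f y" "\<And>q z. f (of_rat q * z) = q * f z" "f 1 = 1"
    using ex_rational_functional by blast
  have f0: "f 0 = 0" using f(1)[of 0 0] by simp
  have f_sum: "f (sum g T) = (\<Sum>i\<in>T. f (g i))" for g :: "('n cmat \<Rightarrow> complex) \<Rightarrow> complex" and T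
    by (induction T rule: infinite_finite_induct) (auto simp: f f0)
  have int: "\<beta> (coroot \<gamma>) = of_rat (f (\<beta> (coroot \<gamma>)))" if "\<beta> \<in> R" "\<gamma> \<in> R" for \<beta> \<gamma>
  proof -
    obtain m :: int where "\<beta> (coroot \<gamma>) = of_int m"
      using coroot[OF \<open>\<gamma> \<in> R\<close>] root_coroot_integral[OF _ \<open>\<gamma> \<in> R\<close> \<open>\<beta> \<in> R\<close>] by metis
    then show ?thesis using f(2)[of "of_int m" 1] f(3) by simp
  qed
  have on_coroot: "\<alpha> (coroot \<gamma>) = (\<Sum>\<beta>\<in>S. of_rat (f (c \<beta>)) * \<beta> (coroot \<gamma>))" if \<gamma>: "\<gamma> \<in> R" for \<gamma>
  proof -
    have "f (\<alpha> (coroot \<gamma>)) = (\<Sum>\<beta>\<in>S. f (c \<beta>) * f (\<beta> (coroot \<gamma>)))"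
      unfolding c[OF coroot_in_a[OF \<gamma>]] f_sum
    proof (rule sum.cong[OF refl])
      fix \<beta> assume "\<beta> \<in> S"
      then have "\<beta> (coroot \<gamma>) = of_rat (f (\<beta> (coroot \<gamma>)))" using int \<gamma> assms(2) by blast
      then show "f (c \<beta> * \<beta> (coroot \<gamma>)) = f (c \<beta>) * f (\<beta> (coroot \<gamma>))"
        using f(2)[of "f (\<beta> (coroot \<gamma>))" "c \<beta>"] by (simp add: mult.commute)
    qed
    then have "\<alpha> (coroot \<gamma>) = of_rat (\<Sum>\<beta>\<in>S. f (c \<beta>) * f (\<beta> (coroot \<gamma>)))"
      using int[OF assms(3) \<gamma>] by simp
    also have "\<dots> = (\<Sum>\<beta>\<in>S. of_rat (f (c \<beta>)) * \<beta> (coroot \<gamma>))"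
      using int \<gamma> assms(2) by (auto simp: of_rat_sum of_rat_mult intro!: sum.cong)
    finally show ?thesis .
  qed
  have lin: "\<beta> (\<Sum>\<gamma>\<in>T. smult_mat (a \<gamma>) (coroot \<gamma>)) = (\<Sum>\<gamma>\<in>T. a \<gamma> * \<beta> (coroot \<gamma>))"
    if "\<beta> \<in> R" "T \<subseteq> R" for \<beta> a T
    using that(2)
  proof (induction T rule: infinite_finite_induct)
    case (insert \<gamma> T)
    have "(\<Sum>\<gamma>\<in>T. smult_mat (a \<gamma>) (coroot \<gamma>)) \<in> \<aa>"
      using insert.prems by (intro lie_algebra_closed_sum lie_algebra_smult coroot_in_a) auto
    then show ?case
      using insert dual_spaceD(1,2)[OF d[OF that(1)]] by (simp add: coroot_in_a a_closed)
  qed (use dual_spaceD(2)[OF d[OF that(1)] a_closed(1), of 0] in \<open>auto simp: smult_mat_0\<close>)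
  show ?thesis
  proof (intro exI ext)
    fix H
    show "\<alpha> H = (\<Sum>\<beta>\<in>S. of_rat (f (c \<beta>)) * \<beta> H)"
    proof (cases "H \<in> \<aa>")
      case False
      have "\<beta> H = 0" if "\<beta> \<in> R" for \<beta> using dual_spaceD(3)[OF d[OF that] False] .
      moreover from this have "(\<Sum>\<beta>\<in>S. of_rat (f (c \<beta>)) * \<beta> H) = 0"
        using assms(2) by (intro sum.neutral) auto
      ultimately show ?thesis using assms(3) by simp
    next
      case True
      obtain a where a: "H = (\<Sum>\<gamma>\<in>R. smult_mat (a \<gamma>) (coroot \<gamma>))" using coroots_span[OF True] by blast
      have "(\<Sum>\<beta>\<in>S. of_rat (f (c \<beta>)) * \<beta> H) = (\<Sum>\<beta>\<in>S. of_rat (f (c \<beta>)) * (\<Sum>\<gamma>\<in>R. a \<gamma> * \<beta> (coroot \<gamma>)))"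
        unfolding a using lin[OF _ order_refl] assms(2) by (intro sum.cong refl) auto
      also have "\<dots> = (\<Sum>\<gamma>\<in>R. a \<gamma> * (\<Sum>\<beta>\<in>S. of_rat (f (c \<beta>)) * \<beta> (coroot \<gamma>)))"
        unfolding sum_distrib_left by (subst sum.swap) (simp add: ac_simps)
      also have "\<dots> = (\<Sum>\<gamma>\<in>R. a \<gamma> * \<alpha> (coroot \<gamma>))" using on_coroot by (intro sum.cong) auto
      also have "\<dots> = \<alpha> H" unfolding a using lin[OF assms(3) order_refl] by simp
      finally show ?thesis ..
    qed
  qed
qed

end

section \<open>Coefficientwise description and normalizer of the lattice\<close>

locale root_valuation = cartan G A for G A :: "('n::finite cmat) set" +
  fixes r lam k :: "('n cmat \<Rightarrow> complex) \<Rightarrow> int"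
  assumes rvf: "root_valuation_function G A r" and k_def: "k = (\<lambda>\<alpha>. lam \<alpha> - r \<alpha>)"
begin

lemma r_combination:
  assumes "finite S" "S \<subseteq> R" "\<alpha> \<in> R" "\<alpha> = (\<lambda>H. \<Sum>\<beta>\<in>S. of_rat (q \<beta>) * \<beta> H)" "\<And>\<beta>. \<beta> \<in> S \<Longrightarrow> r \<beta> \<ge> m"
  shows "r \<alpha> \<ge> m"
proof -
  have "rat_closed R {\<alpha> \<in> R. r \<alpha> \<ge> m}" using rvf by (simp add: root_valuation_function_def)
  moreover have "S \<subseteq> {\<alpha> \<in> R. r \<alpha> \<ge> m}" using assms by auto
  ultimately have "\<alpha> \<in> {\<alpha> \<in> R. r \<alpha> \<ge> m}" using assms(1,3,4) unfolding rat_closed_def by blast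
  then show ?thesis by simp
qed

lemma r_uminus: "\<alpha> \<in> R \<Longrightarrow> r (- \<alpha>) = r \<alpha>"
proof -
  have "r (- \<alpha>) \<ge> r \<alpha>" if \<alpha>: "\<alpha> \<in> R" for \<alpha>
  proof -
    have e: "- \<alpha> = (\<lambda>H. \<Sum>\<beta>\<in>{\<alpha>}. of_rat (-1) * \<beta> H)" by (simp add: fun_eq_iff)
    show ?thesis by (rule r_combination[OF _ _ _ e]) (use \<alpha> root_sl2(1) in auto)
  qed
  from this[of \<alpha>] this[of "- \<alpha>"] show "\<alpha> \<in> R \<Longrightarrow> r (- \<alpha>) = r \<alpha>" using root_sl2(1) by force
qed

lemma r_add:
  assumes "\<alpha> \<in> R" "\<beta> \<in> R" "\<alpha> + \<beta> \<in> R"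
  shows "r (\<alpha> + \<beta>) \<ge> min (r \<alpha>) (r \<beta>)"
\<comment> \<open>Rational combinations are sums over a set of roots, so equal summands have to be
  merged into one with coefficient 2.\<close>
proof (cases "\<alpha> = \<beta>")
  case True
  have e: "\<alpha> + \<beta> = (\<lambda>H. \<Sum>\<gamma>\<in>{\<alpha>}. of_rat 2 * \<gamma> H)" by (simp add: fun_eq_iff True)
  show ?thesis by (rule r_combination[OF _ _ assms(3) e]) (use assms True in auto)
next
  case False
  have e: "\<alpha> + \<beta> = (\<lambda>H. \<Sum>\<gamma>\<in>{\<alpha>, \<beta>}. of_rat 1 * \<gamma> H)" using False by (simp add: fun_eq_iff[of "\<alpha> + \<beta>"])
  show ?thesis by (rule r_combination[OF _ _ assms(3) e]) (use assms in auto)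
qed

text \<open>A root of value \<open>m\<close> that vanishes on the common kernel of the roots of
  larger value would be a rational combination of them, against the closedness of
  \<open>{\<beta>. r \<beta> \<ge> m + 1}\<close>. The finitely many roots of value \<open>m\<close>
  are then avoided simultaneously.\<close>

lemma ex_a_level:
  "\<exists>H\<in>\<aa>. (\<forall>\<beta>\<in>R. r \<beta> > m \<longrightarrow> \<beta> H = 0) \<and> (\<forall>\<beta>\<in>R. r \<beta> = m \<longrightarrow> \<beta> H \<noteq> 0)"
proof -
  let ?V = "{H \<in> \<aa>. \<forall>\<beta>\<in>R. r \<beta> > m \<longrightarrow> \<beta> H = 0}"
  have "\<exists>H\<in>?V. \<forall>\<beta>\<in>{\<beta>\<in>R. r \<beta> = m}. \<beta> H \<noteq> 0"
  proof (rule hyperplanes_avoid[where add = "(+)" and sc = smult_mat])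
    have "0 \<in> ?V"
      using a_closed(1) dual_spaceD(2)[OF root_dual a_closed(1), of _ 0] by (auto simp: smult_mat_0)
    then show "?V \<noteq> {}" by blast
    fix \<alpha> assume \<alpha>: "\<alpha> \<in> {\<beta>\<in>R. r \<beta> = m}"
    show "\<exists>H\<in>?V. \<alpha> H \<noteq> 0"
    proof (rule ccontr)
      assume n: "\<not> (\<exists>H\<in>?V. \<alpha> H \<noteq> 0)"
      let ?S = "{\<beta>\<in>R. r \<beta> \<ge> m + 1}"
      have "\<exists>q. \<alpha> = (\<lambda>H. \<Sum>\<beta>\<in>?S. of_rat (q \<beta>) * \<beta> H)"
        by (rule rational_combination) (use \<alpha> n finite_roots in auto)
      then obtain q where q: "\<alpha> = (\<lambda>H. \<Sum>\<beta>\<in>?S. of_rat (q \<beta>) * \<beta> H)" by blast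
      have "r \<alpha> \<ge> m + 1" by (rule r_combination[OF _ _ _ q]) (use \<alpha> finite_roots in auto)
      then show False using \<alpha> by simp
    qed
  qed (use finite_roots a_closed in \<open>auto simp: dual_spaceD(1,2)[OF root_dual]\<close>)
  then show ?thesis by blast
qed

text \<open>The coefficients of \<open>\<epsilon>\<^sup>m\<close> of the elements of the lattice with torus bound \<open>s\<close> and root exponents \<open>l\<close>.\<close>

definition level :: "(('n cmat \<Rightarrow> complex) \<Rightarrow> int) \<Rightarrow> (('n cmat \<Rightarrow> complex) \<Rightarrow> int) \<Rightarrow> int \<Rightarrow> 'n cmat set"
  where "level s l m = {Z \<in> \<gg>. (\<forall>\<alpha>\<in>R. m < l \<alpha> \<longrightarrow> proj_wt \<alpha> Z = 0) \<and> (\<forall>\<beta>\<in>R. m < s \<beta> \<longrightarrow> \<beta> (proj_wt 0 Z) = 0)}"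

lemma root_at_0: "\<beta> \<in> R \<Longrightarrow> \<beta> 0 = 0"
  using dual_spaceD(2)[OF root_dual a_closed(1), of \<beta> 0] by (simp add: smult_mat_0)

lemma level_closed:
  "0 \<in> level s l m" "X \<in> level s l m \<Longrightarrow> Y \<in> level s l m \<Longrightarrow> X + Y \<in> level s l m"
  "X \<in> level s l m \<Longrightarrow> smult_mat c X \<in> level s l m"
  by (auto simp: level_def lie_algebra_0 lie_algebra_add lie_algebra_smult proj_wt_linear root_at_0 smult_mat_0
      dual_spaceD(1,2)[OF root_dual] proj_wt_0_in_a)

lemma level_sum: "(\<And>i. i \<in> I \<Longrightarrow> f i \<in> level s l m) \<Longrightarrow> sum f I \<in> level s l m"
  by (induction I rule: infinite_finite_induct) (auto simp: level_closed)

lemma level_mono: "m \<le> m' \<Longrightarrow> level s l m \<subseteq> level s l m'"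
  by (auto simp: level_def)

lemma level_sub: "X \<in> level s l m \<Longrightarrow> X \<in> \<gg>"
  by (simp add: level_def)

lemma a_in_level: "H \<in> \<aa> \<Longrightarrow> (\<And>\<beta>. \<beta> \<in> R \<Longrightarrow> m < s \<beta> \<Longrightarrow> \<beta> H = 0) \<Longrightarrow> H \<in> level s l m"
  using a_sub by (auto simp: level_def proj_wt_a roots_iff)

lemma root_space_in_level:
  "\<alpha> \<in> R \<Longrightarrow> X \<in> root_space G A \<alpha> \<Longrightarrow> l \<alpha> \<le> m \<Longrightarrow> X \<in> level s l m"
  using root_space_sub[of X \<alpha>]
  by (auto simp: level_def proj_wt_root_space[OF root_dual] root_at_0 roots_iff)

text \<open>\<open>X \<in> stab i\<close> means that \<open>\<epsilon>\<^sup>i X\<close> normalizes the lattice \<open>\<Lambda>\<close>.\<close>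

definition stab :: "int \<Rightarrow> 'n cmat set"
  where "stab i = {X \<in> \<gg>. \<forall>m. \<forall>Z\<in>level r lam m. lie_bracket X Z \<in> level r lam (m + i)}"

lemma proj_wt_bracket:
  assumes "\<beta> \<in> dual_space \<aa>" "Y \<in> root_space G A \<beta>" "X \<in> \<gg>"
  shows "proj_wt (\<alpha> + \<beta>) (lie_bracket X Y) = lie_bracket (proj_wt \<alpha> X) Y"
proof -
  have e: "lie_bracket X Y = (\<Sum>\<gamma>\<in>wts. lie_bracket (proj_wt \<gamma> X) Y)"
    by (simp add: lie_bracket_sum(1)[symmetric] sum_proj_wt)
  have p: "proj_wt (\<alpha> + \<beta>) (lie_bracket (proj_wt \<gamma> X) Y) = (if \<gamma> = \<alpha> then lie_bracket (proj_wt \<gamma> X) Y else 0)"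
    if "\<gamma> \<in> wts" for \<gamma>
    using proj_wt_root_space[OF dual_add[OF wt_dual[OF that] assms(1)]
        bracket_root_space[OF proj_wt_in_root_space[OF that assms(3)] assms(2)], of "\<alpha> + \<beta>"] by auto
  show ?thesis
  proof (cases "\<alpha> \<in> wts")
    case True
    then show ?thesis unfolding e proj_wt_sum using finite_wts by (simp add: p)
  next
    case False
    then have "wt i - wt j \<noteq> \<alpha>" for i j unfolding wts_def by auto
    then have "proj_wt \<alpha> X = 0" by (intro cj_eqI) (simp add: cj_proj_wt cj_lin_nth)
    moreover have "proj_wt (\<alpha> + \<beta>) (lie_bracket X Y) = 0"
      unfolding e proj_wt_sum using False by (intro sum.neutral) (auto simp: p)
    ultimately show ?thesis by simp
  qed
qed

lemma proj_wt_bracket_a: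
  assumes "H \<in> \<aa>" "X \<in> \<gg>"
  shows "proj_wt \<alpha> (lie_bracket X H) = lie_bracket (proj_wt \<alpha> X) H"
  using proj_wt_bracket[OF zero_dual, of H X \<alpha>] assms centralizer_eq_a by simp

lemma bracket_a_root: "X \<in> root_space G A \<alpha> \<Longrightarrow> H \<in> \<aa> \<Longrightarrow> lie_bracket X H = smult_mat (- \<alpha> H) X"
  using lie_bracket_antisym[of X H] by (simp add: root_space_def) (simp add: smult_mat_def vec_eq_iff)

lemma smult_mat_eq_0_iff: "smult_mat c X = 0 \<longleftrightarrow> c = 0 \<or> X = (0 :: 'n cmat)"
  by (auto simp: smult_mat_def vec_eq_iff)

text \<open>Two kinds of test elements: an \<open>H\<close> of exponent \<open>r \<alpha>\<close>
  with \<open>\<alpha> H \<noteq> 0\<close> bounds the \<open>\<alpha>\<close>-component by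
  \<open>lam \<alpha> - r \<alpha>\<close>, and root vectors bound the torus component by 0.\<close>

lemma stab_sub_level: "stab i \<subseteq> level (\<lambda>_. 0) k i"
proof
  fix X assume X: "X \<in> stab i"
  then have Xg: "X \<in> \<gg>" by (simp add: stab_def)
  show "X \<in> level (\<lambda>_. 0) k i"
    unfolding level_def
  proof (intro CollectI conjI ballI impI Xg)
    fix \<alpha> assume \<alpha>: "\<alpha> \<in> R" "i < k \<alpha>"
    obtain H where H: "H \<in> \<aa>" "\<And>\<beta>. \<beta> \<in> R \<Longrightarrow> r \<beta> > r \<alpha> \<Longrightarrow> \<beta> H = 0" "\<alpha> H \<noteq> 0"
      using ex_a_level[of "r \<alpha>"] \<alpha>(1) by blast
    have "H \<in> level r lam (r \<alpha>)" by (rule a_in_level[OF H(1)]) (rule H(2))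
    then have "lie_bracket X H \<in> level r lam (r \<alpha> + i)" using X by (simp add: stab_def)
    then have "lie_bracket (proj_wt \<alpha> X) H = 0"
      using \<alpha> by (simp add: level_def k_def proj_wt_bracket_a[OF H(1) Xg])
    moreover have "proj_wt \<alpha> X \<in> root_space G A \<alpha>"
      using proj_wt_in_root_space roots_sub_wts \<alpha>(1) Xg by blast
    ultimately show "proj_wt \<alpha> X = 0" using H by (simp add: bracket_a_root smult_mat_eq_0_iff)
  next
    fix \<alpha> assume \<alpha>: "\<alpha> \<in> R" "i < 0"
    obtain y where y: "y \<in> root_space G A \<alpha>" "y \<noteq> 0" using \<alpha>(1) by (auto simp: roots_iff)
    have "y \<in> level r lam (lam \<alpha>)" by (rule root_space_in_level[OF \<alpha>(1) y(1)]) simp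
    then have "lie_bracket X y \<in> level r lam (lam \<alpha> + i)" using X by (simp add: stab_def)
    then have "proj_wt (0 + \<alpha>) (lie_bracket X y) = 0" using \<alpha> by (simp add: level_def)
    then have "lie_bracket (proj_wt 0 X) y = 0"
      unfolding proj_wt_bracket[OF root_dual[OF \<alpha>(1)] y(1) Xg] .
    moreover have "lie_bracket (proj_wt 0 X) y = smult_mat (\<alpha> (proj_wt 0 X)) y"
      using y(1) proj_wt_0_in_a[OF Xg] by (simp add: root_space_def)
    ultimately show "\<alpha> (proj_wt 0 X) = 0" using y(2) by (simp add: smult_mat_eq_0_iff)
  qed
qed

section \<open>The two conditions as normalizer conditions on root spaces\<close>

definition cond1 :: bool where "cond1 \<longleftrightarrow> (\<forall>\<alpha>\<in>R. k \<alpha> + k (- \<alpha>) \<ge> r_max G A r \<alpha> - r \<alpha>)"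

definition cond2 :: bool where "cond2 \<longleftrightarrow> (\<forall>\<alpha>\<in>R. \<forall>\<beta>\<in>R. \<alpha> + \<beta> \<in> R \<longrightarrow>
    k \<alpha> + k \<beta> - k (\<alpha> + \<beta>) \<ge> r (\<alpha> + \<beta>) - min (r \<alpha>) (r \<beta>))"

lemma r_max_ge:
  assumes "\<beta> \<in> R" "\<not> strongly_orthogonal R \<alpha> \<beta>"
  shows "r \<beta> \<le> r_max G A r \<alpha>"
  unfolding r_max_def using assms finite_roots by (intro Max_ge) auto

lemma r_max_attained:
  assumes "\<alpha> \<in> R"
  shows "\<exists>\<beta>\<in>R. \<not> strongly_orthogonal R \<alpha> \<beta> \<and> r_max G A r \<alpha> = r \<beta>"
proof -
  have "r_max G A r \<alpha> \<in> r ` {\<beta> \<in> R. \<not> strongly_orthogonal R \<alpha> \<beta>}"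
    unfolding r_max_def using assms finite_roots by (intro Max_in) (auto simp: strongly_orthogonal_def)
  then show ?thesis by auto
qed

text \<open>A root \<open>\<gamma>\<close> strongly orthogonal to \<open>\<alpha>\<close> vanishes on \<open>[\<gg>\<^sub>\<alpha>, \<gg>\<^sub>-\<^sub>\<alpha>]\<close>, because both factors commute with \<open>\<gg>\<^sub>\<gamma>\<close>.\<close>

lemma not_strongly_orthogonal:
  assumes \<alpha>: "\<alpha> \<in> R" and \<gamma>: "\<gamma> \<in> R" and x: "x \<in> root_space G A \<alpha>" and y: "y \<in> root_space G A (- \<alpha>)"
    and n: "\<gamma> (lie_bracket x y) \<noteq> 0"
  shows "\<not> strongly_orthogonal R \<alpha> \<gamma>"
proof
  assume so: "strongly_orthogonal R \<alpha> \<gamma>"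
  have "\<gamma> - \<alpha> \<notin> R" "\<gamma> - \<alpha> \<noteq> 0"
    using so root_sl2(1)[of "\<gamma> - \<alpha>"] by (auto simp: strongly_orthogonal_def)
  obtain z where z: "z \<in> root_space G A \<gamma>" "z \<noteq> 0" using \<gamma> by (auto simp: roots_iff)
  have xz: "lie_bracket x z = 0"
    using bracket_not_root[OF root_dual[OF \<alpha>] root_dual[OF \<gamma>] x z(1)] so by (auto simp: strongly_orthogonal_def)
  have "- \<alpha> + \<gamma> = \<gamma> - \<alpha>" by simp
  then have yz: "lie_bracket y z = 0"
    using bracket_not_root[OF dual_uminus[OF root_dual[OF \<alpha>]] root_dual[OF \<gamma>] y z(1)] \<open>\<gamma> - \<alpha> \<notin> R\<close> \<open>\<gamma> - \<alpha> \<noteq> 0\<close> by simp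
  have "lie_bracket x (lie_bracket y z) = lie_bracket (lie_bracket x y) z + lie_bracket y (lie_bracket x z)"
    by (rule lie_bracket_jacobi)
  then have "lie_bracket (lie_bracket x y) z = 0" by (simp add: xz yz)
  moreover have "lie_bracket x y \<in> \<aa>" using bracket_root_space[OF x y] centralizer_eq_a by simp
  ultimately show False using z n by (auto simp: root_space_def smult_mat_eq_0_iff)
qed

text \<open>Brackets with the torus part land in exponent
  \<open>r \<alpha> + k \<alpha> = lam \<alpha>\<close>. Condition (2) covers brackets into other
  root spaces. Condition (1) covers brackets into \<open>\<aa>\<close>, where only roots not
  strongly orthogonal to \<alpha> can be nonzero.\<close>

lemma root_space_in_stab:
  assumes c: cond1 cond2 and \<alpha>: "\<alpha> \<in> R" and X: "X \<in> root_space G A \<alpha>"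
  shows "X \<in> stab (k \<alpha>)"
  unfolding stab_def
proof (intro CollectI conjI allI ballI)
  show Xg: "X \<in> \<gg>" by (rule root_space_sub[OF X])
  fix m Z assume Z: "Z \<in> level r lam m"
  then have Zg: "Z \<in> \<gg>" by (rule level_sub)
  have "lie_bracket X (proj_wt 0 Z) \<in> level r lam (m + k \<alpha>)"
  proof (cases "m < r \<alpha>")
    case True
    then have "\<alpha> (proj_wt 0 Z) = 0" using Z \<alpha> by (simp add: level_def)
    then show ?thesis
      using bracket_a_root[OF X proj_wt_0_in_a[OF Zg]] by (simp add: mat_mult(1)[symmetric] level_closed)
  next
    case False
    have "lie_bracket X (proj_wt 0 Z) \<in> root_space G A \<alpha>"
      using bracket_a_root[OF X proj_wt_0_in_a[OF Zg]] root_space_closed(3)[OF X] by simp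
    then show ?thesis using False by (intro root_space_in_level[OF \<alpha>]) (auto simp: k_def)
  qed
  moreover have "lie_bracket X (proj_wt \<beta> Z) \<in> level r lam (m + k \<alpha>)" if \<beta>: "\<beta> \<in> R" for \<beta>
  proof (cases "m < lam \<beta>")
    case True
    then show ?thesis using Z \<beta> by (simp add: level_def[of r lam m] level_closed)
  next
    case False
    have Zb: "proj_wt \<beta> Z \<in> root_space G A \<beta>" using proj_wt_in_root_space roots_sub_wts \<beta> Zg by blast
    have br: "lie_bracket X (proj_wt \<beta> Z) \<in> root_space G A (\<alpha> + \<beta>)" by (rule bracket_root_space[OF X Zb])
    consider "\<alpha> + \<beta> \<in> R" | "\<alpha> + \<beta> = 0" | "\<alpha> + \<beta> \<notin> R" "\<alpha> + \<beta> \<noteq> 0" by blast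
    then show ?thesis
    proof cases
      case 1
      then have "k \<alpha> + k \<beta> - k (\<alpha> + \<beta>) \<ge> r (\<alpha> + \<beta>) - min (r \<alpha>) (r \<beta>)" using c(2) \<alpha> \<beta> by (simp add: cond2_def)
      then have "lam (\<alpha> + \<beta>) \<le> m + k \<alpha>" using False by (simp add: k_def)
      then show ?thesis by (rule root_space_in_level[OF 1 br])
    next
      case 2
      then have b: "\<beta> = - \<alpha>" by (metis add_eq_0_iff)
      have ina: "lie_bracket X (proj_wt \<beta> Z) \<in> \<aa>" using br 2 centralizer_eq_a by simp
      show ?thesis
      proof (rule a_in_level[OF ina], rule ccontr)
        fix \<gamma> assume \<gamma>: "\<gamma> \<in> R" "m + k \<alpha> < r \<gamma>" "\<gamma> (lie_bracket X (proj_wt \<beta> Z)) \<noteq> 0"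
        have "\<not> strongly_orthogonal R \<alpha> \<gamma>"
          using not_strongly_orthogonal[OF \<alpha> \<gamma>(1) X Zb[unfolded b]] \<gamma>(3) b by simp
        then have "r \<gamma> \<le> r_max G A r \<alpha>" by (rule r_max_ge[OF \<gamma>(1)])
        moreover have "k \<alpha> + k (- \<alpha>) \<ge> r_max G A r \<alpha> - r \<alpha>" using c(1) \<alpha> by (simp add: cond1_def)
        moreover have "lam (- \<alpha>) = k (- \<alpha>) + r \<alpha>" using r_uminus[OF \<alpha>] by (simp add: k_def)
        ultimately show False using \<gamma>(2) False b by simp
      qed
    next
      case 3
      then have "lie_bracket X (proj_wt \<beta> Z) = 0"
        using bracket_not_root[OF root_dual[OF \<alpha>] root_dual[OF \<beta>] X Zb] by simp
      then show ?thesis by (simp add: level_closed)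
    qed
  qed
  ultimately show "lie_bracket X Z \<in> level r lam (m + k \<alpha>)"
    by (subst root_decomposition[OF Zg]) (auto simp: lie_bracket_add lie_bracket_sum intro!: level_closed level_sum)
qed

lemma conditions_of_stab:
  assumes st: "\<And>\<alpha> x. \<alpha> \<in> R \<Longrightarrow> x \<in> root_space G A \<alpha> \<Longrightarrow> \<exists>X\<in>stab (k \<alpha>). proj_wt \<alpha> X = x"
  shows cond1 cond2
proof -
  \<comment> \<open>One half of condition (2), with \<open>r \<beta>\<close> in place of the
    minimum; exchanging the two roots gives the other half.\<close>
  have half: "k \<alpha> + lam \<beta> \<ge> lam (\<alpha> + \<beta>)" if \<alpha>: "\<alpha> \<in> R" and \<beta>: "\<beta> \<in> R" and s: "\<alpha> + \<beta> \<in> R" for \<alpha> \<beta>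
  proof -
    obtain x y where xy: "x \<in> root_space G A \<alpha>" "y \<in> root_space G A \<beta>" "lie_bracket x y \<noteq> 0"
      using bracket_root_spaces_nonzero[OF \<alpha> \<beta> s] by blast
    obtain X where X: "X \<in> stab (k \<alpha>)" "proj_wt \<alpha> X = x" using st[OF \<alpha> xy(1)] by blast
    have Xg: "X \<in> \<gg>" using X(1) by (simp add: stab_def)
    have "y \<in> level r lam (lam \<beta>)" by (rule root_space_in_level[OF \<beta> xy(2)]) simp
    then have "lie_bracket X y \<in> level r lam (lam \<beta> + k \<alpha>)" using X(1) by (simp add: stab_def)
    moreover have "proj_wt (\<alpha> + \<beta>) (lie_bracket X y) \<noteq> 0"
      using proj_wt_bracket[OF root_dual[OF \<beta>] xy(2) Xg, of \<alpha>] X(2) xy(3) by simp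
    ultimately show ?thesis using s by (force simp: level_def)
  qed
  \<comment> \<open>Covers the roots \<open>\<beta> = \<alpha>\<close> and
    \<open>\<beta> = - \<alpha>\<close> in the maximum, where
    \<open>r \<beta> = r \<alpha>\<close>.\<close>
  have opp: "k \<alpha> + k (- \<alpha>) \<ge> 0" if \<alpha>: "\<alpha> \<in> R" for \<alpha>
  proof -
    obtain e f where t: "e \<in> root_space G A \<alpha>" "f \<in> root_space G A (- \<alpha>)" "lie_bracket e f \<in> \<aa>" "\<alpha> (lie_bracket e f) = 2"
      using root_sl2(2)[OF \<alpha>] by blast
    obtain X where X: "X \<in> stab (k \<alpha>)" "proj_wt \<alpha> X = e" using st[OF \<alpha> t(1)] by blast
    have Xg: "X \<in> \<gg>" using X(1) by (simp add: stab_def)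
    have m: "- \<alpha> \<in> R" by (rule root_sl2(1)[OF \<alpha>])
    have "f \<in> level r lam (lam (- \<alpha>))" by (rule root_space_in_level[OF m t(2)]) simp
    then have "lie_bracket X f \<in> level r lam (lam (- \<alpha>) + k \<alpha>)" using X(1) by (simp add: stab_def)
    moreover have "proj_wt 0 (lie_bracket X f) = lie_bracket e f"
      using proj_wt_bracket[OF root_dual[OF m] t(2) Xg, of \<alpha>] X(2) by simp
    ultimately have "\<not> lam (- \<alpha>) + k \<alpha> < r \<alpha>" using \<alpha> t(4) by (force simp: level_def)
    then show ?thesis using r_uminus[OF \<alpha>] by (simp add: k_def)
  qed
  show c2: cond2
    unfolding cond2_def
  proof (intro ballI impI)
    fix \<alpha> \<beta> assume ab: "\<alpha> \<in> R" "\<beta> \<in> R" "\<alpha> + \<beta> \<in> R"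
    then show "k \<alpha> + k \<beta> - k (\<alpha> + \<beta>) \<ge> r (\<alpha> + \<beta>) - min (r \<alpha>) (r \<beta>)"
      using half[OF ab] half[of \<beta> \<alpha>] by (simp add: k_def add.commute min_def)
  qed
  \<comment> \<open>Adding (2) for the pairs \<open>(\<alpha>, \<beta>)\<close> and
    \<open>(- \<alpha>, \<alpha> + \<beta>)\<close> cancels the values of \<open>k\<close> at
    \<beta> and at \<open>\<alpha> + \<beta>\<close>; the remaining minima are absorbed by
    \<open>r_add\<close>.\<close>
  have key: "k \<alpha> + k (- \<alpha>) \<ge> r \<beta> - r \<alpha>" if \<alpha>: "\<alpha> \<in> R" and \<beta>: "\<beta> \<in> R" and s: "\<alpha> + \<beta> \<in> R" for \<alpha> \<beta>
  proof -
    have "k \<alpha> + k \<beta> - k (\<alpha> + \<beta>) \<ge> r (\<alpha> + \<beta>) - min (r \<alpha>) (r \<beta>)"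
      using c2 \<alpha> \<beta> s by (simp add: cond2_def)
    moreover have "k (- \<alpha>) + k (\<alpha> + \<beta>) - k (- \<alpha> + (\<alpha> + \<beta>)) \<ge> r (- \<alpha> + (\<alpha> + \<beta>)) - min (r (- \<alpha>)) (r (\<alpha> + \<beta>))"
      using c2 root_sl2(1)[OF \<alpha>] \<beta> s unfolding cond2_def by (metis add_minus_cancel minus_add_cancel)
    moreover have "r (\<alpha> + \<beta>) \<ge> min (r \<alpha>) (r \<beta>)" by (rule r_add[OF \<alpha> \<beta> s])
    ultimately show ?thesis using r_uminus[OF \<alpha>] by simp
  qed
  show cond1
    unfolding cond1_def
  proof
    fix \<alpha> assume \<alpha>: "\<alpha> \<in> R"
    obtain \<beta> where \<beta>: "\<beta> \<in> R" "\<not> strongly_orthogonal R \<alpha> \<beta>" "r_max G A r \<alpha> = r \<beta>"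
      using r_max_attained[OF \<alpha>] by blast
    consider "\<alpha> + \<beta> \<in> R" | "\<alpha> + \<beta> = 0" | "\<alpha> - \<beta> \<in> R" | "\<alpha> - \<beta> = 0"
      using \<beta>(2) by (auto simp: strongly_orthogonal_def)
    then show "k \<alpha> + k (- \<alpha>) \<ge> r_max G A r \<alpha> - r \<alpha>"
    proof cases
      case 1
      then show ?thesis using key[OF \<alpha> \<beta>(1)] \<beta>(3) by simp
    next
      case 2
      then have "\<beta> = - \<alpha>" by (metis add_eq_0_iff)
      then show ?thesis using opp[OF \<alpha>] r_uminus[OF \<alpha>] \<beta>(3) by simp
    next
      case 3
      then show ?thesis
        using key[OF \<alpha> root_sl2(1)[OF \<beta>(1)]] r_uminus[OF \<beta>(1)] \<beta>(3) by simp
    next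
      case 4
      then show ?thesis using opp[OF \<alpha>] \<beta>(3) by simp
    qed
  qed
qed

end

section \<open>Matrices over Laurent series\<close>

lemma coeff_mat_nth: "coeff_mat X m $ i $ j = fls_nth (X $ i $ j) m"
  by (simp add: coeff_mat_def)

lemma fmat_eqI: "(\<And>m. coeff_mat X m = coeff_mat Y m) \<Longrightarrow> X = Y"
  by (simp add: vec_eq_iff coeff_mat_def fls_eq_iff)

lemma coeff_mat_lin:
  "coeff_mat (X + Y) m = coeff_mat X m + coeff_mat Y m" "coeff_mat (X - Y) m = coeff_mat X m - coeff_mat Y m"
  "coeff_mat (- X) m = - coeff_mat X m" "coeff_mat 0 m = 0"
  "coeff_mat (smult_mat (fls_const c) X) m = smult_mat c (coeff_mat X m)"
  "coeff_mat (sum f S) m = (\<Sum>i\<in>S. coeff_mat (f i) m)"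
  by (simp_all add: coeff_mat_def vec_eq_iff smult_mat_def fls_nth_sum)

lemma fls_nth_X_intpow_mult: "fls_nth (fls_X_intpow i * f) m = fls_nth f (m - i)" for f :: "complex fls"
  by (simp add: fls_X_intpow_times_conv_shift)

lemma coeff_mat_shift: "coeff_mat (smult_mat (fls_X_intpow i) X) m = coeff_mat X (m - i)"
  by (simp add: coeff_mat_def vec_eq_iff smult_mat_def fls_nth_X_intpow_mult)

definition emono :: "int \<Rightarrow> 'n::finite cmat \<Rightarrow> 'n fmat"
  where "emono i Y = smult_mat (fls_X_intpow i) (map_mat fls_const Y)"

lemma coeff_emono: "coeff_mat (emono i Y) m = (if m = i then Y else 0)"
  unfolding emono_def coeff_mat_shift by (auto simp: coeff_mat_def vec_eq_iff)

lemma coeff_emono_mult: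
  "coeff_mat (emono i Y ** Z) m = Y ** coeff_mat Z (m - i)" "coeff_mat (Z ** emono i Y) m = coeff_mat Z (m - i) ** Y"
  unfolding emono_def smult_mat_mult coeff_mat_shift
  by (simp_all add: coeff_mat_def vec_eq_iff matrix_matrix_mult_def fls_nth_sum)

lemma coeff_bracket_emono:
  "coeff_mat (lie_bracket (emono i Y) Z) m = lie_bracket Y (coeff_mat Z (m - i))"
  "coeff_mat (lie_bracket Z (emono i Y)) m = lie_bracket (coeff_mat Z (m - i)) Y"
  by (simp_all add: lie_bracket_def coeff_mat_lin coeff_emono_mult)

lemma fmat_bounded: "\<exists>N. \<forall>m<N. coeff_mat (Z :: 'n::finite fmat) m = 0"
proof -
  define N where "N = Min (range (\<lambda>(i, j). fls_subdegree (Z $ i $ j)))"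
  have "N \<le> fls_subdegree (Z $ i $ j)" for i j
    unfolding N_def by (rule Min_le) (auto intro!: image_eqI[of _ _ "(i, j)"])
  then have "fls_nth (Z $ i $ j) m = 0" if "m < N" for i j m
    using that by (meson fls_eq0_below_subdegree less_le_trans)
  then show ?thesis by (intro exI[of _ N]) (simp add: coeff_mat_def vec_eq_iff)
qed

definition lift :: "('n::finite cmat \<Rightarrow> 'n cmat) \<Rightarrow> 'n fmat \<Rightarrow> 'n fmat"
  where "lift L Z = (\<chi> i j. Abs_fls (\<lambda>m. L (coeff_mat Z m) $ i $ j))"

lemma coeff_lift:
  assumes "L 0 = 0"
  shows "coeff_mat (lift L Z) m = L (coeff_mat Z m)"
proof -
  obtain N where "\<forall>m<N. coeff_mat Z m = 0" using fmat_bounded by blast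
  then have 1: "fls_nth (Abs_fls (\<lambda>m. L (coeff_mat Z m) $ i $ j)) m = L (coeff_mat Z m) $ i $ j" for i j
    by (intro nth_Abs_fls_ex_lower_bound exI[of _ N]) (simp add: assms)
  have "coeff_mat (lift L Z) m $ i $ j = L (coeff_mat Z m) $ i $ j" for i j
    unfolding coeff_mat_nth[of "lift L Z"] unfolding lift_def by (simp only: vec_lambda_beta 1)
  then show ?thesis by (simp add: vec_eq_iff)
qed

definition Lat :: "(int \<Rightarrow> 'n::finite cmat set) \<Rightarrow> 'n fmat set"
  where "Lat U = {Z. \<forall>m. coeff_mat Z m \<in> U m}"

lemma val_ge_iff: "val f \<ge> Fin n \<longleftrightarrow> (\<forall>m<n. fls_nth f m = 0)"
proof (cases "f = 0")
  case False
  then show ?thesis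
    using fls_subdegree_geI[of f n] by (auto simp: val_def)
qed (simp add: val_def)

lemma val_eq_iff: "val f = Fin n \<longleftrightarrow> (\<forall>m<n. fls_nth f m = 0) \<and> fls_nth f n \<noteq> 0"
proof (cases "f = 0")
  case False
  then show ?thesis
    using fls_subdegree_eqI[of f n] by (auto simp: val_def)
qed (simp add: val_def)

context cartan
begin

lemma extend_form_nth:
  assumes "\<alpha> \<in> R"
  shows "fls_nth (extend_form \<alpha> u) m = \<alpha> (coeff_mat u m)"
proof -
  have a0: "\<alpha> 0 = 0" using dual_spaceD(2)[OF root_dual[OF assms] a_closed(1), of 0] by (simp add: smult_mat_0)
  obtain N where "\<forall>m<N. coeff_mat u m = 0" using fmat_bounded by blast
  then show ?thesis
    unfolding extend_form_def by (intro nth_Abs_fls_ex_lower_bound exI[of _ N]) (simp add: a0)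
qed

lemma a_ge_iff: "u \<in> a_ge G A r \<longleftrightarrow> (\<forall>m. coeff_mat u m \<in> \<aa> \<and> (\<forall>\<alpha>\<in>R. m < r \<alpha> \<longrightarrow> \<alpha> (coeff_mat u m) = 0))"
  by (auto simp: a_ge_def points_F_def val_ge_iff extend_form_nth)

lemma a_eq_iff: "u \<in> a_eq G A r \<longleftrightarrow> u \<in> a_ge G A r \<and> (\<forall>\<alpha>\<in>R. \<alpha> (coeff_mat u (r \<alpha>)) \<noteq> 0)"
  by (auto simp: a_eq_def a_ge_iff points_F_def val_eq_iff extend_form_nth)

text \<open>Since the roots separate \<open>\<aa>\<close>, integrality is the bound 0 on every root.
  The bound is written \<open>(\<lambda>_. 0) \<alpha>\<close> to match the shape of
  \<open>a_ge_iff\<close>, so that one lemma treats both lattices.\<close>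

lemma points_O_a_iff:
  "u \<in> points_O \<aa> \<longleftrightarrow> (\<forall>m. coeff_mat u m \<in> \<aa> \<and> (\<forall>\<alpha>\<in>R. m < (\<lambda>_. 0) \<alpha> \<longrightarrow> \<alpha> (coeff_mat u m) = 0))"
proof -
  have "(\<forall>m<0. coeff_mat u m = 0) \<longleftrightarrow> (\<forall>m. \<forall>\<alpha>\<in>R. m < 0 \<longrightarrow> \<alpha> (coeff_mat u m) = 0)" if "\<forall>m. coeff_mat u m \<in> \<aa>"
    using roots_span that dual_spaceD(2)[OF root_dual a_closed(1), of _ 0] by (auto simp: smult_mat_0)
  then show ?thesis by (auto simp: points_O_def points_F_def)
qed

lemma P_lattice_iff: "X \<in> P_lattice G A \<alpha> n \<longleftrightarrow> (\<forall>m. coeff_mat X m \<in> root_space G A \<alpha> \<and> (m < n \<longrightarrow> coeff_mat X m = 0))"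
proof
  assume "X \<in> P_lattice G A \<alpha> n"
  then show "\<forall>m. coeff_mat X m \<in> root_space G A \<alpha> \<and> (m < n \<longrightarrow> coeff_mat X m = 0)"
    by (auto simp: P_lattice_def points_O_def points_F_def coeff_mat_shift)
next
  assume *: "\<forall>m. coeff_mat X m \<in> root_space G A \<alpha> \<and> (m < n \<longrightarrow> coeff_mat X m = 0)"
  have sh: "coeff_mat (smult_mat (fls_X_intpow (- n)) X) m = coeff_mat X (m + n)" for m
    by (simp only: coeff_mat_shift) simp
  show "X \<in> P_lattice G A \<alpha> n"
    unfolding P_lattice_def
  proof (rule image_eqI[of _ _ "smult_mat (fls_X_intpow (- n)) X"])
    show "X = smult_mat (fls_X_intpow n) (smult_mat (fls_X_intpow (- n)) X)"
      by (rule fmat_eqI) (simp only: coeff_mat_shift sh, simp)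
    show "smult_mat (fls_X_intpow (- n)) X \<in> points_O (root_space G A \<alpha>)"
      unfolding points_O_def points_F_def mem_Collect_eq sh using * by simp
  qed
qed

end

context root_valuation
begin

lemma root_lattice_eq_Lat:
  assumes M: "\<And>u. u \<in> M \<longleftrightarrow> (\<forall>m. coeff_mat u m \<in> \<aa> \<and> (\<forall>\<alpha>\<in>R. m < s \<alpha> \<longrightarrow> \<alpha> (coeff_mat u m) = 0))"
  shows "root_lattice G A M l = Lat (level s l)"
proof
  show "root_lattice G A M l \<subseteq> Lat (level s l)"
  proof
    fix Z assume "Z \<in> root_lattice G A M l"
    then obtain u X where Z: "Z = u + (\<Sum>\<alpha>\<in>R. X \<alpha>)" "u \<in> M" "\<And>\<alpha>. \<alpha> \<in> R \<Longrightarrow> X \<alpha> \<in> P_lattice G A \<alpha> (l \<alpha>)"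
      unfolding root_lattice_def by blast
    have "coeff_mat (X \<alpha>) m \<in> level s l m" if "\<alpha> \<in> R" for \<alpha> m
      using Z(3)[OF that] root_space_in_level[OF that, of "coeff_mat (X \<alpha>) m" l m s] level_closed(1)[of s l m]
      by (cases "m < l \<alpha>") (auto simp: P_lattice_iff)
    moreover have "coeff_mat u m \<in> level s l m" for m
      using Z(2) M by (intro a_in_level) auto
    ultimately show "Z \<in> Lat (level s l)"
      by (auto simp: Lat_def Z(1) coeff_mat_lin intro!: level_closed level_sum)
  qed
  show "Lat (level s l) \<subseteq> root_lattice G A M l"
  proof
    fix Z assume Z: "Z \<in> Lat (level s l)"
    then have lev: "coeff_mat Z m \<in> level s l m" for m by (simp add: Lat_def)
    note c = coeff_lift[of "proj_wt \<alpha>" for \<alpha>, OF proj_wt_linear(3)]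
    have "Z = lift (proj_wt 0) Z + (\<Sum>\<alpha>\<in>R. lift (proj_wt \<alpha>) Z)"
      by (rule fmat_eqI) (simp add: coeff_mat_lin c root_decomposition[OF level_sub[OF lev], symmetric])
    moreover have "lift (proj_wt 0) Z \<in> M"
      unfolding M c using lev proj_wt_0_in_a[OF level_sub[OF lev]] by (auto simp: level_def)
    moreover have "lift (proj_wt \<alpha>) Z \<in> P_lattice G A \<alpha> (l \<alpha>)" if "\<alpha> \<in> R" for \<alpha>
      unfolding P_lattice_iff c using lev proj_wt_in_root_space[OF _ level_sub[OF lev], of \<alpha>] roots_sub_wts that
      by (auto simp: level_def)
    ultimately show "Z \<in> root_lattice G A M l"
      unfolding root_lattice_def by blast
  qed
qed

lemma Lambda_eq: "Lambda G A r lam = Lat (level r lam)"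
  unfolding Lambda_def by (rule root_lattice_eq_Lat) (rule a_ge_iff)

lemma root_lattice_O_eq: "root_lattice G A (points_O \<aa>) l = Lat (level (\<lambda>_. 0) l)"
  by (rule root_lattice_eq_Lat) (rule points_O_a_iff)

lemma Lat_closed:
  "0 \<in> Lat (level s l)" "X \<in> Lat (level s l) \<Longrightarrow> Y \<in> Lat (level s l) \<Longrightarrow> X + Y \<in> Lat (level s l)"
  "X \<in> Lat (level s l) \<Longrightarrow> smult_mat (fls_const c) X \<in> Lat (level s l)"
  by (auto simp: Lat_def coeff_mat_lin level_closed)

lemma Lat_sum: "(\<And>i. i \<in> I \<Longrightarrow> f i \<in> Lat (level s l)) \<Longrightarrow> sum f I \<in> Lat (level s l)"
  by (induction I rule: infinite_finite_induct) (auto simp: Lat_closed)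

lemma bracket_emono_stab:
  assumes "X \<in> stab i" "Z \<in> Lat (level r lam)"
  shows "lie_bracket (emono i X) Z \<in> Lat (level r lam)"
proof -
  have "lie_bracket X (coeff_mat Z (m - i)) \<in> level r lam m" for m
    using assms unfolding stab_def Lat_def by (metis (mono_tags, lifting) diff_add_cancel mem_Collect_eq)
  then show ?thesis by (simp add: Lat_def coeff_bracket_emono)
qed

text \<open>Put the elements of \<open>ex_a_level\<close> into the exponents that occur as values of
  \<open>r\<close>: \<beta> kills those of exponent below \<open>r \<beta>\<close> and is nonzero on
  the one of exponent \<open>r \<beta>\<close>. Without such a point the submersion condition would
  be vacuous.\<close>

lemma ex_a_eq: "\<exists>u. u \<in> a_eq G A r \<and> (\<exists>h. finite (r ` R) \<and> (\<forall>m. h m \<in> \<aa>) \<and> u = (\<Sum>m\<in>r ` R. emono m (h m)))"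
proof -
  have "\<forall>m. \<exists>H\<in>\<aa>. (\<forall>\<beta>\<in>R. r \<beta> > m \<longrightarrow> \<beta> H = 0) \<and> (\<forall>\<beta>\<in>R. r \<beta> = m \<longrightarrow> \<beta> H \<noteq> 0)"
    using ex_a_level by blast
  then obtain h where h: "\<And>m. h m \<in> \<aa>" "\<And>m \<beta>. \<beta> \<in> R \<Longrightarrow> r \<beta> > m \<Longrightarrow> \<beta> (h m) = 0" "\<And>m \<beta>. \<beta> \<in> R \<Longrightarrow> r \<beta> = m \<Longrightarrow> \<beta> (h m) \<noteq> 0"
    by metis
  define u where "u = (\<Sum>m\<in>r ` R. emono m (h m))"
  have fin: "finite (r ` R)" using finite_roots by simp
  have cu: "coeff_mat u m = (if m \<in> r ` R then h m else 0)" for m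
    unfolding u_def coeff_mat_lin coeff_emono using fin by (simp add: sum.delta)
  have "u \<in> a_eq G A r"
    unfolding a_eq_iff a_ge_iff cu using h a_closed(1) root_at_0 by auto
  then show ?thesis using fin h(1) u_def by blast
qed

end

section \<open>Exponentials of nilpotent matrices\<close>

text \<open>The truncated exponential, polynomial in the formal variable. Unlike the series
  \<open>fexp\<close>, it can be evaluated at 1 over the field of Laurent series.\<close>

definition nexp :: "nat \<Rightarrow> 'a::field_char_0 ^ 'n ^ 'n \<Rightarrow> 'a poly ^ 'n ^ 'n"
  where "nexp n Y = (\<chi> i j. \<Sum>m<n. monom (matpow Y m $ i $ j / fact m) m)"

lemma matpow_add: "matpow X (m + k) = matpow X m ** matpow (X :: 'a::semiring_1 ^ 'n ^ 'n) k"
  by (induction k) (simp_all add: matrix_mul_assoc)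

lemma nexp_fexp:
  assumes "matpow Y n = 0"
  shows "map_mat fps_of_poly (nexp n Y) = fexp Y"
proof -
  have "matpow Y m = 0" if "m \<ge> n" for m
    using matpow_add[of Y n "m - n"] that assms by simp
  then show ?thesis
    by (auto simp: vec_eq_iff fps_eq_iff fexp_def nexp_def coeff_sum coeff_monom)
qed

lemma matpow_minus: "matpow (- Y) m = smult_mat ((-1) ^ m) (matpow (Y :: 'a::comm_ring_1 ^ 'n ^ 'n) m)"
proof -
  have "- Y = smult_mat (-1) Y" for Y :: "'a ^ 'n ^ 'n" by (simp add: smult_mat_def vec_eq_iff)
  then have "matpow (- Y) m = matpow (smult_mat (-1) Y) m" by metis
  also have "\<dots> = smult_mat ((-1) ^ m) (matpow Y m)"
    by (induction m) (simp_all add: smult_mat_mult smult_smult_mat mult.commute, simp add: smult_mat_def vec_eq_iff)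
  finally show ?thesis .
qed

definition nexp1 :: "nat \<Rightarrow> 'a::field_char_0 ^ 'n ^ 'n \<Rightarrow> 'a ^ 'n ^ 'n"
  where "nexp1 n Y = map_mat (\<lambda>p. poly p 1) (nexp n Y)"

lemma nexp1_eq: "nexp1 n Y = (\<Sum>m<n. smult_mat (1 / fact m) (matpow Y m))"
  by (simp add: nexp1_def nexp_def vec_eq_iff poly_sum poly_monom smult_mat_def)

lemma minus_commute: "(- Y) ** Y = Y ** (- (Y :: 'a::comm_ring_1 ^ 'n ^ 'n))"
  by (simp add: vec_eq_iff matrix_matrix_mult_def sum_negf)

lemma nexp1_minus:
  assumes "matpow Y n = 0"
  shows "nexp1 n Y ** nexp1 n (- Y) = mat 1"
proof -
  have n': "matpow (- Y) n = 0" using assms by (simp add: matpow_minus smult_mat_def vec_eq_iff)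
  have "map_mat fps_of_poly (nexp n Y ** nexp n (- Y)) = fexp (Y + - Y)"
    unfolding map_mat_mult[OF is_ring_hom_intros(9)] nexp_fexp[OF assms] nexp_fexp[OF n']
    by (rule fexp_add[symmetric]) (rule minus_commute)
  also have "\<dots> = map_mat fps_of_poly (mat 1)"
    by (simp add: fexp_zero map_mat_1[OF is_ring_hom_intros(9)])
  finally have "nexp n Y ** nexp n (- Y) = mat 1" by (simp add: vec_eq_iff)
  then show ?thesis
    unfolding nexp1_def map_mat_mult[OF is_ring_hom_intros(8), symmetric] by (simp add: map_mat_1[OF is_ring_hom_intros(8)])
qed

text \<open>The Taylor expansion of \<open>exp (t Y) Z exp (- t Y)\<close>, where each derivative
  inserts one bracket with \<open>Y\<close>. The entries are polynomials in \<open>t\<close>, so the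
  expansion stops at a bound \<open>N\<close> of their degrees and can be evaluated at
  \<open>t = 1\<close>.\<close>

lemma nexp1_conj:
  fixes Y Z :: "'a::field_char_0 ^ 'n ^ 'n"
  assumes "matpow Y n = 0"
  shows "\<exists>N. nexp1 n Y ** Z ** nexp1 n (- Y) = (\<Sum>m<N. smult_mat (1 / fact m) ((lie_bracket Y ^^ m) Z))"
proof -
  have n': "matpow (- Y) n = 0" using assms by (simp add: matpow_minus smult_mat_def vec_eq_iff)
  let ?c = "map_mat fps_const :: _ \<Rightarrow> 'a fps ^ 'n ^ 'n"
  let ?V = "\<lambda>Z. fexp Y ** ?c Z ** fexp (- Y)"
  have dV: "mat_deriv (?V Z) = ?V (lie_bracket Y Z)" for Z
  proof -
    have c0: "mat_deriv (?c Z) = 0" by (simp add: vec_eq_iff)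
    have "fexp (- Y) ** ?c (- Y) = ?c (- Y) ** fexp (- Y)" by (rule fexp_commute[symmetric]) simp
    moreover have "mat_deriv (?V Z) = (fexp Y ** ?c Y) ** ?c Z ** fexp (- Y) + fexp Y ** ?c Z ** (fexp (- Y) ** ?c (- Y))"
      by (simp only: mat_deriv_mult c0 fexp_deriv) simp
    ultimately have "mat_deriv (?V Z) = fexp Y ** (?c Y ** ?c Z + ?c Z ** ?c (- Y)) ** fexp (- Y)"
      by (simp only: matrix_add_ldistrib matrix_add_rdistrib' matrix_mul_assoc)
    also have "?c Y ** ?c Z + ?c Z ** ?c (- Y) = ?c (lie_bracket Y Z)"
      by (simp add: lie_bracket_def vec_eq_iff matrix_matrix_mult_def is_ring_hom_sum[OF is_ring_hom_intros(3)] sum_negf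
          fps_const_neg[symmetric] fps_const_sub[symmetric] del: fps_const_neg fps_const_sub)
    finally show ?thesis .
  qed
  have nth: "fps_nth (?V Z $ i $ j) m = (lie_bracket Y ^^ m) Z $ i $ j / fact m" for m i j Z
  proof (induction m arbitrary: Z)
    case 0
    have "map_mat (\<lambda>f. fps_nth f 0) (?V Z) = Z"
      unfolding map_mat_mult[OF is_ring_hom_intros(10)] fexp_0 by (simp add: vec_eq_iff)
    then show ?case by (simp add: vec_eq_iff)
  next
    case (Suc m)
    have "of_nat (Suc m) * fps_nth (?V Z $ i $ j) (Suc m) = fps_nth (mat_deriv (?V Z) $ i $ j) m" by simp
    also have "\<dots> = (lie_bracket Y ^^ Suc m) Z $ i $ j / fact m"
      unfolding dV Suc.IH by (simp add: funpow_swap1)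
    finally show ?case by (simp add: field_simps del: of_nat_Suc funpow.simps)
  qed
  define W where "W = nexp n Y ** map_mat (\<lambda>x. [:x:]) Z ** nexp n (- Y)"
  have WV: "map_mat fps_of_poly W = ?V Z"
  proof -
    have "map_mat fps_of_poly (map_mat (\<lambda>x. [:x:]) Z) = ?c Z" by (simp add: vec_eq_iff fps_of_poly_const)
    then show ?thesis
      unfolding W_def map_mat_mult[OF is_ring_hom_intros(9)] nexp_fexp[OF assms] nexp_fexp[OF n'] by simp
  qed
  define N where "N = Suc (Max (range (\<lambda>(i, j). degree (W $ i $ j))))"
  have deg: "degree (W $ i $ j) < N" for i j
    unfolding N_def by (intro le_imp_less_Suc Max_ge) (auto intro!: image_eqI[of _ _ "(i, j)"])
  have "nexp1 n Y ** Z ** nexp1 n (- Y) = map_mat (\<lambda>p. poly p 1) W"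
    unfolding W_def nexp1_def map_mat_mult[OF is_ring_hom_intros(8)] by (simp add: vec_eq_iff)
  also have "\<dots> = (\<Sum>m<N. smult_mat (1 / fact m) ((lie_bracket Y ^^ m) Z))"
  proof -
    have "poly (W $ i $ j) 1 = (\<Sum>m<N. (lie_bracket Y ^^ m) Z $ i $ j / fact m)" for i j
    proof -
      have "poly (W $ i $ j) 1 = (\<Sum>m\<le>degree (W $ i $ j). coeff (W $ i $ j) m)" by (simp add: poly_altdef)
      also have "\<dots> = (\<Sum>m<N. coeff (W $ i $ j) m)"
        using deg[of i j] by (intro sum.mono_neutral_left) (auto simp: coeff_eq_0)
      also have "\<dots> = (\<Sum>m<N. (lie_bracket Y ^^ m) Z $ i $ j / fact m)"
      proof (rule sum.cong[OF refl])
        fix m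
        have "coeff (W $ i $ j) m = fps_nth (map_mat fps_of_poly W $ i $ j) m" by simp
        then show "coeff (W $ i $ j) m = (lie_bracket Y ^^ m) Z $ i $ j / fact m" unfolding WV nth .
      qed
      finally show ?thesis .
    qed
    then show ?thesis by (simp add: vec_eq_iff smult_mat_def)
  qed
  finally show ?thesis ..
qed

text \<open>\<open>g exp (t Y)\<close> solves the differential equation with initial value
  \<open>g\<close>, so the equations of the group hold along it; being polynomial in
  \<open>t\<close>, it may be specialized to \<open>t = 1\<close>. The factor \<open>c\<close> will
  be a power of the uniformizer.\<close>

lemma (in matrix_monoid) mpoly_eval_nexp1:
  fixes g :: "'a::field_char_0 ^ 'n ^ 'n" and \<phi> :: "complex \<Rightarrow> 'a"
  assumes X: "X \<in> lie_algebra G" and \<phi>: "is_ring_hom \<phi>" and p: "p \<in> vanishing_ideal G"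
    and g: "\<And>p. p \<in> vanishing_ideal G \<Longrightarrow> mpoly_eval \<phi> p (entries g) = 0"
    and Y: "Y = smult_mat c (map_mat \<phi> X)" "matpow Y n = 0"
  shows "mpoly_eval \<phi> p (entries (g ** nexp1 n Y)) = 0"
proof -
  let ?W = "map_mat fps_const g ** fexp Y"
  have h: "is_ring_hom (\<lambda>z. fps_const (\<phi> z))" by (rule is_ring_hom_comp[OF \<phi> is_ring_hom_intros(3)])
  have h2: "is_ring_hom (\<lambda>z. [:\<phi> z:])" by (rule is_ring_hom_comp[OF \<phi> is_ring_hom_intros(5)])
  have "mpoly_eval (\<lambda>z. fps_const (\<phi> z)) p (entries ?W) = 0"
  proof (rule mpoly_eval_ODE_eq_0[OF X \<phi> _ _ p, where c = "fps_const c"])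
    fix i j
    have "mat_deriv (map_mat fps_const g) = 0" by (simp add: vec_eq_iff)
    then have "mat_deriv ?W = ?W ** map_mat fps_const Y"
      by (simp add: mat_deriv_mult fexp_deriv matrix_mul_assoc)
    also have "map_mat fps_const Y = smult_mat (fps_const c) (map_mat (\<lambda>z. fps_const (\<phi> z)) X)"
      by (simp add: Y(1) smult_mat_def vec_eq_iff)
    finally have "mat_deriv ?W $ i $ j = smult_mat (fps_const c) (?W ** map_mat (\<lambda>z. fps_const (\<phi> z)) X) $ i $ j"
      by (simp only: smult_mat_mult)
    then show "fps_deriv (?W $ i $ j) = fps_const c * (\<Sum>k\<in>UNIV. ?W $ i $ k * fps_const (\<phi> (X $ k $ j)))"
      by (simp add: smult_mat_def matrix_matrix_mult_def[of ?W])
  next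
    fix p assume "p \<in> vanishing_ideal G"
    moreover have "map_mat (\<lambda>f. fps_nth f 0) ?W = g"
      unfolding map_mat_mult[OF is_ring_hom_intros(10)] fexp_0 by (simp add: vec_eq_iff)
    ultimately show "mpoly_eval \<phi> p (entries (map_mat (\<lambda>f. fps_nth f 0) ?W)) = 0" using g by simp
  qed
  moreover define V where "V = map_mat (\<lambda>x. [:x:]) g ** nexp n Y"
  have "map_mat fps_of_poly V = ?W"
  proof -
    have "map_mat fps_of_poly (map_mat (\<lambda>x. [:x:]) g) = map_mat fps_const g" by (simp add: vec_eq_iff fps_of_poly_const)
    then show ?thesis unfolding V_def map_mat_mult[OF is_ring_hom_intros(9)] nexp_fexp[OF Y(2)] by simp
  qed
  then have "entries ?W = (\<lambda>v. fps_of_poly (entries V v))" by (auto simp: entries_def fun_eq_iff vec_eq_iff)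
  ultimately have "fps_of_poly (mpoly_eval (\<lambda>z. [:\<phi> z:]) p (entries V)) = 0"
    unfolding mpoly_eval_hom[OF is_ring_hom_intros(9) h2] by (simp add: fps_of_poly_const)
  then have "mpoly_eval (\<lambda>z. [:\<phi> z:]) p (entries V) = 0"
    using fps_of_poly_eq_iff[of _ 0] by simp
  then have "0 = poly (mpoly_eval (\<lambda>z. [:\<phi> z:]) p (entries V)) 1" by simp
  also have "\<dots> = mpoly_eval \<phi> p (\<lambda>v. poly (entries V v) 1)"
    unfolding mpoly_eval_hom[OF is_ring_hom_intros(8) h2] by simp
  also have "(\<lambda>v. poly (entries V v) 1) = entries (map_mat (\<lambda>p. poly p 1) V)" by (auto simp: entries_def fun_eq_iff)
  also have "map_mat (\<lambda>p. poly p 1) V = g ** nexp1 n Y"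
    unfolding V_def map_mat_mult[OF is_ring_hom_intros(8)] nexp1_def by (simp add: vec_eq_iff)
  finally show ?thesis ..
qed

section \<open>Regular functions on loop groups\<close>

text \<open>The range of summation depends on pole bounds instead of the actual subdegrees, so
  coefficients of products are given by one polynomial on all of
  \<open>loop_bounded\<close>.\<close>

lemma fls_mult_nth:
  fixes f g :: "complex fls"
  assumes "\<And>k. k < M \<Longrightarrow> fls_nth f k = 0" "\<And>k. k < N \<Longrightarrow> fls_nth g k = 0"
  shows "fls_nth (f * g) m = (\<Sum>j\<in>{M..m - N}. fls_nth f j * fls_nth g (m - j))"
proof (cases "f = 0 \<or> g = 0")
  case False
  then have "M \<le> fls_subdegree f" "N \<le> fls_subdegree g"
    using assms by (auto intro!: fls_subdegree_geI)
  then show ?thesis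
    unfolding fls_times_nth(2) by (intro sum.mono_neutral_left) (auto simp: not_le)
qed auto

lemma coeff_mat_mult:
  assumes "\<And>k. k < M \<Longrightarrow> coeff_mat X k = 0" "\<And>k. k < N \<Longrightarrow> coeff_mat Z k = 0"
  shows "coeff_mat (X ** Z) m = (\<Sum>j\<in>{M..m - N}. coeff_mat X j ** coeff_mat Z (m - j))"
proof -
  have z: "fls_nth (X $ i $ l) k = 0" if "k < M" for i l k
    using assms(1)[OF that] by (simp add: vec_eq_iff coeff_mat_nth)
  have z': "fls_nth (Z $ i $ l) k = 0" if "k < N" for i l k
    using assms(2)[OF that] by (simp add: vec_eq_iff coeff_mat_nth)
  have "fls_nth ((X ** Z) $ a $ b) m = (\<Sum>j\<in>{M..m - N}. (coeff_mat X j ** coeff_mat Z (m - j)) $ a $ b)" for a b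
    by (simp add: matrix_matrix_mult_def fls_nth_sum coeff_mat_nth fls_mult_nth[OF z z']) (rule sum.swap)
  then show ?thesis by (simp add: vec_eq_iff coeff_mat_nth)
qed

lemma coeff_mat_smult:
  assumes "\<And>k. k < M \<Longrightarrow> fls_nth f k = 0" "\<And>k. k < N \<Longrightarrow> coeff_mat Z k = 0"
  shows "coeff_mat (smult_mat f Z) m = (\<Sum>j\<in>{M..m - N}. smult_mat (fls_nth f j) (coeff_mat Z (m - j)))"
proof -
  have z': "fls_nth (Z $ i $ l) k = 0" if "k < N" for i l k
    using assms(2)[OF that] by (simp add: vec_eq_iff coeff_mat_nth)
  show ?thesis
    by (simp add: vec_eq_iff coeff_mat_nth smult_mat_def fls_mult_nth[OF assms(1) z'])
qed

lemma loop_coord_simps [simp]: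
  "loop_coord z (Inl (i, j, k)) = fls_nth (fst z $ i $ j) k" "loop_coord z (Inr (i, j, k)) = fls_nth (snd z $ i $ j) k"
  by (simp_all add: loop_coord_def)

lemma loop_regular_sum:
  assumes "\<And>i. i \<in> I \<Longrightarrow> loop_regular (f i)"
  shows "loop_regular (\<lambda>z. \<Sum>i\<in>I. f i z)"
  unfolding loop_regular_def
proof
  fix N
  have "\<exists>q. \<forall>z\<in>loop_bounded N. f i z = mpoly_eval id q (loop_coord z)" if "i \<in> I" for i
    using assms[OF that] by (simp add: loop_regular_def)
  then obtain q where "\<And>i z. i \<in> I \<Longrightarrow> z \<in> loop_bounded N \<Longrightarrow> f i z = mpoly_eval id (q i) (loop_coord z)" by metis
  then show "\<exists>q. \<forall>z\<in>loop_bounded N. (\<Sum>i\<in>I. f i z) = mpoly_eval id q (loop_coord z)"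
    by (intro exI[of _ "sum q I"]) (simp add: mpoly_eval_sum is_ring_hom_intros)
qed

lemma loop_regular_intros:
  "loop_regular (\<lambda>_. c)" "loop_regular (\<lambda>z. loop_coord z v)"
  "loop_regular f \<Longrightarrow> loop_regular g \<Longrightarrow> loop_regular (\<lambda>z. f z + g z)"
  "loop_regular f \<Longrightarrow> loop_regular g \<Longrightarrow> loop_regular (\<lambda>z. f z * g z)"
proof -
  show "loop_regular (\<lambda>_. c)"
    by (auto simp: loop_regular_def is_ring_hom_intros intro!: exI[of _ "Cst c"])
  show "loop_regular (\<lambda>z. loop_coord z v)"
    by (auto simp: loop_regular_def is_ring_hom_intros intro!: exI[of _ "Var v"])
  show "loop_regular (\<lambda>z. f z + g z)" if fg: "loop_regular f" "loop_regular g"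
    unfolding loop_regular_def
  proof
    fix N
    obtain p q where "\<And>z. z \<in> loop_bounded N \<Longrightarrow> f z = mpoly_eval id p (loop_coord z)"
      "\<And>z. z \<in> loop_bounded N \<Longrightarrow> g z = mpoly_eval id q (loop_coord z)" using fg unfolding loop_regular_def by metis
    then show "\<exists>q. \<forall>z\<in>loop_bounded N. f z + g z = mpoly_eval id q (loop_coord z)"
      by (intro exI[of _ "p + q"]) (simp add: mpoly_eval_add is_ring_hom_intros)
  qed
  show "loop_regular (\<lambda>z. f z * g z)" if fg: "loop_regular f" "loop_regular g"
    unfolding loop_regular_def
  proof
    fix N
    obtain p q where "\<And>z. z \<in> loop_bounded N \<Longrightarrow> f z = mpoly_eval id p (loop_coord z)"
      "\<And>z. z \<in> loop_bounded N \<Longrightarrow> g z = mpoly_eval id q (loop_coord z)" using fg unfolding loop_regular_def by metis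
    then show "\<exists>q. \<forall>z\<in>loop_bounded N. f z * g z = mpoly_eval id q (loop_coord z)"
      by (intro exI[of _ "p * q"]) (simp add: mpoly_eval_mult is_ring_hom_intros)
  qed
qed

text \<open>The second clause bounds poles uniformly. It is what keeps the coefficients of products
  regular, being sums of a length independent of the point.\<close>

definition loop_series :: "('n::finite fmat \<times> 'n fmat \<Rightarrow> complex fls) \<Rightarrow> bool"
  where "loop_series F \<longleftrightarrow> (\<forall>m. loop_regular (\<lambda>z. fls_nth (F z) m)) \<and>
    (\<forall>N. \<exists>M. \<forall>z\<in>loop_bounded N. \<forall>m<M. fls_nth (F z) m = 0)"

lemma loop_series_sum:
  assumes "finite I" "\<And>i. i \<in> I \<Longrightarrow> loop_series (F i)"
  shows "loop_series (\<lambda>z. \<Sum>i\<in>I. F i z)"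
  unfolding loop_series_def
proof (intro conjI allI)
  fix N
  have "\<exists>M. \<forall>z\<in>loop_bounded N. \<forall>m<M. fls_nth (F i z) m = 0" if "i \<in> I" for i
    using assms(2)[OF that] by (simp add: loop_series_def)
  then obtain M where M: "\<And>i z m. i \<in> I \<Longrightarrow> z \<in> loop_bounded N \<Longrightarrow> m < M i \<Longrightarrow> fls_nth (F i z) m = 0" by metis
  have "Min (insert 0 (M ` I)) \<le> M i" if "i \<in> I" for i using assms(1) that by simp
  then show "\<exists>M. \<forall>z\<in>loop_bounded N. \<forall>m<M. fls_nth (\<Sum>i\<in>I. F i z) m = 0"
    using M by (intro exI[of _ "Min (insert 0 (M ` I))"]) (force simp: fls_nth_sum intro!: sum.neutral)
qed (use assms in \<open>auto simp: fls_nth_sum loop_series_def intro!: loop_regular_sum\<close>)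

lemma loop_series_mult:
  assumes "loop_series F" "loop_series F'"
  shows "loop_series (\<lambda>z. F z * F' z)"
proof -
  have *: "\<exists>M. \<forall>m. \<exists>q. \<forall>z\<in>loop_bounded N. fls_nth (F z * F' z) m = mpoly_eval id q (loop_coord z) \<and> (m < M \<longrightarrow> fls_nth (F z * F' z) m = 0)" for N
  proof -
    have "\<forall>m. \<exists>q. \<forall>z\<in>loop_bounded N. fls_nth (F z) m = mpoly_eval id q (loop_coord z)"
      "\<forall>m. \<exists>q. \<forall>z\<in>loop_bounded N. fls_nth (F' z) m = mpoly_eval id q (loop_coord z)"
      using assms by (auto simp: loop_series_def loop_regular_def)
    then obtain q q' where q: "\<And>m z. z \<in> loop_bounded N \<Longrightarrow> fls_nth (F z) m = mpoly_eval id (q m) (loop_coord z)"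
      "\<And>m z. z \<in> loop_bounded N \<Longrightarrow> fls_nth (F' z) m = mpoly_eval id (q' m) (loop_coord z)" by metis
    obtain M M' where M: "\<And>m z. z \<in> loop_bounded N \<Longrightarrow> m < M \<Longrightarrow> fls_nth (F z) m = 0"
      "\<And>m z. z \<in> loop_bounded N \<Longrightarrow> m < M' \<Longrightarrow> fls_nth (F' z) m = 0"
      using assms unfolding loop_series_def by metis
    have e: "fls_nth (F z * F' z) m = (\<Sum>j\<in>{M..m - M'}. fls_nth (F z) j * fls_nth (F' z) (m - j))"
      if "z \<in> loop_bounded N" for z m
      by (rule fls_mult_nth) (use M[OF that] in auto)
    show ?thesis
      by (intro exI[of _ "M + M'"] allI exI[of _ "\<Sum>j\<in>{M..m - M'}. q j * q' (m - j)" for m])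
        (auto simp: e q mpoly_eval_sum mpoly_eval_mult is_ring_hom_intros)
  qed
  show ?thesis
    unfolding loop_series_def loop_regular_def using * by meson
qed

lemma loop_series_intros:
  "loop_series (\<lambda>_. c)" "loop_series (\<lambda>z. fst z $ i $ j)" "loop_series (\<lambda>z. snd z $ i $ j)"
proof -
  have "\<exists>M. \<forall>m<M. fls_nth c m = 0" by (rule exI[of _ "fls_subdegree c"]) simp
  then show "loop_series (\<lambda>_. c)" by (auto simp: loop_series_def loop_regular_intros(1))
  show "loop_series (\<lambda>z. fst z $ i $ j)" "loop_series (\<lambda>z. snd z $ i $ j)"
    using loop_regular_intros(2)[of "Inl (i, j, m)" for m] loop_regular_intros(2)[of "Inr (i, j, m)" for m]
    by (auto simp: loop_series_def loop_bounded_def vec_eq_iff coeff_mat_nth intro!: exI[of _ "- N" for N])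
qed

lemma loop_series_add: "loop_series F \<Longrightarrow> loop_series F' \<Longrightarrow> loop_series (\<lambda>z. F z + F' z)"
  using loop_series_sum[of UNIV "\<lambda>b. if b then F else F'"] by (simp add: UNIV_bool if_distrib if_distribR add.commute)

lemma loop_series_mpoly_eval: "loop_series (\<lambda>z. mpoly_eval fls_const p (entries (fst z)))"
proof (induction p rule: mpoly_induct)
  case (var v)
  then show ?case by (cases v) (simp add: is_ring_hom_intros entries_def loop_series_intros)
qed (simp_all add: is_ring_hom_intros loop_series_intros mpoly_eval_add mpoly_eval_mult loop_series_add loop_series_mult)

lemma loop_regular_matrix:
  "loop_regular (\<lambda>z. \<Sum>i\<in>UNIV. \<Sum>j\<in>UNIV. c i j * coeff_mat (fst z ** u ** snd z) m $ i $ j)"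
proof -
  have "loop_series (\<lambda>z. (fst z ** u ** snd z) $ i $ j)" for i j
    by (simp add: matrix_matrix_mult_def loop_series_sum loop_series_mult loop_series_intros)
  then show ?thesis
    by (intro loop_regular_sum loop_regular_intros) (simp_all add: coeff_mat_nth loop_series_def)
qed

lemma ex_loop_bounded: "\<exists>N. \<forall>N'\<ge>N. z \<in> loop_bounded N'"
proof -
  obtain a b where "\<forall>m<a. coeff_mat (fst z) m = 0" "\<forall>m<b. coeff_mat (snd z) m = 0" using fmat_bounded by meson
  then show ?thesis by (intro exI[of _ "max (- a) (- b)"]) (auto simp: loop_bounded_def)
qed

lemma ex_loop_bounded2: "\<exists>N. z \<in> loop_bounded N \<and> w \<in> loop_bounded N"
  using ex_loop_bounded[of z] ex_loop_bounded[of w] by (meson max.cobounded1 max.cobounded2)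

text \<open>The differential of a polynomial in possibly infinitely many variables. \<open>V\<close>
  and \<open>c\<close> are fixed before the curve, so curves through the same point with the same
  velocity have the same derivative.\<close>

lemma mpoly_differential:
  fixes a :: "'v \<Rightarrow> complex"
  shows "\<exists>V c. finite V \<and> (\<forall>v. v \<notin> V \<longrightarrow> c v = 0) \<and> (\<forall>\<gamma> b. \<gamma> 0 = a \<longrightarrow> (\<forall>v. ((\<lambda>t. \<gamma> t v) has_field_derivative b v) (at 0)) \<longrightarrow>
    ((\<lambda>t. mpoly_eval id q (\<gamma> t)) has_field_derivative (\<Sum>v\<in>V. c v * b v)) (at 0))"
proof -
  have ext: "(\<Sum>v\<in>V \<union> V'. c v * b v) = (\<Sum>v\<in>V. c v * b v)" "(\<Sum>v\<in>V' \<union> V. c v * b v) = (\<Sum>v\<in>V. c v * b v)"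
    if "finite V" "finite V'" "\<forall>v. v \<notin> V \<longrightarrow> c v = 0" for V V' :: "'v set" and c b :: "'v \<Rightarrow> complex"
    using that by (auto intro!: sum.mono_neutral_right)
  define diff where "diff q V c \<longleftrightarrow> finite V \<and> (\<forall>v. v \<notin> V \<longrightarrow> c v = 0) \<and>
    (\<forall>\<gamma> b. \<gamma> 0 = a \<longrightarrow> (\<forall>v. ((\<lambda>t. \<gamma> t v) has_field_derivative b v) (at 0)) \<longrightarrow>
      ((\<lambda>t. mpoly_eval id q (\<gamma> t)) has_field_derivative (\<Sum>v\<in>V. c v * b v)) (at 0))" for q V and c :: "'v \<Rightarrow> complex"
  have D: "((\<lambda>t. mpoly_eval id q (\<gamma> t)) has_field_derivative (\<Sum>v\<in>V. c v * b v)) (at 0)"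
    if "diff q V c" "\<gamma> 0 = a" "\<forall>v. ((\<lambda>t. \<gamma> t v) has_field_derivative b v) (at 0)" for q V c \<gamma> b
    using that unfolding diff_def by blast
  have "\<exists>V c. diff q V c"
  proof (induction q rule: mpoly_induct)
    case (const c)
    have "diff (Cst c) {} (\<lambda>_. 0)" by (simp add: diff_def is_ring_hom_intros)
    then show ?case by blast
  next
    case (var v)
    have "diff (Var v) {v} (\<lambda>w. if w = v then 1 else 0)" by (simp add: diff_def is_ring_hom_intros)
    then show ?case by blast
  next
    case (add p q)
    then obtain V c V' c' where 1: "diff p V c" and 2: "diff q V' c'" by blast
    note e1 = 1[unfolded diff_def, THEN conjunct1] 1[unfolded diff_def, THEN conjunct2, THEN conjunct1]
    note e2 = 2[unfolded diff_def, THEN conjunct1] 2[unfolded diff_def, THEN conjunct2, THEN conjunct1]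
    have "diff (p + q) (V \<union> V') (\<lambda>v. c v + c' v)"
      unfolding diff_def
    proof (intro conjI allI impI)
      fix \<gamma> b assume g: "\<gamma> 0 = a" "\<forall>v. ((\<lambda>t. \<gamma> t v) has_field_derivative b v) (at 0)"
      show "((\<lambda>t. mpoly_eval id (p + q) (\<gamma> t)) has_field_derivative (\<Sum>v\<in>V \<union> V'. (c v + c' v) * b v)) (at 0)"
        using DERIV_add[OF D[OF 1 g] D[OF 2 g]]
        by (simp add: mpoly_eval_add is_ring_hom_intros distrib_right sum.distrib ext[OF e1(1) e2(1) e1(2)] ext[OF e2(1) e1(1) e2(2)])
    qed (use e1 e2 in auto)
    then show ?case by blast
  next
    case (mult p q)
    then obtain V c V' c' where 1: "diff p V c" and 2: "diff q V' c'" by blast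
    note e1 = 1[unfolded diff_def, THEN conjunct1] 1[unfolded diff_def, THEN conjunct2, THEN conjunct1]
    note e2 = 2[unfolded diff_def, THEN conjunct1] 2[unfolded diff_def, THEN conjunct2, THEN conjunct1]
    have "diff (p * q) (V \<union> V') (\<lambda>v. c v * mpoly_eval id q a + c' v * mpoly_eval id p a)"
      unfolding diff_def
    proof (intro conjI allI impI)
      fix \<gamma> b assume g: "\<gamma> 0 = a" "\<forall>v. ((\<lambda>t. \<gamma> t v) has_field_derivative b v) (at 0)"
      have "(\<Sum>v\<in>V \<union> V'. (c v * mpoly_eval id q a + c' v * mpoly_eval id p a) * b v)
        = (\<Sum>v\<in>V \<union> V'. c v * b v) * mpoly_eval id q a + (\<Sum>v\<in>V \<union> V'. c' v * b v) * mpoly_eval id p a"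
        by (simp add: distrib_right sum.distrib) (simp add: sum_distrib_left ac_simps)
      also have "\<dots> = (\<Sum>v\<in>V. c v * b v) * mpoly_eval id q a + (\<Sum>v\<in>V'. c' v * b v) * mpoly_eval id p a"
        by (simp only: ext[OF e1(1) e2(1) e1(2)] ext[OF e2(1) e1(1) e2(2)])
      finally show "((\<lambda>t. mpoly_eval id (p * q) (\<gamma> t)) has_field_derivative
          (\<Sum>v\<in>V \<union> V'. (c v * mpoly_eval id q a + c' v * mpoly_eval id p a) * b v)) (at 0)"
        using DERIV_mult[OF D[OF 1 g] D[OF 2 g]] g(1)
        by (simp add: mpoly_eval_mult is_ring_hom_intros)
    qed (use e1 e2 in auto)
    then show ?case by blast
  qed
  then show ?thesis unfolding diff_def .
qed

lemma loop_differential: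
  assumes "loop_regular f"
  obtains V c where "finite V"
    "\<And>\<gamma> b. (\<And>t. \<gamma> t \<in> loop_bounded N) \<Longrightarrow> \<gamma> 0 = z \<Longrightarrow>
      (\<And>v. ((\<lambda>t. loop_coord (\<gamma> t) v) has_field_derivative b v) (at 0)) \<Longrightarrow>
      ((\<lambda>t. f (\<gamma> t)) has_field_derivative (\<Sum>v\<in>V. c v * b v)) (at (0 :: complex))"
proof -
  obtain q where q: "\<And>z. z \<in> loop_bounded N \<Longrightarrow> f z = mpoly_eval id q (loop_coord z)"
    using assms unfolding loop_regular_def by meson
  obtain V c where "finite V" and *: "\<And>\<gamma> b. \<gamma> 0 = loop_coord z \<Longrightarrow> (\<And>v. ((\<lambda>t. \<gamma> t v) has_field_derivative b v) (at 0)) \<Longrightarrow>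
    ((\<lambda>t. mpoly_eval id q (\<gamma> t)) has_field_derivative (\<Sum>v\<in>V. c v * b v)) (at 0)"
    using mpoly_differential[of "loop_coord z" q] by blast
  show thesis
  proof (rule that[OF \<open>finite V\<close>])
    fix \<gamma> b assume g: "\<And>t. \<gamma> t \<in> loop_bounded N" "\<gamma> 0 = z" "\<And>v. ((\<lambda>t. loop_coord (\<gamma> t) v) has_field_derivative b v) (at 0)"
    then show "((\<lambda>t. f (\<gamma> t)) has_field_derivative (\<Sum>v\<in>V. c v * b v)) (at 0)"
      using *[of "\<lambda>t. loop_coord (\<gamma> t)" b] by (simp add: q)
  qed
qed

section \<open>Tangent vectors as pairs and their relation to curves\<close>

abbreviation loop_line :: "'n::finite fmat \<times> 'n fmat \<Rightarrow> 'n fmat \<times> 'n fmat \<Rightarrow> complex \<Rightarrow> 'n fmat \<times> 'n fmat"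
  where "loop_line z w t \<equiv> (fst z + smult_mat (fls_const t) (fst w), snd z + smult_mat (fls_const t) (snd w))"

lemma loop_coord_lin:
  "loop_coord (x + y, x' + y') v = loop_coord (x, x') v + loop_coord (y, y') v"
  "loop_coord (smult_mat (fls_const c) x, smult_mat (fls_const c) x') v = c * loop_coord (x, x') v"
  by (cases v; auto simp: smult_mat_def)+

lemma loop_line:
  assumes "z \<in> loop_bounded N" "w \<in> loop_bounded N"
  shows "loop_line z w t \<in> loop_bounded N" "loop_line z w 0 = z"
    "((\<lambda>t. loop_coord (loop_line z w t) v) has_field_derivative loop_coord w v) (at 0)"
proof -
  show "loop_line z w t \<in> loop_bounded N"
    using assms by (auto simp: loop_bounded_def coeff_mat_lin) (simp_all add: smult_mat_def vec_eq_iff)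
  show "loop_line z w 0 = z" by (cases z) (simp add: smult_mat_def vec_eq_iff)
  show "((\<lambda>t. loop_coord (loop_line z w t) v) has_field_derivative loop_coord w v) (at 0)"
    by (auto simp: loop_coord_lin intro!: derivative_eq_intros)
qed

definition tangent_pair :: "('n::finite fmat) set \<Rightarrow> 'n fmat \<Rightarrow> 'n fmat \<Rightarrow> 'n fmat \<Rightarrow> bool"
  where "tangent_pair S x \<xi> \<eta> \<longleftrightarrow> (\<forall>f. loop_regular f \<and> (\<forall>y\<in>S. f (y, matrix_inv y) = 0) \<longrightarrow>
    ((\<lambda>t. f (loop_line (x, matrix_inv x) (\<xi>, \<eta>) t)) has_field_derivative 0) (at 0))"

lemma tangent_space_iff_pair: "\<xi> \<in> tangent_space S x \<longleftrightarrow> (\<exists>\<eta>. tangent_pair S x \<xi> \<eta>)"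
  by (simp add: tangent_space_def tangent_pair_def)

text \<open>Tangent vectors are defined by straight lines, which leave \<open>S\<close>. By
  \<open>loop_differential\<close> the derivative along the line equals the one along the curve,
  where the function is constantly 0.\<close>

lemma tangent_curve:
  assumes "\<And>t. \<gamma> t \<in> S" "\<gamma> 0 = x" "\<And>t. (\<gamma> t, matrix_inv (\<gamma> t)) \<in> loop_bounded N"
    and d: "\<And>v. ((\<lambda>t. loop_coord (\<gamma> t, matrix_inv (\<gamma> t)) v) has_field_derivative loop_coord (\<xi>, \<eta>) v) (at 0)"
  shows "\<xi> \<in> tangent_space S x"
proof -
  \<comment> \<open>Coordinates that vanish along the whole curve have derivative 0, so the velocity
    inherits the pole bound.\<close>
  have "(\<xi>, \<eta>) \<in> loop_bounded N"
    unfolding loop_bounded_def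
  proof (intro CollectI allI impI)
    fix k assume "k < - N"
    then have z: "loop_coord (\<gamma> t, matrix_inv (\<gamma> t)) (Inl (i, j, k)) = 0" "loop_coord (\<gamma> t, matrix_inv (\<gamma> t)) (Inr (i, j, k)) = 0" for t i j
      using assms(3)[of t] by (auto simp: loop_bounded_def vec_eq_iff coeff_mat_nth)
    have "loop_coord (\<xi>, \<eta>) (Inl (i, j, k)) = 0" "loop_coord (\<xi>, \<eta>) (Inr (i, j, k)) = 0" for i j
      using DERIV_unique[OF d[of "Inl (i, j, k)"], of 0] DERIV_unique[OF d[of "Inr (i, j, k)"], of 0]
      by (simp_all only: z DERIV_const)
    then show "coeff_mat (fst (\<xi>, \<eta>)) k = 0 \<and> coeff_mat (snd (\<xi>, \<eta>)) k = 0" by (simp add: vec_eq_iff coeff_mat_nth)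
  qed
  moreover have x: "(x, matrix_inv x) \<in> loop_bounded N" using assms(3)[of 0] assms(2) by simp
  ultimately have line: "loop_line (x, matrix_inv x) (\<xi>, \<eta>) t \<in> loop_bounded N" "loop_line (x, matrix_inv x) (\<xi>, \<eta>) 0 = (x, matrix_inv x)"
    "((\<lambda>t. loop_coord (loop_line (x, matrix_inv x) (\<xi>, \<eta>) t) v) has_field_derivative loop_coord (\<xi>, \<eta>) v) (at 0)" for t v
    using loop_line[of "(x, matrix_inv x)" N "(\<xi>, \<eta>)"] by blast+
  have "tangent_pair S x \<xi> \<eta>"
    unfolding tangent_pair_def
  proof (intro allI impI)
    fix f assume f: "loop_regular f \<and> (\<forall>y\<in>S. f (y, matrix_inv y) = 0)"
    obtain V c where *: "\<And>\<gamma> b. (\<And>t. \<gamma> t \<in> loop_bounded N) \<Longrightarrow> \<gamma> 0 = (x, matrix_inv x) \<Longrightarrow>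
      (\<And>v. ((\<lambda>t. loop_coord (\<gamma> t) v) has_field_derivative b v) (at 0)) \<Longrightarrow>
      ((\<lambda>t. f (\<gamma> t)) has_field_derivative (\<Sum>v\<in>V. c v * b v)) (at (0 :: complex))"
      by (rule loop_differential[of f N "(x, matrix_inv x)"]) (use f in blast)+
    have "((\<lambda>t. f (\<gamma> t, matrix_inv (\<gamma> t))) has_field_derivative (\<Sum>v\<in>V. c v * loop_coord (\<xi>, \<eta>) v)) (at 0)"
      by (rule *) (use assms in auto)
    then have "(\<Sum>v\<in>V. c v * loop_coord (\<xi>, \<eta>) v) = 0"
      using f assms(1) DERIV_unique[OF _ DERIV_const] by simp
    then show "((\<lambda>t. f (loop_line (x, matrix_inv x) (\<xi>, \<eta>) t)) has_field_derivative 0) (at 0)"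
      using *[OF line] by simp
  qed
  then show ?thesis unfolding tangent_space_iff_pair by blast
qed

text \<open>A functional of \<open>y u y^-1\<close> that is constant on \<open>S\<close> becomes a
  vanishing regular function after subtracting the constant. The inverse is a separate coordinate,
  so the product rule alone gives the derivative.\<close>

lemma tangent_pair_matrix:
  assumes t: "tangent_pair S x \<xi> \<eta>"
    and c: "\<And>y. y \<in> S \<Longrightarrow> (\<Sum>i\<in>UNIV. \<Sum>j\<in>UNIV. c i j * coeff_mat (y ** u ** matrix_inv y) m $ i $ j) = d"
  shows "(\<Sum>i\<in>UNIV. \<Sum>j\<in>UNIV. c i j * coeff_mat (\<xi> ** u ** matrix_inv x + x ** u ** \<eta>) m $ i $ j) = 0"
proof -
  define f where "f = (\<lambda>z. (\<Sum>i\<in>UNIV. \<Sum>j\<in>UNIV. c i j * coeff_mat (fst z ** u ** snd z) m $ i $ j) + (- d))"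
  have "loop_regular f" unfolding f_def by (intro loop_regular_intros loop_regular_matrix)
  moreover have "\<forall>y\<in>S. f (y, matrix_inv y) = 0" using c by (simp add: f_def)
  ultimately have "((\<lambda>t. f (loop_line (x, matrix_inv x) (\<xi>, \<eta>) t)) has_field_derivative 0) (at 0)"
    using t unfolding tangent_pair_def by blast
  moreover have "((\<lambda>t. f (loop_line (x, matrix_inv x) (\<xi>, \<eta>) t)) has_field_derivative
    (\<Sum>i\<in>UNIV. \<Sum>j\<in>UNIV. c i j * coeff_mat (\<xi> ** u ** matrix_inv x + x ** u ** \<eta>) m $ i $ j)) (at 0)"
  proof -
    have e: "(x + smult_mat (fls_const t) \<xi>) ** u ** (matrix_inv x + smult_mat (fls_const t) \<eta>)
      = x ** u ** matrix_inv x + smult_mat (fls_const t) (\<xi> ** u ** matrix_inv x + x ** u ** \<eta>)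
        + smult_mat (fls_const (t * t)) (\<xi> ** u ** \<eta>)" for t
    proof -
      have "smult_mat a (X + Y) = smult_mat a X + smult_mat a Y" for a and X Y :: "'a fmat"
        by (simp add: smult_mat_def vec_eq_iff distrib_left)
      then show ?thesis
        by (simp add: matrix_add_ldistrib matrix_add_rdistrib' smult_mat_mult smult_smult_mat add_ac)
    qed
    have n: "smult_mat t X $ i $ j = t * X $ i $ j" for t and X :: "'a cmat" and i j by (simp add: smult_mat_def)
    show ?thesis
      by (auto simp only: f_def e coeff_mat_lin fst_conv snd_conv vector_add_component n intro!: derivative_eq_intros sum.cong)
        (simp_all add: distrib_left distrib_right mult.commute)
  qed
  ultimately show ?thesis by (rule DERIV_unique[symmetric])
qed

text \<open>Differentiate \<open>y y^-1 = 1\<close>, that is, apply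
  \<open>tangent_pair_matrix\<close> with \<open>u = mat 1\<close> and the functionals that pick
  single entries.\<close>

lemma tangent_pair_unique:
  assumes "tangent_pair S x \<xi> \<eta>" "x \<in> S" "\<And>y. y \<in> S \<Longrightarrow> invertible y"
  shows "\<eta> = - (matrix_inv x ** \<xi> ** matrix_inv x)"
proof -
  note inv = matrix_inv_mult[OF assms(3)]
  have "\<xi> ** mat 1 ** matrix_inv x + x ** mat 1 ** \<eta> = 0" (is "?Z = 0")
  proof (rule fmat_eqI)
    fix m
    have "coeff_mat ?Z m $ a $ b = 0" for a b
    proof -
      have "(\<Sum>i\<in>UNIV. \<Sum>j\<in>UNIV. (if i = a \<and> j = b then 1 else 0) * coeff_mat ?Z m $ i $ j) = 0"
        by (rule tangent_pair_matrix[OF assms(1), where d = "\<Sum>i\<in>UNIV. \<Sum>j\<in>UNIV. (if i = a \<and> j = b then 1 else 0) * coeff_mat (mat 1) m $ i $ j"])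
          (simp add: inv)
      moreover have "(\<Sum>i\<in>UNIV. \<Sum>j\<in>UNIV. (if i = a \<and> j = b then 1 else 0) * coeff_mat ?Z m $ i $ j)
        = (\<Sum>i\<in>UNIV. \<Sum>j\<in>UNIV. if i = a \<and> j = b then coeff_mat ?Z m $ i $ j else 0)" by (intro sum.cong) auto
      also have "\<dots> = (\<Sum>i\<in>UNIV. if i = a then coeff_mat ?Z m $ i $ b else 0)"
        by (rule sum.cong) (auto simp: sum.delta)
      ultimately show ?thesis by simp
    qed
    then show "coeff_mat ?Z m = coeff_mat 0 m" by (simp add: vec_eq_iff coeff_mat_lin)
  qed
  then have "x ** \<eta> = - (\<xi> ** matrix_inv x)" by (simp add: eq_neg_iff_add_eq_0 add.commute)
  then have "matrix_inv x ** (x ** \<eta>) = matrix_inv x ** - (\<xi> ** matrix_inv x)" by simp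
  moreover have "A ** - B = - (A ** B)" for A B :: "'a fmat"
    by (simp add: vec_eq_iff matrix_matrix_mult_def sum_negf)
  ultimately show ?thesis by (simp add: matrix_mul_assoc inv assms(2))
qed

lemma tangent_space_iff:
  assumes "x \<in> S" "\<And>y. y \<in> S \<Longrightarrow> invertible y"
  shows "\<xi> \<in> tangent_space S x \<longleftrightarrow> tangent_pair S x \<xi> (- (matrix_inv x ** \<xi> ** matrix_inv x))"
  unfolding tangent_space_iff_pair using tangent_pair_unique[OF _ assms] by blast

text \<open>On a set of bounded pole order a regular function involves finitely many coordinates, so
  tangency is a closed condition in the topology of Laurent series.\<close>

lemma tangent_pair_limit:
  assumes "\<And>M. \<exists>\<xi>' \<eta>'. tangent_pair S x \<xi>' \<eta>' \<and> (\<forall>k\<le>M. coeff_mat \<xi>' k = coeff_mat \<xi> k \<and> coeff_mat \<eta>' k = coeff_mat \<eta> k)"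
  shows "tangent_pair S x \<xi> \<eta>"
  unfolding tangent_pair_def
proof (intro allI impI)
  fix f assume f: "loop_regular f \<and> (\<forall>y\<in>S. f (y, matrix_inv y) = 0)"
  obtain N where N: "(x, matrix_inv x) \<in> loop_bounded N" "(\<xi>, \<eta>) \<in> loop_bounded N" using ex_loop_bounded2 by blast
  obtain V c where V: "finite V" and *: "\<And>\<gamma> b. (\<And>t. \<gamma> t \<in> loop_bounded N) \<Longrightarrow> \<gamma> 0 = (x, matrix_inv x) \<Longrightarrow>
    (\<And>v. ((\<lambda>t. loop_coord (\<gamma> t) v) has_field_derivative b v) (at 0)) \<Longrightarrow>
    ((\<lambda>t. f (\<gamma> t)) has_field_derivative (\<Sum>v\<in>V. c v * b v)) (at (0 :: complex))"
    by (rule loop_differential[of f N "(x, matrix_inv x)"]) (use f in blast)+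
  \<comment> \<open>Besides the exponents seen by the function, \<open>M\<close> dominates
    \<open>- N\<close>, so that an approximation up to \<open>M\<close> keeps the pole
    bound.\<close>
  define M where "M = Max (insert (- N) ((\<lambda>v. case v of Inl (i, j, k) \<Rightarrow> k | Inr (i, j, k) \<Rightarrow> k) ` V))"
  have M: "- N \<le> M" "(case v of Inl (i, j, k) \<Rightarrow> k | Inr (i, j, k) \<Rightarrow> k) \<le> M" if "v \<in> V" for v
    using V that by (auto simp: M_def)
  have MN: "- N \<le> M" using V by (simp add: M_def)
  obtain \<xi>' \<eta>' where t: "tangent_pair S x \<xi>' \<eta>'" "\<And>k. k \<le> M \<Longrightarrow> coeff_mat \<xi>' k = coeff_mat \<xi> k \<and> coeff_mat \<eta>' k = coeff_mat \<eta> k"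
    using assms by meson
  have N': "(\<xi>', \<eta>') \<in> loop_bounded N" using t(2) N(2) MN by (simp add: loop_bounded_def)
  have "(\<Sum>v\<in>V. c v * loop_coord (\<xi>', \<eta>') v) = 0"
    using *[OF loop_line[OF N(1) N']] t(1) f DERIV_unique unfolding tangent_pair_def by blast
  also have "(\<Sum>v\<in>V. c v * loop_coord (\<xi>', \<eta>') v) = (\<Sum>v\<in>V. c v * loop_coord (\<xi>, \<eta>) v)"
  proof (rule sum.cong[OF refl])
    fix v assume v: "v \<in> V"
    show "c v * loop_coord (\<xi>', \<eta>') v = c v * loop_coord (\<xi>, \<eta>) v"
    proof (cases v)
      case (Inl w)
      obtain i j k where w: "w = (i, j, k)" by (cases w)
      have "coeff_mat \<xi>' k $ i $ j = coeff_mat \<xi> k $ i $ j" using t(2)[of k] M(2)[OF v] by (simp add: Inl w)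
      then show ?thesis by (simp add: Inl w coeff_mat_nth)
    next
      case (Inr w)
      obtain i j k where w: "w = (i, j, k)" by (cases w)
      have "coeff_mat \<eta>' k $ i $ j = coeff_mat \<eta> k $ i $ j" using t(2)[of k] M(2)[OF v] by (simp add: Inr w)
      then show ?thesis by (simp add: Inr w coeff_mat_nth)
    qed
  qed
  finally show "((\<lambda>t. f (loop_line (x, matrix_inv x) (\<xi>, \<eta>) t)) has_field_derivative 0) (at 0)"
    using *[OF loop_line[OF N]] by simp
qed

lemma tangent_pair_add:
  assumes "tangent_pair S x \<xi> \<eta>" "tangent_pair S x \<xi>' \<eta>'"
  shows "tangent_pair S x (\<xi> + \<xi>') (\<eta> + \<eta>')"
  unfolding tangent_pair_def
proof (intro allI impI)
  fix f assume f: "loop_regular f \<and> (\<forall>y\<in>S. f (y, matrix_inv y) = 0)"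
  obtain N where N: "(x, matrix_inv x) \<in> loop_bounded N" "(\<xi>, \<eta>) \<in> loop_bounded N" "(\<xi>', \<eta>') \<in> loop_bounded N"
  proof -
    obtain a b c where "\<forall>N\<ge>a. (x, matrix_inv x) \<in> loop_bounded N" "\<forall>N\<ge>b. (\<xi>, \<eta>) \<in> loop_bounded N" "\<forall>N\<ge>c. (\<xi>', \<eta>') \<in> loop_bounded N"
      using ex_loop_bounded by metis
    then show thesis by (intro that[of "max a (max b c)"]) auto
  qed
  then have N3: "(\<xi> + \<xi>', \<eta> + \<eta>') \<in> loop_bounded N" by (simp add: loop_bounded_def coeff_mat_lin)
  obtain V c where V: "finite V" and *: "\<And>\<gamma> b. (\<And>t. \<gamma> t \<in> loop_bounded N) \<Longrightarrow> \<gamma> 0 = (x, matrix_inv x) \<Longrightarrow>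
    (\<And>v. ((\<lambda>t. loop_coord (\<gamma> t) v) has_field_derivative b v) (at 0)) \<Longrightarrow>
    ((\<lambda>t. f (\<gamma> t)) has_field_derivative (\<Sum>v\<in>V. c v * b v)) (at (0 :: complex))"
    by (rule loop_differential[of f N "(x, matrix_inv x)"]) (use f in blast)+
  have "(\<Sum>v\<in>V. c v * loop_coord (\<xi>, \<eta>) v) = 0" "(\<Sum>v\<in>V. c v * loop_coord (\<xi>', \<eta>') v) = 0"
    using *[OF loop_line[OF N(1,2)]] *[OF loop_line[OF N(1,3)]] assms f DERIV_unique unfolding tangent_pair_def by blast+
  then show "((\<lambda>t. f (loop_line (x, matrix_inv x) (\<xi> + \<xi>', \<eta> + \<eta>') t)) has_field_derivative 0) (at 0)"
    using *[OF loop_line[OF N(1) N3]] by (simp add: loop_coord_lin distrib_left sum.distrib)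
qed

lemma tangent_space_add: "\<xi> \<in> tangent_space S x \<Longrightarrow> \<xi>' \<in> tangent_space S x \<Longrightarrow> \<xi> + \<xi>' \<in> tangent_space S x"
  unfolding tangent_space_iff_pair using tangent_pair_add by blast

lemma tangent_space_0: "0 \<in> tangent_space S x"
proof -
  have "loop_line (x, matrix_inv x) (0, 0) t = (x, matrix_inv x)" for t by (simp add: smult_mat_def vec_eq_iff)
  then have "tangent_pair S x 0 0" unfolding tangent_pair_def by simp
  then show ?thesis unfolding tangent_space_iff_pair by blast
qed

lemma tangent_space_sum: "(\<And>i. i \<in> I \<Longrightarrow> \<xi> i \<in> tangent_space S x) \<Longrightarrow> sum \<xi> I \<in> tangent_space S x"
  by (induction I rule: infinite_finite_induct) (auto simp: tangent_space_0 tangent_space_add)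

text \<open>With bounded poles a regular function is a single polynomial in the coordinates along
  the curve, hence continuous there. So the ordinary connectedness of the complex plane passes to
  the Zariski topology.\<close>

lemma curve_in_component:
  fixes \<gamma> :: "complex \<Rightarrow> 'n::finite fmat"
  assumes S: "\<And>t. \<gamma> t \<in> S" and b: "\<And>t. (\<gamma> t, matrix_inv (\<gamma> t)) \<in> loop_bounded N"
    and cont: "\<And>v. continuous_on UNIV (\<lambda>t. loop_coord (\<gamma> t, matrix_inv (\<gamma> t)) v)"
    and 0: "\<gamma> 0 \<in> connected_component_of_set (loop_zariski S) e"
  shows "\<gamma> t \<in> connected_component_of_set (loop_zariski S) e"
proof -
  have "continuous_map euclidean (loop_zariski S) \<gamma>"
    unfolding loop_zariski_def continuous_on_generated_topo_iff
  proof (intro conjI allI impI)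
    fix U assume "U \<in> {{g \<in> S. f (g, matrix_inv g) \<noteq> 0} |f. loop_regular f}"
    then obtain f where U: "U = {g \<in> S. f (g, matrix_inv g) \<noteq> 0}" and f: "loop_regular f" by blast
    obtain q where q: "\<And>z. z \<in> loop_bounded N \<Longrightarrow> f z = mpoly_eval id q (loop_coord z)"
      using f unfolding loop_regular_def by meson
    have "continuous_on UNIV (\<lambda>t. mpoly_eval id q (loop_coord (\<gamma> t, matrix_inv (\<gamma> t))))"
    proof (induction q rule: mpoly_induct)
      case (var v)
      then show ?case using cont[of v] by (simp add: is_ring_hom_intros)
    qed (simp_all add: is_ring_hom_intros mpoly_eval_add mpoly_eval_mult continuous_on_add continuous_on_mult)
    then have "open ((\<lambda>t. mpoly_eval id q (loop_coord (\<gamma> t, matrix_inv (\<gamma> t)))) -` (- {0}))"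
      by (intro open_vimage) auto
    moreover have "\<gamma> -` U \<inter> topspace euclidean = (\<lambda>t. mpoly_eval id q (loop_coord (\<gamma> t, matrix_inv (\<gamma> t)))) -` (- {0})"
      using S q b by (auto simp: U)
    ultimately show "openin euclidean (\<gamma> -` U \<inter> topspace euclidean)" by (simp only: open_openin)
  next
    have "S \<in> {{g \<in> S. f (g, matrix_inv g) \<noteq> 0} |f. loop_regular f}"
      by (intro CollectI exI[of _ "\<lambda>_. 1"] conjI loop_regular_intros(1)) simp
    then have "S \<subseteq> \<Union> {{g \<in> S. f (g, matrix_inv g) \<noteq> 0} |f. loop_regular f}" by (rule Union_upper)
    then show "\<gamma> ` topspace euclidean \<subseteq> \<Union> {{g \<in> S. f (g, matrix_inv g) \<noteq> 0} |f. loop_regular f}"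
      using S by (intro order_trans[OF image_subsetI]) auto
  qed
  then have "connectedin (loop_zariski S) (range \<gamma>)"
    by (intro connectedin_continuous_map_image[where X = euclidean]) (auto simp: connected_UNIV)
  then have "connected_component_of (loop_zariski S) (\<gamma> 0) (\<gamma> t)"
    unfolding connected_component_of_def by blast
  then show ?thesis using 0 connected_component_of_trans by fastforce
qed

lemma fls_poly_derivative:
  "((\<lambda>t. fls_nth (poly Q (fls_const t)) m) has_field_derivative fls_nth (coeff Q 1) m) (at (0::complex))"
proof (induction Q arbitrary: m)
  case (pCons a Q)
  have e: "fls_nth (poly (pCons a Q) (fls_const t)) m = fls_nth a m + t * fls_nth (poly Q (fls_const t)) m" for t by simp
  show ?case
    unfolding e by (rule derivative_eq_intros pCons.IH refl)+ (simp add: coeff_pCons poly_0_coeff_0)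
qed simp

text \<open>The coefficients of \<open>p\<close> evaluated at a Laurent point are regular functions.
  As \<open>mat 1\<close> is a constant point, the linear term of the \<open>m\<close>-th one is the
  differential of \<open>p\<close> applied to the \<open>m\<close>-th coefficient of
  \<open>\<xi>\<close>.\<close>

lemma tangent_pair_lie_algebra:
  assumes t: "tangent_pair S (mat 1) \<xi> \<eta>"
    and S: "\<And>y p. y \<in> S \<Longrightarrow> p \<in> vanishing_ideal G \<Longrightarrow> mpoly_eval fls_const p (entries y) = 0"
  shows "coeff_mat \<xi> m \<in> lie_algebra G"
  unfolding lie_algebra_iff
proof
  fix p assume p: "p \<in> vanishing_ideal G"
  define Q where "Q p = mpoly_eval (\<lambda>c. [:fls_const c:]) p (\<lambda>v. [:entries (mat 1) v, entries \<xi> v:])" for p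
  have h: "is_ring_hom (\<lambda>c::complex. [:fls_const c:])" by (rule is_ring_hom_comp[OF is_ring_hom_intros(4,5)])
  have Q: "mpoly_eval fls_const p (entries (mat 1 + smult_mat (fls_const t) \<xi>)) = poly (Q p) (fls_const t)" for t p
    unfolding Q_def mpoly_eval_hom[OF is_ring_hom_intros(8) h]
    by (intro arg_cong2[where f = "\<lambda>a b. mpoly_eval a p b"]) (auto simp: entries_def smult_mat_def fun_eq_iff)
  have 0: "coeff (Q p) 0 = fls_const (mpoly_eval id p (entries (mat 1)))" for p
  proof -
    have "coeff (Q p) 0 = mpoly_eval fls_const p (entries (mat 1))"
      using Q[of p 0] by (simp add: poly_0_coeff_0) (simp add: smult_mat_def zero_vec_def[symmetric])
    also have "\<dots> = fls_const (mpoly_eval id p (entries (mat 1)))"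
      unfolding mpoly_eval_hom[OF is_ring_hom_intros(4) is_ring_hom_intros(1)]
      by (intro arg_cong2[where f = "\<lambda>a b. mpoly_eval a p b"]) (auto simp: entries_def mat_def fun_eq_iff)
    finally show ?thesis .
  qed
  have 1: "fls_nth (coeff (Q p) 1) m = mpoly_eval id (D (coeff_mat \<xi> m) p) (entries (mat 1))" for p
  proof (induction p rule: mpoly_induct)
    case (var v)
    obtain i j where v: "v = (i, j)" by (cases v)
    have "mpoly_eval id (D (coeff_mat \<xi> m) (Var v)) (entries (mat 1)) = coeff_mat \<xi> m $ i $ j"
      by (simp add: v D_simps mpoly_eval_sum mpoly_eval_mult is_ring_hom_intros entries_def mat_def if_distrib
          if_distribR cong: if_cong)
    moreover have "coeff (Q (Var v)) 1 = \<xi> $ i $ j" by (simp add: Q_def h v entries_def)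
    ultimately show ?case by (simp only: coeff_mat_nth)
  next
    case (mult p q)
    have "coeff (Q (p * q)) 1 = coeff (Q p) 0 * coeff (Q q) 1 + coeff (Q p) 1 * coeff (Q q) 0"
      unfolding Q_def mpoly_eval_mult[OF h] by (simp add: coeff_mult atMost_Suc)
    then show ?case
      unfolding 0 using mult by (simp add: D_simps mpoly_eval_add mpoly_eval_mult is_ring_hom_intros mult.commute id_def)
  qed (simp_all add: Q_def h D_simps mpoly_eval_add mpoly_eval_0 is_ring_hom_intros)
  define f where "f = (\<lambda>z::'a fmat \<times> 'a fmat. fls_nth (mpoly_eval fls_const p (entries (fst z))) m)"
  have "loop_regular f" unfolding f_def using loop_series_mpoly_eval[of p] by (simp add: loop_series_def)
  then have "((\<lambda>t. f (loop_line (mat 1, matrix_inv (mat 1)) (\<xi>, \<eta>) t)) has_field_derivative 0) (at 0)"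
    using t S[OF _ p] unfolding tangent_pair_def by (auto simp: f_def)
  then have "((\<lambda>t. fls_nth (poly (Q p) (fls_const t)) m) has_field_derivative 0) (at 0)"
    by (simp add: f_def Q)
  then show "mpoly_eval id (D (coeff_mat \<xi> m) p) (entries (mat 1)) = 0"
    using DERIV_unique[OF fls_poly_derivative[of "Q p" m]] 1[of p] by simp
qed

section \<open>Curves in the stabilizer\<close>

lemma polynomial_curve_derivative:
  fixes a :: "nat \<Rightarrow> complex"
  shows "((\<lambda>t. \<Sum>m<n. t ^ m * a m) has_field_derivative (if 1 < n then a 1 else 0)) (at 0)"
proof -
  have "((\<lambda>t. t ^ m * a m) has_field_derivative (if m = 1 then a 1 else 0)) (at 0)" for m
  proof (cases m)
    case (Suc k)
    have "((\<lambda>t. t ^ m * a m) has_field_derivative of_nat m * 0 ^ (m - 1) * a m) (at 0)"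
      by (rule derivative_eq_intros refl | simp)+
    then show ?thesis using Suc by (cases k) auto
  qed simp
  then have "((\<lambda>t. \<Sum>m<n. t ^ m * a m) has_field_derivative (\<Sum>m<n. if m = 1 then a 1 else 0)) (at 0)"
    by (rule DERIV_sum)
  then show ?thesis by simp
qed

lemma curve_tangent:
  fixes \<gamma> :: "complex \<Rightarrow> 'n::finite fmat"
  assumes "\<And>t. \<gamma> t \<in> S" "\<And>t. (\<gamma> t, matrix_inv (\<gamma> t)) \<in> loop_bounded N"
    and "\<And>v. continuous_on UNIV (\<lambda>t. loop_coord (\<gamma> t, matrix_inv (\<gamma> t)) v)"
    and "\<And>v. ((\<lambda>t. loop_coord (\<gamma> t, matrix_inv (\<gamma> t)) v) has_field_derivative loop_coord (\<xi>, \<eta>) v) (at 0)"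
    and "\<gamma> 0 = x" "x \<in> connected_component_of_set (loop_zariski S) e"
  shows "\<xi> \<in> tangent_space (connected_component_of_set (loop_zariski S) e) x"
  by (rule tangent_curve[where \<gamma> = \<gamma> and N = N and \<eta> = \<eta>]) (use assms curve_in_component[of \<gamma> S N e] in auto)

lemma polynomial_curve_tangent:
  fixes \<gamma> :: "complex \<Rightarrow> 'n::finite fmat"
  assumes S: "\<And>t. \<gamma> t \<in> S" and n: "1 < n"
    and g: "\<And>t. \<gamma> t = (\<Sum>m<n. smult_mat (fls_const (t ^ m)) (C m))"
    and g': "\<And>t. matrix_inv (\<gamma> t) = (\<Sum>m<n. smult_mat (fls_const (t ^ m)) (C' m))"
    and x: "\<gamma> 0 = x" "x \<in> connected_component_of_set (loop_zariski S) e"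
  shows "C 1 \<in> tangent_space (connected_component_of_set (loop_zariski S) e) x"
proof -
  have "\<exists>N. \<forall>m. m < n \<longrightarrow> (C m, C' m) \<in> loop_bounded N"
  proof -
    have "\<forall>m. \<exists>M. \<forall>N\<ge>M. (C m, C' m) \<in> loop_bounded N" using ex_loop_bounded by blast
    from choice[OF this] obtain M where M: "\<And>m N. N \<ge> M m \<Longrightarrow> (C m, C' m) \<in> loop_bounded N" by blast
    have "M m \<le> Max (M ` {..<n})" if "m < n" for m using that by simp
    then show ?thesis using M by blast
  qed
  then obtain N where N: "\<And>m. m < n \<Longrightarrow> (C m, C' m) \<in> loop_bounded N" by blast
  have "smult_mat (t::complex) (0 :: 'n cmat) = 0" for t by (simp add: smult_mat_def vec_eq_iff)
  then have b: "(\<gamma> t, matrix_inv (\<gamma> t)) \<in> loop_bounded N" for t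
    unfolding g' using N by (auto simp: g loop_bounded_def coeff_mat_lin intro!: sum.neutral)
  have c: "loop_coord (\<gamma> t, matrix_inv (\<gamma> t)) v = (\<Sum>m<n. t ^ m * loop_coord (C m, C' m) v)" for t v
    unfolding g' by (cases v) (auto simp: g fls_nth_sum smult_mat_def)
  show ?thesis
  proof (rule curve_tangent[where \<gamma> = \<gamma> and \<eta> = "C' 1", OF S b _ _ x])
    fix v
    show "continuous_on UNIV (\<lambda>t. loop_coord (\<gamma> t, matrix_inv (\<gamma> t)) v)"
      unfolding c by (intro continuous_intros)
    show "((\<lambda>t. loop_coord (\<gamma> t, matrix_inv (\<gamma> t)) v) has_field_derivative loop_coord (C 1, C' 1) v) (at 0)"
      unfolding c using polynomial_curve_derivative[of "\<lambda>m. loop_coord (C m, C' m) v" n] n by simp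
  qed
qed

lemma mpoly_eval_map_const:
  "mpoly_eval fls_const p (entries (map_mat fls_const X)) = fls_const (mpoly_eval id p (entries X))"
  unfolding mpoly_eval_hom[OF is_ring_hom_intros(4) is_ring_hom_intros(1)]
  by (intro arg_cong2[where f = "\<lambda>a b. mpoly_eval a p b"]) (auto simp: entries_def fun_eq_iff)

lemma matpow_map_const: "matpow (map_mat fls_const (X :: complex ^ 'n ^ 'n)) m = map_mat fls_const (matpow X m)"
  by (induction m) (simp_all add: map_mat_1[OF is_ring_hom_intros(4)] map_mat_mult[OF is_ring_hom_intros(4)])

lemma fls_const_fact: "fls_const (c / fact m) = fls_const c * (1 / fact m :: complex fls)"
proof -
  have "(fact m :: complex fls) = of_nat (fact m)" by simp
  also have "\<dots> = fls_const (of_nat (fact m))" by (rule fls_of_nat)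
  also have "\<dots> = fls_const (fact m)" by simp
  finally have "(fact m :: complex fls) = fls_const (fact m)" .
  then have "fls_const (c / fact m) * fact m = fls_const c" by simp
  then show ?thesis by (simp add: field_simps)
qed

context cartan
begin

text \<open>The \<open>m\<close>-th power shifts weights by \<open>m \<alpha>\<close>, and
  \<open>wts\<close> contains only finitely many multiples of \<alpha>. The bound
  \<open>n > 1\<close> keeps the linear term in the truncated exponential.\<close>

lemma root_vector_nilpotent:
  assumes \<alpha>: "\<alpha> \<in> R" and X: "X \<in> root_space G A \<alpha>"
  shows "\<exists>n>1. matpow X n = 0"
proof -
  have X0: "cj X $ i $ j = 0" if "wt i - wt j \<noteq> \<alpha>" for i j
    using X that by (simp add: root_space_iff[OF root_dual[OF \<alpha>]])
  have sh: "wt i - wt j = (\<lambda>H. of_nat m * \<alpha> H)" if "cj (matpow X m) $ i $ j \<noteq> 0" for m i j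
    using that
  proof (induction m arbitrary: j)
    case 0
    then have "i = j" unfolding matpow.simps cj_1 by (simp add: mat_def split: if_splits)
    then show ?case by (simp add: fun_eq_iff)
  next
    case (Suc m)
    then have "(\<Sum>l\<in>UNIV. cj (matpow X m) $ i $ l * cj X $ l $ j) \<noteq> 0"
      by (simp add: cj_mult) (simp add: matrix_matrix_mult_def)
    then obtain l where l: "cj (matpow X m) $ i $ l \<noteq> 0" "cj X $ l $ j \<noteq> 0"
      by (auto elim!: sum.not_neutral_contains_not_neutral)
    have "wt i - wt j = (wt i - wt l) + (wt l - wt j)" by simp
    also have "\<dots> = (\<lambda>H. of_nat (Suc m) * \<alpha> H)"
      using Suc.IH[OF l(1)] X0[of l j] l(2) by (auto simp: fun_eq_iff algebra_simps)
    finally show ?case .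
  qed
  obtain H where H: "\<alpha> H \<noteq> 0" using \<alpha> by (auto simp: roots_iff fun_eq_iff)
  have "inj (\<lambda>m::nat. (\<lambda>H. of_nat m * \<alpha> H :: complex))"
    using H by (auto simp: inj_def dest: fun_cong[of _ _ H])
  then have "infinite ((\<lambda>m::nat. (\<lambda>H. of_nat m * \<alpha> H :: complex)) ` {2..})"
    using finite_imageD[OF _ inj_on_subset[OF _ subset_UNIV]] infinite_Ici by blast
  then obtain n where n: "n \<ge> 2" "(\<lambda>H. of_nat n * \<alpha> H) \<notin> wts"
    using finite_wts finite_subset by (metis atLeast_iff image_subsetI)
  have "cj (matpow X n) $ i $ j = 0" for i j
    using sh[of n i j] n(2) unfolding wts_def by (metis (mono_tags) UNIV_I case_prod_conv image_eqI)
  then have "matpow X n = 0" by (intro cj_eqI) simp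
  then show ?thesis using n(1) by (intro exI[of _ n]) simp
qed

end

context root_valuation
begin

abbreviation "S \<equiv> lattice_stabilizer G (Lambda G A r lam)"
abbreviation "K \<equiv> K_group G A r lam"
abbreviation "\<Lambda> \<equiv> Lat (level r lam)"

lemma S_D:
  assumes "x \<in> S"
  shows "invertible x" "p \<in> vanishing_ideal G \<Longrightarrow> mpoly_eval fls_const p (entries x) = 0"
    "(\<lambda>X. x ** X ** matrix_inv x) ` \<Lambda> = \<Lambda>"
  using assms by (auto simp: lattice_stabilizer_def group_F_def Lambda_eq)

lemma invertible_of_right_inverse: "g ** h = mat 1 \<Longrightarrow> invertible (g :: 'a::field ^ 'm ^ 'm)"
  unfolding invertible_def using matrix_left_right_inverse by blast

lemma S_mult:
  assumes x: "x \<in> S" and g: "g ** g' = mat 1"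
    and v: "\<And>p. p \<in> vanishing_ideal G \<Longrightarrow> mpoly_eval fls_const p (entries (x ** g)) = 0"
    and L: "\<And>Z. Z \<in> \<Lambda> \<Longrightarrow> g ** Z ** g' \<in> \<Lambda>" "\<And>Z. Z \<in> \<Lambda> \<Longrightarrow> g' ** Z ** g \<in> \<Lambda>"
  shows "x ** g \<in> S" "matrix_inv (x ** g) = g' ** matrix_inv x"
proof -
  note ix = matrix_inv_mult[OF S_D(1)[OF x]]
  have g2: "g' ** g = mat 1" using g matrix_left_right_inverse by blast
  have e: "(x ** g) ** (g' ** matrix_inv x) = mat 1"
    by (simp add: matrix_mul_assoc mat_cancel[OF g] ix)
  then show 2: "matrix_inv (x ** g) = g' ** matrix_inv x" by (rule matrix_inv_eq)
  have gL: "(\<lambda>Z. g ** Z ** g') ` \<Lambda> = \<Lambda>"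
  proof
    show "\<Lambda> \<subseteq> (\<lambda>Z. g ** Z ** g') ` \<Lambda>"
    proof
      fix Z assume "Z \<in> \<Lambda>"
      moreover have "Z = g ** (g' ** Z ** g) ** g'" by (simp add: matrix_mul_assoc g mat_cancel[OF g])
      ultimately show "Z \<in> (\<lambda>Z. g ** Z ** g') ` \<Lambda>" using L(2) by blast
    qed
  qed (use L in auto)
  have "(\<lambda>X. (x ** g) ** X ** matrix_inv (x ** g)) ` \<Lambda> = (\<lambda>X. x ** X ** matrix_inv x) ` ((\<lambda>Z. g ** Z ** g') ` \<Lambda>)"
    unfolding 2 image_image by (intro image_cong refl) (simp add: matrix_mul_assoc)
  then show "x ** g \<in> S"
    using v invertible_of_right_inverse[OF e] S_D(3)[OF x]
    by (simp add: lattice_stabilizer_def group_F_def Lambda_eq gL)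
qed

lemma one_in_S: "mat 1 \<in> S"
proof -
  have "mpoly_eval fls_const p (entries (mat 1 :: 'n fmat)) = 0" if "p \<in> vanishing_ideal G" for p
    using mpoly_eval_map_const[of p "mat 1"] that one_in
    by (simp add: map_mat_1[OF is_ring_hom_intros(4)] vanishing_ideal_def)
  then show ?thesis by (simp add: lattice_stabilizer_def group_F_def invertible_of_right_inverse[of "mat 1" "mat 1"] matrix_inv_eq[of "mat 1" "mat 1"])
qed

lemma topspace_S: "topspace (loop_zariski S) = S"
proof -
  have "S \<in> {{g \<in> S. f (g, matrix_inv g) \<noteq> 0} |f. loop_regular f}"
    by (intro CollectI exI[of _ "\<lambda>_. 1"] conjI loop_regular_intros(1)) simp
  then show ?thesis unfolding loop_zariski_def topology_generated_by_topspace by auto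
qed

lemma K_sub_S: "K \<subseteq> S"
  unfolding K_group_def using connected_component_of_subset_topspace topspace_S by metis

lemma one_in_K: "mat 1 \<in> K"
  unfolding K_group_def using connected_component_of_refl[of "loop_zariski S"] topspace_S one_in_S by simp

lemma level_stab_mono: "i \<le> j \<Longrightarrow> stab i \<subseteq> stab j"
proof
  fix X assume "i \<le> j" "X \<in> stab i"
  then show "X \<in> stab j" using level_mono[of "m + i" "m + j" r lam for m] unfolding stab_def by auto
qed

lemma smult_in_stab: "X \<in> stab i \<Longrightarrow> smult_mat c X \<in> stab i"
proof -
  have "lie_bracket (smult_mat c X) Z = smult_mat c (lie_bracket X Z)" for Z :: "'n cmat"
    by (rule smult_mat_bracket)
  then show "X \<in> stab i \<Longrightarrow> smult_mat c X \<in> stab i" by (simp add: stab_def lie_algebra_smult level_closed)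
qed

lemma nexp1_conj_lattice:
  assumes X: "X \<in> stab i" and n: "matpow (emono i X) n = 0" and Z: "Z \<in> \<Lambda>"
  shows "nexp1 n (emono i X) ** Z ** nexp1 n (- emono i X) \<in> \<Lambda>"
proof -
  obtain N where N: "nexp1 n (emono i X) ** Z ** nexp1 n (- emono i X) = (\<Sum>m<N. smult_mat (1 / fact m) ((lie_bracket (emono i X) ^^ m) Z))"
    using nexp1_conj[OF n] by blast
  have "(lie_bracket (emono i X) ^^ m) Z \<in> \<Lambda>" for m
    by (induction m) (use Z X in \<open>auto intro: bracket_emono_stab\<close>)
  then have "smult_mat (1 / fact m) ((lie_bracket (emono i X) ^^ m) Z) \<in> \<Lambda>" for m
    using Lat_closed(3)[of _ r lam "1 / fact m"] fls_const_fact[of 1 m] by simp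
  then show ?thesis unfolding N by (intro Lat_sum)
qed

text \<open>The curve \<open>x exp (t \<epsilon>^i X)\<close> starts at \<open>x\<close> and stays
  in the stabilizer, hence in the component \<open>K\<close>. Its entries are polynomial in
  \<open>t\<close>, with linear coefficient \<open>x ** emono i X\<close>.\<close>

lemma root_tangent:
  assumes \<alpha>: "\<alpha> \<in> R" and X: "X \<in> root_space G A \<alpha>" "X \<in> stab i" and x: "x \<in> K"
  shows "x ** emono i X \<in> tangent_space K x"
proof -
  obtain n where n: "1 < n" "matpow X n = 0" using root_vector_nilpotent[OF \<alpha> X(1)] by blast
  have np: "matpow (emono i (smult_mat c X)) m = smult_mat (fls_const (c ^ m)) (matpow (emono i X) m)" for c m
  proof -
    have e: "emono i (smult_mat c X) = smult_mat (fls_const c) (emono i X)"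
      by (rule fmat_eqI) (simp add: coeff_mat_lin coeff_emono smult_mat_0)
    have "fls_const c ^ m = fls_const (c ^ m)" by (induction m) (simp_all add: fls_const_mult_const)
    then show ?thesis unfolding e matpow_smult by simp
  qed
  have n0: "matpow (emono i X) n = 0"
    unfolding emono_def matpow_smult matpow_map_const n(2) by (simp add: smult_mat_def vec_eq_iff)
  have nc: "matpow (emono i (smult_mat c X)) n = 0" for c unfolding np n0 by (simp add: smult_mat_def vec_eq_iff)
  have mi: "- emono i (smult_mat c X) = emono i (smult_mat (- c) X)" for c
    by (rule fmat_eqI) (simp add: coeff_mat_lin coeff_emono, simp add: smult_mat_def vec_eq_iff)
  let ?g = "\<lambda>t. nexp1 n (emono i (smult_mat t X))"
  have inv: "?g t ** ?g (- t) = mat 1" for t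
    using nexp1_minus[OF nc, of t] unfolding mi .
  have L: "?g t ** Z ** ?g (- t) \<in> \<Lambda>" if "Z \<in> \<Lambda>" for t Z
    using nexp1_conj_lattice[OF smult_in_stab[OF X(2)] nc that, of t] unfolding mi .
  have xS: "x \<in> S" using x K_sub_S by blast
  have v: "mpoly_eval fls_const p (entries (x ** ?g t)) = 0" if "p \<in> vanishing_ideal G" for p t
    using X(1) S_D(2)[OF xS] that
    by (intro mpoly_eval_nexp1[where X = "smult_mat t X", OF lie_algebra_smult[OF root_space_sub] is_ring_hom_intros(4) _ _ emono_def nc]) auto
  have L': "?g (- t) ** Z ** ?g t \<in> \<Lambda>" if "Z \<in> \<Lambda>" for t Z using L[OF that, of "- t"] by simp
  have S: "x ** ?g t \<in> S" "matrix_inv (x ** ?g t) = ?g (- t) ** matrix_inv x" for t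
    by (rule S_mult[OF xS inv v L L']; assumption)+
  have ge: "?g t = (\<Sum>m<n. smult_mat (fls_const (t ^ m)) (smult_mat (1 / fact m) (matpow (emono i X) m)))" for t
    unfolding nexp1_eq np by (simp add: smult_smult_mat mult.commute)
  let ?C = "\<lambda>m. x ** smult_mat (1 / fact m) (matpow (emono i X) m)"
  have "?C 1 \<in> tangent_space (connected_component_of_set (loop_zariski S) (mat 1)) x"
  proof (rule polynomial_curve_tangent[where \<gamma> = "\<lambda>t. x ** ?g t" and C = ?C, OF S(1) n(1)])
    show "x ** ?g t = (\<Sum>m<n. smult_mat (fls_const (t ^ m)) (?C m))" for t
      unfolding ge matrix_mult_sum_right smult_mat_mult ..
    have "fls_const ((- t) ^ m) = fls_const (t ^ m) * (- 1) ^ m" for t :: complex and m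
      by (induction m) (simp_all add: fls_const_mult_const[symmetric] del: fls_const_mult_const)
    then show "matrix_inv (x ** ?g t) = (\<Sum>m<n. smult_mat (fls_const (t ^ m)) (smult_mat ((- 1) ^ m) (smult_mat (1 / fact m) (matpow (emono i X) m)) ** matrix_inv x))" for t
      unfolding S(2) unfolding ge matrix_mult_sum_left smult_mat_mult smult_smult_mat by (simp add: mult.assoc)
    show "x ** ?g 0 = x"
    proof -
      have "?g 0 = (\<Sum>m<n. if m = 0 then mat 1 else 0)"
        unfolding ge by (rule sum.cong) (auto simp: smult_mat_def vec_eq_iff zero_power)
      then show ?thesis using n(1) by simp
    qed
  qed (use x in \<open>simp add: K_group_def\<close>)
  moreover have "?C 1 = x ** emono i X" by (simp add: smult_mat_def)
  ultimately show ?thesis by (simp add: K_group_def)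
qed

end

section \<open>Curves in the torus\<close>

text \<open>\<open>tser i c\<close> is the series \<open>exp (c \<epsilon>\<^sup>i)\<close>.\<close>

definition tser :: "nat \<Rightarrow> complex \<Rightarrow> complex fls"
  where "tser i c = (if i = 0 then fls_const (exp c) else fps_to_fls (fps_exp c oo fps_X ^ i))"

lemma fps_X_power_nth_0: "i > 0 \<Longrightarrow> fps_nth (fps_X ^ i :: complex fps) 0 = 0"
  by (simp add: fps_X_power_nth)

lemma tser_add: "tser i (c + d) = tser i c * tser i d"
  by (simp add: tser_def exp_add fps_exp_add_mult fps_compose_mult_distrib fps_X_power_nth_0 fls_times_fps_to_fls)

lemma tser_0: "tser i 0 = 1"
  by (simp add: tser_def)

lemma tser_nth_neg: "m < 0 \<Longrightarrow> fls_nth (tser i c) m = 0"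
  by (simp add: tser_def)

lemma tser_nth:
  assumes "i > 0"
  shows "fls_nth (tser i (t * c)) (int m) = (\<Sum>j<Suc m. t ^ j * (c ^ j / fact j * (if m = i * j then 1 else 0)))"
proof -
  have "fls_nth (tser i (t * c)) (int m) = (\<Sum>j\<le>m. fps_nth (fps_exp (t * c)) j * fps_nth ((fps_X ^ i) ^ j) m)"
    using assms by (simp add: tser_def fps_compose_nth atLeast0AtMost)
  also have "\<dots> = (\<Sum>j<Suc m. t ^ j * (c ^ j / fact j * (if m = i * j then 1 else 0)))"
    unfolding lessThan_Suc_atMost
    by (intro sum.cong refl) (simp add: power_mult_distrib power_mult[symmetric] fps_X_power_nth)
  finally show ?thesis .
qed

lemma tser_derivative:
  "((\<lambda>t. fls_nth (tser i (t * c)) m) has_field_derivative (if m = int i then c else 0)) (at 0)"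
  "continuous_on UNIV (\<lambda>t. fls_nth (tser i (t * c)) m)"
proof -
  have "((\<lambda>t. fls_nth (tser i (t * c)) m) has_field_derivative (if m = int i then c else 0)) (at 0) \<and>
    continuous_on UNIV (\<lambda>t. fls_nth (tser i (t * c)) m)"
  proof (cases "m < 0")
    case True
    then show ?thesis by (simp add: tser_nth_neg)
  next
    case False
    then obtain k where m: "m = int k" by (metis nonneg_int_cases not_less)
    show ?thesis
    proof (cases "i = 0")
      case True
      show ?thesis
      proof (cases "k = 0")
        case True
        have "((\<lambda>t. exp (t * c)) has_field_derivative c) (at 0)" by (auto intro!: derivative_eq_intros)
        then show ?thesis using \<open>i = 0\<close> True by (auto simp: tser_def m intro!: continuous_intros)
      qed (use True in \<open>simp add: tser_def m\<close>)
    next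
      case False
      show ?thesis
        unfolding m tser_nth[OF False[unfolded neq0_conv]]
      proof
        show "((\<lambda>t. \<Sum>j<Suc k. t ^ j * (c ^ j / fact j * (if k = i * j then 1 else 0))) has_field_derivative
          (if int k = int i then c else 0)) (at 0)"
          using polynomial_curve_derivative[of "\<lambda>j. c ^ j / fact j * (if k = i * j then 1 else 0)" "Suc k"] False
          by (auto split: if_splits)
        show "continuous_on UNIV (\<lambda>t. \<Sum>j<Suc k. t ^ j * (c ^ j / fact j * (if k = i * j then 1 else 0)))"
          by (intro continuous_intros)
      qed
    qed
  qed
  then show "((\<lambda>t. fls_nth (tser i (t * c)) m) has_field_derivative (if m = int i then c else 0)) (at 0)"
    "continuous_on UNIV (\<lambda>t. fls_nth (tser i (t * c)) m)" by blast+
qed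

lemma map_mat_dg: "f 0 = 0 \<Longrightarrow> map_mat f (dg y) = dg (\<lambda>l. f (y l))"
  by (simp add: dg_def vec_eq_iff)

context cartan
begin

text \<open>The element \<open>exp (\<epsilon>^i H)\<close>. Semisimple \<open>H\<close> has no
  finite exponential sum, so it is built from the exponentials of its eigenvalues.\<close>

definition tor :: "nat \<Rightarrow> 'n cmat \<Rightarrow> 'n fmat"
  where "tor i H = map_mat fls_const P ** dg (\<lambda>l. tser i (\<tau> H l)) ** map_mat fls_const (matrix_inv P)"

lemma ic_dg_\<tau>: "H \<in> \<aa> \<Longrightarrow> ic (dg (\<tau> H)) = H"
  using cj_a cj_ic by metis

lemma ic_dg_nth: "ic (dg y) $ i $ j = (\<Sum>l\<in>UNIV. P $ i $ l * y l * matrix_inv P $ l $ j)"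
  unfolding ic_def matrix_matrix_mult_def[of "P ** dg y"] by (simp add: dg_mult)

lemma map_const_P:
  "map_mat fls_const P ** map_mat fls_const (matrix_inv P) = mat 1"
  "map_mat fls_const (matrix_inv P) ** map_mat fls_const P = mat 1"
  using matrix_inv_mult[OF P(1)]
  by (simp_all only: map_mat_mult[OF is_ring_hom_intros(4), symmetric] map_mat_1[OF is_ring_hom_intros(4)])

lemma map_const_eq_emono: "map_mat fls_const Y = emono 0 Y"
  by (rule fmat_eqI) (simp add: coeff_emono, simp add: coeff_mat_def vec_eq_iff)

lemma coeff_conj_P:
  "coeff_mat (map_mat fls_const P ** Z ** map_mat fls_const (matrix_inv P)) m = ic (coeff_mat Z m)"
  "coeff_mat (map_mat fls_const (matrix_inv P) ** Z ** map_mat fls_const P) m = cj (coeff_mat Z m)"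
  by (simp_all add: map_const_eq_emono coeff_emono_mult ic_def cj_def)

lemma coeff_dg: "coeff_mat (dg y) m = dg (\<lambda>l. fls_nth (y l) m)"
  by (simp add: coeff_mat_def dg_def vec_eq_iff)

lemma coeff_tor: "coeff_mat (tor i H) m = ic (dg (\<lambda>l. fls_nth (tser i (\<tau> H l)) m))"
  unfolding tor_def coeff_conj_P coeff_dg ..

lemma \<tau>_uminus: "\<tau> (- H) l = - \<tau> H l"
  using \<tau>_lin(1)[of H "- H" l] \<tau>_lin(3)[of l] by (simp add: eq_neg_iff_add_eq_0 add.commute)

lemma tor_minus: "tor i H ** tor i (- H) = mat 1"
proof -
  have "tser i c * tser i (- c) = 1" for c using tser_add[of i c "- c"] by (simp add: tser_0)
  then have "dg (\<lambda>l. tser i (\<tau> H l)) ** dg (\<lambda>l. tser i (\<tau> (- H) l)) = mat 1"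
    by (simp add: dg_comp \<tau>_uminus) (simp add: dg_def mat_def)
  then have "map_mat fls_const P ** (dg (\<lambda>l. tser i (\<tau> H l)) ** dg (\<lambda>l. tser i (\<tau> (- H) l))) ** map_mat fls_const (matrix_inv P) = mat 1"
    by (simp add: map_const_P)
  then show ?thesis
    unfolding tor_def by (simp add: matrix_mul_assoc mat_cancel[OF map_const_P(2)])
qed

text \<open>Conjugation multiplies the component of weight \<alpha> by the series
  \<open>tser i (\<alpha> H)\<close>. This series has no negative exponents, so the outer sum starts
  at 0 and coefficients move only upwards.\<close>

lemma coeff_tor_conj:
  assumes H: "H \<in> \<aa>" and Z: "\<And>m. m < N \<Longrightarrow> coeff_mat Z m = 0"
  shows "coeff_mat (tor i H ** Z ** tor i (- H)) m =
    (\<Sum>j\<in>{0..m - N}. \<Sum>\<alpha>\<in>wts. smult_mat (fls_nth (tser i (\<alpha> H)) j) (proj_wt \<alpha> (coeff_mat Z (m - j))))"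
proof -
  let ?Z = "map_mat fls_const (matrix_inv P) ** Z ** map_mat fls_const P"
  let ?W = "dg (\<lambda>l. tser i (\<tau> H l)) ** ?Z ** dg (\<lambda>l. tser i (\<tau> (- H) l))"
  have e: "tor i H ** Z ** tor i (- H) = map_mat fls_const P ** ?W ** map_mat fls_const (matrix_inv P)"
    unfolding tor_def by (simp add: matrix_mul_assoc)
  have W: "?W $ a $ b = tser i ((wt a - wt b) H) * ?Z $ a $ b" for a b
  proof -
    have "?W $ a $ b = tser i (\<tau> H a) * ?Z $ a $ b * tser i (- \<tau> H b)" by (simp add: dg_mult \<tau>_uminus)
    also have "\<dots> = tser i (\<tau> H a + - \<tau> H b) * ?Z $ a $ b" unfolding tser_add by simp
    finally show ?thesis using H by (simp add: wt_def)
  qed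
  have cZ: "coeff_mat ?Z k = 0" if "k < N" for k unfolding coeff_conj_P Z[OF that] by simp
  have "coeff_mat ?W m $ a $ b = (\<Sum>j\<in>{0..m - N}. fls_nth (tser i ((wt a - wt b) H)) j * cj (coeff_mat Z (m - j)) $ a $ b)" for a b
  proof -
    have z: "fls_nth (?Z $ a $ b) k = 0" if "k < N" for k
      using cZ[OF that] by (simp add: coeff_mat_nth[symmetric])
    have zc: "fls_nth (?Z $ a $ b) k = cj (coeff_mat Z k) $ a $ b" for k
      unfolding coeff_mat_nth[symmetric] coeff_conj_P ..
    have "fls_nth (tser i ((wt a - wt b) H) * ?Z $ a $ b) m
      = (\<Sum>j\<in>{0..m - N}. fls_nth (tser i ((wt a - wt b) H)) j * fls_nth (?Z $ a $ b) (m - j))"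
      by (rule fls_mult_nth) (use z tser_nth_neg in blast)+
    then show ?thesis by (simp only: coeff_mat_nth[of ?W] W zc)
  qed
  then have "cj (coeff_mat (tor i H ** Z ** tor i (- H)) m) $ a $ b
    = (\<Sum>j\<in>{0..m - N}. fls_nth (tser i ((wt a - wt b) H)) j * cj (coeff_mat Z (m - j)) $ a $ b)" for a b
    unfolding e coeff_conj_P by simp
  moreover have "wt a - wt b \<in> wts" for a b unfolding wts_def by (rule image_eqI[of _ _ "(a, b)"]) auto
  moreover have "(\<Sum>\<alpha>\<in>wts. x \<alpha> * (if \<beta> = \<alpha> then y else 0)) = x \<beta> * y" if "\<beta> \<in> wts" for \<beta> y and x :: "_ \<Rightarrow> complex"
    using that finite_wts by (simp add: if_distrib sum.delta' cong: if_cong)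
  ultimately show ?thesis
    by (intro cj_eqI) (simp add: cj_lin_nth cj_proj_wt)
qed

lemma mpoly_eval_tor:
  assumes H: "H \<in> \<aa>" and p: "p \<in> vanishing_ideal G"
  shows "mpoly_eval fls_const p (entries (tor i H)) = 0"
proof -
  note PH = fexp_conj[OF matrix_inv_mult(2)[OF P(1)], of "dg (\<tau> H)"]
  have Hg: "H \<in> \<gg>" using H a_sub by blast
  have fH: "fexp H = map_mat fps_const P ** dg (\<lambda>l. fps_exp (\<tau> H l)) ** map_mat fps_const (matrix_inv P)"
    using PH ic_dg_\<tau>[OF H] by (simp add: ic_def fexp_dg)
  show ?thesis
  \<comment> \<open>Substituting \<open>\<epsilon>^i\<close> into a formal exponential requires a
    series without constant term. For \<open>i = 0\<close> the convergent exponential gives a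
    constant point of the group instead.\<close>
  proof (cases "i = 0")
    case True
    have "mexp 1 H = P ** mexp 1 (dg (\<tau> H)) ** matrix_inv P"
      using mexp_conj[OF matrix_inv_mult(2)[OF P(1)], of 1 "dg (\<tau> H)"] ic_dg_\<tau>[OF H] by (simp add: ic_def)
    also have "mexp 1 (dg (\<tau> H)) = dg (\<lambda>l. exp (\<tau> H l))"
      unfolding mexp_def fexp_dg by (subst map_mat_dg) (simp_all add: eval_fps_exp)
    finally have "map_mat fls_const (mexp 1 H) = tor i H"
      unfolding tor_def by (simp add: map_mat_mult[OF is_ring_hom_intros(4)] map_mat_dg tser_def True)
    moreover have "mexp 1 H \<in> G" by (rule mexp_in_group[OF alg Hg])
    ultimately show ?thesis
      using mpoly_eval_map_const[of p "mexp 1 H"] p by (simp add: vanishing_ideal_def)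
  next
    case False
    let ?\<psi> = "\<lambda>f :: complex fps. fps_to_fls (f oo fps_X ^ i)"
    have 1: "is_ring_hom (\<lambda>f :: complex fps. f oo fps_X ^ i)"
      using False by (simp add: is_ring_hom_def fps_compose_add_distrib fps_compose_mult_distrib fps_X_power_nth_0)
    have h: "is_ring_hom ?\<psi>" using is_ring_hom_comp[OF 1 is_ring_hom_intros(7)] .
    have c: "?\<psi> (fps_const c) = fls_const c" for c by simp
    have "map_mat ?\<psi> (fexp H) = map_mat fls_const P ** map_mat ?\<psi> (dg (\<lambda>l. fps_exp (\<tau> H l))) ** map_mat fls_const (matrix_inv P)"
      unfolding fH map_mat_mult[OF h] by (simp add: c)
    also have "map_mat ?\<psi> (dg (\<lambda>l. fps_exp (\<tau> H l))) = dg (\<lambda>l. tser i (\<tau> H l))"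
      using False by (subst map_mat_dg) (simp_all add: tser_def)
    finally have "tor i H = map_mat ?\<psi> (fexp H)" by (simp add: tor_def)
    then have "mpoly_eval fls_const p (entries (tor i H)) = ?\<psi> (mpoly_eval fps_const p (entries (fexp H)))"
      unfolding mpoly_eval_hom[OF h is_ring_hom_intros(3)]
      by (intro arg_cong2[where f = "\<lambda>a b. mpoly_eval a p b"]) (auto simp: entries_def fun_eq_iff)
    then show ?thesis by (simp add: mpoly_eval_fexp[OF Hg p])
  qed
qed

end

context root_valuation
begin

lemma proj_wt_in_level:
  assumes "\<alpha> \<in> wts" "Y \<in> level s l m"
  shows "proj_wt \<alpha> Y \<in> level s l m"
proof -
  note Yg = level_sub[OF assms(2)]
  consider "\<alpha> = 0" | "\<alpha> \<in> R" | "\<alpha> \<noteq> 0" "\<alpha> \<notin> R" by blast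
  then show ?thesis
  proof cases
    case 1
    show ?thesis unfolding 1 using assms(2) by (intro a_in_level proj_wt_0_in_a[OF Yg]) (simp add: level_def)
  next
    case 2
    show ?thesis
    proof (cases "m < l \<alpha>")
      case True
      then have "proj_wt \<alpha> Y = 0" using assms(2) 2 by (simp add: level_def)
      then show ?thesis by (simp add: level_closed)
    next
      case False
      then show ?thesis by (intro root_space_in_level[OF 2 proj_wt_in_root_space[OF assms(1) Yg]]) simp
    qed
  next
    case 3
    then show ?thesis using proj_wt_not_root[OF Yg] by (simp add: level_closed)
  qed
qed

lemma tor_conj_lattice:
  assumes H: "H \<in> \<aa>" and Z: "Z \<in> \<Lambda>"
  shows "tor i H ** Z ** tor i (- H) \<in> \<Lambda>"
proof -
  obtain N where N: "\<And>m. m < N \<Longrightarrow> coeff_mat Z m = 0" using fmat_bounded by blast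
  have "proj_wt \<alpha> (coeff_mat Z (m - j)) \<in> level r lam m" if "\<alpha> \<in> wts" "j \<ge> 0" for \<alpha> m j
    using proj_wt_in_level[OF that(1), of "coeff_mat Z (m - j)" r lam "m - j"] Z level_mono[of "m - j" m r lam] that(2)
    by (auto simp: Lat_def)
  moreover have "coeff_mat (tor i H ** Z ** tor i (- H)) m =
    (\<Sum>j\<in>{0..m - N}. \<Sum>\<alpha>\<in>wts. smult_mat (fls_nth (tser i (\<alpha> H)) j) (proj_wt \<alpha> (coeff_mat Z (m - j))))" for m
    by (rule coeff_tor_conj[OF H N])
  ultimately show ?thesis
    unfolding Lat_def by (simp only: mem_Collect_eq) (intro allI level_sum level_closed, auto)
qed

text \<open>Only the identity is treated: at the other points of \<open>K\<close> the torus
  directions of the target come from \<open>a_ge\<close>.\<close>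

lemma torus_tangent:
  assumes H: "H \<in> \<aa>"
  shows "emono (int i) H \<in> tangent_space K (mat 1)"
proof -
  let ?g = "\<lambda>t. tor i (smult_mat t H)"
  have tH: "smult_mat t H \<in> \<aa>" for t using a_closed(3)[OF H] .
  have m: "- smult_mat t H = smult_mat (- t) H" for t by (simp add: smult_mat_def vec_eq_iff)
  have inv: "?g t ** ?g (- t) = mat 1" for t using tor_minus[of i "smult_mat t H"] unfolding m .
  have L: "?g t ** Z ** ?g (- t) \<in> \<Lambda>" if "Z \<in> \<Lambda>" for t Z
    using tor_conj_lattice[OF tH that, of i t] unfolding m .
  have L': "?g (- t) ** Z ** ?g t \<in> \<Lambda>" if "Z \<in> \<Lambda>" for t Z using L[OF that, of "- t"] by simp
  have v: "mpoly_eval fls_const p (entries (mat 1 ** ?g t)) = 0" if "p \<in> vanishing_ideal G" for p t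
    using mpoly_eval_tor[OF tH that] by simp
  have S1: "mat 1 ** ?g t \<in> S" for t
    by (rule S_mult[OF one_in_S inv v L L']; assumption)
  have S: "?g t \<in> S" "matrix_inv (?g t) = ?g (- t)" for t
    using S1[of t] matrix_inv_eq[OF inv] by simp_all
  have "0 = ic (dg (\<lambda>_. 0))" by (simp add: vec_eq_iff ic_dg_nth)
  then have b: "(?g t, matrix_inv (?g t)) \<in> loop_bounded 0" for t
    by (simp add: loop_bounded_def S(2) coeff_tor tser_nth_neg)
  \<comment> \<open>The factor \<open>s\<close> is 1 for the curve and -1 for its inverse, so both
    components of the pair are covered at once.\<close>
  have nth: "fls_nth (?g (s * t) $ a $ b) k = (\<Sum>l\<in>UNIV. P $ a $ l * fls_nth (tser i (t * (s * \<tau> H l))) k * matrix_inv P $ l $ b)" for s t a b k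
    unfolding coeff_mat_nth[symmetric] coeff_tor ic_dg_nth \<tau>_lin by (simp add: mult_ac)
  have cont: "continuous_on UNIV (\<lambda>t. fls_nth (?g (s * t) $ a $ b) k)" for s a b k
    unfolding nth by (intro continuous_intros tser_derivative(2))
  have der: "((\<lambda>t. fls_nth (?g (s * t) $ a $ b) k) has_field_derivative fls_nth (emono (int i) (smult_mat s H) $ a $ b) k) (at 0)" for s a b k
  proof -
    have "((\<lambda>t. fls_nth (?g (s * t) $ a $ b) k) has_field_derivative
      (\<Sum>l\<in>UNIV. P $ a $ l * (if k = int i then s * \<tau> H l else 0) * matrix_inv P $ l $ b)) (at 0)"
      unfolding nth by (intro DERIV_sum DERIV_cmult DERIV_cmult_right tser_derivative(1))
    also have "(\<Sum>l\<in>UNIV. P $ a $ l * (if k = int i then s * \<tau> H l else 0) * matrix_inv P $ l $ b)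
      = coeff_mat (emono (int i) (ic (dg (\<lambda>l. s * \<tau> H l)))) k $ a $ b"
      by (simp add: coeff_emono ic_dg_nth)
    also have "ic (dg (\<lambda>l. s * \<tau> H l)) = smult_mat s H"
    proof -
      have "\<tau> (smult_mat s H) = (\<lambda>l. s * \<tau> H l)" by (simp add: fun_eq_iff \<tau>_lin)
      then show ?thesis using ic_dg_\<tau>[OF tH, of s] by simp
    qed
    finally show ?thesis by (simp add: coeff_mat_nth)
  qed
  have "emono (int i) H \<in> tangent_space (connected_component_of_set (loop_zariski S) (mat 1)) (mat 1)"
  proof (rule curve_tangent[where \<gamma> = ?g and \<eta> = "emono (int i) (smult_mat (- 1) H)", OF S(1) b])
    fix v
    have s1: "smult_mat 1 H = H" by (simp add: smult_mat_def)
    show "continuous_on UNIV (\<lambda>t. loop_coord (?g t, matrix_inv (?g t)) v)"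
      using cont[of 1] cont[of "- 1"] by (cases v) (auto simp: S(2))
    show "((\<lambda>t. loop_coord (?g t, matrix_inv (?g t)) v) has_field_derivative
        loop_coord (emono (int i) H, emono (int i) (smult_mat (- 1) H)) v) (at 0)"
      using der[of 1] der[of "- 1"] by (cases v) (auto simp: S(2) s1)
    have "dg (\<lambda>_. 1) = (mat 1 :: 'n fmat)" by (simp add: dg_def mat_def)
    then show "?g 0 = mat 1" by (simp add: tor_def \<tau>_lin tser_0 map_const_P)
  qed (use one_in_K in \<open>simp add: K_group_def\<close>)
  then show ?thesis by (simp add: K_group_def)
qed

end

section \<open>Tangent spaces of the stabilizer\<close>

lemma functional_entries:
  fixes l :: "'n::finite cmat \<Rightarrow> complex"
  assumes add: "\<And>X Y. l (X + Y) = l X + l Y" and sc: "\<And>c X. l (smult_mat c X) = c * l X"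
  shows "l Z = (\<Sum>i\<in>UNIV. \<Sum>j\<in>UNIV. l (\<chi> a b. if a = i \<and> b = j then 1 else 0) * Z $ i $ j)"
proof -
  let ?E = "\<lambda>i j. (\<chi> a b. if a = i \<and> b = j then 1 else 0) :: 'n cmat"
  have 0: "l 0 = 0" using sc[of 0 0] by (simp add: smult_mat_def zero_vec_def)
  have sum: "l (sum f I) = (\<Sum>i\<in>I. l (f i))" for I :: "'n set" and f
    by (induction I rule: infinite_finite_induct) (auto simp: 0 add)
  have "(\<Sum>i\<in>UNIV. \<Sum>j\<in>UNIV. smult_mat (Z $ i $ j) (?E i j)) $ a $ b = Z $ a $ b" for a b
  proof -
    have "(\<Sum>i\<in>UNIV. \<Sum>j\<in>UNIV. smult_mat (Z $ i $ j) (?E i j)) $ a $ b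
      = (\<Sum>i\<in>UNIV. \<Sum>j\<in>UNIV. if i = a then (if j = b then Z $ i $ j else 0) else 0)"
      by (simp add: smult_mat_def) (intro sum.cong refl, auto)
    also have "\<dots> = (\<Sum>i\<in>UNIV. if i = a then (\<Sum>j\<in>UNIV. if j = b then Z $ i $ j else 0) else 0)"
      by (intro sum.cong refl) auto
    finally show ?thesis by simp
  qed
  then have "Z = (\<Sum>i\<in>UNIV. \<Sum>j\<in>UNIV. smult_mat (Z $ i $ j) (?E i j))" by (simp add: vec_eq_iff)
  then have "l Z = l (\<Sum>i\<in>UNIV. \<Sum>j\<in>UNIV. smult_mat (Z $ i $ j) (?E i j))" by simp
  then show ?thesis by (simp add: sum sc mult.commute)
qed

lemma coeff_mat_mult':
  assumes "\<And>k. k < M \<Longrightarrow> coeff_mat X k = 0" "\<And>k. k < N \<Longrightarrow> coeff_mat Z k = 0"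
  shows "coeff_mat (X ** Z) m = (\<Sum>j\<in>{N..m - M}. coeff_mat X (m - j) ** coeff_mat Z j)"
proof -
  have "coeff_mat (X ** Z) m = (\<Sum>j\<in>{M..m - N}. coeff_mat X j ** coeff_mat Z (m - j))"
    by (rule coeff_mat_mult[OF assms])
  also have "\<dots> = (\<Sum>j\<in>{N..m - M}. coeff_mat X (m - j) ** coeff_mat Z j)"
    by (rule sum.reindex_bij_witness[of _ "\<lambda>j. m - j" "\<lambda>j. m - j"]) auto
  finally show ?thesis .
qed

context root_valuation
begin

text \<open>The three families express membership in \<open>\<gg>\<close>, the bounds on root
  components and the bounds on the torus component. Roots are linear only on \<open>\<aa>\<close>,
  being 0 elsewhere; hence the third family uses differences of diagonal entries
  \<open>\<tau>\<close>, which are linear on all matrices.\<close>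

lemma level_functionals:
  "\<exists>L. (\<forall>l\<in>L. (\<forall>X Y. l (X + Y) = l X + l Y) \<and> (\<forall>c X. l (smult_mat c X) = c * l X)) \<and>
    (\<forall>Z. Z \<in> level s l' m \<longleftrightarrow> (\<forall>l\<in>L. l Z = 0))"
proof -
  let ?L1 = "(\<lambda>p Z. mpoly_eval id (D Z p) (entries (mat 1))) ` vanishing_ideal G"
  let ?L2 = "(\<lambda>(\<alpha>, i, j) Z. cj (proj_wt \<alpha> Z) $ i $ j) ` ({\<alpha>\<in>R. m < l' \<alpha>} \<times> UNIV \<times> UNIV)"
  let ?L3 = "(\<lambda>(i, j) Z. \<tau> (proj_wt 0 Z) i - \<tau> (proj_wt 0 Z) j) ` {(i, j). wt i - wt j \<in> R \<and> m < s (wt i - wt j)}"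
  have g: "Z \<in> \<gg> \<longleftrightarrow> (\<forall>l\<in>?L1. l Z = 0)" for Z by (simp add: lie_algebra_iff)
  have r: "(\<forall>\<alpha>\<in>R. m < l' \<alpha> \<longrightarrow> proj_wt \<alpha> Z = 0) \<longleftrightarrow> (\<forall>l\<in>?L2. l Z = 0)" for Z
  proof -
    have "proj_wt \<alpha> Z = 0 \<longleftrightarrow> (\<forall>i j. cj (proj_wt \<alpha> Z) $ i $ j = 0)" for \<alpha>
      using cj_eqI[of "proj_wt \<alpha> Z" 0] by (auto simp: cj_lin_nth)
    then show ?thesis by auto
  qed
  have t: "(\<forall>\<beta>\<in>R. m < s \<beta> \<longrightarrow> \<beta> (proj_wt 0 Z) = 0) \<longleftrightarrow> (\<forall>l\<in>?L3. l Z = 0)" if "Z \<in> \<gg>" for Z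
  proof -
    have "(\<forall>\<beta>\<in>R. m < s \<beta> \<longrightarrow> \<beta> (proj_wt 0 Z) = 0) \<longleftrightarrow>
      (\<forall>i j. wt i - wt j \<in> R \<longrightarrow> m < s (wt i - wt j) \<longrightarrow> (wt i - wt j) (proj_wt 0 Z) = 0)"
      using roots_sub_wts unfolding wts_def by (auto 0 4)
    also have "\<dots> \<longleftrightarrow> (\<forall>l\<in>?L3. l Z = 0)"
      using proj_wt_0_in_a[OF that] by (auto simp: wt_def)
    finally show ?thesis .
  qed
  have "Z \<in> level s l' m \<longleftrightarrow> (\<forall>l\<in>?L1 \<union> ?L2 \<union> ?L3. l Z = 0)" for Z
    unfolding level_def ball_Un mem_Collect_eq r[symmetric] g[symmetric] using t[of Z] by blast
  moreover have "(\<forall>X Y. l (X + Y) = l X + l Y) \<and> (\<forall>c X. l (smult_mat c X) = c * l X)" if "l \<in> ?L1 \<union> ?L2 \<union> ?L3" for l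
    using that
  proof (elim UnE imageE)
    fix p assume "l = (\<lambda>Z. mpoly_eval id (D Z p) (entries (mat 1)))"
    then show ?thesis by (simp add: D_add D_smult mpoly_eval_add mpoly_eval_mult is_ring_hom_intros)
  next
    fix z assume l: "l = (\<lambda>(\<alpha>, i, j) Z. cj (proj_wt \<alpha> Z) $ i $ j) z"
    obtain \<alpha> i j where z: "z = (\<alpha>, i, j)" by (cases z)
    show ?thesis unfolding l z by (simp add: proj_wt_linear cj_lin_nth)
  next
    fix z assume l: "l = (\<lambda>(i, j) Z. \<tau> (proj_wt 0 Z) i - \<tau> (proj_wt 0 Z) j) z"
    obtain i j where z: "z = (i, j)" by (cases z)
    show ?thesis unfolding l z by (simp add: proj_wt_linear \<tau>_lin algebra_simps)
  qed
  ultimately show ?thesis by (intro exI[of _ "?L1 \<union> ?L2 \<union> ?L3"]) blast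
qed

lemma K_invertible: "y \<in> K \<Longrightarrow> invertible y"
  using K_sub_S S_D(1) by blast

lemma K_conj: "x \<in> K \<Longrightarrow> Z \<in> \<Lambda> \<Longrightarrow> x ** Z ** matrix_inv x \<in> \<Lambda>"
  using S_D(3)[of x] K_sub_S by blast

lemma tangent_sub:
  assumes x: "x \<in> K" and \<xi>: "\<xi> \<in> tangent_space K x" and u: "u \<in> \<Lambda>"
  shows "\<xi> ** u ** matrix_inv x - x ** u ** matrix_inv x ** \<xi> ** matrix_inv x \<in> \<Lambda>"
proof -
  let ?\<eta> = "- (matrix_inv x ** \<xi> ** matrix_inv x)"
  have t: "tangent_pair K x \<xi> ?\<eta>"
    using \<xi> tangent_space_iff[OF x K_invertible] by blast
  have "\<xi> ** u ** matrix_inv x + x ** u ** ?\<eta> \<in> \<Lambda>"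
    unfolding Lat_def
  proof (intro CollectI allI)
    fix m
    obtain L where "\<forall>l\<in>L. (\<forall>X Y. l (X + Y) = l X + l Y) \<and> (\<forall>c X. l (smult_mat c X) = c * l X)"
      "\<forall>Z. Z \<in> level r lam m \<longleftrightarrow> (\<forall>l\<in>L. l Z = 0)"
      using level_functionals[of r lam m] by blast
    then have L: "l \<in> L \<Longrightarrow> l (X + Y) = l X + l Y" "l \<in> L \<Longrightarrow> l (smult_mat c X) = c * l X"
      "Z \<in> level r lam m \<longleftrightarrow> (\<forall>l\<in>L. l Z = 0)" for l X Y c Z by blast+
    have "l (coeff_mat (\<xi> ** u ** matrix_inv x + x ** u ** ?\<eta>) m) = 0" if l: "l \<in> L" for l
    proof -
      note e = functional_entries[of l, OF L(1,2)[OF l]]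
      have "l (coeff_mat (y ** u ** matrix_inv y) m) = 0" if "y \<in> K" for y
        using K_conj[OF that u] L(3) l by (auto simp: Lat_def)
      then show ?thesis
        by (subst e) (rule tangent_pair_matrix[OF t, where d = 0], simp only: e[symmetric])
    qed
    then show "coeff_mat (\<xi> ** u ** matrix_inv x + x ** u ** ?\<eta>) m \<in> level r lam m" using L(3) by blast
  qed
  moreover have "A ** - B = - (A ** B)" for A B :: "'n fmat"
    by (simp add: vec_eq_iff matrix_matrix_mult_def sum_negf)
  ultimately show ?thesis by (simp add: matrix_mul_assoc)
qed

lemma matrix_inv_1: "matrix_inv (mat 1 :: 'a::field ^ 'm ^ 'm) = mat 1"
  by (rule matrix_inv_eq) simp

text \<open>At the identity the bound of \<open>tangent_sub\<close> reads
  \<open>[\<xi>, u] \<in> \<Lambda>\<close>; testing it on the monomials \<open>emono m Z\<close>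
  isolates single coefficients of \<open>\<xi>\<close>.\<close>

lemma tangent_stab:
  assumes \<xi>: "\<xi> \<in> tangent_space K (mat 1)"
  shows "coeff_mat \<xi> i \<in> stab i"
  unfolding stab_def
proof (intro CollectI conjI allI ballI)
  obtain \<eta> where "tangent_pair K (mat 1) \<xi> \<eta>" using \<xi> unfolding tangent_space_iff_pair by blast
  then show "coeff_mat \<xi> i \<in> \<gg>"
    by (rule tangent_pair_lie_algebra) (use S_D(2) K_sub_S in blast)
  fix m Z assume "Z \<in> level r lam m"
  then have "emono m Z \<in> \<Lambda>" by (simp add: Lat_def coeff_emono level_closed)
  from tangent_sub[OF one_in_K \<xi> this]
  have "lie_bracket \<xi> (emono m Z) \<in> \<Lambda>" by (simp add: matrix_inv_1 lie_bracket_def)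
  then have "coeff_mat (lie_bracket \<xi> (emono m Z)) (m + i) \<in> level r lam (m + i)" unfolding Lat_def by blast
  then show "lie_bracket (coeff_mat \<xi> i) Z \<in> level r lam (m + i)"
    unfolding coeff_bracket_emono by simp
qed

lemma emono_lin: "emono m 0 = 0" "emono m (X + Y) = emono m X + emono m Y" "emono m (sum f I) = (\<Sum>i\<in>I. emono m (f i))"
  by (rule fmat_eqI, simp add: coeff_mat_lin coeff_emono)+

text \<open>Partial sums of \<open>Y\<close> are finite sums of velocities of curves, and the whole
  series follows by \<open>tangent_pair_limit\<close>. The alternative in the last assumption
  reflects that torus curves are available only at the identity.\<close>

lemma tangent_Lat:
  assumes c: cond1 cond2 and x: "x \<in> K" and Y: "Y \<in> Lat (level (\<lambda>_. 0) k)"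
    and 0: "x = mat 1 \<or> (\<forall>m. proj_wt 0 (coeff_mat Y m) = 0)"
  shows "x ** Y \<in> tangent_space K x"
proof -
  have lev: "coeff_mat Y m \<in> level (\<lambda>_. 0) k m" for m using Y by (simp add: Lat_def)
  note Yg = level_sub[OF lev]
  have mono: "x ** emono m (coeff_mat Y m) \<in> tangent_space K x" for m
  proof -
    have root: "x ** emono m (proj_wt \<alpha> (coeff_mat Y m)) \<in> tangent_space K x" if \<alpha>: "\<alpha> \<in> R" for \<alpha>
    proof (cases "m < k \<alpha>")
      case True
      then have "proj_wt \<alpha> (coeff_mat Y m) = 0" using lev[of m] \<alpha> by (simp add: level_def)
      then show ?thesis by (simp add: emono_lin tangent_space_0)
    next
      case False
      have X: "proj_wt \<alpha> (coeff_mat Y m) \<in> root_space G A \<alpha>"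
        using proj_wt_in_root_space[OF _ Yg] roots_sub_wts \<alpha> by blast
      show ?thesis
        by (rule root_tangent[OF \<alpha> X _ x]) (use root_space_in_stab[OF c \<alpha> X] level_stab_mono[of "k \<alpha>" m] False in auto)
    qed
    have zero: "x ** emono m (proj_wt 0 (coeff_mat Y m)) \<in> tangent_space K x"
    proof (cases "proj_wt 0 (coeff_mat Y m) = 0")
      case True
      then show ?thesis by (simp add: emono_lin tangent_space_0)
    next
      case False
      note a = proj_wt_0_in_a[OF Yg, of m]
      have "\<not> m < 0" using roots_span[OF a] lev[of m] False by (auto simp: level_def)
      then have "emono (int (nat m)) (proj_wt 0 (coeff_mat Y m)) \<in> tangent_space K (mat 1)"
        by (intro torus_tangent a)
      then show ?thesis using 0 False \<open>\<not> m < 0\<close> by auto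
    qed
    have "x ** emono m (coeff_mat Y m) = x ** emono m (proj_wt 0 (coeff_mat Y m)) + (\<Sum>\<alpha>\<in>R. x ** emono m (proj_wt \<alpha> (coeff_mat Y m)))"
      by (subst root_decomposition[OF Yg]) (simp add: emono_lin matrix_add_ldistrib matrix_mult_sum_right)
    then show ?thesis using root zero by (simp add: tangent_space_add tangent_space_sum)
  qed
  note inv = matrix_inv_mult[OF K_invertible[OF x]]
  obtain N where N: "\<And>m. m < N \<Longrightarrow> coeff_mat Y m = 0" using fmat_bounded by blast
  obtain a where a: "\<And>m. m < a \<Longrightarrow> coeff_mat x m = 0 \<and> coeff_mat (matrix_inv x) m = 0"
  proof -
    obtain a b where "\<forall>m<a. coeff_mat x m = 0" "\<forall>m<b. coeff_mat (matrix_inv x) m = 0" using fmat_bounded by meson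
    then show thesis by (intro that[of "min a b"]) auto
  qed
  have e: "matrix_inv x ** (x ** Z) ** matrix_inv x = Z ** matrix_inv x" for Z by (simp add: matrix_mul_assoc inv)
  have "tangent_pair K x (x ** Y) (- (matrix_inv x ** (x ** Y) ** matrix_inv x))"
  proof (rule tangent_pair_limit)
    fix M
    \<comment> \<open>All coefficients of \<open>x\<close> and its inverse below \<open>a\<close>
      vanish, so the terms of \<open>Y\<close> beyond \<open>M - a\<close> affect
      \<open>x ** Y\<close> and \<open>Y ** matrix_inv x\<close> only beyond
      \<open>M\<close>.\<close>
    define T where "T = (\<Sum>m\<in>{N..M - a}. emono m (coeff_mat Y m))"
    have T: "coeff_mat (Y - T) m = 0" if "m < M - a + 1" for m
    proof -
      have "coeff_mat T m = (\<Sum>j\<in>{N..M - a}. if m = j then coeff_mat Y m else 0)"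
        unfolding T_def coeff_mat_lin coeff_emono by (rule sum.cong) auto
      also have "\<dots> = coeff_mat Y m" using that N[of m] by (auto simp: not_le)
      finally show ?thesis by (simp add: coeff_mat_lin)
    qed
    have "x ** T = (\<Sum>m\<in>{N..M - a}. x ** emono m (coeff_mat Y m))" unfolding T_def by (rule matrix_mult_sum_right)
    then have "x ** T \<in> tangent_space K x" using mono by (simp add: tangent_space_sum)
    then have "tangent_pair K x (x ** T) (- (matrix_inv x ** (x ** T) ** matrix_inv x))"
      using tangent_space_iff[OF x K_invertible] by blast
    moreover have "coeff_mat (x ** T) m = coeff_mat (x ** Y) m" "coeff_mat (T ** matrix_inv x) m = coeff_mat (Y ** matrix_inv x) m" if "m \<le> M" for m
    proof -
      have "coeff_mat (x ** (Y - T)) m = 0"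
        by (subst coeff_mat_mult[of a _ "M - a + 1"]) (use a T that in auto)
      then show "coeff_mat (x ** T) m = coeff_mat (x ** Y) m" by (simp add: matrix_mult_diff coeff_mat_lin)
      have "coeff_mat ((Y - T) ** matrix_inv x) m = 0"
        by (subst coeff_mat_mult[of "M - a + 1" _ a]) (use a T that in auto)
      then show "coeff_mat (T ** matrix_inv x) m = coeff_mat (Y ** matrix_inv x) m" by (simp add: matrix_mult_diff coeff_mat_lin)
    qed
    ultimately show "\<exists>\<xi>' \<eta>'. tangent_pair K x \<xi>' \<eta>' \<and> (\<forall>m\<le>M. coeff_mat \<xi>' m = coeff_mat (x ** Y) m \<and>
      coeff_mat \<eta>' m = coeff_mat (- (matrix_inv x ** (x ** Y) ** matrix_inv x)) m)"
      unfolding e by (intro exI[of _ "x ** T"] exI[of _ "- (T ** matrix_inv x)"]) (simp add: coeff_mat_lin)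
  qed
  then show ?thesis unfolding tangent_space_iff_pair by blast
qed

section \<open>The Lie algebra of \<open>K\<close> and the criterion for submersion\<close>

lemma K_lie_algebra_eq:
  assumes cond1 cond2
  shows "K_lie_algebra G A r lam = root_lattice G A (points_O \<aa>) k"
  unfolding K_lie_algebra_def root_lattice_O_eq
proof
  show "tangent_space K (mat 1) \<subseteq> Lat (level (\<lambda>_. 0) k)"
    using tangent_stab stab_sub_level by (fastforce simp: Lat_def)
  show "Lat (level (\<lambda>_. 0) k) \<subseteq> tangent_space K (mat 1)"
    using tangent_Lat[OF assms one_in_K] by auto
qed

lemma a_ge_sub: "a_ge G A r \<subseteq> \<Lambda>"
  by (auto simp: a_ge_iff Lat_def intro!: a_in_level)

lemma bracket_root_a_series:
  assumes u: "u \<in> points_F \<aa>" and \<alpha>: "\<alpha> \<in> R" and W: "\<And>m. coeff_mat W m \<in> root_space G A \<alpha>"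
  shows "lie_bracket W u = smult_mat (- extend_form \<alpha> u) W"
proof (rule fmat_eqI)
  fix m
  obtain M where M: "\<And>m. m < M \<Longrightarrow> coeff_mat W m = 0" using fmat_bounded by blast
  obtain N where N: "\<And>m. m < N \<Longrightarrow> coeff_mat u m = 0" using fmat_bounded by blast
  have ua: "coeff_mat u j \<in> \<aa>" for j using u by (simp add: points_F_def)
  have z: "fls_nth (- extend_form \<alpha> u) j = 0" if "j < N" for j
    using extend_form_nth[OF \<alpha>] N[OF that] root_at_0[OF \<alpha>] by simp
  have "coeff_mat (lie_bracket W u) m = (\<Sum>j\<in>{N..m - M}. lie_bracket (coeff_mat W (m - j)) (coeff_mat u j))"
    by (simp add: lie_bracket_def coeff_mat_lin coeff_mat_mult'[OF M N] coeff_mat_mult[OF N M] sum_subtractf)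
  also have "\<dots> = (\<Sum>j\<in>{N..m - M}. smult_mat (fls_nth (- extend_form \<alpha> u) j) (coeff_mat W (m - j)))"
    using bracket_a_root[OF W ua] by (simp add: extend_form_nth[OF \<alpha>])
  also have "\<dots> = coeff_mat (smult_mat (- extend_form \<alpha> u) W) m"
    by (rule coeff_mat_smult[OF z M, symmetric])
  finally show "coeff_mat (lie_bracket W u) m = coeff_mat (smult_mat (- extend_form \<alpha> u) W) m" .
qed

text \<open>Dividing the \<open>\<alpha>\<close>-component by \<open>- \<alpha>(u)\<close>, of valuation \<open>r \<alpha>\<close>, turns exponent \<open>lam \<alpha>\<close> into \<open>k \<alpha>\<close>.\<close>

lemma Lambda_decomposition:
  assumes u: "u \<in> a_eq G A r" and Z: "Z \<in> \<Lambda>"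
  shows "\<exists>Y\<in>Lat (level (\<lambda>_. 0) k). \<exists>v\<in>a_ge G A r. (\<forall>m. proj_wt 0 (coeff_mat Y m) = 0) \<and> Z = lie_bracket Y u + v"
proof -
  have lev: "coeff_mat Z m \<in> level r lam m" for m using Z by (simp add: Lat_def)
  note Zg = level_sub[OF lev]
  define W where "W \<alpha> = lift (proj_wt \<alpha>) Z" for \<alpha>
  have cW: "coeff_mat (W \<alpha>) m = proj_wt \<alpha> (coeff_mat Z m)" for \<alpha> m
    unfolding W_def by (rule coeff_lift) (rule proj_wt_linear(3))
  have W: "coeff_mat (W \<alpha>) m \<in> root_space G A \<alpha>" if "\<alpha> \<in> R" for \<alpha> m
    unfolding cW using proj_wt_in_root_space[OF _ Zg] roots_sub_wts that by blast
  have W0: "coeff_mat (W \<alpha>) m = 0" if "\<alpha> \<in> R" "m < lam \<alpha>" for \<alpha> m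
    unfolding cW using lev[of m] that by (simp add: level_def)
  have ua: "u \<in> points_F \<aa>" using u by (simp add: a_eq_def)
  define f where "f \<alpha> = - inverse (extend_form \<alpha> u)" for \<alpha>
  have val: "val (extend_form \<alpha> u) = Fin (r \<alpha>)" if "\<alpha> \<in> R" for \<alpha> using u that by (simp add: a_eq_def)
  have nz: "extend_form \<alpha> u \<noteq> 0" and sd: "fls_subdegree (extend_form \<alpha> u) = r \<alpha>" if "\<alpha> \<in> R" for \<alpha>
    using val[OF that] by (auto simp: val_def split: if_splits)
  have f0: "fls_nth (f \<alpha>) m = 0" if "\<alpha> \<in> R" "m < - r \<alpha>" for \<alpha> m
    unfolding f_def using that sd[OF that(1)] by (simp add: fls_eq0_below_subdegree)
  define Y where "Y = (\<Sum>\<alpha>\<in>R. smult_mat (f \<alpha>) (W \<alpha>))"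
  define v where "v = W 0"
  have cf: "coeff_mat (smult_mat (f \<alpha>) (W \<alpha>)) m = (\<Sum>j\<in>{- r \<alpha>..m - lam \<alpha>}. smult_mat (fls_nth (f \<alpha>) j) (coeff_mat (W \<alpha>) (m - j)))"
    if "\<alpha> \<in> R" for \<alpha> m
    by (rule coeff_mat_smult) (use f0[OF that] W0[OF that] in auto)
  have sumr: "sum g I \<in> root_space G A \<alpha>" if "\<And>i. i \<in> I \<Longrightarrow> g i \<in> root_space G A \<alpha>" for g \<alpha> and I :: "int set"
    using that by (induction I rule: infinite_finite_induct) (auto simp: root_space_closed)
  have fr: "coeff_mat (smult_mat (f \<alpha>) (W \<alpha>)) m \<in> root_space G A \<alpha>" if "\<alpha> \<in> R" for \<alpha> m
    unfolding cf[OF that] by (intro sumr root_space_closed W that)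
  have fl: "coeff_mat (smult_mat (f \<alpha>) (W \<alpha>)) m \<in> level (\<lambda>_. 0) k m" if "\<alpha> \<in> R" for \<alpha> m
  proof (cases "m < k \<alpha>")
    case True
    then have "coeff_mat (smult_mat (f \<alpha>) (W \<alpha>)) m = 0" unfolding cf[OF that] by (simp add: k_def)
    then show ?thesis by (simp add: level_closed)
  next
    case False
    then show ?thesis by (intro root_space_in_level[OF that fr[OF that]]) simp
  qed
  have "Y \<in> Lat (level (\<lambda>_. 0) k)"
    using fl by (auto simp: Y_def Lat_def coeff_mat_lin intro!: level_sum)
  moreover have "proj_wt 0 (coeff_mat Y m) = 0" for m
  proof -
    have "proj_wt 0 (coeff_mat (smult_mat (f \<alpha>) (W \<alpha>)) m) = 0" if "\<alpha> \<in> R" for \<alpha>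
      using proj_wt_root_space[OF root_dual[OF that] fr[OF that], of 0] that by (auto simp: roots_iff)
    then show ?thesis by (simp add: Y_def coeff_mat_lin proj_wt_sum)
  qed
  moreover have "v \<in> a_ge G A r"
    unfolding a_ge_iff v_def cW using lev proj_wt_0_in_a[OF Zg] by (auto simp: level_def)
  moreover have "Z = lie_bracket Y u + v"
  proof -
    have "lie_bracket (smult_mat (f \<alpha>) (W \<alpha>)) u = W \<alpha>" if \<alpha>: "\<alpha> \<in> R" for \<alpha>
    proof -
      have "lie_bracket (smult_mat (f \<alpha>) (W \<alpha>)) u = smult_mat (f \<alpha>) (lie_bracket (W \<alpha>) u)" by (rule smult_mat_bracket)
      also have "\<dots> = smult_mat (f \<alpha> * - extend_form \<alpha> u) (W \<alpha>)"
        by (simp add: bracket_root_a_series[OF ua \<alpha> W[OF \<alpha>]] smult_smult_mat)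
      also have "f \<alpha> * - extend_form \<alpha> u = 1" using nz[OF \<alpha>] by (simp add: f_def)
      finally show ?thesis by (simp add: smult_mat_def)
    qed
    then have "lie_bracket Y u + v = (\<Sum>\<alpha>\<in>R. W \<alpha>) + W 0" by (simp add: Y_def v_def lie_bracket_sum)
    also have "\<dots> = Z"
      by (rule fmat_eqI) (simp add: coeff_mat_lin cW root_decomposition[OF Zg, symmetric] add.commute)
    finally show ?thesis ..
  qed
  ultimately show ?thesis by blast
qed

lemma conj_differential_eq:
  "conj_differential x u \<xi> v = (\<xi> ** u ** matrix_inv x - x ** u ** matrix_inv x ** \<xi> ** matrix_inv x) + x ** v ** matrix_inv x"
  by (simp add: conj_differential_def)

lemma lattice_of_conditions:
  assumes cond1 cond2
  shows "root_valuation_lattice G A r lam"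
  unfolding root_valuation_lattice_def Lambda_eq
proof (intro ballI subset_antisym)
  fix x u assume x: "x \<in> K" and u: "u \<in> a_eq G A r"
  have uL: "u \<in> \<Lambda>" using u a_ge_sub by (auto simp: a_eq_iff)
  show "(\<lambda>(\<xi>, v). conj_differential x u \<xi> v) ` (tangent_space K x \<times> a_ge G A r) \<subseteq> \<Lambda>"
    unfolding conj_differential_eq using tangent_sub[OF x _ uL] K_conj[OF x] a_ge_sub by (auto intro!: Lat_closed)
  show "\<Lambda> \<subseteq> (\<lambda>(\<xi>, v). conj_differential x u \<xi> v) ` (tangent_space K x \<times> a_ge G A r)"
  proof
    fix Z assume "Z \<in> \<Lambda>"
    \<comment> \<open>Conjugation by \<open>x\<close> maps the lattice onto itself, so
      \<open>Z\<close> is transported back to the identity; a solution \<open>Y\<close> found there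
      is translated to the tangent vector \<open>x ** Y\<close>.\<close>
    then have "Z \<in> (\<lambda>X. x ** X ** matrix_inv x) ` \<Lambda>" using S_D(3) x K_sub_S by blast
    then obtain Z0 where Z0: "Z0 \<in> \<Lambda>" "Z = x ** Z0 ** matrix_inv x" by blast
    obtain Y v where Y: "Y \<in> Lat (level (\<lambda>_. 0) k)" "v \<in> a_ge G A r" "\<And>m. proj_wt 0 (coeff_mat Y m) = 0" "Z0 = lie_bracket Y u + v"
      using Lambda_decomposition[OF u Z0(1)] by blast
    have "x ** Y \<in> tangent_space K x" by (rule tangent_Lat[OF assms x Y(1)]) (use Y(3) in blast)
    moreover have "Z = conj_differential x u (x ** Y) v"
    proof -
      note i = matrix_inv_mult[OF K_invertible[OF x]]
      have "conj_differential x u (x ** Y) v = x ** Y ** u ** matrix_inv x - x ** u ** Y ** matrix_inv x + x ** v ** matrix_inv x"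
        unfolding conj_differential_eq by (simp add: matrix_mul_assoc mat_cancel[OF i(2)])
      also have "\<dots> = Z"
        unfolding Z0(2) Y(4) lie_bracket_def
        by (simp add: matrix_add_ldistrib matrix_add_rdistrib' matrix_mult_diff matrix_mul_assoc)
      finally show ?thesis ..
    qed
    ultimately show "Z \<in> (\<lambda>(\<xi>, v). conj_differential x u \<xi> v) ` (tangent_space K x \<times> a_ge G A r)"
      using Y(2) by (intro image_eqI[of _ _ "(x ** Y, v)"]) auto
  qed
qed

text \<open>Surjectivity at the identity is used for one \<open>u\<close> only, on the vectors
  \<open>emono (lam \<alpha>) x\<close>: the coefficient of exponent \<open>k \<alpha>\<close> of a
  preimage is, up to a scalar, the normalizing element with \<alpha>-part \<open>x\<close>.\<close>

lemma conditions_of_lattice: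
  assumes "root_valuation_lattice G A r lam"
  shows cond1 cond2
proof -
  obtain u where u: "u \<in> a_eq G A r" using ex_a_eq by blast
  have st: "\<exists>X\<in>stab (k \<alpha>). proj_wt \<alpha> X = x" if \<alpha>: "\<alpha> \<in> R" and x: "x \<in> root_space G A \<alpha>" for \<alpha> x
  proof -
    have "x \<in> level r lam (lam \<alpha>)" by (rule root_space_in_level[OF \<alpha> x]) simp
    then have "emono (lam \<alpha>) x \<in> \<Lambda>" by (simp add: Lat_def coeff_emono level_closed)
    then have "emono (lam \<alpha>) x \<in> (\<lambda>(\<xi>, v). conj_differential (mat 1) u \<xi> v) ` (tangent_space K (mat 1) \<times> a_ge G A r)"
      using assms one_in_K u unfolding root_valuation_lattice_def Lambda_eq by blast
    then obtain \<xi> v where \<xi>: "\<xi> \<in> tangent_space K (mat 1)" and v: "v \<in> a_ge G A r"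
      and e: "emono (lam \<alpha>) x = lie_bracket \<xi> u + v"
      by (auto simp: conj_differential_eq matrix_inv_1 lie_bracket_def)
    have ua: "coeff_mat u m \<in> \<aa>" for m using u by (simp add: a_eq_iff a_ge_iff)
    have u0: "\<alpha> (coeff_mat u m) = 0" if "m < r \<alpha>" for m using u \<alpha> that by (simp add: a_eq_iff a_ge_iff)
    have \<xi>g: "coeff_mat \<xi> m \<in> \<gg>" and \<xi>0: "m < k \<alpha> \<Longrightarrow> proj_wt \<alpha> (coeff_mat \<xi> m) = 0" for m
      using stab_sub_level tangent_stab[OF \<xi>, of m] \<alpha> by (auto simp: level_def)
    obtain M where M: "\<And>m. m < M \<Longrightarrow> coeff_mat \<xi> m = 0" using fmat_bounded by blast
    obtain N where N: "\<And>m. m < N \<Longrightarrow> coeff_mat u m = 0" using fmat_bounded by blast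
    have p: "proj_wt \<alpha> (coeff_mat \<xi> m) \<in> root_space G A \<alpha>" for m
      using proj_wt_in_root_space[OF _ \<xi>g] roots_sub_wts \<alpha> by blast
    have "lie_bracket \<xi> u = \<xi> ** u - u ** \<xi>" by (simp add: lie_bracket_def)
    then have "coeff_mat (lie_bracket \<xi> u) (lam \<alpha>) = (\<Sum>j\<in>{N..lam \<alpha> - M}. lie_bracket (coeff_mat \<xi> (lam \<alpha> - j)) (coeff_mat u j))"
      unfolding lie_bracket_def[of "coeff_mat _ _"] by (simp add: coeff_mat_lin coeff_mat_mult'[OF M N] coeff_mat_mult[OF N M] sum_subtractf)
    then have "proj_wt \<alpha> (coeff_mat (lie_bracket \<xi> u) (lam \<alpha>))
      = (\<Sum>j\<in>{N..lam \<alpha> - M}. smult_mat (- \<alpha> (coeff_mat u j)) (proj_wt \<alpha> (coeff_mat \<xi> (lam \<alpha> - j))))"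
      by (simp add: proj_wt_sum proj_wt_bracket_a[OF ua \<xi>g] bracket_a_root[OF p ua])
    \<comment> \<open>For \<open>j < r \<alpha>\<close> the root vanishes on the coefficient of
      \<open>u\<close>, and for \<open>j > r \<alpha>\<close> the index
      \<open>lam \<alpha> - j\<close> is below \<open>k \<alpha>\<close>, where the component of
      \<open>\<xi>\<close> vanishes; one term remains.\<close>
    also have "\<dots> = (\<Sum>j\<in>{N..lam \<alpha> - M}. if j = r \<alpha> then smult_mat (- \<alpha> (coeff_mat u (r \<alpha>))) (proj_wt \<alpha> (coeff_mat \<xi> (k \<alpha>))) else 0)"
    proof (rule sum.cong[OF refl])
      fix j
      consider "j < r \<alpha>" | "j = r \<alpha>" | "j > r \<alpha>" by linarith
      then show "smult_mat (- \<alpha> (coeff_mat u j)) (proj_wt \<alpha> (coeff_mat \<xi> (lam \<alpha> - j)))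
        = (if j = r \<alpha> then smult_mat (- \<alpha> (coeff_mat u (r \<alpha>))) (proj_wt \<alpha> (coeff_mat \<xi> (k \<alpha>))) else 0)"
        using u0[of j] \<xi>0[of "lam \<alpha> - j"] by cases (auto simp: k_def smult_mat_eq_0_iff)
    qed
    also have "\<dots> = smult_mat (- \<alpha> (coeff_mat u (r \<alpha>))) (proj_wt \<alpha> (coeff_mat \<xi> (k \<alpha>)))"
    proof -
      \<comment> \<open>If the surviving index lies outside the summation range, one of its two
        factors is 0, so the formula holds there as well.\<close>
      have "smult_mat (- \<alpha> (coeff_mat u (r \<alpha>))) (proj_wt \<alpha> (coeff_mat \<xi> (k \<alpha>))) = 0" if "r \<alpha> < N \<or> lam \<alpha> - M < r \<alpha>"
        using that N[of "r \<alpha>"] M[of "k \<alpha>"] root_at_0[OF \<alpha>] by (auto simp: k_def smult_mat_eq_0_iff proj_wt_linear)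
      then show ?thesis by (auto simp: sum.delta not_le)
    qed
    finally have "proj_wt \<alpha> (coeff_mat (lie_bracket \<xi> u) (lam \<alpha>)) = smult_mat (- \<alpha> (coeff_mat u (r \<alpha>))) (proj_wt \<alpha> (coeff_mat \<xi> (k \<alpha>)))" .
    moreover have "proj_wt \<alpha> (coeff_mat v (lam \<alpha>)) = 0"
      using v \<alpha> proj_wt_a[of "coeff_mat v (lam \<alpha>)" \<alpha>] by (auto simp: a_ge_iff roots_iff)
    moreover have "proj_wt \<alpha> (coeff_mat (emono (lam \<alpha>) x) (lam \<alpha>)) = x"
      using proj_wt_root_space[OF root_dual[OF \<alpha>] x, of \<alpha>] by (simp add: coeff_emono)
    ultimately have "x = proj_wt \<alpha> (smult_mat (- \<alpha> (coeff_mat u (r \<alpha>))) (coeff_mat \<xi> (k \<alpha>)))"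
      unfolding e by (simp add: coeff_mat_lin proj_wt_linear)
    then show ?thesis using smult_in_stab[OF tangent_stab[OF \<xi>]] by blast
  qed
  show cond1 cond2 by (rule conditions_of_stab[OF st]; assumption)+
qed

end

theorem proposition11p1:
  fixes G A :: "(complex ^ 'n::finite ^ 'n) set"
    and r lam k :: "((complex ^ 'n ^ 'n) \<Rightarrow> complex) \<Rightarrow> int"
  assumes "semisimple_group G"
    and "maximal_torus A G"
    and "root_valuation_function G A r"
    and "k = (\<lambda>\<alpha>. lam \<alpha> - r \<alpha>)"
  shows "(root_valuation_lattice G A r lam \<longleftrightarrow>
      (\<forall>\<alpha>\<in>roots G A. k \<alpha> + k (- \<alpha>) \<ge> r_max G A r \<alpha> - r \<alpha>) \<and>
      (\<forall>\<alpha>\<in>roots G A. \<forall>\<beta>\<in>roots G A. \<alpha> + \<beta> \<in> roots G A \<longrightarrow>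
         k \<alpha> + k \<beta> - k (\<alpha> + \<beta>) \<ge> r (\<alpha> + \<beta>) - min (r \<alpha>) (r \<beta>))) \<and>
    (root_valuation_lattice G A r lam \<longrightarrow>
      K_lie_algebra G A r lam = root_lattice G A (points_O (lie_algebra A)) k)"
proof -
  interpret root_valuation G A r lam k
    by unfold_locales (use assms in auto)
  have "root_valuation_lattice G A r lam \<longleftrightarrow> cond1 \<and> cond2"
    using lattice_of_conditions conditions_of_lattice by blast
  then show ?thesis
    using K_lie_algebra_eq unfolding cond1_def cond2_def by blast
qed

end
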